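(* Let $(E,\tau,M)$ be a vector bundle and $(E^*,\pi,M)$ its dual bundle. There is a one-to-one correspondence between Lie algebroid structures on $(E,\tau,M)$ and homogeneous Poisson structures on $E^*$ such that, for each pair $(X,Y)$ of smooth sections of $\tau$, $\Phi_X$ and $\Phi_Y$ being the corresponding vertical functions on $E^*$, $$\{\Phi_X,\Phi_Y\}=\Phi_{\{X,Y\}},$$ the bracket in the left hand side being the Poisson bracket of functions on $E^*$, and the bracket in the right hand side the bracket of sections for the corresponding Lie algebroid structure on $(E,\tau,M)$.
   Context: Vector bundles are smooth, real, locally trivial and of finite rank, over a smooth manifold. A Lie algebroid structure on a vector bundle $(E,\tau,M)$ consists of a real Lie algebra bracket $\{\ ,\ \}$ on the space of smooth sections of $\tau$ and a smooth vector bundle map $\rho:E\to TM$ (the anchor) such that $\{s_1,fs_2\}=f\{s_1,s_2\}+\bigl(\mathcal L(\rho\circ s_1)f\bigr)s_2$ for all smooth sections $s_1,s_2$ of $\tau$ and all $f\in C^\infty(M,\mathbb R)$, where $\mathcal L$ denotes the Lie derivative. A Poisson structure on a manifold $N$ is a Lie algebra bracket on $C^\infty(N,\mathbb R)$ satisfying $\{f,gh\}=\{f,g\}h+g\{f,h\}$. For a smooth section $X$ of $\tau$, the associated vertical function $\Phi_X:E^*\to\mathbb R$ is $\Phi_X(\xi)=\langle\xi,X(\pi(\xi))\rangle$. A function on $E^*$ is called vertical if it is $\Phi_X$ for some smooth section $X$ of $\tau$. A Poisson structure on $E^*$ is called homogeneous if the Poisson bracket of any two vertical functions is vertical.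
   Formalization: The vector bundle is required to have positive rank: for rank 0 over the plane, every Poisson structure on the dual bundle (a copy of the base) is homogeneous, while there is only one Lie algebroid structure, so the claim fails. *)

theory Defs
  imports "HOL-Analysis.Analysis"
begin

section \<open>Finite-dimensional model spaces\<close>

text \<open>
  Charts take values in a finite-dimensional inner product space.  The class
  \<^class>\<open>euclidean_space\<close> is not used for base manifolds because it forces a positive
  dimension, whereas zero-dimensional bases (Lie algebras, as Lie algebroids over a point) must be
  covered; the instance for \<^typ>\<open>unit\<close> below is the zero-dimensional model.  The superclass
  \<^class>\<open>heine_borel\<close> is implied by finite dimension and only listed for convenience.
\<close>

class finite_dim_inner = real_inner + heine_borel +
  assumes finite_spanning_set: "\<exists>B. finite B \<and> (\<forall>x. \<exists>c. x = (\<Sum>b\<in>B. c b *\<^sub>R b))"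

instance euclidean_space \<subseteq> finite_dim_inner
  by standard (metis finite_Basis euclidean_representation)

instance prod :: (finite_dim_inner, finite_dim_inner) finite_dim_inner
proof
  obtain A :: "'a set" where A: "finite A" "\<And>x. \<exists>c. x = (\<Sum>b\<in>A. c b *\<^sub>R b)"
    using finite_spanning_set by blast
  obtain B :: "'b set" where B: "finite B" "\<And>y. \<exists>d. y = (\<Sum>b\<in>B. d b *\<^sub>R b)"
    using finite_spanning_set by blast
  let ?C = "(\<lambda>x. (x, 0)) ` A \<union> Pair 0 ` B :: ('a \<times> 'b) set"
  have fin: "finite ?C"
    using A B by simp
  have l: "linear (\<lambda>x. (x, 0) :: 'a \<times> 'b)" "linear (Pair 0 :: 'b \<Rightarrow> 'a \<times> 'b)"
    by (simp_all add: linear_iff)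
  have "(x, y) \<in> span ?C" for x y
  proof -
    obtain c d where "x = (\<Sum>b\<in>A. c b *\<^sub>R b)" "y = (\<Sum>b\<in>B. d b *\<^sub>R b)"
      using A(2)[of x] B(2)[of y] by blast
    then have "(x, 0) = (\<Sum>b\<in>A. c b *\<^sub>R (b, 0::'b))" "(0, y) = (\<Sum>b\<in>B. d b *\<^sub>R (0::'a, b))"
      using linear_sum[OF l(1), of "\<lambda>b. c b *\<^sub>R b" A] linear_sum[OF l(2), of "\<lambda>b. d b *\<^sub>R b" B]
      by simp_all
    moreover have "(\<Sum>b\<in>A. c b *\<^sub>R (b, 0::'b)) \<in> span ?C" "(\<Sum>b\<in>B. d b *\<^sub>R (0::'a, b)) \<in> span ?C"
      by (intro span_sum span_scale span_base; blast)+
    ultimately have "(x, 0) + (0, y) \<in> span ?C"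
      by (metis span_add)
    then show ?thesis
      by simp
  qed
  then have "\<exists>c. p = (\<Sum>b\<in>?C. c b *\<^sub>R b)" for p :: "'a \<times> 'b"
    using span_finite[OF fin] by (cases p) auto
  then show "\<exists>C::('a \<times> 'b) set. finite C \<and> (\<forall>p. \<exists>c. p = (\<Sum>b\<in>C. c b *\<^sub>R b))"
    using fin by blast
qed

instantiation unit :: real_inner
begin

definition zero_unit :: unit where "zero_unit = ()"
definition plus_unit :: "unit \<Rightarrow> unit \<Rightarrow> unit" where "plus_unit _ _ = ()"
definition scaleR_unit :: "real \<Rightarrow> unit \<Rightarrow> unit" where "scaleR_unit _ _ = ()"
definition norm_unit :: "unit \<Rightarrow> real" where "norm_unit _ = 0"
definition dist_unit :: "unit \<Rightarrow> unit \<Rightarrow> real" where "dist_unit _ _ = 0"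
definition sgn_unit :: "unit \<Rightarrow> unit" where "sgn_unit _ = ()"
definition inner_unit :: "unit \<Rightarrow> unit \<Rightarrow> real" where "inner_unit _ _ = 0"
definition uniformity_unit :: "(unit \<times> unit) filter"
  where "uniformity_unit = (INF e\<in>{0 <..}. principal {(x, y). dist x y < e})"
definition open_unit :: "unit set \<Rightarrow> bool"
  where "open_unit U = (\<forall>x\<in>U. eventually (\<lambda>(x', y). x' = x \<longrightarrow> y \<in> U) uniformity)"

instance
  by standard (simp_all add: zero_unit_def plus_unit_def scaleR_unit_def norm_unit_def dist_unit_def
      sgn_unit_def inner_unit_def uniformity_unit_def open_unit_def)

end

instance unit :: finite_dim_inner
proof
  show "\<exists>l r. strict_mono (r::nat \<Rightarrow> nat) \<and> (f \<circ> r) \<longlonglongrightarrow> l" for f :: "nat \<Rightarrow> unit"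
  proof (intro exI conjI)
    show "(f \<circ> id) \<longlonglongrightarrow> ()"
      by (rule tendsto_eventually) simp
  qed (rule strict_mono_id)
  show "\<exists>B::unit set. finite B \<and> (\<forall>x. \<exists>c. x = (\<Sum>b\<in>B. c b *\<^sub>R b))"
    by (intro exI[of _ UNIV]) simp
qed

section \<open>Smooth manifolds and smooth maps\<close>

text \<open>Only meant for open \<open>S\<close>.\<close>

primrec Ck_on :: "nat \<Rightarrow> 'a::real_normed_vector set \<Rightarrow> ('a \<Rightarrow> 'b::real_normed_vector) \<Rightarrow> bool" where
  "Ck_on 0 S f \<longleftrightarrow> continuous_on S f"
| "Ck_on (Suc k) S f \<longleftrightarrow> (\<forall>x\<in>S. f differentiable (at x)) \<and>
     (\<forall>v. Ck_on k S (\<lambda>x. frechet_derivative f (at x) v))"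

definition smooth_on :: "'a::real_normed_vector set \<Rightarrow> ('a \<Rightarrow> 'b::real_normed_vector) \<Rightarrow> bool"
  where "smooth_on S f \<longleftrightarrow> (\<forall>k. Ck_on k S f)"

text \<open>
  A chart is a pair of its domain and its coordinate map.  A manifold is given by an atlas: its
  points are the union of the chart domains, and its topology is the one making all charts
  homeomorphisms onto open sets.  The atlas need not be maximal; smooth maps and functions, and
  hence everything below, depend only on the smooth structure that it generates.
\<close>

type_synonym ('a, 'm) chart = "'a set \<times> ('a \<Rightarrow> 'm)"
type_synonym ('a, 'm) atlas = "('a, 'm) chart set"

definition points :: "('a, 'm) atlas \<Rightarrow> 'a set"
  where "points A = (\<Union>(U, \<phi>)\<in>A. U)"

definition smooth_atlas :: "('a, 'm::finite_dim_inner) atlas \<Rightarrow> bool"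
  where "smooth_atlas A \<longleftrightarrow>
    (\<forall>(U, \<phi>)\<in>A. inj_on \<phi> U \<and> open (\<phi> ` U)) \<and>
    (\<forall>(U, \<phi>)\<in>A. \<forall>(V, \<psi>)\<in>A. open (\<phi> ` (U \<inter> V)) \<and>
       smooth_on (\<phi> ` (U \<inter> V)) (\<psi> \<circ> the_inv_into U \<phi>))"

definition open_in_atlas :: "('a, 'm::finite_dim_inner) atlas \<Rightarrow> 'a set \<Rightarrow> bool"
  where "open_in_atlas A W \<longleftrightarrow> W \<subseteq> points A \<and> (\<forall>(U, \<phi>)\<in>A. open (\<phi> ` (U \<inter> W)))"

definition manifold_topology :: "('a, 'm::finite_dim_inner) atlas \<Rightarrow> 'a topology"
  where "manifold_topology A = topology (open_in_atlas A)"

lemma istopology_open_in_atlas: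
  assumes "smooth_atlas A"
  shows "istopology (open_in_atlas A)"
  unfolding istopology_def
proof (intro conjI allI impI)
  fix S T assume ST: "open_in_atlas A S" "open_in_atlas A T"
  have "open (\<phi> ` (U \<inter> (S \<inter> T)))" if c: "(U, \<phi>) \<in> A" for U \<phi>
  proof -
    have "inj_on \<phi> U"
      using assms c unfolding smooth_atlas_def by blast
    then have "\<phi> ` (U \<inter> (S \<inter> T)) = \<phi> ` (U \<inter> S) \<inter> \<phi> ` (U \<inter> T)"
      unfolding inj_on_def by blast
    moreover have "open (\<phi> ` (U \<inter> S))" "open (\<phi> ` (U \<inter> T))"
      using ST c unfolding open_in_atlas_def by blast+
    ultimately show ?thesis by auto
  qed
  then show "open_in_atlas A (S \<inter> T)"
    using ST unfolding open_in_atlas_def by blast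
next
  fix \<K> assume K: "\<forall>K\<in>\<K>. open_in_atlas A K"
  have "open (\<phi> ` (U \<inter> \<Union>\<K>))" if c: "(U, \<phi>) \<in> A" for U \<phi>
  proof -
    have "\<phi> ` (U \<inter> \<Union>\<K>) = (\<Union>K\<in>\<K>. \<phi> ` (U \<inter> K))" by blast
    moreover have "\<forall>K\<in>\<K>. open (\<phi> ` (U \<inter> K))"
      using K c unfolding open_in_atlas_def by blast
    ultimately show ?thesis by auto
  qed
  then show "open_in_atlas A (\<Union>\<K>)"
    using K unfolding open_in_atlas_def by blast
qed

lemma openin_manifold_topology:
  "smooth_atlas A \<Longrightarrow> openin (manifold_topology A) W \<longleftrightarrow> open_in_atlas A W"
  by (simp add: manifold_topology_def istopology_open_in_atlas topology_inverse')

definition smooth_manifold :: "('a, 'm::finite_dim_inner) atlas \<Rightarrow> bool"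
  where "smooth_manifold A \<longleftrightarrow> smooth_atlas A \<and>
    Hausdorff_space (manifold_topology A) \<and> second_countable (manifold_topology A)"

text \<open>Requiring the sets \<open>\<phi> ` (U \<inter> f -` V)\<close> to be open makes \<open>f\<close> continuous.\<close>

definition smooth_map ::
    "('a, 'm::real_normed_vector) atlas \<Rightarrow> ('b, 'n::real_normed_vector) atlas \<Rightarrow> ('a \<Rightarrow> 'b) \<Rightarrow> bool"
  where "smooth_map A B f \<longleftrightarrow> f \<in> points A \<rightarrow> points B \<and>
    (\<forall>(U, \<phi>)\<in>A. \<forall>(V, \<psi>)\<in>B. open (\<phi> ` (U \<inter> f -` V)) \<and>
       smooth_on (\<phi> ` (U \<inter> f -` V)) (\<psi> \<circ> f \<circ> the_inv_into U \<phi>))"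

definition diffeomorphism ::
    "('a, 'm::real_normed_vector) atlas \<Rightarrow> ('b, 'n::real_normed_vector) atlas \<Rightarrow> ('a \<Rightarrow> 'b) \<Rightarrow> bool"
  where "diffeomorphism A B f \<longleftrightarrow> bij_betw f (points A) (points B) \<and>
    smooth_map A B f \<and> smooth_map B A (the_inv_into (points A) f)"

definition vector_space_atlas :: "('v, 'v) atlas"
  where "vector_space_atlas = {(UNIV, id)}"

definition restrict_atlas :: "('a, 'm) atlas \<Rightarrow> 'a set \<Rightarrow> ('a, 'm) atlas"
  where "restrict_atlas A W = (\<lambda>(U, \<phi>). (U \<inter> W, \<phi>)) ` A"

definition prod_atlas :: "('a, 'm) atlas \<Rightarrow> ('b, 'n) atlas \<Rightarrow> ('a \<times> 'b, 'm \<times> 'n) atlas"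
  where "prod_atlas A B = {(U \<times> V, map_prod \<phi> \<psi>) | U \<phi> V \<psi>. (U, \<phi>) \<in> A \<and> (V, \<psi>) \<in> B}"

section \<open>Algebraic structures on sets\<close>

definition real_vector_space_on ::
    "'v set \<Rightarrow> ('v \<Rightarrow> 'v \<Rightarrow> 'v) \<Rightarrow> (real \<Rightarrow> 'v \<Rightarrow> 'v) \<Rightarrow> 'v \<Rightarrow> bool"
  where "real_vector_space_on V add smul zero \<longleftrightarrow>
    zero \<in> V \<and> (\<forall>x\<in>V. \<forall>y\<in>V. add x y \<in> V) \<and> (\<forall>c. \<forall>x\<in>V. smul c x \<in> V) \<and>
    (\<forall>x\<in>V. \<forall>y\<in>V. \<forall>z\<in>V. add (add x y) z = add x (add y z)) \<and>
    (\<forall>x\<in>V. \<forall>y\<in>V. add x y = add y x) \<and>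
    (\<forall>x\<in>V. add zero x = x) \<and>
    (\<forall>x\<in>V. \<exists>y\<in>V. add x y = zero) \<and>
    (\<forall>c. \<forall>x\<in>V. \<forall>y\<in>V. smul c (add x y) = add (smul c x) (smul c y)) \<and>
    (\<forall>c d. \<forall>x\<in>V. smul (c + d) x = add (smul c x) (smul d x)) \<and>
    (\<forall>c d. \<forall>x\<in>V. smul c (smul d x) = smul (c * d) x) \<and>
    (\<forall>x\<in>V. smul 1 x = x)"

text \<open>
  Here and below, maps that are counted (brackets, anchors, sections, functions) are extensional,
  i.e. \<^const>\<open>undefined\<close> outside their domain, so that equality in HOL is equality on the domain.
\<close>

definition lie_bracket_on ::
    "'v set \<Rightarrow> ('v \<Rightarrow> 'v \<Rightarrow> 'v) \<Rightarrow> (real \<Rightarrow> 'v \<Rightarrow> 'v) \<Rightarrow> 'v \<Rightarrow> ('v \<Rightarrow> 'v \<Rightarrow> 'v) \<Rightarrow> bool"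
  where "lie_bracket_on V add smul zero br \<longleftrightarrow>
    br \<in> V \<rightarrow>\<^sub>E V \<rightarrow>\<^sub>E V \<and>
    (\<forall>x\<in>V. \<forall>y\<in>V. \<forall>z\<in>V. br (add x y) z = add (br x z) (br y z)) \<and>
    (\<forall>x\<in>V. \<forall>y\<in>V. \<forall>z\<in>V. br x (add y z) = add (br x y) (br x z)) \<and>
    (\<forall>c. \<forall>x\<in>V. \<forall>y\<in>V. br (smul c x) y = smul c (br x y)) \<and>
    (\<forall>c. \<forall>x\<in>V. \<forall>y\<in>V. br x (smul c y) = smul c (br x y)) \<and>
    (\<forall>x\<in>V. br x x = zero) \<and>
    (\<forall>x\<in>V. \<forall>y\<in>V. \<forall>z\<in>V. add (add (br x (br y z)) (br y (br z x))) (br z (br x y)) = zero)"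

section \<open>Smooth functions and Poisson structures\<close>

definition smooth_functions :: "('a, 'm::real_normed_vector) atlas \<Rightarrow> ('a \<Rightarrow> real) set"
  where "smooth_functions A = {f \<in> extensional (points A). smooth_map A vector_space_atlas f}"

definition fun_add :: "('a, 'm) atlas \<Rightarrow> ('a \<Rightarrow> real) \<Rightarrow> ('a \<Rightarrow> real) \<Rightarrow> 'a \<Rightarrow> real"
  where "fun_add A f g = (\<lambda>x\<in>points A. f x + g x)"

definition fun_scale :: "('a, 'm) atlas \<Rightarrow> real \<Rightarrow> ('a \<Rightarrow> real) \<Rightarrow> 'a \<Rightarrow> real"
  where "fun_scale A c f = (\<lambda>x\<in>points A. c * f x)"

definition fun_zero :: "('a, 'm) atlas \<Rightarrow> 'a \<Rightarrow> real"
  where "fun_zero A = (\<lambda>x\<in>points A. 0)"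

definition fun_mult :: "('a, 'm) atlas \<Rightarrow> ('a \<Rightarrow> real) \<Rightarrow> ('a \<Rightarrow> real) \<Rightarrow> 'a \<Rightarrow> real"
  where "fun_mult A f g = (\<lambda>x\<in>points A. f x * g x)"

definition poisson_structure ::
    "('a, 'm::real_normed_vector) atlas \<Rightarrow> (('a \<Rightarrow> real) \<Rightarrow> ('a \<Rightarrow> real) \<Rightarrow> 'a \<Rightarrow> real) \<Rightarrow> bool"
  where "poisson_structure A P \<longleftrightarrow>
    lie_bracket_on (smooth_functions A) (fun_add A) (fun_scale A) (fun_zero A) P \<and>
    (\<forall>f\<in>smooth_functions A. \<forall>g\<in>smooth_functions A. \<forall>h\<in>smooth_functions A.
       P f (fun_mult A g h) = fun_add A (fun_mult A (P f g) h) (fun_mult A g (P f h)))"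

section \<open>Vector bundles\<close>

text \<open>
  The model space of the total space of a bundle with base modelled on \<open>'m\<close> and typical fibre \<open>'f\<close>
  is \<open>'m \<times> 'f\<close>; the rank is the dimension of \<open>'f\<close>.
\<close>

record ('a, 'm, 'e, 'f) vbundle =
  base :: "('a, 'm) atlas"
  total_space :: "('e, 'm \<times> 'f) atlas"
  projection :: "'e \<Rightarrow> 'a"
  vadd :: "'e \<Rightarrow> 'e \<Rightarrow> 'e"
  vscale :: "real \<Rightarrow> 'e \<Rightarrow> 'e"
  vzero :: "'a \<Rightarrow> 'e"

definition fibre :: "('a, 'm, 'e, 'f) vbundle \<Rightarrow> 'a \<Rightarrow> 'e set"
  where "fibre E x = {e \<in> points (total_space E). projection E e = x}"

text \<open>
  \<open>\<Psi>\<close> is the fibre component of the trivialization, which is the map \<open>e \<mapsto> (projection E e, \<Psi> e)\<close>.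
\<close>

definition local_trivialization ::
    "('a, 'm::finite_dim_inner, 'e, 'f::finite_dim_inner) vbundle \<Rightarrow> 'a set \<Rightarrow> ('e \<Rightarrow> 'f) \<Rightarrow> bool"
  where "local_trivialization E U \<Psi> \<longleftrightarrow>
    openin (manifold_topology (base E)) U \<and>
    diffeomorphism (restrict_atlas (total_space E) (projection E -` U))
      (prod_atlas (restrict_atlas (base E) U) vector_space_atlas) (\<lambda>e. (projection E e, \<Psi> e)) \<and>
    (\<forall>x\<in>U. \<forall>u\<in>fibre E x. \<forall>v\<in>fibre E x. \<Psi> (vadd E u v) = \<Psi> u + \<Psi> v) \<and>
    (\<forall>x\<in>U. \<forall>c. \<forall>u\<in>fibre E x. \<Psi> (vscale E c u) = c *\<^sub>R \<Psi> u)"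

definition vector_bundle ::
    "('a, 'm::finite_dim_inner, 'e, 'f::finite_dim_inner) vbundle \<Rightarrow> bool"
  where "vector_bundle E \<longleftrightarrow>
    smooth_manifold (base E) \<and> smooth_manifold (total_space E) \<and>
    smooth_map (total_space E) (base E) (projection E) \<and>
    (\<forall>x\<in>points (base E). real_vector_space_on (fibre E x) (vadd E) (vscale E) (vzero E x)) \<and>
    (\<forall>x\<in>points (base E). \<exists>U \<Psi>. x \<in> U \<and> local_trivialization E U \<Psi>)"

text \<open>Vector bundle maps covering the identity of the common base.\<close>

definition vector_bundle_map ::
    "('a, 'm::finite_dim_inner, 'e, 'f::finite_dim_inner) vbundle \<Rightarrow>
     ('a, 'm, 'e2, 'f2::finite_dim_inner) vbundle \<Rightarrow> ('e \<Rightarrow> 'e2) \<Rightarrow> bool"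
  where "vector_bundle_map E F h \<longleftrightarrow>
    smooth_map (total_space E) (total_space F) h \<and>
    (\<forall>e\<in>points (total_space E). projection F (h e) = projection E e) \<and>
    (\<forall>x\<in>points (base E). \<forall>u\<in>fibre E x. \<forall>v\<in>fibre E x. h (vadd E u v) = vadd F (h u) (h v)) \<and>
    (\<forall>x\<in>points (base E). \<forall>c. \<forall>u\<in>fibre E x. h (vscale E c u) = vscale F c (h u))"

definition sections :: "('a, 'm::finite_dim_inner, 'e, 'f::finite_dim_inner) vbundle \<Rightarrow> ('a \<Rightarrow> 'e) set"
  where "sections E = {s \<in> extensional (points (base E)).
    smooth_map (base E) (total_space E) s \<and> (\<forall>x\<in>points (base E). projection E (s x) = x)}"

definition sec_add :: "('a, 'm, 'e, 'f) vbundle \<Rightarrow> ('a \<Rightarrow> 'e) \<Rightarrow> ('a \<Rightarrow> 'e) \<Rightarrow> 'a \<Rightarrow> 'e"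
  where "sec_add E s t = (\<lambda>x\<in>points (base E). vadd E (s x) (t x))"

definition sec_scale :: "('a, 'm, 'e, 'f) vbundle \<Rightarrow> real \<Rightarrow> ('a \<Rightarrow> 'e) \<Rightarrow> 'a \<Rightarrow> 'e"
  where "sec_scale E c s = (\<lambda>x\<in>points (base E). vscale E c (s x))"

definition sec_zero :: "('a, 'm, 'e, 'f) vbundle \<Rightarrow> 'a \<Rightarrow> 'e"
  where "sec_zero E = (\<lambda>x\<in>points (base E). vzero E x)"

definition sec_mult :: "('a, 'm, 'e, 'f) vbundle \<Rightarrow> ('a \<Rightarrow> real) \<Rightarrow> ('a \<Rightarrow> 'e) \<Rightarrow> 'a \<Rightarrow> 'e"
  where "sec_mult E f s = (\<lambda>x\<in>points (base E). vscale E (f x) (s x))"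

section \<open>The tangent bundle\<close>

text \<open>Tangent vectors at \<open>x\<close> are the derivations at \<open>x\<close> of the algebra of smooth functions.\<close>

definition tangent_space :: "('a, 'm::finite_dim_inner) atlas \<Rightarrow> 'a \<Rightarrow> (('a \<Rightarrow> real) \<Rightarrow> real) set"
  where "tangent_space A x = {v \<in> extensional (smooth_functions A).
    (\<forall>f\<in>smooth_functions A. \<forall>g\<in>smooth_functions A. v (fun_add A f g) = v f + v g) \<and>
    (\<forall>c. \<forall>f\<in>smooth_functions A. v (fun_scale A c f) = c * v f) \<and>
    (\<forall>f\<in>smooth_functions A. \<forall>g\<in>smooth_functions A. v (fun_mult A f g) = v f * g x + f x * v g)}"

text \<open>
  The components of a tangent vector in a chart form the vector \<open>a\<close> such that the tangent vector
  is the directional derivative along \<open>a\<close> in that chart.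
\<close>

definition tangent_components ::
    "('a, 'm::finite_dim_inner) atlas \<Rightarrow> ('a, 'm) chart \<Rightarrow> 'a \<Rightarrow> (('a \<Rightarrow> real) \<Rightarrow> real) \<Rightarrow> 'm"
  where "tangent_components A c x v = (case c of (U, \<phi>) \<Rightarrow>
    THE a. \<forall>f\<in>smooth_functions A. v f = frechet_derivative (f \<circ> the_inv_into U \<phi>) (at (\<phi> x)) a)"

definition tangent_atlas ::
    "('a, 'm::finite_dim_inner) atlas \<Rightarrow> ('a \<times> (('a \<Rightarrow> real) \<Rightarrow> real), 'm \<times> 'm) atlas"
  where "tangent_atlas A =
    {(SIGMA x:U. tangent_space A x, \<lambda>(x, v). (\<phi> x, tangent_components A (U, \<phi>) x v)) | U \<phi>.
      (U, \<phi>) \<in> A}"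

definition tangent_bundle ::
    "('a, 'm::finite_dim_inner) atlas \<Rightarrow> ('a, 'm, 'a \<times> (('a \<Rightarrow> real) \<Rightarrow> real), 'm) vbundle"
  where "tangent_bundle A = \<lparr>
    base = A,
    total_space = tangent_atlas A,
    projection = fst,
    vadd = (\<lambda>(x, v) (y, w). (x, \<lambda>f\<in>smooth_functions A. v f + w f)),
    vscale = (\<lambda>c (x, v). (x, \<lambda>f\<in>smooth_functions A. c * v f)),
    vzero = (\<lambda>x. (x, \<lambda>f\<in>smooth_functions A. 0))\<rparr>"

text \<open>A tangent vector is a pair of its base point and a derivation, whence the \<^const>\<open>snd\<close>.\<close>

definition lie_derivative ::
    "('a, 'm) atlas \<Rightarrow> ('a \<Rightarrow> 'a \<times> (('a \<Rightarrow> real) \<Rightarrow> real)) \<Rightarrow> ('a \<Rightarrow> real) \<Rightarrow> 'a \<Rightarrow> real"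
  where "lie_derivative A Z f = (\<lambda>x\<in>points A. snd (Z x) f)"

section \<open>The dual bundle\<close>

definition dual_space :: "('a, 'm, 'e, 'f) vbundle \<Rightarrow> 'a \<Rightarrow> ('e \<Rightarrow> real) set"
  where "dual_space E x = {\<xi> \<in> extensional (fibre E x).
    (\<forall>u\<in>fibre E x. \<forall>v\<in>fibre E x. \<xi> (vadd E u v) = \<xi> u + \<xi> v) \<and>
    (\<forall>c. \<forall>u\<in>fibre E x. \<xi> (vscale E c u) = c * \<xi> u)}"

text \<open>
  A local trivialization \<open>\<Psi>\<close> of \<open>E\<close> turns the standard basis of \<open>'f\<close> into a local frame; the
  fibre coordinates of a covector are its values on that frame.  The class
  \<^class>\<open>euclidean_space\<close> makes the rank positive.  Rank 0 must be excluded: there the only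
  vertical function is 0, so every Poisson structure on the dual (a copy of the base) is
  homogeneous, although the bundle carries exactly one Lie algebroid structure.
\<close>

definition dual_components ::
    "('a, 'm, 'e, 'f::euclidean_space) vbundle \<Rightarrow> ('e \<Rightarrow> 'f) \<Rightarrow> 'a \<Rightarrow> ('e \<Rightarrow> real) \<Rightarrow> 'f"
  where "dual_components E \<Psi> x \<xi> = (\<Sum>b\<in>Basis. \<xi> (the_inv_into (fibre E x) \<Psi> b) *\<^sub>R b)"

definition dual_atlas ::
    "('a, 'm::finite_dim_inner, 'e, 'f::euclidean_space) vbundle \<Rightarrow> ('a \<times> ('e \<Rightarrow> real), 'm \<times> 'f) atlas"
  where "dual_atlas E =
    {(SIGMA x:U \<inter> V. dual_space E x, \<lambda>(x, \<xi>). (\<phi> x, dual_components E \<Psi> x \<xi>)) | U \<phi> V \<Psi>.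
      (U, \<phi>) \<in> base E \<and> local_trivialization E V \<Psi>}"

definition dual_bundle ::
    "('a, 'm::finite_dim_inner, 'e, 'f::euclidean_space) vbundle \<Rightarrow>
     ('a, 'm, 'a \<times> ('e \<Rightarrow> real), 'f) vbundle"
  where "dual_bundle E = \<lparr>
    base = base E,
    total_space = dual_atlas E,
    projection = fst,
    vadd = (\<lambda>(x, \<xi>) (y, \<eta>). (x, \<lambda>e\<in>fibre E x. \<xi> e + \<eta> e)),
    vscale = (\<lambda>c (x, \<xi>). (x, \<lambda>e\<in>fibre E x. c * \<xi> e)),
    vzero = (\<lambda>x. (x, \<lambda>e\<in>fibre E x. 0))\<rparr>"

section \<open>Lie algebroids and homogeneous Poisson structures\<close>

definition lie_algebroid ::
    "('a, 'm::finite_dim_inner, 'e, 'f::finite_dim_inner) vbundle \<Rightarrow>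
     (('a \<Rightarrow> 'e) \<Rightarrow> ('a \<Rightarrow> 'e) \<Rightarrow> 'a \<Rightarrow> 'e) \<Rightarrow>
     ('e \<Rightarrow> 'a \<times> (('a \<Rightarrow> real) \<Rightarrow> real)) \<Rightarrow> bool"
  where "lie_algebroid E br \<rho> \<longleftrightarrow>
    lie_bracket_on (sections E) (sec_add E) (sec_scale E) (sec_zero E) br \<and>
    \<rho> \<in> extensional (points (total_space E)) \<and>
    vector_bundle_map E (tangent_bundle (base E)) \<rho> \<and>
    (\<forall>s1\<in>sections E. \<forall>s2\<in>sections E. \<forall>f\<in>smooth_functions (base E).
       br s1 (sec_mult E f s2) =
         sec_add E (sec_mult E f (br s1 s2)) (sec_mult E (lie_derivative (base E) (\<rho> \<circ> s1) f) s2))"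

definition lie_algebroid_structures ::
    "('a, 'm::finite_dim_inner, 'e, 'f::finite_dim_inner) vbundle \<Rightarrow>
     ((('a \<Rightarrow> 'e) \<Rightarrow> ('a \<Rightarrow> 'e) \<Rightarrow> 'a \<Rightarrow> 'e) \<times> ('e \<Rightarrow> 'a \<times> (('a \<Rightarrow> real) \<Rightarrow> real))) set"
  where "lie_algebroid_structures E = {(br, \<rho>). lie_algebroid E br \<rho>}"

definition vertical_function ::
    "('a, 'm::finite_dim_inner, 'e, 'f::euclidean_space) vbundle \<Rightarrow> ('a \<Rightarrow> 'e) \<Rightarrow>
     'a \<times> ('e \<Rightarrow> real) \<Rightarrow> real"
  where "vertical_function E X =
    (\<lambda>\<xi>\<in>points (total_space (dual_bundle E)). snd \<xi> (X (projection (dual_bundle E) \<xi>)))"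

definition vertical ::
    "('a, 'm::finite_dim_inner, 'e, 'f::euclidean_space) vbundle \<Rightarrow>
     ('a \<times> ('e \<Rightarrow> real) \<Rightarrow> real) \<Rightarrow> bool"
  where "vertical E f \<longleftrightarrow> (\<exists>X\<in>sections E. f = vertical_function E X)"

definition homogeneous_poisson_structures ::
    "('a, 'm::finite_dim_inner, 'e, 'f::euclidean_space) vbundle \<Rightarrow>
     (('a \<times> ('e \<Rightarrow> real) \<Rightarrow> real) \<Rightarrow> ('a \<times> ('e \<Rightarrow> real) \<Rightarrow> real) \<Rightarrow>
      'a \<times> ('e \<Rightarrow> real) \<Rightarrow> real) set"
  where "homogeneous_poisson_structures E =
    {P. poisson_structure (total_space (dual_bundle E)) P \<and>
        (\<forall>f g. vertical E f \<and> vertical E g \<longrightarrow> vertical E (P f g))}"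

end

theory Submission
  imports Defs
begin

text \<open>
  Call a function on \<open>E\<^sup>*\<close> affine if it is the sum of a vertical function \<open>\<Phi>\<^sub>X\<close> and of a function \<open>h \<circ> \<pi>\<close> with
  \<open>h\<close> smooth on the base.  Both kinds of structure amount to the same Lie bracket on affine functions,
  \<open>{\<Phi>\<^sub>X + h \<circ> \<pi>, \<Phi>\<^sub>Y + k \<circ> \<pi>} = \<Phi>\<^bsub>{X, Y}\<^esub> + (\<rho>(X) k - \<rho>(Y) h) \<circ> \<pi>\<close>.

  Given a Lie algebroid, the value of this bracket at a point of \<open>E\<^sup>*\<close> depends only on the differentials
  of the two affine functions there, and affine functions realise all differentials; so the bracket extends in
  exactly one way to a biderivation of the smooth functions on \<open>E\<^sup>*\<close>.  The Jacobiator of a biderivation is a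
  derivation in each argument, so it vanishes because it vanishes on affine functions.

  Conversely, let a homogeneous Poisson structure be given.  Since \<open>f \<circ> \<pi>\<close> times a vertical function is vertical,
  the Leibniz rule shows that \<open>{\<Phi>\<^sub>X, f \<circ> \<pi>}\<close> times any vertical function is vertical.  As the rank is positive,
  \<open>{\<Phi>\<^sub>X, f \<circ> \<pi>}\<close> is constant on fibres, which defines \<open>\<rho>(X) f\<close>; a second application of the same argument
  gives \<open>{f \<circ> \<pi>, g \<circ> \<pi>} = 0\<close>.
\<close>

section \<open>Smooth maps between finite-dimensional spaces\<close>

text \<open>Vertical functions alone cannot carry the bracket: they vanish on the zero section, so
  at its points their differentials see no base direction. Basic functions repair this, and with
  them the anchor enters the bracket.

  A Poisson structure is here an operator on functions, and tangent vectors are derivations, so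
  locality has to be earned. Cutoff functions and the lemma of Hadamard show that derivations are
  directional derivatives; equality of differentials at a point can then be expressed as agreement
  under all derivations. The extension is built pointwise, by exchanging arguments for affine
  functions with the same differential, and never through a bivector field.

  Two points are delicate. An affine function whose differential vanishes at one single point must
  have zero bracket there with every affine function; the Leibniz rule of the algebroid gives this.
  And the Jacobi identity for affine functions requires that the anchor respects brackets, which is
  no axiom and is forced, in positive rank, by the Jacobi identity of sections.\<close>

lemma orthonormal_basis_exists:
  "\<exists>B::'m::finite_dim_inner set. finite B \<and> (\<forall>x. x = (\<Sum>b\<in>B. (x \<bullet> b) *\<^sub>R b)) \<and>
     (\<forall>b\<in>B. \<forall>c\<in>B. b \<bullet> c = (if b = c then 1 else 0))"
proof -
  obtain B :: "'m set" where B: "finite B" "\<And>x. \<exists>c. x = (\<Sum>b\<in>B. c b *\<^sub>R b)"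
    using finite_spanning_set by blast
  obtain C where C: "finite C" "span C = span B" "pairwise orthogonal C"
    using basis_orthogonal[OF B(1)] by blast
  \<comment> \<open>An orthogonal family may contain 0, which cannot be normalised; dropping it
    leaves the span unchanged.\<close>
  define D where "D = (\<lambda>c. c /\<^sub>R norm c) ` (C - {0})"
  have fin: "finite D" using C by (simp add: D_def)
  have on: "b \<bullet> c = (if b = c then 1 else 0)" if "b \<in> D" "c \<in> D" for b c
  proof -
    obtain b' where b': "b' \<in> C - {0}" "b = b' /\<^sub>R norm b'"
      using \<open>b \<in> D\<close> unfolding D_def by (rule imageE) simp
    obtain c' where c': "c' \<in> C - {0}" "c = c' /\<^sub>R norm c'"
      using \<open>c \<in> D\<close> unfolding D_def by (rule imageE) simp
    note bc = b' c'
    show ?thesis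
    proof (cases "b' = c'")
      case True
      then show ?thesis using bc by (simp add: dot_square_norm power2_eq_square)
    next
      case False
      then have "b' \<bullet> c' = 0" using bc C(3) by (auto simp: pairwise_def orthogonal_def)
      then have "b \<bullet> c = 0" using bc by simp
      moreover have "b \<bullet> b = 1" using b' by (simp add: dot_square_norm power2_eq_square)
      then have "b \<noteq> c" using \<open>b \<bullet> c = 0\<close> by auto
      ultimately show ?thesis by simp
    qed
  qed
  have "c \<in> span D" if "c \<in> C" for c
  proof (cases "c = 0")
    case False
    then have "c /\<^sub>R norm c \<in> span D" using that by (auto simp: D_def intro: span_base)
    then have "norm c *\<^sub>R (c /\<^sub>R norm c) \<in> span D" by (rule span_scale)
    then show ?thesis using False by simp
  qed (simp add: span_zero)
  then have "span C \<subseteq> span D" by (intro span_minimal) auto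
  moreover have "x \<in> span B" for x
    using B(2)[of x] span_finite[OF B(1)] by auto
  ultimately have sp: "x \<in> span D" for x using C(2) by auto
  have "x = (\<Sum>b\<in>D. (x \<bullet> b) *\<^sub>R b)" for x
  proof -
    obtain u where u: "x = (\<Sum>b\<in>D. u b *\<^sub>R b)"
      using sp[of x] span_finite[OF fin] by auto
    have "x \<bullet> c = u c" if "c \<in> D" for c
    proof -
      have "x \<bullet> c = (\<Sum>b\<in>D. u b * (b \<bullet> c))"
        by (simp add: u inner_sum_left)
      also have "\<dots> = (\<Sum>b\<in>D. if b = c then u b else 0)"
        by (rule sum.cong) (auto simp: on that)
      also have "\<dots> = u c" using fin that by simp
      finally show ?thesis .
    qed
    then show ?thesis by (subst (1) u) simp
  qed
  then show ?thesis using fin on by blast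
qed

text \<open>Serves as \<open>Basis\<close> for base manifolds, where dimension 0 is allowed; there
  the set is empty.\<close>

definition onb :: "'m::finite_dim_inner set"
  where "onb = (SOME B. finite B \<and> (\<forall>x. x = (\<Sum>b\<in>B. (x \<bullet> b) *\<^sub>R b)) \<and>
     (\<forall>b\<in>B. \<forall>c\<in>B. b \<bullet> c = (if b = c then 1 else 0)))"

lemma finite_onb [simp]: "finite (onb :: 'm::finite_dim_inner set)"
  and onb_expansion: "x = (\<Sum>b\<in>onb. (x \<bullet> b) *\<^sub>R b)"
  and onb_inner: "b \<in> onb \<Longrightarrow> c \<in> onb \<Longrightarrow> b \<bullet> c = (if b = c then 1 else 0)"
  for x b c :: "'m::finite_dim_inner"
proof -
  have *: "finite (onb::'m set) \<and> (\<forall>x::'m. x = (\<Sum>b\<in>onb. (x \<bullet> b) *\<^sub>R b)) \<and>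
     (\<forall>b\<in>onb. \<forall>c\<in>onb. (b::'m) \<bullet> c = (if b = c then 1 else 0))"
    unfolding onb_def by (rule someI_ex[OF orthonormal_basis_exists])
  show "finite (onb::'m set)" using * by blast
  show "x = (\<Sum>b\<in>onb. (x \<bullet> b) *\<^sub>R b)" using * by blast
  show "b \<in> onb \<Longrightarrow> c \<in> onb \<Longrightarrow> b \<bullet> c = (if b = c then 1 else 0)" using * by blast
qed

lemma linear_onb_expansion:
  fixes x :: "'m::finite_dim_inner"
  assumes "linear L"
  shows "L x = (\<Sum>b\<in>onb. (x \<bullet> b) *\<^sub>R L b)"
proof -
  have "L (\<Sum>b\<in>onb. (x \<bullet> b) *\<^sub>R b) = (\<Sum>b\<in>onb. (x \<bullet> b) *\<^sub>R L b)"
    by (simp add: linear_sum[OF assms] linear_scale[OF assms])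
  then show ?thesis using onb_expansion[of x] by simp
qed

lemma sum_onb_inner:
  fixes u :: "'m::finite_dim_inner \<Rightarrow> real"
  shows "c \<in> onb \<Longrightarrow> (\<Sum>b\<in>onb. u b *\<^sub>R b) \<bullet> c = u c"
proof -
  assume c: "c \<in> onb"
  have "(\<Sum>b\<in>onb. u b *\<^sub>R b) \<bullet> c = (\<Sum>b\<in>onb. if b = c then u b else 0)"
    unfolding inner_sum_left by (rule sum.cong) (auto simp: onb_inner c)
  then show ?thesis using c by simp
qed

section \<open>Calculus of maps of class C^k\<close>

lemma Ck_on_SucI:
  assumes "\<And>x. x \<in> S \<Longrightarrow> (f has_derivative f' x) (at x)"
    and "\<And>v. Ck_on k S (\<lambda>x. frechet_derivative f (at x) v)"
  shows "Ck_on (Suc k) S f"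
  using assms by (auto simp: differentiable_def)

lemma Ck_on_SucD: "Ck_on (Suc k) S f \<Longrightarrow> Ck_on k S f"
proof (induction k arbitrary: f)
  case 0
  then show ?case
    by (auto intro!: continuous_at_imp_continuous_on differentiable_imp_continuous_within)
qed simp

lemma Ck_on_derivative:
  assumes "Ck_on (Suc k) S f" "x \<in> S"
  shows "(f has_derivative frechet_derivative f (at x)) (at x)"
  using assms by (simp add: frechet_derivative_works)

text \<open>At a point of an open set the derivative depends only on values in that set, so
  agreement passes to derivatives of every order.\<close>

lemma Ck_on_cong_imp:
  assumes "open S" "Ck_on k S f" "\<And>x. x \<in> S \<Longrightarrow> f x = g x"
  shows "Ck_on k S g"
  using assms(2,3)
proof (induction k arbitrary: f g)
  case 0
  then show ?case using continuous_on_cong[of S S f g] by simp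
next
  case (Suc k)
  have d: "(g has_derivative frechet_derivative f (at x)) (at x)" if "x \<in> S" for x
    using has_derivative_transform_within_open[OF Ck_on_derivative[OF Suc.prems(1) that] assms(1) that]
      Suc.prems(2) by blast
  show ?case
  proof (rule Ck_on_SucI[OF d])
    fix v
    show "Ck_on k S (\<lambda>x. frechet_derivative g (at x) v)"
      by (rule Suc.IH[of "\<lambda>x. frechet_derivative f (at x) v"])
        (use Suc.prems frechet_derivative_at[OF d] in auto)
  qed
qed

text \<open>Lets the closure proofs work with an explicit formula for the derivative instead of the
  \<open>frechet_derivative\<close> that occurs in \<open>Ck_on\<close>.\<close>

lemma Ck_on_Suc_derivativeI:
  assumes "open S" "\<And>x. x \<in> S \<Longrightarrow> (f has_derivative f' x) (at x)"
    and "\<And>v. Ck_on k S (\<lambda>x. f' x v)"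
  shows "Ck_on (Suc k) S f"
proof (rule Ck_on_SucI[OF assms(2)])
  show "Ck_on k S (\<lambda>x. frechet_derivative f (at x) v)" for v
    by (rule Ck_on_cong_imp[OF assms(1) assms(3)[of v]])
      (simp add: frechet_derivative_at[OF assms(2), symmetric])
qed

lemma Ck_on_subset: "Ck_on k S f \<Longrightarrow> T \<subseteq> S \<Longrightarrow> Ck_on k T f"
  by (induction k arbitrary: f) (auto intro: continuous_on_subset)

lemma Ck_on_local:
  assumes "\<And>x. x \<in> S \<Longrightarrow> \<exists>T. open T \<and> x \<in> T \<and> Ck_on k T f"
  shows "Ck_on k S f"
  using assms
proof (induction k arbitrary: f)
  case 0
  then show ?case
    by (metis Ck_on.simps(1) continuous_at_imp_continuous_on continuous_on_eq_continuous_at)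
next
  case (Suc k)
  then show ?case by simp metis
qed

lemma Ck_on_const: "Ck_on k S (\<lambda>x. c)"
  by (induction k arbitrary: c) simp_all

lemma Ck_on_bounded_linear:
  assumes "open S" "bounded_linear L" "Ck_on k S f"
  shows "Ck_on k S (\<lambda>x. L (f x))"
  using assms(3)
proof (induction k arbitrary: f)
  case 0
  then show ?case using bounded_linear.continuous_on[OF assms(2)] by simp
next
  case (Suc k)
  show ?case
    by (rule Ck_on_Suc_derivativeI[OF assms(1) bounded_linear.has_derivative[OF assms(2) Ck_on_derivative[OF Suc.prems]]])
      (use Suc in auto)
qed

lemma Ck_on_add:
  assumes "open S" "Ck_on k S f" "Ck_on k S g"
  shows "Ck_on k S (\<lambda>x. f x + g x)"
  using assms(2,3)
proof (induction k arbitrary: f g)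
  case 0
  then show ?case by (simp add: continuous_on_add)
next
  case (Suc k)
  show ?case
    by (rule Ck_on_Suc_derivativeI[OF assms(1) has_derivative_add[OF Ck_on_derivative[OF Suc.prems(1)]
          Ck_on_derivative[OF Suc.prems(2)]]]) (use Suc in auto)
qed

lemma Ck_on_sum:
  assumes "open S" "\<And>i. i \<in> I \<Longrightarrow> Ck_on k S (f i)"
  shows "Ck_on k S (\<lambda>x. \<Sum>i\<in>I. f i x)"
  using assms(2)
  by (induction I rule: infinite_finite_induct) (auto simp: Ck_on_const intro: Ck_on_add[OF assms(1)])

text \<open>One proof for products, scalar multiples and inner products. The product rule pairs a
  differentiated factor with an undifferentiated one, so the induction also uses that order k + 1
  implies order k.\<close>

lemma Ck_on_bilinear:
  assumes "open S" "bounded_bilinear B" "Ck_on k S f" "Ck_on k S g"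
  shows "Ck_on k S (\<lambda>x. B (f x) (g x))"
  using assms(3,4)
proof (induction k arbitrary: f g)
  case 0
  then show ?case using bounded_bilinear.continuous_on[OF assms(2)] by simp
next
  case (Suc k)
  show ?case
  proof (rule Ck_on_Suc_derivativeI[OF assms(1) bounded_bilinear.FDERIV[OF assms(2) Ck_on_derivative[OF Suc.prems(1)]
          Ck_on_derivative[OF Suc.prems(2)]]])
    fix v
    show "Ck_on k S (\<lambda>x. B (f x) (frechet_derivative g (at x) v) + B (frechet_derivative f (at x) v) (g x))"
      by (intro Ck_on_add[OF assms(1)] Suc.IH)
        (use Suc.prems Ck_on_SucD[OF Suc.prems(1)] Ck_on_SucD[OF Suc.prems(2)] in auto)
  qed
qed

text \<open>By the chain rule g is differentiated in the direction
  \<open>frechet_derivative f (at x) v\<close>, which moves with x, whereas \<open>Ck_on\<close>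
  speaks of fixed directions only. Expanding it in an orthonormal basis of the intermediate space
  gives a finite sum of products, in which the induction hypothesis applies to the derivatives of g
  along basis vectors. This is where finite dimension enters.\<close>

lemma Ck_on_compose:
  fixes f :: "'a::real_normed_vector \<Rightarrow> 'n::finite_dim_inner"
  assumes "open S" "f ` S \<subseteq> T" "Ck_on k S f" "Ck_on k T g"
  shows "Ck_on k S (\<lambda>x. g (f x))"
  using assms(3,4)
proof (induction k arbitrary: g)
  case 0
  then show ?case using continuous_on_compose2[of T g S f] assms by simp
next
  case (Suc k)
  have d: "((\<lambda>x. g (f x)) has_derivative
      (\<lambda>v. frechet_derivative g (at (f x)) (frechet_derivative f (at x) v))) (at x)" if "x \<in> S" for x
    by (rule has_derivative_compose[OF Ck_on_derivative[OF Suc.prems(1) that]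
          Ck_on_derivative[OF Suc.prems(2)]]) (use that assms in auto)
  show ?case
  proof (rule Ck_on_Suc_derivativeI[OF assms(1) d])
    fix v
    have "Ck_on k S (\<lambda>x. \<Sum>b\<in>onb. (frechet_derivative f (at x) v \<bullet> b) *\<^sub>R frechet_derivative g (at (f x)) b)"
    proof (intro Ck_on_sum Ck_on_bilinear[OF assms(1) bounded_bilinear_scaleR] assms(1))
      fix b :: 'n
      show "Ck_on k S (\<lambda>x. frechet_derivative f (at x) v \<bullet> b)"
        by (rule Ck_on_bounded_linear[OF assms(1) bounded_linear_inner_left]) (use Suc.prems(1) in auto)
      show "Ck_on k S (\<lambda>x. frechet_derivative g (at (f x)) b)"
        by (rule Suc.IH) (use Suc.prems Ck_on_SucD[OF Suc.prems(1)] in auto)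
    qed
    then show "Ck_on k S (\<lambda>x. frechet_derivative g (at (f x)) (frechet_derivative f (at x) v))"
    proof (rule Ck_on_cong_imp[OF assms(1)])
      fix x assume "x \<in> S"
      then have "linear (frechet_derivative g (at (f x)))"
        using Ck_on_derivative[OF Suc.prems(2), of "f x"] assms has_derivative_linear by blast
      then show "(\<Sum>b\<in>onb. (frechet_derivative f (at x) v \<bullet> b) *\<^sub>R frechet_derivative g (at (f x)) b) =
          frechet_derivative g (at (f x)) (frechet_derivative f (at x) v)"
        by (rule linear_onb_expansion[symmetric])
    qed
  qed
qed

section \<open>Closure properties of smooth maps\<close>

lemma smooth_on_cong_imp:
  "open S \<Longrightarrow> smooth_on S f \<Longrightarrow> (\<And>x. x \<in> S \<Longrightarrow> f x = g x) \<Longrightarrow> smooth_on S g"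
  unfolding smooth_on_def using Ck_on_cong_imp by blast

lemma smooth_on_subset: "smooth_on S f \<Longrightarrow> T \<subseteq> S \<Longrightarrow> smooth_on T f"
  unfolding smooth_on_def using Ck_on_subset by blast

lemma smooth_on_local:
  "(\<And>x. x \<in> S \<Longrightarrow> \<exists>T. open T \<and> x \<in> T \<and> smooth_on T f) \<Longrightarrow> smooth_on S f"
  unfolding smooth_on_def using Ck_on_local by metis

lemma smooth_on_const: "smooth_on S (\<lambda>x. c)"
  by (simp add: smooth_on_def Ck_on_const)

lemma smooth_on_bounded_linear:
  "open S \<Longrightarrow> bounded_linear L \<Longrightarrow> smooth_on S f \<Longrightarrow> smooth_on S (\<lambda>x. L (f x))"
  by (simp add: smooth_on_def Ck_on_bounded_linear)

lemma smooth_on_id: "smooth_on S (\<lambda>x. x)"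
proof -
  have "Ck_on k S (\<lambda>x. x)" for k
    by (cases k) (simp_all add: frechet_derivative_ident Ck_on_const)
  then show ?thesis by (simp add: smooth_on_def)
qed

lemma smooth_on_linear: "open S \<Longrightarrow> bounded_linear L \<Longrightarrow> smooth_on S L"
  using smooth_on_bounded_linear[OF _ _ smooth_on_id, of S L] by simp

lemma smooth_on_add:
  "open S \<Longrightarrow> smooth_on S f \<Longrightarrow> smooth_on S g \<Longrightarrow> smooth_on S (\<lambda>x. f x + g x)"
  by (simp add: smooth_on_def Ck_on_add)

lemma smooth_on_sum:
  "open S \<Longrightarrow> (\<And>i. i \<in> I \<Longrightarrow> smooth_on S (f i)) \<Longrightarrow> smooth_on S (\<lambda>x. \<Sum>i\<in>I. f i x)"
  by (simp add: smooth_on_def Ck_on_sum)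

lemma smooth_on_bilinear:
  "open S \<Longrightarrow> bounded_bilinear B \<Longrightarrow> smooth_on S f \<Longrightarrow> smooth_on S g \<Longrightarrow> smooth_on S (\<lambda>x. B (f x) (g x))"
  by (simp add: smooth_on_def Ck_on_bilinear)

lemmas smooth_on_mult = smooth_on_bilinear[OF _ bounded_bilinear_mult]
lemmas smooth_on_scaleR = smooth_on_bilinear[OF _ bounded_bilinear_scaleR]
lemmas smooth_on_inner = smooth_on_bilinear[OF _ bounded_bilinear_inner]

lemma smooth_on_compose:
  fixes f :: "'a::real_normed_vector \<Rightarrow> 'n::finite_dim_inner"
  shows "open S \<Longrightarrow> f ` S \<subseteq> T \<Longrightarrow> smooth_on S f \<Longrightarrow> smooth_on T g \<Longrightarrow> smooth_on S (\<lambda>x. g (f x))"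
  by (simp add: smooth_on_def Ck_on_compose)

lemma smooth_on_Pair:
  assumes "open S" "smooth_on S f" "smooth_on S g"
  shows "smooth_on S (\<lambda>x. (f x, g x))"
proof -
  have l: "bounded_linear (\<lambda>x. (x, 0))" "bounded_linear (\<lambda>x. (0, x))"
    by (auto intro!: bounded_linear_Pair bounded_linear_ident bounded_linear_zero)
  have "smooth_on S (\<lambda>x. (f x, 0) + (0, g x))"
    by (intro smooth_on_add assms smooth_on_bounded_linear[OF _ l(1)] smooth_on_bounded_linear[OF _ l(2)])
  then show ?thesis by simp
qed

lemma smooth_on_continuous: "smooth_on S f \<Longrightarrow> continuous_on S f"
  unfolding smooth_on_def by (metis Ck_on.simps(1))

lemma smooth_on_derivative:
  "smooth_on S f \<Longrightarrow> x \<in> S \<Longrightarrow> (f has_derivative frechet_derivative f (at x)) (at x)"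
  unfolding smooth_on_def using Ck_on_derivative by blast

lemma smooth_on_frechet_derivative:
  "smooth_on S f \<Longrightarrow> smooth_on S (\<lambda>x. frechet_derivative f (at x) v)"
  unfolding smooth_on_def using Ck_on.simps(2) by blast

lemma frechet_derivative_onb_expansion:
  fixes f :: "'m::finite_dim_inner \<Rightarrow> 'b::real_normed_vector"
  assumes "smooth_on S f" "x \<in> S"
  shows "frechet_derivative f (at x) a = (\<Sum>b\<in>onb. (a \<bullet> b) *\<^sub>R frechet_derivative f (at x) b)"
  using linear_onb_expansion[OF has_derivative_linear[OF smooth_on_derivative[OF assms]]] .

text \<open>The direction may vary with the point: a vector field with smooth components sends
  smooth functions to smooth functions.\<close>

lemma smooth_on_directional_derivative:
  fixes f :: "'m::finite_dim_inner \<Rightarrow> 'b::real_normed_vector"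
  assumes "open S" "smooth_on S f" "smooth_on S a"
  shows "smooth_on S (\<lambda>x. frechet_derivative f (at x) (a x))"
proof (rule smooth_on_cong_imp[OF assms(1)])
  show "smooth_on S (\<lambda>x. \<Sum>b\<in>onb. (a x \<bullet> b) *\<^sub>R frechet_derivative f (at x) b)"
    by (intro smooth_on_sum smooth_on_scaleR smooth_on_inner assms smooth_on_frechet_derivative smooth_on_const)
qed (rule frechet_derivative_onb_expansion[OF assms(2), symmetric])

section \<open>Bump functions and the lemma of Hadamard\<close>

instance finite_dim_inner \<subseteq> banach ..

text \<open>The derivative of 1/f is, up to sign, the product of two copies of 1/f and a derivative
  of f, so each order of differentiability of 1/f yields the next.\<close>

lemma smooth_on_inverse:
  fixes f :: "'a::real_normed_vector \<Rightarrow> real"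
  assumes "open S" "smooth_on S f" "\<And>x. x \<in> S \<Longrightarrow> f x \<noteq> 0"
  shows "smooth_on S (\<lambda>x. inverse (f x))"
proof -
  have "Ck_on k S (\<lambda>x. inverse (f x))" for k
  proof (induction k)
    case 0
    then show ?case using smooth_on_continuous[OF assms(2)] assms(3) by (auto intro: continuous_on_inverse)
  next
    case (Suc k)
    show ?case
    proof (rule Ck_on_Suc_derivativeI[OF assms(1) Deriv.has_derivative_inverse[OF assms(3) smooth_on_derivative[OF assms(2)]]])
      fix v
      have c: "Ck_on k S (\<lambda>x. frechet_derivative f (at x) v)"
        using smooth_on_frechet_derivative[OF assms(2)] by (simp add: smooth_on_def)
      have "Ck_on k S (\<lambda>x. (-1) * (inverse (f x) * frechet_derivative f (at x) v * inverse (f x)))"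
        by (intro Ck_on_bilinear[OF assms(1) bounded_bilinear_mult] Ck_on_const Suc c)
      then show "Ck_on k S (\<lambda>x. - (inverse (f x) * frechet_derivative f (at x) v * inverse (f x)))"
        by simp
    qed
  qed
  then show ?thesis by (simp add: smooth_on_def)
qed

text \<open>For n = 0 this is the classical smooth function that is flat at 0. The power of 1/t is
  carried along because the derivative of one member is a combination of the members with exponents
  n + 2 and n + 1; the family is closed under differentiation.\<close>

definition flat_exp :: "nat \<Rightarrow> real \<Rightarrow> real"
  where "flat_exp n t = (if t > 0 then exp (- inverse t) * inverse t ^ n else 0)"

text \<open>With u = 1/t, a single term of the exponential series gives u^(n+1) \<le> (n+1)! exp u.
  A linear bound is enough: it makes every member of the family tend to 0 at 0.\<close>

lemma flat_exp_bound: "\<exists>C. \<forall>t. \<bar>flat_exp n t\<bar> \<le> C * \<bar>t\<bar>"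
proof -
  have pow: "u ^ k \<le> fact k * exp u" if "u \<ge> 0" for u :: real and k
  proof -
    have "(\<lambda>i. u ^ i /\<^sub>R fact i) sums exp u" by (rule exp_converges)
    then have s: "(\<lambda>i. u ^ i / fact i) sums exp u" by (simp add: divide_inverse mult.commute)
    have "(\<Sum>i\<in>{k}. u ^ i / fact i) \<le> (\<Sum>i. u ^ i / fact i)"
      by (rule sum_le_suminf[OF sums_summable[OF s]]) (use that in auto)
    then have "u ^ k / fact k \<le> exp u" using sums_unique[OF s] by simp
    then show ?thesis by (simp add: field_simps)
  qed
  have "\<bar>flat_exp n t\<bar> \<le> fact (Suc n) * \<bar>t\<bar>" for t
  proof (cases "t > 0")
    case True
    have "inverse t ^ Suc n \<le> fact (Suc n) * exp (inverse t)"
      using pow[of "inverse t" "Suc n"] True by simp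
    then have "inverse t ^ Suc n * exp (- inverse t) * t \<le> (fact (Suc n) * exp (inverse t)) * exp (- inverse t) * t"
      using True by (intro mult_right_mono) auto
    then show ?thesis using True by (simp add: flat_exp_def exp_minus field_simps)
  next
    case False
    then have "flat_exp n t = 0" by (simp add: flat_exp_def)
    then show ?thesis by (simp only: abs_zero) (intro mult_nonneg_nonneg, auto)
  qed
  then show ?thesis by blast
qed

lemma flat_exp_derivative:
  "(flat_exp n has_derivative (\<lambda>v. v * (flat_exp (n + 2) t - n * flat_exp (Suc n) t))) (at t)"
proof -
  have "(flat_exp n has_real_derivative (flat_exp (n + 2) t - n * flat_exp (Suc n) t)) (at t)"
  proof (cases "t = 0")
    case True
    obtain C where C: "\<And>s. \<bar>flat_exp (Suc n) s\<bar> \<le> C * \<bar>s\<bar>" using flat_exp_bound by blast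
    have "((\<lambda>s. C * \<bar>s\<bar>) \<longlongrightarrow> C * \<bar>0\<bar>) (at 0)" by (intro tendsto_intros)
    then have "((\<lambda>s. C * \<bar>s\<bar>) \<longlongrightarrow> 0) (at 0)" by simp
    then have "(flat_exp (Suc n) \<longlongrightarrow> 0) (at 0)"
      by (rule Lim_null_comparison[rotated]) (use C in auto)
    \<comment> \<open>Dividing by h raises the exponent by one, so the difference quotient at 0 is
      the next member of the family, which tends to 0.\<close>
    moreover have "(flat_exp n (0 + h) - flat_exp n 0) / h = flat_exp (Suc n) h" for h
      by (simp add: flat_exp_def divide_inverse)
    ultimately have "((\<lambda>h. (flat_exp n (0 + h) - flat_exp n 0) / h) \<longlongrightarrow> 0) (at 0)" by simp
    moreover have "flat_exp (n + 2) t - n * flat_exp (Suc n) t = 0" using True by (simp add: flat_exp_def)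
    ultimately show ?thesis by (simp only: DERIV_def True)
  next
    case False
    then consider "t > 0" | "t < 0" by linarith
    then show ?thesis
    proof cases
      case 1
      have "((\<lambda>t. exp (- inverse t) * inverse t ^ n) has_real_derivative
          (flat_exp (n + 2) t - n * flat_exp (Suc n) t)) (at t)"
      proof (cases n)
        case (Suc m)
        \<comment> \<open>The power rule leaves an exponent with truncated subtraction, whence the
          separate case m = 0.\<close>
        have "inverse t * inverse t ^ (m - Suc 0) = inverse t ^ m \<or> m = 0" by (cases m) auto
        then show ?thesis using 1 Suc
          by (auto intro!: derivative_eq_intros simp: flat_exp_def power2_eq_square algebra_simps)
      qed (use 1 in \<open>auto intro!: derivative_eq_intros simp: flat_exp_def power2_eq_square algebra_simps\<close>)
      moreover have "open {0::real<..}" "t \<in> {0<..}" using 1 by auto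
      ultimately show ?thesis
        by (rule has_field_derivative_transform_within_open) (simp add: flat_exp_def)
    next
      case 2
      have "((\<lambda>t. 0) has_real_derivative (flat_exp (n + 2) t - n * flat_exp (Suc n) t)) (at t)"
        using 2 by (simp add: flat_exp_def)
      moreover have "open {..<0::real}" "t \<in> {..<0}" using 2 by auto
      ultimately show ?thesis
        by (rule has_field_derivative_transform_within_open) (simp add: flat_exp_def)
    qed
  qed
  then have "(flat_exp n has_derivative (*) (flat_exp (n + 2) t - n * flat_exp (Suc n) t)) (at t)"
    by (simp only: has_field_derivative_def)
  then show ?thesis by (rule has_derivative_eq_rhs) (simp add: fun_eq_iff mult.commute)
qed

lemma smooth_flat_exp: "smooth_on UNIV (flat_exp n)"
proof -
  have "Ck_on k UNIV (flat_exp n)" for k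
  proof (induction k arbitrary: n)
    case 0
    have "\<forall>t. isCont (flat_exp n) t"
      using flat_exp_derivative has_derivative_continuous by blast
    then show ?case by (simp add: continuous_at_imp_continuous_on)
  next
    case (Suc k)
    show ?case
    proof (rule Ck_on_Suc_derivativeI[OF open_UNIV flat_exp_derivative])
      fix v :: real
      have "Ck_on k UNIV (\<lambda>t. v * (flat_exp (n + 2) t + (- real n) * flat_exp (Suc n) t))"
        by (intro Ck_on_bilinear[OF open_UNIV bounded_bilinear_mult] Ck_on_const Ck_on_add Suc open_UNIV)
      then show "Ck_on k UNIV (\<lambda>t. v * (flat_exp (n + 2) t - n * flat_exp (Suc n) t))" by simp
    qed
  qed
  then show ?thesis by (simp add: smooth_on_def)
qed

text \<open>The function is u / (u + w), where u is positive exactly inside the ball of radius r and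
  w exactly outside the closed ball of radius r/2. These two regions cover the space, so the
  denominator never vanishes. Squared distances keep the arguments of \<open>flat_exp\<close>
  smooth.\<close>

lemma bump_function_exists:
  fixes y0 :: "'m::finite_dim_inner"
  assumes "r > 0"
  shows "\<exists>b::'m \<Rightarrow> real. smooth_on UNIV b \<and> (\<forall>y\<in>ball y0 (r / 2). b y = 1) \<and> (\<forall>y. y \<notin> ball y0 r \<longrightarrow> b y = 0)"
proof -
  define q where "q y = (y - y0) \<bullet> (y - y0)" for y :: 'm
  have q: "q y = (dist y0 y)\<^sup>2" for y
    by (simp add: q_def dist_norm power2_norm_eq_inner[symmetric] norm_minus_commute)
  define u where "u y = flat_exp 0 (r\<^sup>2 + (-1) * q y)" for y
  define w where "w y = flat_exp 0 (q y + - ((r/2)\<^sup>2))" for y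
  have sq: "smooth_on UNIV q"
  proof -
    have "smooth_on UNIV (\<lambda>y. (y + (- y0)) \<bullet> (y + (- y0)))"
      by (intro smooth_on_inner smooth_on_add smooth_on_id smooth_on_const open_UNIV)
    then show ?thesis by (simp add: q_def[abs_def])
  qed
  have sm: "smooth_on UNIV u" "smooth_on UNIV w"
    unfolding u_def w_def
    by (rule smooth_on_compose[OF open_UNIV subset_UNIV _ smooth_flat_exp];
        intro smooth_on_mult smooth_on_add sq smooth_on_const open_UNIV)+
  have nz: "u y + w y \<noteq> 0" for y
  proof -
    have "0 < r\<^sup>2 + (-1) * q y \<or> 0 < q y + - ((r/2)\<^sup>2)"
    proof (cases "q y < r\<^sup>2")
      case False
      moreover have "(r/2)\<^sup>2 < r\<^sup>2" using assms by (intro power_strict_mono) auto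
      ultimately show ?thesis by auto
    qed simp
    moreover have "u y \<ge> 0" "w y \<ge> 0" by (simp_all add: u_def w_def flat_exp_def)
    moreover have "flat_exp 0 t > 0" if "t > 0" for t using that by (simp add: flat_exp_def)
    ultimately show ?thesis unfolding u_def w_def by (smt (verit))
  qed
  define b where "b y = u y * inverse (u y + w y)" for y
  have "smooth_on UNIV b"
    unfolding b_def by (intro smooth_on_mult smooth_on_inverse smooth_on_add sm open_UNIV nz)
  moreover have "b y = 1" if "y \<in> ball y0 (r/2)" for y
  proof -
    have "q y < (r/2)\<^sup>2" unfolding q using that by (intro power_strict_mono) auto
    then have "w y = 0" by (simp add: w_def flat_exp_def)
    then show ?thesis using nz[of y] by (simp add: b_def)
  qed
  moreover have "b y = 0" if "y \<notin> ball y0 r" for y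
  proof -
    have "r\<^sup>2 \<le> q y" unfolding q using that assms by (intro power_mono) auto
    then show ?thesis by (simp add: b_def u_def flat_exp_def)
  qed
  ultimately show ?thesis by blast
qed

text \<open>The weight t^n is there because differentiation in y under the integral sign pulls out a
  factor t; with all weights included, the family is closed under differentiation.\<close>

definition ray_integral :: "nat \<Rightarrow> ('m::finite_dim_inner \<Rightarrow> real) \<Rightarrow> 'm \<Rightarrow> real"
  where "ray_integral n f y = integral (cbox 0 1) (\<lambda>t. t ^ n * f (t *\<^sub>R y))"

lemma scaleR_in_ball: "y \<in> ball 0 r \<Longrightarrow> t \<in> cbox 0 (1::real) \<Longrightarrow> t *\<^sub>R y \<in> ball (0::'m::real_normed_vector) r"
proof -
  assume a: "y \<in> ball 0 r" "t \<in> cbox 0 (1::real)"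
  have "norm (t *\<^sub>R y) \<le> norm y" using a by (simp add: mult_left_le_one_le)
  then show ?thesis using a by simp
qed

lemma mult_norm_less: "norm y < r \<Longrightarrow> 0 \<le> t \<Longrightarrow> t \<le> 1 \<Longrightarrow> t * norm y < r"
  using mult_left_le_one_le[of "norm y" t] by simp

lemma ray_integral_derivative:
  fixes f :: "'m::finite_dim_inner \<Rightarrow> real"
  assumes f: "smooth_on (ball 0 r) f" and y: "y \<in> ball 0 r"
  shows "(ray_integral n f has_derivative
    (\<lambda>v. ray_integral (Suc n) (\<lambda>z. frechet_derivative f (at z) v) y)) (at y)"
proof -
  let ?B = "ball (0::'m) r"
  let ?d = "\<lambda>b y t. t ^ Suc n * frechet_derivative f (at (t *\<^sub>R y)) b"
  have cont: "continuous_on (?B \<times> cbox 0 1) (\<lambda>(y, t). g (t *\<^sub>R y))" if "continuous_on ?B g" for g :: "'m \<Rightarrow> real"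
    unfolding case_prod_unfold
    by (rule continuous_on_compose2[OF that]) (auto intro!: continuous_intros simp: mult_norm_less)
  have cd: "continuous_on (?B \<times> cbox 0 1) (\<lambda>(y, t). ?d b y t)" for b
    unfolding case_prod_unfold
    using cont[OF smooth_on_continuous[OF smooth_on_frechet_derivative[OF f]]]
    by (intro continuous_intros) (simp add: case_prod_unfold)
  have cd1: "(\<lambda>t. ?d b y t) integrable_on cbox 0 1" for b
    by (rule integrable_continuous, rule continuous_on_mult, intro continuous_intros,
        rule continuous_on_compose2[OF smooth_on_continuous[OF smooth_on_frechet_derivative[OF f]]])
      (use y in \<open>auto intro!: continuous_intros simp: mult_norm_less\<close>)
  have ci: "(\<lambda>t. t ^ n * f (t *\<^sub>R x)) integrable_on cbox 0 1" if "x \<in> ?B" for x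
    by (rule integrable_continuous, rule continuous_on_mult, intro continuous_intros,
        rule continuous_on_compose2[OF smooth_on_continuous[OF f]])
      (use that in \<open>auto intro!: continuous_intros simp: mult_norm_less\<close>)
  \<comment> \<open>Leibniz's rule asks for the derivative as a continuous map into the bounded
    linear functionals. Assembled from partial derivatives along an orthonormal basis, it is visibly
    continuous.\<close>
  define L where "L x t = (\<Sum>b\<in>onb. ?d b x t *\<^sub>R blinfun_inner_right b)" for x and t :: real
  have L: "blinfun_apply (L x t) v = t ^ Suc n * frechet_derivative f (at (t *\<^sub>R x)) v"
    if "x \<in> ?B" "t \<in> cbox 0 1" for x t v
    using frechet_derivative_onb_expansion[OF f scaleR_in_ball[OF that], of v]
    by (simp add: L_def blinfun.sum_left blinfun.scaleR_left sum_distrib_left inner_commute mult_ac)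
  have "((\<lambda>x. integral (cbox 0 1) (\<lambda>t. t ^ n * f (t *\<^sub>R x))) has_derivative integral (cbox 0 1) (L y)) (at y within ?B)"
  proof (rule leibniz_rule[OF _ ci _ y convex_ball])
    fix x t assume xt: "x \<in> ?B" "t \<in> cbox 0 (1::real)"
    have "((\<lambda>x. f (t *\<^sub>R x)) has_derivative (\<lambda>v. frechet_derivative f (at (t *\<^sub>R x)) (t *\<^sub>R v))) (at x within ?B)"
      by (rule has_derivative_compose[where g=f and f="\<lambda>x. t *\<^sub>R x" and x=x, OF _ smooth_on_derivative[OF f scaleR_in_ball[OF xt]]])
        (auto intro!: derivative_eq_intros)
    moreover have "frechet_derivative f (at (t *\<^sub>R x)) (t *\<^sub>R v) = t * frechet_derivative f (at (t *\<^sub>R x)) v" for v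
      using linear_scale[OF has_derivative_linear[OF smooth_on_derivative[OF f scaleR_in_ball[OF xt]]]] by simp
    ultimately have "((\<lambda>x. f (t *\<^sub>R x)) has_derivative (\<lambda>v. t * frechet_derivative f (at (t *\<^sub>R x)) v)) (at x within ?B)"
      by simp
    then have "((\<lambda>x. t ^ n * f (t *\<^sub>R x)) has_derivative (\<lambda>v. t ^ n * (t * frechet_derivative f (at (t *\<^sub>R x)) v))) (at x within ?B)"
      by (rule has_derivative_mult_right)
    then show "((\<lambda>x. t ^ n * f (t *\<^sub>R x)) has_derivative blinfun_apply (L x t)) (at x within ?B)"
      by (rule has_derivative_eq_rhs) (simp add: L[OF xt] fun_eq_iff mult_ac)
  next
    show "continuous_on (?B \<times> cbox 0 1) (\<lambda>(x, t). L x t)"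
      unfolding L_def case_prod_unfold
      by (intro continuous_intros cd[unfolded case_prod_unfold])
  qed
  then have *: "(ray_integral n f has_derivative integral (cbox 0 1) (L y)) (at y)"
    using y by (simp add: ray_integral_def[abs_def] at_within_open[OF _ open_ball])
  have "(L y has_integral (\<Sum>b\<in>onb. integral (cbox 0 1) (?d b y) *\<^sub>R blinfun_inner_right b)) (cbox 0 1)"
    unfolding L_def[abs_def]
    by (intro has_integral_sum has_integral_scaleR_left integrable_integral cd1 finite_onb)
  then have iL: "integral (cbox 0 1) (L y) = (\<Sum>b\<in>onb. integral (cbox 0 1) (?d b y) *\<^sub>R blinfun_inner_right b)"
    by (rule integral_unique)
  have "ray_integral (Suc n) (\<lambda>z. frechet_derivative f (at z) v) y = blinfun_apply (integral (cbox 0 1) (L y)) v" for v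
  proof -
    have "L y integrable_on cbox 0 1" using \<open>(L y has_integral _) _\<close> by blast
    then have "blinfun_apply (integral (cbox 0 1) (L y)) v = integral (cbox 0 1) (\<lambda>t. blinfun_apply (L y t) v)"
      by (rule blinfun_apply_integral)
    also have "\<dots> = ray_integral (Suc n) (\<lambda>z. frechet_derivative f (at z) v) y"
      unfolding ray_integral_def by (rule integral_cong) (simp add: L[OF y])
    finally show ?thesis by simp
  qed
  then show ?thesis using * by simp
qed

lemma smooth_ray_integral:
  fixes f :: "'m::finite_dim_inner \<Rightarrow> real"
  assumes "smooth_on (ball 0 r) f"
  shows "smooth_on (ball 0 r) (ray_integral n f)"
proof -
  have "Ck_on k (ball 0 r) (ray_integral n f)" for k
    using assms
  proof (induction k arbitrary: n f)
    case 0
    have "\<forall>y\<in>ball 0 r. isCont (ray_integral n f) y"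
      using ray_integral_derivative[OF 0] has_derivative_continuous by blast
    then show ?case by (simp add: continuous_at_imp_continuous_on)
  next
    case (Suc k)
    show ?case
      by (rule Ck_on_Suc_derivativeI[OF open_ball ray_integral_derivative[OF Suc.prems]])
        (use Suc.IH smooth_on_frechet_derivative[OF Suc.prems] in auto)
  qed
  then show ?thesis by (simp add: smooth_on_def)
qed

text \<open>The fundamental theorem of calculus on the segment from 0 to y, with the direction y
  expanded in the orthonormal basis and taken out of the integral.\<close>

lemma hadamard_origin:
  fixes f :: "'m::finite_dim_inner \<Rightarrow> real"
  assumes f: "smooth_on (ball 0 r) f" and y: "y \<in> ball 0 r"
  shows "f y = f 0 + (\<Sum>b\<in>onb. (y \<bullet> b) * ray_integral 0 (\<lambda>z. frechet_derivative f (at z) b) y)"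
proof -
  let ?d = "\<lambda>b t. frechet_derivative f (at (t *\<^sub>R y)) b"
  have cd: "(?d b) integrable_on cbox 0 1" for b
    by (rule integrable_continuous,
        rule continuous_on_compose2[OF smooth_on_continuous[OF smooth_on_frechet_derivative[OF f]]])
      (use y in \<open>auto intro!: continuous_intros simp: mult_norm_less\<close>)
  have "((\<lambda>t. ?d y t) has_integral (f (1 *\<^sub>R y) - f (0 *\<^sub>R y))) {0..1}"
  proof (rule fundamental_theorem_of_calculus)
    fix t :: real assume "t \<in> {0..1}"
    then have ty: "t *\<^sub>R y \<in> ball 0 r" using scaleR_in_ball[OF y] by simp
    have "((\<lambda>t. f (t *\<^sub>R y)) has_derivative (\<lambda>s. ?d (s *\<^sub>R y) t)) (at t within {0..1})"
      by (rule has_derivative_compose[where g=f and f="\<lambda>t. t *\<^sub>R y" and x=t, OF _ smooth_on_derivative[OF f ty]])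
        (auto intro!: derivative_eq_intros)
    then show "((\<lambda>t. f (t *\<^sub>R y)) has_vector_derivative ?d y t) (at t within {0..1})"
      using linear_scale[OF has_derivative_linear[OF smooth_on_derivative[OF f ty]]]
      by (simp add: has_vector_derivative_def)
  qed simp
  moreover have "((\<lambda>t. ?d y t) has_integral (\<Sum>b\<in>onb. (y \<bullet> b) *\<^sub>R integral (cbox 0 1) (?d b))) {0..1}"
  proof (rule has_integral_eq)
    show "((\<lambda>t. \<Sum>b\<in>onb. (y \<bullet> b) *\<^sub>R ?d b t) has_integral (\<Sum>b\<in>onb. (y \<bullet> b) *\<^sub>R integral (cbox 0 1) (?d b))) {0..1}"
      using cd by (intro has_integral_sum has_integral_cmul) (auto simp: has_integral_integral[symmetric])
    show "\<And>t. t \<in> {0..1} \<Longrightarrow> (\<Sum>b\<in>onb. (y \<bullet> b) *\<^sub>R ?d b t) = ?d y t"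
      using frechet_derivative_onb_expansion[OF f scaleR_in_ball[OF y]] by simp
  qed
  ultimately have "f (1 *\<^sub>R y) - f (0 *\<^sub>R y) = (\<Sum>b\<in>onb. (y \<bullet> b) *\<^sub>R integral (cbox 0 1) (?d b))"
    by (rule has_integral_unique)
  then show ?thesis by (simp add: ray_integral_def)
qed

text \<open>The remainder functions are tied to the partial derivatives at the centre because a
  derivation at that point sees nothing else of them. Translation moves the centre to the origin,
  where the rays start.\<close>

lemma hadamard:
  fixes f :: "'m::finite_dim_inner \<Rightarrow> real"
  assumes f: "smooth_on (ball y0 r) f" and r: "r > 0"
  shows "\<exists>g. (\<forall>b. smooth_on (ball y0 r) (g b) \<and> g b y0 = frechet_derivative f (at y0) b) \<and>
    (\<forall>y\<in>ball y0 r. f y = f y0 + (\<Sum>b\<in>onb. ((y - y0) \<bullet> b) * g b y))"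
proof -
  define F where "F z = f (z + y0)" for z
  have sh: "(\<lambda>z. z + y0) ` ball 0 r \<subseteq> ball y0 r" "(\<lambda>y. y - y0) ` ball y0 r \<subseteq> ball 0 r"
    by (auto simp: dist_norm norm_minus_commute)
  have F: "smooth_on (ball 0 r) F"
    unfolding F_def by (rule smooth_on_compose[OF open_ball sh(1) smooth_on_add[OF open_ball smooth_on_id smooth_on_const] f])
  have sub: "smooth_on (ball y0 r) (\<lambda>y. y - y0)"
    using smooth_on_add[OF open_ball smooth_on_id smooth_on_const, of y0 r "- y0"] by simp
  define g where "g b y = ray_integral 0 (\<lambda>z. frechet_derivative F (at z) b) (y - y0)" for b y
  have "smooth_on (ball y0 r) (g b)" for b
    unfolding g_def
    by (rule smooth_on_compose[OF open_ball sh(2) sub smooth_ray_integral[OF smooth_on_frechet_derivative[OF F]]])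
  moreover have "g b y0 = frechet_derivative f (at y0) b" for b
  proof -
    have "(F has_derivative frechet_derivative f (at (0 + y0))) (at 0)"
      unfolding F_def
      by (rule has_derivative_compose[where g=f and f="\<lambda>z. z + y0" and f'="\<lambda>v. v"])
        (use r smooth_on_derivative[OF f, of y0] in \<open>auto intro!: derivative_eq_intros\<close>)
    then have "frechet_derivative F (at 0) = frechet_derivative f (at y0)"
      using frechet_derivative_at by fastforce
    \<comment> \<open>At the centre the integrand is constant on the unit interval.\<close>
    then show ?thesis by (simp add: g_def ray_integral_def)
  qed
  moreover have "f y = f y0 + (\<Sum>b\<in>onb. ((y - y0) \<bullet> b) * g b y)" if "y \<in> ball y0 r" for y
    using hadamard_origin[OF F, of "y - y0"] that by (simp add: F_def g_def dist_norm norm_minus_commute)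
  ultimately show ?thesis by blast
qed

section \<open>Smooth functions and maps on manifolds\<close>

lemma smooth_atlasD:
  assumes "smooth_atlas A" "(U, \<phi>) \<in> A"
  shows "inj_on \<phi> U" "open (\<phi> ` U)"
    "(V, \<psi>) \<in> A \<Longrightarrow> open (\<phi> ` (U \<inter> V))"
    "(V, \<psi>) \<in> A \<Longrightarrow> smooth_on (\<phi> ` (U \<inter> V)) (\<lambda>y. \<psi> (the_inv_into U \<phi> y))"
  using assms unfolding smooth_atlas_def by (auto simp: o_def split: prod.splits)

lemma open_in_atlasD:
  "open_in_atlas A S \<Longrightarrow> (U, \<phi>) \<in> A \<Longrightarrow> open (\<phi> ` (U \<inter> S))"
  "open_in_atlas A S \<Longrightarrow> S \<subseteq> points A"
  unfolding open_in_atlas_def by auto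

lemma chart_subset_points: "(U, \<phi>) \<in> A \<Longrightarrow> U \<subseteq> points A"
  unfolding points_def by auto

lemma pointsE:
  assumes "x \<in> points A" obtains U \<phi> where "(U, \<phi>) \<in> A" "x \<in> U"
  using assms unfolding points_def by auto

lemma the_inv_into_chart:
  assumes "smooth_atlas A" "(U, \<phi>) \<in> A" "x \<in> U"
  shows "the_inv_into U \<phi> (\<phi> x) = x"
  using the_inv_into_f_f[OF smooth_atlasD(1)[OF assms(1,2)] assms(3)] .

lemma open_in_atlas_Int:
  assumes "smooth_atlas A" "open_in_atlas A S" "open_in_atlas A T" shows "open_in_atlas A (S \<inter> T)"
  using istopology_open_in_atlas[OF assms(1)] assms(2,3) by (simp add: istopology_def)

lemma open_in_atlas_Union:
  assumes "smooth_atlas A" "\<And>S. S \<in> \<K> \<Longrightarrow> open_in_atlas A S" shows "open_in_atlas A (\<Union>\<K>)"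
  using istopology_open_in_atlas[OF assms(1)] assms(2) by (simp add: istopology_def)

lemma open_in_atlas_local:
  assumes "smooth_atlas A" "\<And>x. x \<in> S \<Longrightarrow> \<exists>T. open_in_atlas A T \<and> x \<in> T \<and> T \<subseteq> S"
  shows "open_in_atlas A S"
proof -
  have "S = \<Union>{T. open_in_atlas A T \<and> T \<subseteq> S}" using assms(2) by blast
  then show ?thesis using open_in_atlas_Union[OF assms(1), of "{T. open_in_atlas A T \<and> T \<subseteq> S}"] by simp
qed

lemma open_in_atlas_chart:
  assumes "smooth_atlas A" "(U, \<phi>) \<in> A" shows "open_in_atlas A U"
  unfolding open_in_atlas_def using chart_subset_points[OF assms(2)] smooth_atlasD(3)[OF assms(1) _ assms(2)] by auto

lemma open_in_atlas_points:
  assumes "smooth_atlas A" shows "open_in_atlas A (points A)"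
  by (rule open_in_atlas_local[OF assms])
    (meson open_in_atlas_chart[OF assms] chart_subset_points pointsE)

text \<open>Local smoothness with values in a vector space, tested in all charts of the atlas. Meant
  for open S, where the rules for \<open>smooth_on\<close> carry over chart by chart.\<close>

definition smooth_in ::
    "('a, 'm::real_normed_vector) atlas \<Rightarrow> 'a set \<Rightarrow> ('a \<Rightarrow> 'b::real_normed_vector) \<Rightarrow> bool"
  where "smooth_in A S f \<longleftrightarrow> (\<forall>(U, \<phi>)\<in>A. smooth_on (\<phi> ` (U \<inter> S)) (\<lambda>y. f (the_inv_into U \<phi> y)))"

lemma smooth_inD:
  "smooth_in A S f \<Longrightarrow> (U, \<phi>) \<in> A \<Longrightarrow> smooth_on (\<phi> ` (U \<inter> S)) (\<lambda>y. f (the_inv_into U \<phi> y))"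
  unfolding smooth_in_def by auto

lemma smooth_inI:
  "(\<And>U \<phi>. (U, \<phi>) \<in> A \<Longrightarrow> smooth_on (\<phi> ` (U \<inter> S)) (\<lambda>y. f (the_inv_into U \<phi> y))) \<Longrightarrow> smooth_in A S f"
  unfolding smooth_in_def by auto

lemma smooth_in_cong:
  assumes "smooth_atlas A" "open_in_atlas A S" "smooth_in A S f" "\<And>x. x \<in> S \<Longrightarrow> f x = g x"
  shows "smooth_in A S g"
proof (rule smooth_inI)
  fix U \<phi> assume c: "(U, \<phi>) \<in> A"
  show "smooth_on (\<phi> ` (U \<inter> S)) (\<lambda>y. g (the_inv_into U \<phi> y))"
    by (rule smooth_on_cong_imp[OF open_in_atlasD(1)[OF assms(2) c] smooth_inD[OF assms(3) c]])
      (auto simp: the_inv_into_chart[OF assms(1) c] assms(4))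
qed

lemma smooth_in_subset: "smooth_in A S f \<Longrightarrow> T \<subseteq> S \<Longrightarrow> smooth_in A T f"
  unfolding smooth_in_def by (blast intro: smooth_on_subset)

lemma smooth_in_local:
  assumes "\<And>x. x \<in> S \<Longrightarrow> \<exists>T. open_in_atlas A T \<and> x \<in> T \<and> smooth_in A T f"
  shows "smooth_in A S f"
proof (rule smooth_inI, rule smooth_on_local)
  fix U \<phi> y assume c: "(U, \<phi>) \<in> A" and "y \<in> \<phi> ` (U \<inter> S)"
  then obtain x where x: "x \<in> U" "x \<in> S" "y = \<phi> x" by blast
  obtain T where T: "open_in_atlas A T" "x \<in> T" "smooth_in A T f" using assms[OF x(2)] by blast
  show "\<exists>T. open T \<and> y \<in> T \<and> smooth_on T (\<lambda>y. f (the_inv_into U \<phi> y))"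
    using open_in_atlasD(1)[OF T(1) c] smooth_inD[OF T(3) c] x T(2) by blast
qed

lemma smooth_in_const: "smooth_in A S (\<lambda>x. c)"
  by (simp add: smooth_in_def smooth_on_const case_prod_unfold)

lemma smooth_in_bounded_linear:
  assumes "open_in_atlas A S" "bounded_linear L" "smooth_in A S f"
  shows "smooth_in A S (\<lambda>x. L (f x))"
  using smooth_on_bounded_linear[OF open_in_atlasD(1)[OF assms(1)] assms(2) smooth_inD[OF assms(3)]]
  by (rule smooth_inI)

lemma smooth_in_bilinear:
  assumes "open_in_atlas A S" "bounded_bilinear B" "smooth_in A S f" "smooth_in A S g"
  shows "smooth_in A S (\<lambda>x. B (f x) (g x))"
  using smooth_on_bilinear[OF open_in_atlasD(1)[OF assms(1)] assms(2) smooth_inD[OF assms(3)] smooth_inD[OF assms(4)]]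
  by (rule smooth_inI)

lemmas smooth_in_mult = smooth_in_bilinear[OF _ bounded_bilinear_mult]
lemmas smooth_in_scaleR = smooth_in_bilinear[OF _ bounded_bilinear_scaleR]
lemmas smooth_in_inner = smooth_in_bilinear[OF _ bounded_bilinear_inner]

lemma smooth_in_add:
  assumes "open_in_atlas A S" "smooth_in A S f" "smooth_in A S g"
  shows "smooth_in A S (\<lambda>x. f x + g x)"
  using smooth_on_add[OF open_in_atlasD(1)[OF assms(1)] smooth_inD[OF assms(2)] smooth_inD[OF assms(3)]]
  by (rule smooth_inI)

lemma smooth_in_Pair:
  assumes "open_in_atlas A S" "smooth_in A S f" "smooth_in A S g"
  shows "smooth_in A S (\<lambda>x. (f x, g x))"
  using smooth_on_Pair[OF open_in_atlasD(1)[OF assms(1)] smooth_inD[OF assms(2)] smooth_inD[OF assms(3)]]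
  by (rule smooth_inI)

lemma smooth_in_sum:
  assumes "open_in_atlas A S" "\<And>i. i \<in> I \<Longrightarrow> smooth_in A S (f i)"
  shows "smooth_in A S (\<lambda>x. \<Sum>i\<in>I. f i x)"
  using smooth_on_sum[OF open_in_atlasD(1)[OF assms(1)] smooth_inD[OF assms(2)]]
  by (rule smooth_inI)

lemma smooth_in_compose:
  fixes f :: "'a \<Rightarrow> 'n::finite_dim_inner"
  assumes A: "smooth_atlas A" and "open_in_atlas A S" "smooth_in A S f" "f ` S \<subseteq> T" "smooth_on T g"
  shows "smooth_in A S (\<lambda>x. g (f x))"
proof (rule smooth_inI)
  fix U \<phi> assume c: "(U, \<phi>) \<in> A"
  show "smooth_on (\<phi> ` (U \<inter> S)) (\<lambda>y. g (f (the_inv_into U \<phi> y)))"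
    by (rule smooth_on_compose[OF open_in_atlasD(1)[OF assms(2) c] _ smooth_inD[OF assms(3) c] assms(5)])
      (use assms(4) in \<open>auto simp: the_inv_into_chart[OF A c]\<close>)
qed

lemma smooth_in_chart:
  assumes "smooth_atlas A" "(U, \<phi>) \<in> A" shows "smooth_in A U \<phi>"
  by (rule smooth_inI) (rule smooth_atlasD(4)[OF assms(1) _ assms(2)])

text \<open>One chart around S suffices: on S the function is its expression in that chart composed
  with the coordinate map, and the latter is smooth with respect to all other charts.\<close>

lemma smooth_in_chartI:
  assumes A: "smooth_atlas A" and c: "(U, \<phi>) \<in> A" and "S \<subseteq> U" "open_in_atlas A S"
    and f: "smooth_on (\<phi> ` S) (\<lambda>y. f (the_inv_into U \<phi> y))"
  shows "smooth_in A S f"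
proof (rule smooth_in_cong[OF A assms(4)])
  show "smooth_in A S (\<lambda>x. (\<lambda>y. f (the_inv_into U \<phi> y)) (\<phi> x))"
    by (rule smooth_in_compose[OF A assms(4) smooth_in_subset[OF smooth_in_chart[OF A c] assms(3)] subset_refl f])
qed (use assms(3) the_inv_into_chart[OF A c] in auto)

lemma open_in_atlas_smooth_preimage:
  assumes A: "smooth_atlas A" and "open_in_atlas A S" "smooth_in A S f" "open N"
  shows "open_in_atlas A (S \<inter> f -` N)"
  unfolding open_in_atlas_def
proof (intro conjI ballI, goal_cases)
  case 1
  then show ?case using open_in_atlasD(2)[OF assms(2)] by blast
next
  case (2 c)
  obtain U \<phi> where [simp]: "c = (U, \<phi>)" by fastforce
  have c: "(U, \<phi>) \<in> A" using 2 by simp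
  have "open (\<phi> ` (U \<inter> S) \<inter> (\<lambda>y. f (the_inv_into U \<phi> y)) -` N)"
    by (rule continuous_open_preimage[OF smooth_on_continuous[OF smooth_inD[OF assms(3) c]]
          open_in_atlasD(1)[OF assms(2) c] assms(4)])
  also have "\<phi> ` (U \<inter> S) \<inter> (\<lambda>y. f (the_inv_into U \<phi> y)) -` N = \<phi> ` (U \<inter> (S \<inter> f -` N))"
    using the_inv_into_chart[OF A c] by auto
  finally show ?case by simp
qed

text \<open>Moves from maps into \<open>vector_space_atlas\<close> to \<open>smooth_in\<close>, for
  which the calculus is available. The target has one chart with full domain, so the openness
  conditions of \<open>smooth_map\<close> become trivial.\<close>

lemma smooth_functions_iff:
  assumes "smooth_atlas A"
  shows "f \<in> smooth_functions A \<longleftrightarrow> f \<in> extensional (points A) \<and> smooth_in A (points A) f"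
proof -
  have "U \<inter> points A = U" if "(U, \<phi>) \<in> A" for U \<phi> using chart_subset_points[OF that] by blast
  then have *: "(open (\<phi> ` (U \<inter> f -` UNIV)) \<and> smooth_on (\<phi> ` (U \<inter> f -` UNIV)) (id \<circ> f \<circ> the_inv_into U \<phi>))
      = smooth_on (\<phi> ` (U \<inter> points A)) (\<lambda>y. f (the_inv_into U \<phi> y))"
    if "(U, \<phi>) \<in> A" for U \<phi>
    using smooth_atlasD(2)[OF assms that] that by (simp add: o_def)
  have pts: "points vector_space_atlas = (UNIV :: real set)"
    by (simp add: points_def vector_space_atlas_def)
  have "smooth_map A vector_space_atlas f \<longleftrightarrow> (\<forall>(U, \<phi>)\<in>A. open (\<phi> ` (U \<inter> f -` UNIV)) \<and>
      smooth_on (\<phi> ` (U \<inter> f -` UNIV)) (id \<circ> f \<circ> the_inv_into U \<phi>))"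
    unfolding smooth_map_def pts by (simp add: vector_space_atlas_def case_prod_unfold)
  also have "\<dots> \<longleftrightarrow> smooth_in A (points A) f"
    unfolding smooth_in_def by (intro ball_cong refl) (clarify, rule *)
  finally show ?thesis by (simp add: smooth_functions_def)
qed

lemma smooth_functionsD:
  assumes "smooth_atlas A" "f \<in> smooth_functions A"
  shows "f \<in> extensional (points A)" "S \<subseteq> points A \<Longrightarrow> smooth_in A S f"
proof -
  show "f \<in> extensional (points A)" using assms(2) smooth_functions_iff[OF assms(1)] by simp
  show "smooth_in A S f" if "S \<subseteq> points A"
    by (rule smooth_in_subset[OF _ that]) (use assms(2) smooth_functions_iff[OF assms(1)] in simp)
qed

lemma smooth_functions_restrictI:
  assumes "smooth_atlas A" "smooth_in A (points A) f"
  shows "(\<lambda>x\<in>points A. f x) \<in> smooth_functions A"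
  using smooth_in_cong[OF assms(1) open_in_atlas_points[OF assms(1)] assms(2), of "restrict f (points A)"]
  by (simp add: smooth_functions_iff[OF assms(1)])

lemma smooth_functions_eqI:
  assumes "f \<in> smooth_functions A" "g \<in> smooth_functions A" "\<And>x. x \<in> points A \<Longrightarrow> f x = g x"
  shows "f = g"
  by (rule extensionalityI[of _ "points A"]) (use assms in \<open>simp_all add: smooth_functions_def\<close>)

lemma smooth_functions_closed:
  assumes A: "smooth_atlas A"
  shows "f \<in> smooth_functions A \<Longrightarrow> g \<in> smooth_functions A \<Longrightarrow> fun_add A f g \<in> smooth_functions A"
    "f \<in> smooth_functions A \<Longrightarrow> g \<in> smooth_functions A \<Longrightarrow> fun_mult A f g \<in> smooth_functions A"
    "f \<in> smooth_functions A \<Longrightarrow> fun_scale A c f \<in> smooth_functions A"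
    "fun_zero A \<in> smooth_functions A"
    "(\<lambda>x\<in>points A. c) \<in> smooth_functions A"
    "(\<And>i. i \<in> I \<Longrightarrow> h i \<in> smooth_functions A) \<Longrightarrow> (\<lambda>x\<in>points A. \<Sum>i\<in>I. h i x) \<in> smooth_functions A"
proof -
  note sm = smooth_functions_restrictI[OF A] open_in_atlas_points[OF A] smooth_functionsD(2)[OF A _ subset_refl]
  show "fun_add A f g \<in> smooth_functions A" if "f \<in> smooth_functions A" "g \<in> smooth_functions A"
    unfolding fun_add_def by (intro sm(1) smooth_in_add sm(2,3) that)
  show "fun_mult A f g \<in> smooth_functions A" if "f \<in> smooth_functions A" "g \<in> smooth_functions A"
    unfolding fun_mult_def by (intro sm(1) smooth_in_mult sm(2,3) that)
  show "fun_scale A c f \<in> smooth_functions A" if "f \<in> smooth_functions A"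
    unfolding fun_scale_def by (intro sm(1) smooth_in_mult sm(2,3) that smooth_in_const)
  show "fun_zero A \<in> smooth_functions A" "(\<lambda>x\<in>points A. c) \<in> smooth_functions A"
    unfolding fun_zero_def by (intro sm(1) smooth_in_const)+
  show "(\<lambda>x\<in>points A. \<Sum>i\<in>I. h i x) \<in> smooth_functions A" if "\<And>i. i \<in> I \<Longrightarrow> h i \<in> smooth_functions A"
    by (intro sm(1) smooth_in_sum sm(2,3) that)
qed

lemma fun_operations_apply [simp]:
  "x \<in> points A \<Longrightarrow> fun_add A f g x = f x + g x"
  "x \<in> points A \<Longrightarrow> fun_mult A f g x = f x * g x"
  "x \<in> points A \<Longrightarrow> fun_scale A c f x = c * f x"
  "x \<in> points A \<Longrightarrow> fun_zero A x = 0"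
  by (simp_all add: fun_add_def fun_mult_def fun_scale_def fun_zero_def)

section \<open>Smooth maps between manifolds\<close>

lemma smooth_map_iff:
  "smooth_map A B f \<longleftrightarrow> (\<forall>x\<in>points A. f x \<in> points B) \<and> (\<forall>U \<phi> V \<psi>. (U, \<phi>) \<in> A \<longrightarrow> (V, \<psi>) \<in> B \<longrightarrow>
    open (\<phi> ` (U \<inter> f -` V)) \<and> smooth_on (\<phi> ` (U \<inter> f -` V)) (\<lambda>y. \<psi> (f (the_inv_into U \<phi> y))))"
proof -
  have *: "(\<forall>(U, \<phi>)\<in>A. \<forall>(V, \<psi>)\<in>B. R U \<phi> V \<psi>) \<longleftrightarrow>
      (\<forall>U \<phi> V \<psi>. (U, \<phi>) \<in> A \<longrightarrow> (V, \<psi>) \<in> B \<longrightarrow> R U \<phi> V \<psi>)" for R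
    by fast
  show ?thesis unfolding smooth_map_def Pi_iff * o_def ..
qed

lemma smooth_map_points: "smooth_map A B f \<Longrightarrow> x \<in> points A \<Longrightarrow> f x \<in> points B"
  by (simp add: smooth_map_iff)

lemma smooth_map_chart:
  assumes A: "smooth_atlas A" and f: "smooth_map A B f" and c: "(V, \<psi>) \<in> B"
  shows "open_in_atlas A (points A \<inter> f -` V)" "smooth_in A (points A \<inter> f -` V) (\<lambda>x. \<psi> (f x))"
proof -
  have *: "U \<inter> (points A \<inter> f -` V) = U \<inter> f -` V" if "(U, \<phi>) \<in> A" for U \<phi>
    using chart_subset_points[OF that] by blast
  have f': "open (\<phi> ` (U \<inter> f -` V))" "smooth_on (\<phi> ` (U \<inter> f -` V)) (\<lambda>y. \<psi> (f (the_inv_into U \<phi> y)))"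
    if "(U, \<phi>) \<in> A" for U \<phi>
    using f that c by (simp_all add: smooth_map_iff)
  have "open (\<phi> ` (U \<inter> (points A \<inter> f -` V)))" if "(U, \<phi>) \<in> A" for U \<phi>
    unfolding *[OF that] by (rule f'(1)[OF that])
  then show "open_in_atlas A (points A \<inter> f -` V)"
    by (simp add: open_in_atlas_def split_beta)
  show "smooth_in A (points A \<inter> f -` V) (\<lambda>x. \<psi> (f x))"
    by (rule smooth_inI) (simp only: * f'(2))
qed

text \<open>The neighbourhoods T make the preimages of chart domains open and f smooth on them at
  the same time, so continuity requires no separate proof.\<close>

lemma smooth_mapI:
  assumes A: "smooth_atlas A" and "\<And>x. x \<in> points A \<Longrightarrow> f x \<in> points B"
    and loc: "\<And>x V \<psi>. x \<in> points A \<Longrightarrow> (V, \<psi>) \<in> B \<Longrightarrow> f x \<in> V \<Longrightarrow>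
      \<exists>T. open_in_atlas A T \<and> x \<in> T \<and> T \<subseteq> f -` V \<and> smooth_in A T (\<lambda>x. \<psi> (f x))"
  shows "smooth_map A B f"
proof -
  have "open (\<phi> ` (U \<inter> f -` V)) \<and> smooth_on (\<phi> ` (U \<inter> f -` V)) (\<lambda>y. \<psi> (f (the_inv_into U \<phi> y)))"
    if c: "(U, \<phi>) \<in> A" "(V, \<psi>) \<in> B" for U \<phi> V \<psi>
  proof -
    have "open_in_atlas A (points A \<inter> f -` V)"
    proof (rule open_in_atlas_local[OF A])
      fix x assume x: "x \<in> points A \<inter> f -` V"
      obtain T where T: "open_in_atlas A T" "x \<in> T" "T \<subseteq> f -` V"
        using loc[OF _ c(2), of x] x by auto
      then show "\<exists>T. open_in_atlas A T \<and> x \<in> T \<and> T \<subseteq> points A \<inter> f -` V"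
        using open_in_atlasD(2)[OF T(1)] by auto
    qed
    moreover have "smooth_in A (points A \<inter> f -` V) (\<lambda>x. \<psi> (f x))"
    proof (rule smooth_in_local)
      fix x assume x: "x \<in> points A \<inter> f -` V"
      then show "\<exists>T. open_in_atlas A T \<and> x \<in> T \<and> smooth_in A T (\<lambda>x. \<psi> (f x))"
        using loc[OF _ c(2), of x] by auto
    qed
    moreover have "U \<inter> (points A \<inter> f -` V) = U \<inter> f -` V"
      using chart_subset_points[OF c(1)] by blast
    ultimately show ?thesis
      using open_in_atlasD(1)[OF _ c(1), of "points A \<inter> f -` V"] smooth_inD[OF _ c(1), of "points A \<inter> f -` V"]
      by simp
  qed
  then show ?thesis using assms(2) by (simp add: smooth_map_iff)
qed

lemma smooth_map_pullback:
  assumes A: "smooth_atlas A" and B: "smooth_atlas B" and f: "smooth_map A B f" and T: "open_in_atlas B T"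
  shows "open_in_atlas A (points A \<inter> f -` T)"
    "smooth_in B T g \<Longrightarrow> smooth_in A (points A \<inter> f -` T) (\<lambda>x. g (f x))"
proof -
  have *: "\<exists>S. open_in_atlas A S \<and> x \<in> S \<and> S \<subseteq> points A \<inter> f -` T \<and>
      (smooth_in B T g \<longrightarrow> smooth_in A S (\<lambda>x. g (f x)))" if x: "x \<in> points A \<inter> f -` T" for x
  proof -
    have "f x \<in> points B" using smooth_map_points[OF f, of x] x by simp
    then obtain V \<psi> where c: "(V, \<psi>) \<in> B" "f x \<in> V" by (rule pointsE)
    \<comment> \<open>The points that f sends into both V and T, described in the coordinates
      \<psi>: there the condition is an open one on a smooth vector-valued map.\<close>
    let ?S = "(points A \<inter> f -` V) \<inter> (\<lambda>x. \<psi> (f x)) -` (\<psi> ` (V \<inter> T))"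
    have o: "open_in_atlas A ?S"
      by (rule open_in_atlas_smooth_preimage[OF A smooth_map_chart[OF A f c(1)] open_in_atlasD(1)[OF T c(1)]])
    have sub: "?S \<subseteq> points A \<inter> f -` T"
      using smooth_atlasD(1)[OF B c(1)] by (auto dest: inj_onD)
    moreover have "smooth_in A ?S (\<lambda>x. g (f x))" if g: "smooth_in B T g"
    proof (rule smooth_in_cong[OF A o])
      show "smooth_in A ?S (\<lambda>x. (\<lambda>y. g (the_inv_into V \<psi> y)) (\<psi> (f x)))"
        by (rule smooth_in_compose[OF A o smooth_in_subset[OF smooth_map_chart(2)[OF A f c(1)]] _ smooth_inD[OF g c(1)]]) auto
    qed (auto simp: the_inv_into_chart[OF B c(1)])
    ultimately show ?thesis using o x c by blast
  qed
  show "open_in_atlas A (points A \<inter> f -` T)" by (rule open_in_atlas_local[OF A]) (use * in blast)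
  show "smooth_in A (points A \<inter> f -` T) (\<lambda>x. g (f x))" if "smooth_in B T g"
    by (rule smooth_in_local) (use * that in blast)
qed

lemma smooth_map_compose:
  assumes A: "smooth_atlas A" and B: "smooth_atlas B" and f: "smooth_map A B f" and g: "smooth_map B C g"
  shows "smooth_map A C (\<lambda>x. g (f x))"
proof (rule smooth_mapI[OF A])
  fix x W \<kappa> assume x: "x \<in> points A" and c: "(W, \<kappa>) \<in> C" "g (f x) \<in> W"
  note 1 = smooth_map_chart[OF B g c(1)]
  note 2 = smooth_map_pullback(1)[OF A B f 1(1)] smooth_map_pullback(2)[OF A B f 1(1) 1(2)]
  show "\<exists>T. open_in_atlas A T \<and> x \<in> T \<and> T \<subseteq> (\<lambda>x. g (f x)) -` W \<and> smooth_in A T (\<lambda>x. \<kappa> (g (f x)))"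
    by (rule exI[of _ "points A \<inter> f -` (points B \<inter> g -` W)"])
      (use 2 x c smooth_map_points[OF f x] in auto)
qed (use smooth_map_points[OF f] smooth_map_points[OF g] in auto)

text \<open>K plays the part of the support. It lies inside W and is closed in the whole manifold,
  so that each point outside W has a neighbourhood on which \<beta> vanishes.\<close>

definition cutoff :: "('a, 'm::finite_dim_inner) atlas \<Rightarrow> 'a set \<Rightarrow> 'a set \<Rightarrow> ('a \<Rightarrow> real) \<Rightarrow> bool"
  where "cutoff A W N \<beta> \<longleftrightarrow> \<beta> \<in> smooth_functions A \<and> open_in_atlas A W \<and> open_in_atlas A N \<and> N \<subseteq> W \<and>
    (\<forall>x\<in>N. \<beta> x = 1) \<and> (\<exists>K\<subseteq>W. open_in_atlas A (points A - K) \<and> (\<forall>x\<in>points A - K. \<beta> x = 0))"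

lemma cutoffD:
  assumes "cutoff A W N \<beta>"
  shows "\<beta> \<in> smooth_functions A" "open_in_atlas A W" "open_in_atlas A N" "N \<subseteq> W" "\<And>x. x \<in> N \<Longrightarrow> \<beta> x = 1"
    "\<And>x. x \<in> points A \<Longrightarrow> x \<notin> W \<Longrightarrow> \<exists>T. open_in_atlas A T \<and> x \<in> T \<and> (\<forall>z\<in>T. \<beta> z = 0)"
  using assms unfolding cutoff_def by blast+

text \<open>The device by which local data become global functions and sections in everything that
  follows.\<close>

lemma smooth_in_cutoff:
  fixes u :: "'a \<Rightarrow> 'b::real_normed_vector"
  assumes A: "smooth_atlas A" and \<beta>: "cutoff A W N \<beta>" and u: "smooth_in A W u"
  shows "smooth_in A (points A) (\<lambda>x. if x \<in> W then \<beta> x *\<^sub>R u x else 0)"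
proof (rule smooth_in_local)
  fix x assume x: "x \<in> points A"
  show "\<exists>T. open_in_atlas A T \<and> x \<in> T \<and> smooth_in A T (\<lambda>x. if x \<in> W then \<beta> x *\<^sub>R u x else 0)"
  proof (cases "x \<in> W")
    case True
    have "smooth_in A W (\<lambda>x. if x \<in> W then \<beta> x *\<^sub>R u x else 0)"
      by (rule smooth_in_cong[OF A cutoffD(2)[OF \<beta>] smooth_in_scaleR[OF cutoffD(2)[OF \<beta>] smooth_functionsD(2)[OF A cutoffD(1)[OF \<beta>]] u]])
        (use open_in_atlasD(2)[OF cutoffD(2)[OF \<beta>]] in auto)
    then show ?thesis using True cutoffD(2)[OF \<beta>] by blast
  next
    case False
    then obtain T where T: "open_in_atlas A T" "x \<in> T" "\<forall>z\<in>T. \<beta> z = 0"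
      using cutoffD(6)[OF \<beta> x] by blast
    have "smooth_in A T (\<lambda>x. if x \<in> W then \<beta> x *\<^sub>R u x else 0)"
      by (rule smooth_in_cong[OF A T(1) smooth_in_const[of A T 0]]) (use T in auto)
    then show ?thesis using T by blast
  qed
qed

text \<open>A closed coordinate ball is compact, hence closed in the whole manifold by the Hausdorff
  property. Otherwise the bump function, extended by zero, could jump at limit points of the ball
  outside the chart.\<close>

lemma cutoff_exists:
  fixes A :: "('a, 'm::finite_dim_inner) atlas"
  assumes A: "smooth_atlas A" and H: "Hausdorff_space (manifold_topology A)"
    and W: "open_in_atlas A W" and p: "p \<in> W"
  shows "\<exists>N \<beta>. p \<in> N \<and> cutoff A W N \<beta>"
proof -
  have pA: "p \<in> points A" using p open_in_atlasD(2)[OF W] by blast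
  obtain U \<phi> where c: "(U, \<phi>) \<in> A" "p \<in> U" using pA by (rule pointsE)
  note inv = the_inv_into_chart[OF A c(1)]
  have "\<phi> p \<in> \<phi> ` (U \<inter> W)" using c p by blast
  then obtain r where r: "r > 0" "cball (\<phi> p) r \<subseteq> \<phi> ` (U \<inter> W)"
    using open_in_atlasD(1)[OF W c(1)] open_contains_cball by blast
  obtain b :: "'m \<Rightarrow> real" where b: "smooth_on UNIV b" "\<And>y. y \<in> ball (\<phi> p) (r / 2) \<Longrightarrow> b y = 1"
    "\<And>y. y \<notin> ball (\<phi> p) r \<Longrightarrow> b y = 0"
    using bump_function_exists[OF r(1), of "\<phi> p"] by blast
  define K where "K = the_inv_into U \<phi> ` cball (\<phi> p) r"
  have KW: "K \<subseteq> U \<inter> W" using r(2) inv unfolding K_def by auto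
  have top: "topspace (manifold_topology A) = points A"
    using openin_manifold_topology[OF A] open_in_atlas_points[OF A] open_in_atlasD(2)
    by (metis openin_topspace openin_subset subset_antisym)
  have "continuous_map (top_of_set (\<phi> ` U)) (manifold_topology A) (the_inv_into U \<phi>)"
    unfolding continuous_map_def
  proof (intro conjI allI impI)
    show "the_inv_into U \<phi> \<in> topspace (top_of_set (\<phi> ` U)) \<rightarrow> topspace (manifold_topology A)"
      using inv chart_subset_points[OF c(1)] by (auto simp: top)
    fix S assume "openin (manifold_topology A) S"
    then have "open (\<phi> ` (U \<inter> S))" using openin_manifold_topology[OF A] open_in_atlasD(1)[OF _ c(1)] by blast
    moreover have "{y \<in> topspace (top_of_set (\<phi> ` U)). the_inv_into U \<phi> y \<in> S} = \<phi> ` (U \<inter> S)"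
      using inv by auto
    ultimately show "openin (top_of_set (\<phi> ` U)) {y \<in> topspace (top_of_set (\<phi> ` U)). the_inv_into U \<phi> y \<in> S}"
      by (metis Int_lower1 image_mono open_subset)
  qed
  moreover have "compactin (top_of_set (\<phi> ` U)) (cball (\<phi> p) r)"
    using r(2) by (auto simp: compactin_subtopology)
  ultimately have "compactin (manifold_topology A) K"
    unfolding K_def by (rule image_compactin[rotated])
  then have "closedin (manifold_topology A) K" using compactin_imp_closedin[OF H] by blast
  then have oK: "open_in_atlas A (points A - K)"
    using openin_manifold_topology[OF A] top by (metis closedin_def)
  define \<beta> where "\<beta> = (\<lambda>x\<in>points A. if x \<in> U then b (\<phi> x) else 0)"
  have zero: "\<beta> x = 0" if "x \<in> points A - K" for x
  proof -
    have "\<phi> x \<notin> ball (\<phi> p) r" if "x \<in> U"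
    proof
      assume "\<phi> x \<in> ball (\<phi> p) r"
      then have "the_inv_into U \<phi> (\<phi> x) \<in> K" unfolding K_def by (intro imageI) auto
      then show False using inv that \<open>x \<in> points A - K\<close> by auto
    qed
    then show ?thesis using that b(3) by (auto simp: \<beta>_def)
  qed
  have "smooth_in A (points A) \<beta>"
  proof (rule smooth_in_local)
    fix x assume x: "x \<in> points A"
    show "\<exists>T. open_in_atlas A T \<and> x \<in> T \<and> smooth_in A T \<beta>"
    proof (cases "x \<in> U")
      case True
      have "smooth_in A U \<beta>"
        by (rule smooth_in_cong[OF A open_in_atlas_chart[OF A c(1)]
              smooth_in_compose[OF A open_in_atlas_chart[OF A c(1)] smooth_in_chart[OF A c(1)] subset_UNIV b(1)]])
          (use chart_subset_points[OF c(1)] in \<open>auto simp: \<beta>_def\<close>)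
      then show ?thesis using True open_in_atlas_chart[OF A c(1)] by blast
    next
      case False
      have "smooth_in A (points A - K) \<beta>"
        by (rule smooth_in_cong[OF A oK smooth_in_const[of _ _ 0]]) (simp add: zero)
      then show ?thesis using False x KW oK by blast
    qed
  qed
  then have "\<beta> \<in> smooth_functions A" using smooth_functions_iff[OF A] by (auto simp: \<beta>_def)
  moreover define N where "N = (U \<inter> \<phi> -` ball (\<phi> p) (r / 2))"
  have oN: "open_in_atlas A N"
    unfolding N_def
    by (rule open_in_atlas_smooth_preimage[OF A open_in_atlas_chart[OF A c(1)] smooth_in_chart[OF A c(1)] open_ball])
  moreover have "N \<subseteq> W"
  proof
    fix x assume x: "x \<in> N"
    then have "dist (\<phi> p) (\<phi> x) \<le> r" using r(1) by (auto simp: N_def)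
    then have "\<phi> x \<in> \<phi> ` (U \<inter> W)" using r(2) by auto
    then show "x \<in> W" using x inv unfolding N_def by (metis IntE imageE)
  qed
  moreover have "\<forall>x\<in>N. \<beta> x = 1"
    using b(2) chart_subset_points[OF c(1)] by (auto simp: N_def \<beta>_def)
  moreover have "p \<in> N" using c r by (simp add: N_def)
  ultimately show ?thesis unfolding cutoff_def using W zero oK KW by blast
qed

section \<open>Tangent vectors as directional derivatives\<close>

lemma tangent_spaceD:
  assumes "v \<in> tangent_space A p" "f \<in> smooth_functions A"
  shows "g \<in> smooth_functions A \<Longrightarrow> v (fun_add A f g) = v f + v g"
    "v (fun_scale A c f) = c * v f"
    "g \<in> smooth_functions A \<Longrightarrow> v (fun_mult A f g) = v f * g p + f p * v g"
  using assms unfolding tangent_space_def by auto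

lemma tangent_spaceI:
  assumes "v \<in> extensional (smooth_functions A)"
    and "\<And>f g. f \<in> smooth_functions A \<Longrightarrow> g \<in> smooth_functions A \<Longrightarrow> v (fun_add A f g) = v f + v g"
    and "\<And>c f. f \<in> smooth_functions A \<Longrightarrow> v (fun_scale A c f) = c * v f"
    and "\<And>f g. f \<in> smooth_functions A \<Longrightarrow> g \<in> smooth_functions A \<Longrightarrow> v (fun_mult A f g) = v f * g p + f p * v g"
  shows "v \<in> tangent_space A p"
  using assms unfolding tangent_space_def by auto

text \<open>The Leibniz rule for 1 = 1 * 1 gives v 1 = 2 v 1.\<close>

lemma tangent_const:
  assumes A: "smooth_atlas A" and v: "v \<in> tangent_space A p" and p: "p \<in> points A"
  shows "v (\<lambda>x\<in>points A. c) = 0"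
proof -
  let ?one = "\<lambda>x\<in>points A. 1::real"
  note one = smooth_functions_closed(5)[OF A, of 1]
  have "fun_mult A ?one ?one = ?one" by (simp add: fun_mult_def restrict_def fun_eq_iff)
  then have "v ?one = v ?one * 1 + 1 * v ?one"
    using tangent_spaceD(3)[OF v one one] p by simp
  then have "v ?one = 0" by simp
  moreover have "fun_scale A c ?one = (\<lambda>x\<in>points A. c)" by (simp add: fun_scale_def restrict_def fun_eq_iff)
  ultimately show ?thesis using tangent_spaceD(2)[OF v one, of c] by simp
qed

lemma tangent_sum:
  assumes A: "smooth_atlas A" and v: "v \<in> tangent_space A p" and p: "p \<in> points A"
    and "finite I" "\<And>i. i \<in> I \<Longrightarrow> f i \<in> smooth_functions A"
  shows "v (\<lambda>x\<in>points A. \<Sum>i\<in>I. f i x) = (\<Sum>i\<in>I. v (f i))"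
  using assms(4,5)
proof (induction I)
  case empty
  then show ?case using tangent_const[OF A v p, of 0] by (simp only: sum.empty)
next
  case (insert i I)
  have "(\<lambda>x\<in>points A. \<Sum>i\<in>insert i I. f i x) = fun_add A (f i) (\<lambda>x\<in>points A. \<Sum>i\<in>I. f i x)"
    using insert.hyps by (simp add: fun_add_def fun_eq_iff restrict_def)
  moreover have "v (fun_add A (f i) (\<lambda>x\<in>points A. \<Sum>i\<in>I. f i x)) = v (f i) + v (\<lambda>x\<in>points A. \<Sum>i\<in>I. f i x)"
    using insert.prems by (intro tangent_spaceD(1)[OF v] smooth_functions_closed(6)[OF A]) auto
  ultimately show ?case
    using insert by simp
qed

locale hausdorff_atlas =
  fixes A :: "('a, 'm::finite_dim_inner) atlas"
  assumes atlas: "smooth_atlas A" and hausdorff: "Hausdorff_space (manifold_topology A)"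
begin

lemmas smooth_fun_add = smooth_functions_closed(1)[OF atlas]
lemmas smooth_fun_mult = smooth_functions_closed(2)[OF atlas]
lemmas smooth_fun_scale = smooth_functions_closed(3)[OF atlas]
lemmas smooth_fun_zero = smooth_functions_closed(4)[OF atlas]
lemmas smooth_fun_const = smooth_functions_closed(5)[OF atlas]
lemmas smooth_fun_sum = smooth_functions_closed(6)[OF atlas]

lemma cutoff_function:
  assumes "cutoff A W N \<beta>" "smooth_in A W u"
  shows "(\<lambda>x\<in>points A. if x \<in> W then \<beta> x *\<^sub>R u x else 0) \<in> smooth_functions A"
  by (rule smooth_functions_restrictI[OF atlas smooth_in_cutoff[OF atlas assms]])

lemma frechet_derivative_coordinate:
  assumes c: "(U, \<phi>) \<in> A" and N: "open_in_atlas A N" "p \<in> N" "p \<in> U"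
    and f: "\<And>x. x \<in> N \<Longrightarrow> x \<in> U \<Longrightarrow> f x = \<phi> x \<bullet> b + k"
  shows "frechet_derivative (f \<circ> the_inv_into U \<phi>) (at (\<phi> p)) w = w \<bullet> b"
proof -
  have "((\<lambda>y. y \<bullet> b + k) has_derivative (\<lambda>w. w \<bullet> b)) (at (\<phi> p))"
    by (auto intro!: derivative_eq_intros)
  then have "((f \<circ> the_inv_into U \<phi>) has_derivative (\<lambda>w. w \<bullet> b)) (at (\<phi> p))"
    by (rule has_derivative_transform_within_open[OF _ open_in_atlasD(1)[OF N(1) c]])
      (use N f the_inv_into_chart[OF atlas c] in auto)
  then show ?thesis using frechet_derivative_at by metis
qed

text \<open>Derivations act on global functions only, so the chart coordinates have to be cut off;
  near p this changes nothing.\<close>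

lemma coordinate_functions_exist:
  assumes c: "(U, \<phi>) \<in> A" and p: "p \<in> U"
  shows "\<exists>N a. open_in_atlas A N \<and> p \<in> N \<and> N \<subseteq> U \<and>
    (\<forall>b. a b \<in> smooth_functions A \<and> (\<forall>x\<in>N. a b x = \<phi> x \<bullet> b))"
proof -
  obtain N \<beta> where N: "p \<in> N" "cutoff A U N \<beta>"
    using cutoff_exists[OF atlas hausdorff open_in_atlas_chart[OF atlas c] p] by blast
  note N' = cutoffD[OF N(2)]
  define a where "a b = (\<lambda>x\<in>points A. if x \<in> U then \<beta> x *\<^sub>R (\<phi> x \<bullet> b) else 0)" for b
  have "a b \<in> smooth_functions A" for b
    unfolding a_def
    by (rule cutoff_function[OF N(2)])
      (rule smooth_in_bounded_linear[OF N'(2) bounded_linear_inner_left smooth_in_chart[OF atlas c]])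
  moreover have "a b x = \<phi> x \<bullet> b" if "x \<in> N" for b x
    using that N'(4,5) open_in_atlasD(2)[OF N'(3)] by (auto simp: a_def)
  ultimately show ?thesis using N N' by blast
qed

text \<open>Hadamard's expansion of f - f(p) holds only in a coordinate ball. Multiplied by the
  square of a cutoff function it becomes an identity between global functions, to which v applies.
  In each product the coordinate factor \<open>a b\<close> vanishes at p, so only v
  (\<open>a b\<close>) times the partial derivative of f survives.\<close>

lemma derivation_is_directional_derivative:
  assumes c: "(U, \<phi>) \<in> A" and p: "p \<in> U" and v: "v \<in> tangent_space A p"
  shows "\<exists>w. \<forall>f\<in>smooth_functions A. v f = frechet_derivative (f \<circ> the_inv_into U \<phi>) (at (\<phi> p)) w"
proof -
  have pA: "p \<in> points A" using chart_subset_points[OF c] p by blast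
  note inv = the_inv_into_chart[OF atlas c]
  obtain r where r: "r > 0" "ball (\<phi> p) r \<subseteq> \<phi> ` U"
    using smooth_atlasD(2)[OF atlas c] p open_contains_ball by blast
  define W where "W = U \<inter> \<phi> -` ball (\<phi> p) r"
  have W: "open_in_atlas A W" "p \<in> W" "W \<subseteq> U"
    unfolding W_def using r p
    by (auto intro: open_in_atlas_smooth_preimage[OF atlas open_in_atlas_chart[OF atlas c] smooth_in_chart[OF atlas c]])
  have \<phi>W: "smooth_in A W \<phi>" by (rule smooth_in_subset[OF smooth_in_chart[OF atlas c] W(3)])
  obtain N \<beta> where N: "p \<in> N" "cutoff A W N \<beta>"
    using cutoff_exists[OF atlas hausdorff W(1,2)] by blast
  note N' = cutoffD[OF N(2)]
  have \<beta>p: "\<beta> p = 1" using N'(5) N(1) by simp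
  define a where "a b = (\<lambda>x\<in>points A. if x \<in> W then \<beta> x *\<^sub>R ((\<phi> x + - \<phi> p) \<bullet> b) else 0)" for b
  have a: "a b \<in> smooth_functions A" for b
    unfolding a_def
    by (rule cutoff_function[OF N(2)])
      (intro smooth_in_bounded_linear[OF W(1) bounded_linear_inner_left] smooth_in_add[OF W(1)] \<phi>W smooth_in_const)
  have "v f = frechet_derivative (f \<circ> the_inv_into U \<phi>) (at (\<phi> p)) (\<Sum>b\<in>onb. v (a b) *\<^sub>R b)"
    if f: "f \<in> smooth_functions A" for f
  proof -
    let ?F = "f \<circ> the_inv_into U \<phi>"
    have F: "smooth_on (ball (\<phi> p) r) ?F"
      unfolding o_def
      by (rule smooth_on_subset[OF smooth_inD[OF smooth_functionsD(2)[OF atlas f chart_subset_points[OF c]] c]])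
        (use r(2) in simp)
    obtain g where g: "\<And>b. smooth_on (ball (\<phi> p) r) (g b)" "\<And>b. g b (\<phi> p) = frechet_derivative ?F (at (\<phi> p)) b"
      "\<And>y. y \<in> ball (\<phi> p) r \<Longrightarrow> ?F y = ?F (\<phi> p) + (\<Sum>b\<in>onb. ((y - \<phi> p) \<bullet> b) * g b y)"
      using hadamard[OF F r(1)] by blast
    define G where "G b = (\<lambda>x\<in>points A. if x \<in> W then \<beta> x *\<^sub>R g b (\<phi> x) else 0)" for b
    have G: "G b \<in> smooth_functions A" for b
      unfolding G_def
      by (rule cutoff_function[OF N(2)], rule smooth_in_compose[OF atlas W(1) \<phi>W _ g(1)]) (auto simp: W_def)
    define f1 where "f1 = fun_add A f (\<lambda>x\<in>points A. - f p)"
    have f1: "f1 \<in> smooth_functions A" unfolding f1_def by (intro smooth_fun_add f smooth_fun_const)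
    have vf1: "v f1 = v f"
      unfolding f1_def using tangent_spaceD(1)[OF v f smooth_fun_const] tangent_const[OF atlas v pA] by simp
    have f1p: "f1 p = 0" using pA by (simp add: f1_def)
    \<comment> \<open>One factor \<beta> goes to the coordinate and one to the remainder function;
      off W both sides vanish.\<close>
    have eq: "fun_mult A \<beta> (fun_mult A \<beta> f1) = (\<lambda>x\<in>points A. \<Sum>b\<in>onb. fun_mult A (a b) (G b) x)"
    proof (rule smooth_functions_eqI)
      show "fun_mult A \<beta> (fun_mult A \<beta> f1) \<in> smooth_functions A" by (intro smooth_fun_mult N'(1) f1)
      show "(\<lambda>x\<in>points A. \<Sum>b\<in>onb. fun_mult A (a b) (G b) x) \<in> smooth_functions A"
        by (intro smooth_fun_sum smooth_fun_mult a G)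
      fix x assume x: "x \<in> points A"
      show "fun_mult A \<beta> (fun_mult A \<beta> f1) x = (\<lambda>x\<in>points A. \<Sum>b\<in>onb. fun_mult A (a b) (G b) x) x"
      proof (cases "x \<in> W")
        case True
        then have "f x = f p + (\<Sum>b\<in>onb. ((\<phi> x - \<phi> p) \<bullet> b) * g b (\<phi> x))"
          using g(3)[of "\<phi> x"] inv[of x] inv[of p] p W by (simp add: W_def)
        then have "f1 x = (\<Sum>b\<in>onb. ((\<phi> x - \<phi> p) \<bullet> b) * g b (\<phi> x))" using x by (simp add: f1_def)
        then have "\<beta> x * (\<beta> x * f1 x) = (\<Sum>b\<in>onb. (\<beta> x * ((\<phi> x - \<phi> p) \<bullet> b)) * (\<beta> x * g b (\<phi> x)))"
          by (simp only: sum_distrib_left mult_ac)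
        then show ?thesis using x True by (simp add: a_def G_def)
      next
        case False
        then have "\<beta> x = 0" using N'(6)[OF x] by blast
        then show ?thesis using x False by (simp add: a_def)
      qed
    qed
    \<comment> \<open>Both cutoff factors equal 1 at p, and the terms that differentiate them are
      multiplied by \<open>f1 p = 0\<close>.\<close>
    have "v (fun_mult A \<beta> (fun_mult A \<beta> f1)) = v f"
      using tangent_spaceD(3)[OF v N'(1) smooth_fun_mult[OF N'(1) f1]] tangent_spaceD(3)[OF v N'(1) f1]
      by (simp add: pA f1p \<beta>p vf1)
    moreover have "v (\<lambda>x\<in>points A. \<Sum>b\<in>onb. fun_mult A (a b) (G b) x) =
        (\<Sum>b\<in>onb. v (a b) * frechet_derivative ?F (at (\<phi> p)) b)"
    proof -
      have "v (fun_mult A (a b) (G b)) = v (a b) * frechet_derivative ?F (at (\<phi> p)) b" for b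
        using tangent_spaceD(3)[OF v a[of b] G[of b]] pA W(2) by (simp add: a_def G_def \<beta>p g(2))
      moreover have "v (\<lambda>x\<in>points A. \<Sum>b\<in>onb. fun_mult A (a b) (G b) x) = (\<Sum>b\<in>onb. v (fun_mult A (a b) (G b)))"
        by (rule tangent_sum[OF atlas v pA finite_onb smooth_fun_mult[OF a G]])
      ultimately show ?thesis by simp
    qed
    moreover have "frechet_derivative ?F (at (\<phi> p)) (\<Sum>b\<in>onb. v (a b) *\<^sub>R b) =
        (\<Sum>b\<in>onb. v (a b) * frechet_derivative ?F (at (\<phi> p)) b)"
      using frechet_derivative_onb_expansion[OF F, of "\<phi> p" "\<Sum>b\<in>onb. v (a b) *\<^sub>R b"] r(1)
      by (simp add: sum_onb_inner)
    ultimately show ?thesis using eq by simp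
  qed
  then show ?thesis by blast
qed

text \<open>Justifies the definite description in \<open>tangent_components\<close>: the direction
  exists because v is a directional derivative, and it is unique because cut-off coordinates recover
  each of its inner products.\<close>

lemma tangent_components_apply:
  assumes c: "(U, \<phi>) \<in> A" and p: "p \<in> U" and v: "v \<in> tangent_space A p" and f: "f \<in> smooth_functions A"
  shows "v f = frechet_derivative (f \<circ> the_inv_into U \<phi>) (at (\<phi> p)) (tangent_components A (U, \<phi>) p v)"
proof -
  obtain w where w: "\<forall>f\<in>smooth_functions A. v f = frechet_derivative (f \<circ> the_inv_into U \<phi>) (at (\<phi> p)) w"
    using derivation_is_directional_derivative[OF c p v] by blast
  obtain N a where N: "open_in_atlas A N" "p \<in> N" and a: "\<And>b. a b \<in> smooth_functions A"
    "\<And>b x. x \<in> N \<Longrightarrow> a b x = \<phi> x \<bullet> b"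
    using coordinate_functions_exist[OF c p] by metis
  have "\<exists>!w. \<forall>f\<in>smooth_functions A. v f = frechet_derivative (f \<circ> the_inv_into U \<phi>) (at (\<phi> p)) w"
  proof (rule ex1I[where a=w])
    show "\<forall>f\<in>smooth_functions A. v f = frechet_derivative (f \<circ> the_inv_into U \<phi>) (at (\<phi> p)) w" by (rule w)
    fix w' assume w': "\<forall>f\<in>smooth_functions A. v f = frechet_derivative (f \<circ> the_inv_into U \<phi>) (at (\<phi> p)) w'"
    have D: "frechet_derivative (a b \<circ> the_inv_into U \<phi>) (at (\<phi> p)) z = z \<bullet> b" for b z
      by (rule frechet_derivative_coordinate[OF c N p, where k=0]) (simp add: a(2))
    have "w' \<bullet> b = w \<bullet> b" for b
      using bspec[OF w a(1)[of b]] bspec[OF w' a(1)[of b]] by (simp only: D)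
    then show "w' = w" using onb_expansion[of w] onb_expansion[of w'] by simp
  qed
  then have "\<forall>f\<in>smooth_functions A. v f = frechet_derivative (f \<circ> the_inv_into U \<phi>) (at (\<phi> p))
      (THE w. \<forall>f\<in>smooth_functions A. v f = frechet_derivative (f \<circ> the_inv_into U \<phi>) (at (\<phi> p)) w)"
    by (rule theI')
  then show ?thesis using f unfolding tangent_components_def by simp
qed

lemma tangent_components_inner:
  assumes c: "(U, \<phi>) \<in> A" and N: "open_in_atlas A N" "p \<in> N" "p \<in> U"
    and v: "v \<in> tangent_space A p" and f: "f \<in> smooth_functions A"
    and "\<And>x. x \<in> N \<Longrightarrow> f x = \<phi> x \<bullet> b"
  shows "tangent_components A (U, \<phi>) p v \<bullet> b = v f"
proof -
  have "frechet_derivative (f \<circ> the_inv_into U \<phi>) (at (\<phi> p)) w = w \<bullet> b" for w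
    by (rule frechet_derivative_coordinate[OF c N, where k=0]) (simp add: assms(7))
  then show ?thesis by (simp only: tangent_components_apply[OF c N(3) v f])
qed

text \<open>The coefficients are partial derivatives of f and do not involve v. Hence the
  differential of f at p is that of a linear combination of coordinate functions.\<close>

lemma tangent_apply_expansion:
  assumes c: "(U, \<phi>) \<in> A" and N: "open_in_atlas A N" "p \<in> N" "p \<in> U"
    and v: "v \<in> tangent_space A p" and f: "f \<in> smooth_functions A"
    and a: "\<And>b. b \<in> onb \<Longrightarrow> a b \<in> smooth_functions A"
    and ax: "\<And>b x. b \<in> onb \<Longrightarrow> x \<in> N \<Longrightarrow> a b x = \<phi> x \<bullet> b"
  shows "v f = (\<Sum>b\<in>onb. frechet_derivative (f \<circ> the_inv_into U \<phi>) (at (\<phi> p)) b * v (a b))"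
proof -
  have F: "smooth_on (\<phi> ` U) (f \<circ> the_inv_into U \<phi>)"
    unfolding o_def
    using smooth_inD[OF smooth_functionsD(2)[OF atlas f chart_subset_points[OF c]] c] by simp
  have "v f = (\<Sum>b\<in>onb. (tangent_components A (U, \<phi>) p v \<bullet> b) *\<^sub>R frechet_derivative (f \<circ> the_inv_into U \<phi>) (at (\<phi> p)) b)"
    unfolding tangent_components_apply[OF c N(3) v f]
    by (rule frechet_derivative_onb_expansion[OF F imageI[OF N(3)]])
  also have "\<dots> = (\<Sum>b\<in>onb. frechet_derivative (f \<circ> the_inv_into U \<phi>) (at (\<phi> p)) b * v (a b))"
  proof (rule sum.cong[OF refl])
    fix b :: 'm assume b: "b \<in> onb"
    have "tangent_components A (U, \<phi>) p v \<bullet> b = v (a b)"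
      by (rule tangent_components_inner[OF c N v a[OF b] ax[OF b]])
    then show "(tangent_components A (U, \<phi>) p v \<bullet> b) *\<^sub>R frechet_derivative (f \<circ> the_inv_into U \<phi>) (at (\<phi> p)) b =
        frechet_derivative (f \<circ> the_inv_into U \<phi>) (at (\<phi> p)) b * v (a b)"
      by simp
  qed
  finally show ?thesis .
qed

lemma smooth_in_directional_derivative:
  assumes c: "(U, \<phi>) \<in> A" and T: "open_in_atlas A T" "T \<subseteq> U" and z: "smooth_in A T z" and f: "f \<in> smooth_functions A"
  shows "smooth_in A T (\<lambda>x. frechet_derivative (f \<circ> the_inv_into U \<phi>) (at (\<phi> x)) (z x))"
proof (rule smooth_in_chartI[OF atlas c T(2,1)])
  have UT: "U \<inter> T = T" using T(2) by blast
  have o: "open (\<phi> ` T)" using open_in_atlasD(1)[OF T(1) c] UT by simp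
  have F: "smooth_on (\<phi> ` T) (f \<circ> the_inv_into U \<phi>)"
    unfolding o_def
    using smooth_inD[OF smooth_functionsD(2)[OF atlas f open_in_atlasD(2)[OF T(1)]] c] UT by simp
  have "smooth_on (\<phi> ` T) (\<lambda>y. frechet_derivative (f \<circ> the_inv_into U \<phi>) (at y) (z (the_inv_into U \<phi> y)))"
    by (rule smooth_on_directional_derivative[OF o F]) (use smooth_inD[OF z c] UT in simp)
  then show "smooth_on (\<phi> ` T) (\<lambda>y. frechet_derivative (f \<circ> the_inv_into U \<phi>) (at (\<phi> (the_inv_into U \<phi> y))) (z (the_inv_into U \<phi> y)))"
    by (rule smooth_on_cong_imp[OF o]) (use T(2) the_inv_into_chart[OF atlas c] in auto)
qed

end

section \<open>Extending Lie brackets to Poisson structures\<close>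

text \<open>A Poisson structure without the Jacobi identity, written pointwise. Antisymmetry carries
  linearity and the Leibniz rule over to the first argument.\<close>

definition biderivation ::
    "('a, 'm::real_normed_vector) atlas \<Rightarrow> (('a \<Rightarrow> real) \<Rightarrow> ('a \<Rightarrow> real) \<Rightarrow> 'a \<Rightarrow> real) \<Rightarrow> bool"
  where "biderivation A P \<longleftrightarrow>
    P \<in> smooth_functions A \<rightarrow>\<^sub>E smooth_functions A \<rightarrow>\<^sub>E smooth_functions A \<and>
    (\<forall>f\<in>smooth_functions A. \<forall>g\<in>smooth_functions A. \<forall>p\<in>points A.
      P g f p = - P f g p \<and> (\<forall>c. P f (fun_scale A c g) p = c * P f g p) \<and>
      (\<forall>h\<in>smooth_functions A. P f (fun_add A g h) p = P f g p + P f h p \<and>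
        P f (fun_mult A g h) p = P f g p * h p + g p * P f h p))"

lemma biderivationD:
  assumes "biderivation A P" "f \<in> smooth_functions A" "g \<in> smooth_functions A"
  shows "P f g \<in> smooth_functions A"
    "p \<in> points A \<Longrightarrow> P g f p = - P f g p"
    "p \<in> points A \<Longrightarrow> P f (fun_scale A c g) p = c * P f g p"
    "p \<in> points A \<Longrightarrow> h \<in> smooth_functions A \<Longrightarrow> P f (fun_add A g h) p = P f g p + P f h p"
    "p \<in> points A \<Longrightarrow> h \<in> smooth_functions A \<Longrightarrow> P f (fun_mult A g h) p = P f g p * h p + g p * P f h p"
proof -
  show "P f g \<in> smooth_functions A"
    using PiE_mem[OF PiE_mem[OF conjunct1[OF assms(1)[unfolded biderivation_def]] assms(2)] assms(3)] .
  have *: "\<forall>p\<in>points A.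
      P g f p = - P f g p \<and> (\<forall>c. P f (fun_scale A c g) p = c * P f g p) \<and>
      (\<forall>h\<in>smooth_functions A. P f (fun_add A g h) p = P f g p + P f h p \<and>
        P f (fun_mult A g h) p = P f g p * h p + g p * P f h p)"
    using assms unfolding biderivation_def by blast
  show "p \<in> points A \<Longrightarrow> P g f p = - P f g p"
    "p \<in> points A \<Longrightarrow> P f (fun_scale A c g) p = c * P f g p"
    "p \<in> points A \<Longrightarrow> h \<in> smooth_functions A \<Longrightarrow> P f (fun_add A g h) p = P f g p + P f h p"
    "p \<in> points A \<Longrightarrow> h \<in> smooth_functions A \<Longrightarrow> P f (fun_mult A g h) p = P f g p * h p + g p * P f h p"
    using * by blast+
qed

lemma biderivationI:
  assumes "P \<in> smooth_functions A \<rightarrow>\<^sub>E smooth_functions A \<rightarrow>\<^sub>E smooth_functions A"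
    and "\<And>f g p. f \<in> smooth_functions A \<Longrightarrow> g \<in> smooth_functions A \<Longrightarrow> p \<in> points A \<Longrightarrow> P g f p = - P f g p"
    and "\<And>f g p c. f \<in> smooth_functions A \<Longrightarrow> g \<in> smooth_functions A \<Longrightarrow> p \<in> points A \<Longrightarrow>
      P f (fun_scale A c g) p = c * P f g p"
    and "\<And>f g h p. f \<in> smooth_functions A \<Longrightarrow> g \<in> smooth_functions A \<Longrightarrow> h \<in> smooth_functions A \<Longrightarrow> p \<in> points A \<Longrightarrow>
      P f (fun_add A g h) p = P f g p + P f h p"
    and "\<And>f g h p. f \<in> smooth_functions A \<Longrightarrow> g \<in> smooth_functions A \<Longrightarrow> h \<in> smooth_functions A \<Longrightarrow> p \<in> points A \<Longrightarrow>
      P f (fun_mult A g h) p = P f g p * h p + g p * P f h p"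
  shows "biderivation A P"
  unfolding biderivation_def by (intro conjI ballI allI assms)

context
  fixes A :: "('a, 'm::finite_dim_inner) atlas" and P
  assumes A: "smooth_atlas A" and P: "biderivation A P"
begin

private lemma closed:
  "f \<in> smooth_functions A \<Longrightarrow> g \<in> smooth_functions A \<Longrightarrow> fun_add A f g \<in> smooth_functions A"
  "f \<in> smooth_functions A \<Longrightarrow> g \<in> smooth_functions A \<Longrightarrow> fun_mult A f g \<in> smooth_functions A"
  "f \<in> smooth_functions A \<Longrightarrow> fun_scale A c f \<in> smooth_functions A"
  "f \<in> smooth_functions A \<Longrightarrow> g \<in> smooth_functions A \<Longrightarrow> P f g \<in> smooth_functions A"
  by (intro smooth_functions_closed[OF A] biderivationD(1)[OF P]; assumption)+

lemma biderivation_eqs: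
  assumes "f \<in> smooth_functions A" "g \<in> smooth_functions A"
  shows "P g f = fun_scale A (-1) (P f g)"
    "P f (fun_scale A c g) = fun_scale A c (P f g)"
    "h \<in> smooth_functions A \<Longrightarrow> P f (fun_add A g h) = fun_add A (P f g) (P f h)"
    "h \<in> smooth_functions A \<Longrightarrow> P f (fun_mult A g h) = fun_add A (fun_mult A (P f g) h) (fun_mult A g (P f h))"
proof -
  show "P g f = fun_scale A (-1) (P f g)"
    by (rule smooth_functions_eqI[of _ A]; simp add: assms closed biderivationD(2)[OF P assms])
qed (rule smooth_functions_eqI[of _ A]; simp add: assms closed biderivationD(3-5)[OF P])+

lemma biderivation_left:
  assumes "f \<in> smooth_functions A" "g \<in> smooth_functions A"
  shows "P (fun_scale A c g) f = fun_scale A c (P g f)"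
    "h \<in> smooth_functions A \<Longrightarrow> P (fun_add A g h) f = fun_add A (P g f) (P h f)"
    "h \<in> smooth_functions A \<Longrightarrow> P (fun_mult A g h) f = fun_add A (fun_mult A (P g f) h) (fun_mult A g (P h f))"
proof -
  note E = biderivation_eqs(1)[OF assms(1)] closed assms
  show "P (fun_scale A c g) f = fun_scale A c (P g f)"
    by (rule smooth_functions_eqI[of _ A]; simp add: E biderivationD(3)[OF P assms])
  show "P (fun_add A g h) f = fun_add A (P g f) (P h f)" if "h \<in> smooth_functions A"
    by (rule smooth_functions_eqI[of _ A]; simp add: E biderivationD(4)[OF P assms] that)
  show "P (fun_mult A g h) f = fun_add A (fun_mult A (P g f) h) (fun_mult A g (P h f))" if "h \<in> smooth_functions A"
    by (rule smooth_functions_eqI[of _ A]; simp add: E biderivationD(5)[OF P assms] that)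
qed

text \<open>The Hamiltonian vector of f at p. Through it a bracket at p depends only on
  differentials at p.\<close>

lemma biderivation_tangent:
  assumes "f \<in> smooth_functions A" "p \<in> points A"
  shows "(\<lambda>g\<in>smooth_functions A. P f g p) \<in> tangent_space A p"
  by (rule tangent_spaceI; simp add: assms closed biderivationD(3-5)[OF P])

text \<open>Iterated brackets are of second order in f, yet their cyclic sum is of first order:
  applied to a product, the Leibniz rule leaves mixed products of single brackets, and these cancel
  by antisymmetry.\<close>

lemma jacobiator_tangent:
  assumes g: "g \<in> smooth_functions A" and h: "h \<in> smooth_functions A" and p: "p \<in> points A"
  shows "(\<lambda>f\<in>smooth_functions A. P f (P g h) p + P g (P h f) p + P h (P f g) p) \<in> tangent_space A p"
proof -
  let ?J = "\<lambda>f. P f (P g h) p + P g (P h f) p + P h (P f g) p"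
  note gh = closed(4)[OF g h]
  have add: "?J (fun_add A f k) = ?J f + ?J k"
    if f: "f \<in> smooth_functions A" and k: "k \<in> smooth_functions A" for f k
    using p by (simp only: biderivation_left(2)[OF gh f k] biderivation_left(2)[OF g f k] biderivation_eqs(3)[OF h f k]
        biderivation_eqs(3)[OF g closed(4)[OF h f] closed(4)[OF h k]]
        biderivation_eqs(3)[OF h closed(4)[OF f g] closed(4)[OF k g]] fun_operations_apply)
  have scale: "?J (fun_scale A c f) = c * ?J f" if f: "f \<in> smooth_functions A" for c f
    using p by (simp add: biderivation_left(1)[OF gh f] biderivation_left(1)[OF g f] biderivation_eqs(2)[OF h f]
        biderivation_eqs(2)[OF g closed(4)[OF h f]] biderivation_eqs(2)[OF h closed(4)[OF f g]] distrib_left)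
  have mult: "?J (fun_mult A f k) = ?J f * k p + f p * ?J k"
    if f: "f \<in> smooth_functions A" and k: "k \<in> smooth_functions A" for f k
  proof -
    note c = closed(4)[OF h f] closed(4)[OF h k] closed(4)[OF f g] closed(4)[OF k g]
    have 1: "P (fun_mult A f k) (P g h) p = P f (P g h) p * k p + f p * P k (P g h) p"
      using p by (simp only: biderivation_left(3)[OF gh f k] fun_operations_apply)
    have 2: "P g (P h (fun_mult A f k)) p =
        P g (P h f) p * k p + P h f p * P g k p + (P g f p * P h k p + f p * P g (P h k) p)"
      using p by (simp only: biderivation_eqs(4)[OF h f k] biderivation_eqs(3)[OF g closed(2)[OF c(1) k] closed(2)[OF f c(2)]]
          biderivation_eqs(4)[OF g c(1) k] biderivation_eqs(4)[OF g f c(2)] fun_operations_apply)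
    have 3: "P h (P (fun_mult A f k) g) p =
        P h (P f g) p * k p + P f g p * P h k p + (P h f p * P k g p + f p * P h (P k g) p)"
      using p by (simp only: biderivation_left(3)[OF g f k] biderivation_eqs(3)[OF h closed(2)[OF c(3) k] closed(2)[OF f c(4)]]
          biderivation_eqs(4)[OF h c(3) k] biderivation_eqs(4)[OF h f c(4)] fun_operations_apply)
    \<comment> \<open>With these two signs the four mixed products in the expansions above cancel in
      pairs.\<close>
    have a: "P g f p = - P f g p" "P k g p = - P g k p"
      using biderivationD(2)[OF P f g p] biderivationD(2)[OF P g k p] by simp_all
    show ?thesis unfolding 1 2 3 a by (simp add: algebra_simps)
  qed
  show ?thesis
    by (rule tangent_spaceI; simp only: restrict_extensional restrict_apply closed add scale mult if_True)
qed

end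

text \<open>Antisymmetry comes from {f + g, f + g} = 0 by bilinearity. The two requirements on the
  right are handled differently later: the first is checked directly, the second is reduced to
  special functions.\<close>

lemma poisson_structure_iff:
  assumes A: "smooth_atlas (A :: ('a, 'm::finite_dim_inner) atlas)"
  shows "poisson_structure A P \<longleftrightarrow> biderivation A P \<and>
    (\<forall>f\<in>smooth_functions A. \<forall>g\<in>smooth_functions A. \<forall>h\<in>smooth_functions A. \<forall>p\<in>points A.
      P f (P g h) p + P g (P h f) p + P h (P f g) p = 0)" (is "?L \<longleftrightarrow> ?R")
proof
  assume ?L
  then have lie: "lie_bracket_on (smooth_functions A) (fun_add A) (fun_scale A) (fun_zero A) P"
    and leib: "\<forall>f\<in>smooth_functions A. \<forall>g\<in>smooth_functions A. \<forall>h\<in>smooth_functions A.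
       P f (fun_mult A g h) = fun_add A (fun_mult A (P f g) h) (fun_mult A g (P f h))"
    unfolding poisson_structure_def by blast+
  note l = lie[unfolded lie_bracket_on_def]
  have ant: "P g f p = - P f g p"
    if f: "f \<in> smooth_functions A" and g: "g \<in> smooth_functions A" and p: "p \<in> points A" for f g p
  proof -
    note fg = smooth_functions_closed(1)[OF A f g]
    have "P (fun_add A f g) (fun_add A f g) p = 0" using l fg p by simp
    moreover have "P (fun_add A f g) (fun_add A f g) = fun_add A (P f (fun_add A f g)) (P g (fun_add A f g))"
      using l f g fg by blast
    moreover have "P f (fun_add A f g) = fun_add A (P f f) (P f g)" "P g (fun_add A f g) = fun_add A (P g f) (P g g)"
      using l f g by simp_all
    moreover have "P f f p = 0" "P g g p = 0" using l f g p by simp_all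
    ultimately show ?thesis using p by simp
  qed
  have "biderivation A P"
  proof (rule biderivationI[OF conjunct1[OF l] ant])
    fix f g h p c assume fgh: "f \<in> smooth_functions A" "g \<in> smooth_functions A" and p: "p \<in> points A"
    have "P f (fun_scale A c g) = fun_scale A c (P f g)" using l fgh by blast
    then show "P f (fun_scale A c g) p = c * P f g p" using p by simp
    assume h: "h \<in> smooth_functions A"
    have "P f (fun_add A g h) = fun_add A (P f g) (P f h)" using l fgh h by blast
    then show "P f (fun_add A g h) p = P f g p + P f h p" using p by simp
    have "P f (fun_mult A g h) = fun_add A (fun_mult A (P f g) h) (fun_mult A g (P f h))" using leib fgh h by blast
    then show "P f (fun_mult A g h) p = P f g p * h p + g p * P f h p" using p by simp
  qed
  moreover have "P f (P g h) p + P g (P h f) p + P h (P f g) p = 0"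
    if "f \<in> smooth_functions A" "g \<in> smooth_functions A" "h \<in> smooth_functions A" "p \<in> points A" for f g h p
  proof -
    have "fun_add A (fun_add A (P f (P g h)) (P g (P h f))) (P h (P f g)) = fun_zero A" using l that by blast
    then have "fun_add A (fun_add A (P f (P g h)) (P g (P h f))) (P h (P f g)) p = fun_zero A p" by simp
    then show ?thesis using that by simp
  qed
  ultimately show ?R by blast
next
  assume R: ?R
  then have P: "biderivation A P" by blast
  note E = biderivation_eqs[OF A P] biderivation_left[OF A P]
  have z: "P f f = fun_zero A" if f: "f \<in> smooth_functions A" for f
  proof (rule smooth_functions_eqI)
    show "P f f p = fun_zero A p" if "p \<in> points A" for p
      unfolding fun_operations_apply(4)[OF that] using biderivationD(2)[OF P f f that] by linarith
  qed (intro biderivationD(1)[OF P] f smooth_functions_closed[OF A])+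
  have j: "fun_add A (fun_add A (P f (P g h)) (P g (P h f))) (P h (P f g)) = fun_zero A"
    if "f \<in> smooth_functions A" "g \<in> smooth_functions A" "h \<in> smooth_functions A" for f g h
  proof (rule smooth_functions_eqI)
    show "fun_add A (fun_add A (P f (P g h)) (P g (P h f))) (P h (P f g)) p = fun_zero A p" if p: "p \<in> points A" for p
      unfolding fun_operations_apply[OF p]
      using R \<open>f \<in> smooth_functions A\<close> \<open>g \<in> smooth_functions A\<close> \<open>h \<in> smooth_functions A\<close> p by blast
  qed (intro biderivationD(1)[OF P] smooth_functions_closed[OF A] that)+
  have "P \<in> smooth_functions A \<rightarrow>\<^sub>E smooth_functions A \<rightarrow>\<^sub>E smooth_functions A"
    using P unfolding biderivation_def by blast
  then show ?L
    unfolding poisson_structure_def lie_bracket_on_def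
    by (intro conjI ballI allI; simp only: E(2-) z j)
qed

text \<open>What is used of the affine functions: a linear space of smooth functions, closed under
  real multiples only, that contains near each point the coordinates of some chart.\<close>

locale coordinate_functions = hausdorff_atlas A for A :: "('a, 'm::finite_dim_inner) atlas" +
  fixes C :: "('a \<Rightarrow> real) set"
  assumes C_smooth: "f \<in> C \<Longrightarrow> f \<in> smooth_functions A"
    and C_zero: "fun_zero A \<in> C"
    and C_add: "f \<in> C \<Longrightarrow> g \<in> C \<Longrightarrow> fun_add A f g \<in> C"
    and C_scale: "f \<in> C \<Longrightarrow> fun_scale A c f \<in> C"
    and C_coordinates: "p \<in> points A \<Longrightarrow> \<exists>U \<phi> N a. (U, \<phi>) \<in> A \<and> open_in_atlas A N \<and> p \<in> N \<and> N \<subseteq> U \<and>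
      (\<forall>b\<in>onb. a b \<in> C \<and> (\<forall>x\<in>N. a b x = \<phi> x \<bullet> b))"
begin

text \<open>Since tangent vectors are derivations, equality of differentials can be stated without
  choosing a chart.\<close>

definition same_differential :: "'a \<Rightarrow> ('a \<Rightarrow> real) \<Rightarrow> ('a \<Rightarrow> real) \<Rightarrow> bool"
  where "same_differential p f g \<longleftrightarrow> (\<forall>v\<in>tangent_space A p. v f = v g)"

text \<open>The coefficients are real numbers because C is only a linear space; variable
  coefficients are frozen at one point at a time.\<close>

definition combination :: "('i \<Rightarrow> real) \<Rightarrow> ('i \<Rightarrow> 'a \<Rightarrow> real) \<Rightarrow> 'i set \<Rightarrow> 'a \<Rightarrow> real"
  where "combination k a I = (\<lambda>x\<in>points A. \<Sum>i\<in>I. fun_scale A (k i) (a i) x)"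

lemma combination_insert:
  "finite I \<Longrightarrow> i \<notin> I \<Longrightarrow> combination k a (insert i I) = fun_add A (fun_scale A (k i) (a i)) (combination k a I)"
  by (simp add: combination_def fun_add_def restrict_def fun_eq_iff)

lemma combination_empty: "combination k a {} = fun_zero A"
  by (simp add: combination_def fun_zero_def restrict_def fun_eq_iff)

lemma combination_in:
  assumes "finite I" "\<And>i. i \<in> I \<Longrightarrow> a i \<in> C"
  shows "combination k a I \<in> C"
  using assms by (induction I) (simp_all add: combination_insert combination_empty C_zero C_add C_scale)

lemma tangent_combination:
  assumes "v \<in> tangent_space A p" "p \<in> points A" "finite I" "\<And>i. i \<in> I \<Longrightarrow> a i \<in> C"
  shows "v (combination k a I) = (\<Sum>i\<in>I. k i * v (a i))"
proof -
  have "v (combination k a I) = (\<Sum>i\<in>I. v (fun_scale A (k i) (a i)))"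
    unfolding combination_def
    by (rule tangent_sum[OF atlas assms(1-3)]) (rule smooth_fun_scale[OF C_smooth[OF assms(4)]])
  then show ?thesis using tangent_spaceD(2)[OF assms(1) C_smooth[OF assms(4)]] by simp
qed

text \<open>The functions \<open>a b\<close> stay the same for all q in N and for all f; only the
  coefficients, the partial derivatives of f at q, vary, and they do so smoothly. This uniformity is
  what later makes the extended bracket smooth.\<close>

lemma local_coordinate_combination:
  assumes p: "p \<in> points A"
  shows "\<exists>N a. open_in_atlas A N \<and> p \<in> N \<and> (\<forall>b\<in>onb. a b \<in> C) \<and>
    (\<forall>f\<in>smooth_functions A. \<exists>k. (\<forall>b\<in>(onb::'m set). smooth_in A N (k b)) \<and>
      (\<forall>q\<in>N. same_differential q f (combination (\<lambda>b. k b q) a onb)))"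
proof -
  obtain U \<phi> N a where c: "(U, \<phi>) \<in> A" and N: "open_in_atlas A N" "p \<in> N" "N \<subseteq> U"
    and a: "\<And>b. b \<in> onb \<Longrightarrow> a b \<in> C" "\<And>b x. b \<in> onb \<Longrightarrow> x \<in> N \<Longrightarrow> a b x = \<phi> x \<bullet> b"
    using C_coordinates[OF p] by blast
  have "\<exists>k. (\<forall>b\<in>(onb::'m set). smooth_in A N (k b)) \<and>
      (\<forall>q\<in>N. same_differential q f (combination (\<lambda>b. k b q) a onb))" if f: "f \<in> smooth_functions A" for f
  proof -
    define k where "k b q = frechet_derivative (f \<circ> the_inv_into U \<phi>) (at (\<phi> q)) b" for b q
    have "smooth_in A N (k b)" for b
      unfolding k_def by (rule smooth_in_directional_derivative[OF c N(1,3) smooth_in_const f])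
    moreover have "same_differential q f (combination (\<lambda>b. k b q) a onb)" if q: "q \<in> N" for q
      unfolding same_differential_def
    proof
      fix v assume v: "v \<in> tangent_space A q"
      have qA: "q \<in> points A" using q open_in_atlasD(2)[OF N(1)] by blast
      have "v f = (\<Sum>b\<in>onb. k b q * v (a b))"
        unfolding k_def
        by (rule tangent_apply_expansion[OF c N(1) q _ v f C_smooth[OF a(1)] a(2)]) (use q N in auto)
      then show "v f = v (combination (\<lambda>b. k b q) a onb)"
        using tangent_combination[OF v qA finite_onb, of a "\<lambda>b. k b q"] a(1) by simp
    qed
    ultimately show ?thesis by blast
  qed
  then show ?thesis using N(1,2) a(1) by blast
qed

lemma same_differential_exists:
  assumes p: "p \<in> points A" and f: "f \<in> smooth_functions A"
  shows "\<exists>a\<in>C. same_differential p f a"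
proof -
  obtain N a where N: "open_in_atlas A N" "p \<in> N" and a: "\<And>b. b \<in> (onb::'m set) \<Longrightarrow> a b \<in> C"
    and *: "\<forall>f\<in>smooth_functions A. \<exists>k. (\<forall>b\<in>(onb::'m set). smooth_in A N (k b)) \<and>
      (\<forall>q\<in>N. same_differential q f (combination (\<lambda>b. k b q) a onb))"
    using local_coordinate_combination[OF p] by blast
  obtain k where "\<forall>q\<in>N. same_differential q f (combination (\<lambda>b. k b q) a onb)"
    using bspec[OF * f] by blast
  then have "same_differential p f (combination (\<lambda>b. k b p) a onb)" using N(2) by blast
  moreover have "combination (\<lambda>b. k b p) a onb \<in> C" by (rule combination_in[OF finite_onb], erule a)
  ultimately show ?thesis by blast
qed

lemma biderivation_cong:
  assumes P: "biderivation A P" and p: "p \<in> points A"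
    and s: "f \<in> smooth_functions A" "f' \<in> smooth_functions A" "g \<in> smooth_functions A" "g' \<in> smooth_functions A"
    and "same_differential p f f'" "same_differential p g g'"
  shows "P f g p = P f' g' p"
proof -
  have "P h k p = P h k' p" if "h \<in> smooth_functions A" "k \<in> smooth_functions A" "k' \<in> smooth_functions A"
    "same_differential p k k'" for h k k'
    using that biderivation_tangent[OF atlas P that(1) p] unfolding same_differential_def by fastforce
  then show ?thesis using assms(7,8) biderivationD(2)[OF P _ _ p] s by metis
qed

text \<open>Elements of C realise every differential at every point, and a biderivation sees only
  differentials.\<close>

lemma biderivation_eqI:
  assumes P: "biderivation A P" and Q: "biderivation A Q" and eq: "\<And>f g. f \<in> C \<Longrightarrow> g \<in> C \<Longrightarrow> P f g = Q f g"
  shows "P = Q"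
proof -
  have *: "P f g = Q f g" if f: "f \<in> smooth_functions A" and g: "g \<in> smooth_functions A" for f g
  proof (rule smooth_functions_eqI[OF biderivationD(1)[OF P f g] biderivationD(1)[OF Q f g]])
    fix p assume p: "p \<in> points A"
    obtain a where a: "a \<in> C" "same_differential p f a" using same_differential_exists[OF p f] by blast
    obtain b where b: "b \<in> C" "same_differential p g b" using same_differential_exists[OF p g] by blast
    show "P f g p = Q f g p"
      using biderivation_cong[OF P p f C_smooth[OF a(1)] g C_smooth[OF b(1)] a(2) b(2)]
        biderivation_cong[OF Q p f C_smooth[OF a(1)] g C_smooth[OF b(1)] a(2) b(2)] eq[OF a(1) b(1)] by simp
  qed
  have ext: "P \<in> extensional (smooth_functions A)" "Q \<in> extensional (smooth_functions A)"
    "\<And>f. f \<in> smooth_functions A \<Longrightarrow> P f \<in> extensional (smooth_functions A)"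
    "\<And>f. f \<in> smooth_functions A \<Longrightarrow> Q f \<in> extensional (smooth_functions A)"
    using P Q unfolding biderivation_def by (simp_all add: PiE_iff)
  show ?thesis
    by (rule extensionalityI[OF ext(1,2)], rule extensionalityI[OF ext(3,4)]) (simp_all add: *)
qed

end

text \<open>The first-order condition is imposed on the first argument; antisymmetry of B transfers
  it to the second.\<close>

locale poisson_extension = coordinate_functions A C for A :: "('a, 'm::finite_dim_inner) atlas" and C +
  fixes B
  assumes B_lie: "lie_bracket_on C (fun_add A) (fun_scale A) (fun_zero A) B"
    and B_first_order: "p \<in> points A \<Longrightarrow> f \<in> C \<Longrightarrow> g \<in> C \<Longrightarrow> (\<And>v. v \<in> tangent_space A p \<Longrightarrow> v f = 0) \<Longrightarrow> B f g p = 0"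
begin

lemma B_closed: "f \<in> C \<Longrightarrow> g \<in> C \<Longrightarrow> B f g \<in> C"
  by (rule PiE_mem[OF PiE_mem[OF conjunct1[OF B_lie[unfolded lie_bracket_on_def]]]])

lemma B_eqs:
  assumes "f \<in> C" "g \<in> C"
  shows "h \<in> C \<Longrightarrow> B (fun_add A f g) h = fun_add A (B f h) (B g h)"
    "h \<in> C \<Longrightarrow> B h (fun_add A f g) = fun_add A (B h f) (B h g)"
    "B (fun_scale A c f) g = fun_scale A c (B f g)" "B g (fun_scale A c f) = fun_scale A c (B g f)"
    "B f f = fun_zero A"
  using B_lie assms unfolding lie_bracket_on_def by simp_all

lemma B_antisym:
  assumes f: "f \<in> C" and g: "g \<in> C" and p: "p \<in> points A"
  shows "B g f p = - B f g p"
proof -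
  have "B (fun_add A f g) (fun_add A f g) p = 0" using B_eqs(5)[OF C_add[OF f g]] C_add f g p by simp
  moreover have "B (fun_add A f g) (fun_add A f g) p = B f f p + B f g p + (B g f p + B g g p)"
    using p by (simp add: B_eqs(1,2) f g C_add)
  ultimately show ?thesis using B_eqs(5)[OF f] B_eqs(5)[OF g] f g p by simp
qed

lemma B_cong_left:
  assumes p: "p \<in> points A" and f: "f \<in> C" "f' \<in> C" and g: "g \<in> C" and same: "same_differential p f f'"
  shows "B f g p = B f' g p"
proof -
  let ?d = "fun_add A f (fun_scale A (-1) f')"
  have d: "?d \<in> C" by (intro C_add C_scale f)
  have "B ?d g p = 0"
  proof (rule B_first_order[OF p d g])
    fix v assume v: "v \<in> tangent_space A p"
    have "v f = v f'" using same v unfolding same_differential_def by blast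
    then show "v ?d = 0"
      using tangent_spaceD(1)[OF v C_smooth[OF f(1)] smooth_fun_scale[OF C_smooth[OF f(2)]]]
        tangent_spaceD(2)[OF v C_smooth[OF f(2)]] by simp
  qed
  moreover have "B ?d g = fun_add A (B f g) (fun_scale A (-1) (B f' g))"
    by (simp only: B_eqs(1)[OF f(1) C_scale[OF f(2)] g] B_eqs(3)[OF f(2) g])
  ultimately show ?thesis using p by simp
qed

lemma B_cong:
  assumes p: "p \<in> points A" and f: "f \<in> C" "f' \<in> C" and g: "g \<in> C" "g' \<in> C"
    and "same_differential p f f'" "same_differential p g g'"
  shows "B f g p = B f' g' p"
  using B_cong_left[OF p f g(1) assms(6)] B_cong_left[OF p g f(2) assms(7)]
    B_antisym[OF f(2) g(1) p] B_antisym[OF f(2) g(2) p] by simp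

definition representative :: "'a \<Rightarrow> ('a \<Rightarrow> real) \<Rightarrow> 'a \<Rightarrow> real"
  where "representative p f = (SOME a. a \<in> C \<and> same_differential p f a)"

text \<open>Representatives are chosen separately at each point, so smoothness in p is not evident
  from the definition. The value is independent of the choice by \<open>B_cong\<close>.\<close>

definition extended_bracket :: "('a \<Rightarrow> real) \<Rightarrow> ('a \<Rightarrow> real) \<Rightarrow> 'a \<Rightarrow> real"
  where "extended_bracket = (\<lambda>f\<in>smooth_functions A. \<lambda>g\<in>smooth_functions A. \<lambda>p\<in>points A.
    B (representative p f) (representative p g) p)"

lemma representative:
  assumes "p \<in> points A" "f \<in> smooth_functions A"
  shows "representative p f \<in> C" "same_differential p f (representative p f)"
  using someI_ex[of "\<lambda>a. a \<in> C \<and> same_differential p f a"] same_differential_exists[OF assms]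
  unfolding representative_def by blast+

lemma extended_bracket_apply:
  assumes p: "p \<in> points A" and f: "f \<in> smooth_functions A" and g: "g \<in> smooth_functions A"
    and a: "a \<in> C" "same_differential p f a" and b: "b \<in> C" "same_differential p g b"
  shows "extended_bracket f g p = B a b p"
proof -
  have "same_differential p (representative p f) a"
    using representative(2)[OF p f] a(2) unfolding same_differential_def by (metis (no_types))
  moreover have "same_differential p (representative p g) b"
    using representative(2)[OF p g] b(2) unfolding same_differential_def by (metis (no_types))
  ultimately have "B (representative p f) (representative p g) p = B a b p"
    by (rule B_cong[OF p representative(1)[OF p f] a(1) representative(1)[OF p g] b(1)])
  then show ?thesis using p f g by (simp add: extended_bracket_def)
qed

lemma B_combination_left:
  assumes "finite I" "\<And>i. i \<in> I \<Longrightarrow> a i \<in> C" "g \<in> C" "p \<in> points A"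
  shows "B (combination k a I) g p = (\<Sum>i\<in>I. k i * B (a i) g p)"
  using assms(1,2)
proof (induction I)
  case empty
  have "B (fun_zero A) g p = 0"
    by (rule B_first_order[OF assms(4) C_zero assms(3)])
      (use tangent_const[OF atlas _ assms(4), of _ 0] in \<open>simp add: fun_zero_def\<close>)
  then show ?case by (simp add: combination_empty)
next
  case (insert i I)
  have C: "fun_scale A (k i) (a i) \<in> C" "combination k a I \<in> C" "a i \<in> C"
    using insert by (auto intro: C_scale combination_in)
  show ?case
    using insert assms(4) by (simp add: combination_insert B_eqs(1)[OF C(1,2) assms(3)] B_eqs(3)[OF C(3) assms(3)])
qed

lemma B_combination:
  assumes "finite I" "\<And>i. i \<in> I \<Longrightarrow> a i \<in> C" "p \<in> points A"
  shows "B (combination k a I) (combination l a I) p = (\<Sum>i\<in>I. \<Sum>j\<in>I. k i * l j * B (a i) (a j) p)"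
proof -
  have c: "combination l a I \<in> C" for l by (rule combination_in[OF assms(1)], erule assms(2))
  have "B (combination k a I) (combination l a I) p = (\<Sum>i\<in>I. k i * B (a i) (combination l a I) p)"
    by (rule B_combination_left[OF assms(1) _ c assms(3)], erule assms(2))
  also have "\<dots> = (\<Sum>i\<in>I. k i * (\<Sum>j\<in>I. l j * B (a i) (a j) p))"
  proof (rule sum.cong[OF refl])
    fix i assume i: "i \<in> I"
    have "B (a i) (combination l a I) p = - (\<Sum>j\<in>I. l j * B (a j) (a i) p)"
      using B_antisym[OF c assms(2)[OF i] assms(3)] B_combination_left[OF assms(1) _ assms(2)[OF i] assms(3), of a] assms(2)
      by simp
    also have "\<dots> = (\<Sum>j\<in>I. l j * B (a i) (a j) p)"
      unfolding sum_negf[symmetric]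
      by (rule sum.cong[OF refl]) (simp add: B_antisym[OF assms(2)[OF i] assms(2) assms(3)])
    finally show "k i * B (a i) (combination l a I) p = k i * (\<Sum>j\<in>I. l j * B (a i) (a j) p)" by simp
  qed
  finally show ?thesis by (simp add: sum_distrib_left mult.assoc)
qed

text \<open>Near p both arguments may be represented by combinations of the same functions
  \<open>a b\<close> with smooth coefficients, and the bracket becomes a finite sum of coefficients
  times the smooth functions \<open>B (a b) (a c)\<close>.\<close>

lemma extended_bracket_smooth:
  assumes f: "f \<in> smooth_functions A" and g: "g \<in> smooth_functions A"
  shows "extended_bracket f g \<in> smooth_functions A"
proof -
  have "smooth_in A (points A) (extended_bracket f g)"
  proof (rule smooth_in_local)
    fix p assume p: "p \<in> points A"
    obtain N a where N: "open_in_atlas A N" "p \<in> N" and a: "\<And>b. b \<in> (onb::'m set) \<Longrightarrow> a b \<in> C"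
      and *: "\<forall>f\<in>smooth_functions A. \<exists>k. (\<forall>b\<in>(onb::'m set). smooth_in A N (k b)) \<and>
        (\<forall>q\<in>N. same_differential q f (combination (\<lambda>b. k b q) a onb))"
      using local_coordinate_combination[OF p] by blast
    obtain k where k: "\<And>b. b \<in> onb \<Longrightarrow> smooth_in A N (k b)"
      "\<And>q. q \<in> N \<Longrightarrow> same_differential q f (combination (\<lambda>b. k b q) a onb)"
      using bspec[OF * f] by blast
    obtain l where l: "\<And>b. b \<in> onb \<Longrightarrow> smooth_in A N (l b)"
      "\<And>q. q \<in> N \<Longrightarrow> same_differential q g (combination (\<lambda>b. l b q) a onb)"
      using bspec[OF * g] by blast
    have NA: "N \<subseteq> points A" by (rule open_in_atlasD(2)[OF N(1)])
    have "smooth_in A N (\<lambda>q. \<Sum>b\<in>onb. \<Sum>c\<in>onb. k b q * l c q * B (a b) (a c) q)"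
      by (intro smooth_in_sum smooth_in_mult N(1) k(1) l(1) smooth_functionsD(2)[OF atlas] C_smooth B_closed a NA)
    then have "smooth_in A N (extended_bracket f g)"
    proof (rule smooth_in_cong[OF atlas N(1)])
      fix q assume q: "q \<in> N"
      have qA: "q \<in> points A" using q NA by blast
      have c: "combination k a onb \<in> C" for k by (rule combination_in[OF finite_onb], erule a)
      have "extended_bracket f g q = B (combination (\<lambda>b. k b q) a onb) (combination (\<lambda>b. l b q) a onb) q"
        by (rule extended_bracket_apply[OF qA f g c k(2)[OF q] c l(2)[OF q]])
      also have "\<dots> = (\<Sum>b\<in>onb. \<Sum>c\<in>onb. k b q * l c q * B (a b) (a c) q)"
        by (rule B_combination[OF finite_onb _ qA], erule a)
      finally show "(\<Sum>b\<in>onb. \<Sum>c\<in>onb. k b q * l c q * B (a b) (a c) q) = extended_bracket f g q" by simp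
    qed
    then show "\<exists>T. open_in_atlas A T \<and> p \<in> T \<and> smooth_in A T (extended_bracket f g)" using N by blast
  qed
  then show ?thesis using smooth_functions_iff[OF atlas] f g by (simp add: extended_bracket_def)
qed

lemma extended_bracket_extends:
  assumes f: "f \<in> C" and g: "g \<in> C"
  shows "extended_bracket f g = B f g"
proof (rule smooth_functions_eqI)
  show "extended_bracket f g \<in> smooth_functions A" by (intro extended_bracket_smooth C_smooth f g)
  show "B f g \<in> smooth_functions A" by (intro C_smooth B_closed f g)
  show "extended_bracket f g p = B f g p" if "p \<in> points A" for p
    by (rule extended_bracket_apply[OF that C_smooth[OF f] C_smooth[OF g] f _ g]) (simp_all add: same_differential_def)
qed

lemma biderivation_extended_bracket: "biderivation A extended_bracket"
proof -
  have ext: "extended_bracket \<in> smooth_functions A \<rightarrow>\<^sub>E smooth_functions A \<rightarrow>\<^sub>E smooth_functions A"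
  proof (rule PiE_I)
    fix f assume f: "f \<in> smooth_functions A"
    show "extended_bracket f \<in> smooth_functions A \<rightarrow>\<^sub>E smooth_functions A"
      by (rule PiE_I) (use f extended_bracket_smooth in \<open>simp_all add: extended_bracket_def\<close>)
  qed (simp add: extended_bracket_def)
  have main: "extended_bracket g f p = - extended_bracket f g p"
      "extended_bracket f (fun_scale A c g) p = c * extended_bracket f g p"
      "extended_bracket f (fun_add A g h) p = extended_bracket f g p + extended_bracket f h p"
      "extended_bracket f (fun_mult A g h) p = extended_bracket f g p * h p + g p * extended_bracket f h p"
    if f: "f \<in> smooth_functions A" and g: "g \<in> smooth_functions A" and h: "h \<in> smooth_functions A"
      and p: "p \<in> points A" for f g h p c
  proof -
    obtain a where a: "a \<in> C" "same_differential p f a" using same_differential_exists[OF p f] by blast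
    obtain b where b: "b \<in> C" "same_differential p g b" using same_differential_exists[OF p g] by blast
    obtain d where d: "d \<in> C" "same_differential p h d" using same_differential_exists[OF p h] by blast
    have bd: "v g = v b" "v h = v d" if "v \<in> tangent_space A p" for v
      using b(2) d(2) that unfolding same_differential_def by blast+
    note e = extended_bracket_apply[OF p f _ a]
    have eg: "extended_bracket f g p = B a b p" and eh: "extended_bracket f h p = B a d p"
      by (rule e[OF g b], rule e[OF h d])
    have "extended_bracket g f p = B b a p" by (rule extended_bracket_apply[OF p g f b a])
    moreover have "extended_bracket f (fun_scale A c g) p = B a (fun_scale A c b) p"
      by (rule e[OF smooth_fun_scale[OF g] C_scale[OF b(1)]])
        (simp add: same_differential_def tangent_spaceD(2) g b C_smooth bd)
    moreover have "extended_bracket f (fun_add A g h) p = B a (fun_add A b d) p"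
      by (rule e[OF smooth_fun_add[OF g h] C_add[OF b(1) d(1)]])
        (simp add: same_differential_def tangent_spaceD(1) g h b d C_smooth bd)
    \<comment> \<open>The product of b and d need not lie in C. With the coefficients h p and g p
      frozen, the combination does lie in C, and it has the differential of gh at p.\<close>
    moreover have "extended_bracket f (fun_mult A g h) p = B a (fun_add A (fun_scale A (h p) b) (fun_scale A (g p) d)) p"
      by (rule e[OF smooth_fun_mult[OF g h] C_add[OF C_scale[OF b(1)] C_scale[OF d(1)]]])
        (simp add: same_differential_def tangent_spaceD g h b d C_smooth smooth_fun_scale bd)
    ultimately show "extended_bracket g f p = - extended_bracket f g p"
      "extended_bracket f (fun_scale A c g) p = c * extended_bracket f g p"
      "extended_bracket f (fun_add A g h) p = extended_bracket f g p + extended_bracket f h p"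
      "extended_bracket f (fun_mult A g h) p = extended_bracket f g p * h p + g p * extended_bracket f h p"
      using p by (simp_all add: eg eh B_eqs(2,4) B_antisym[OF a(1) b(1)] a(1) b(1) d(1) C_scale)
  qed
  show ?thesis
    by (rule biderivationI[OF ext main(1,2)]) (simp_all add: main(3,4))
qed

text \<open>In an iterated bracket the inner bracket must be known near p, so a function cannot be
  exchanged for one that merely shares its differential at p. In the Jacobiator as a whole it can,
  since the Jacobiator is a derivation in that function.\<close>

theorem poisson_structure_extended_bracket: "poisson_structure A extended_bracket"
proof -
  let ?P = extended_bracket
  note P = biderivation_extended_bracket
  have red: "?P f (?P g h) p + ?P g (?P h f) p + ?P h (?P f g) p = ?P a (?P g h) p + ?P g (?P h a) p + ?P h (?P a g) p"
    if "f \<in> smooth_functions A" "g \<in> smooth_functions A" "h \<in> smooth_functions A" "p \<in> points A"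
      "a \<in> C" "same_differential p f a" for f g h p a
    using that(6) jacobiator_tangent[OF atlas P that(2-4)] that(1) C_smooth[OF that(5)]
    unfolding same_differential_def by fastforce
  have "?P f (?P g h) p + ?P g (?P h f) p + ?P h (?P f g) p = 0"
    if f: "f \<in> smooth_functions A" and g: "g \<in> smooth_functions A" and h: "h \<in> smooth_functions A"
      and p: "p \<in> points A" for f g h p
  proof -
    obtain a where a: "a \<in> C" "same_differential p f a" using same_differential_exists[OF p f] by blast
    obtain b where b: "b \<in> C" "same_differential p g b" using same_differential_exists[OF p g] by blast
    obtain d where d: "d \<in> C" "same_differential p h d" using same_differential_exists[OF p h] by blast
    note s = C_smooth[OF a(1)] C_smooth[OF b(1)] C_smooth[OF d(1)]
    \<comment> \<open>The Jacobiator is invariant under cyclic rotation, so the reduction in its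
      first argument is applied to each of the three arguments in turn.\<close>
    have "?P f (?P g h) p + ?P g (?P h f) p + ?P h (?P f g) p = ?P a (?P b d) p + ?P b (?P d a) p + ?P d (?P a b) p"
      using red[OF f g h p a] red[OF g h s(1) p b] red[OF h s(1,2) p d] by simp
    also have "\<dots> = fun_add A (fun_add A (B a (B b d)) (B b (B d a))) (B d (B a b)) p"
      using p by (simp add: extended_bracket_extends a b d B_closed)
    also have "\<dots> = fun_zero A p"
      using B_lie a(1) b(1) d(1) unfolding lie_bracket_on_def by simp
    finally show ?thesis using p by simp
  qed
  then show ?thesis using P poisson_structure_iff[OF atlas] by blast
qed

end

section \<open>Trivializations and sections\<close>

lemma points_restrict_atlas: "points (restrict_atlas A W) = points A \<inter> W"
  by (auto simp: points_def restrict_atlas_def)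

lemma prod_atlasI: "(U, \<phi>) \<in> A \<Longrightarrow> (V, \<psi>) \<in> B \<Longrightarrow> (U \<times> V, map_prod \<phi> \<psi>) \<in> prod_atlas A B"
  unfolding prod_atlas_def by (intro CollectI exI conjI, rule refl, assumption+)

lemma points_prod_atlas:
  fixes A :: "('a, 'm) atlas" and B :: "('c, 'n) atlas"
  shows "points (prod_atlas A B) = points A \<times> points B"
proof (rule set_eqI, rule iffI)
  fix z :: "'a \<times> 'c"
  assume "z \<in> points (prod_atlas A B)"
  then obtain W \<kappa> where w: "(W, \<kappa>) \<in> prod_atlas A B" "z \<in> W" by (rule pointsE)
  have "\<exists>U \<phi> V \<psi>. (W, \<kappa>) = (U \<times> V, map_prod \<phi> \<psi>) \<and> (U, \<phi>) \<in> A \<and> (V, \<psi>) \<in> B"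
    using w(1) unfolding prod_atlas_def by (rule CollectD)
  then obtain U \<phi> V \<psi> where eq: "(W, \<kappa>) = (U \<times> V, map_prod \<phi> \<psi>)" and c: "(U, \<phi>) \<in> A" "(V, \<psi>) \<in> B"
    by (elim exE conjE)
  have "z \<in> U \<times> V" using eq w(2) by simp
  then show "z \<in> points A \<times> points B"
    using chart_subset_points[OF c(1)] chart_subset_points[OF c(2)] by (auto simp: mem_Times_iff)
next
  fix z :: "'a \<times> 'c"
  assume "z \<in> points A \<times> points B"
  then have z: "fst z \<in> points A" "snd z \<in> points B" by (simp_all add: mem_Times_iff)
  obtain U \<phi> where c: "(U, \<phi>) \<in> A" "fst z \<in> U" using z(1) by (rule pointsE)
  obtain V \<psi> where d: "(V, \<psi>) \<in> B" "snd z \<in> V" using z(2) by (rule pointsE)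
  have "z \<in> U \<times> V" using c d by (simp add: mem_Times_iff)
  then show "z \<in> points (prod_atlas A B)"
    using chart_subset_points[OF prod_atlasI[OF c(1) d(1)]] by (rule subsetD[rotated])
qed

lemma smooth_mapD:
  assumes "smooth_map A B f" "(U, \<phi>) \<in> A" "(V, \<psi>) \<in> B"
  shows "open (\<phi> ` (U \<inter> f -` V))" "smooth_on (\<phi> ` (U \<inter> f -` V)) (\<lambda>y. \<psi> (f (the_inv_into U \<phi> y)))"
  using assms by (simp_all add: smooth_map_iff)

lemma restrict_atlasI: "(U, \<phi>) \<in> A \<Longrightarrow> (U \<inter> W, \<phi>) \<in> restrict_atlas A W"
  unfolding restrict_atlas_def by (rule image_eqI) simp_all

lemma vector_space_atlasI: "(UNIV, id) \<in> vector_space_atlas"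
  by (simp add: vector_space_atlas_def)

lemma points_vector_space_atlas: "points vector_space_atlas = UNIV"
  by (simp add: points_def vector_space_atlas_def)

locale smooth_bundle =
  fixes E :: "('a, 'm::finite_dim_inner, 'e, 'f::euclidean_space) vbundle"
  assumes vector_bundle: "vector_bundle E"
begin

abbreviation "M \<equiv> base E"
abbreviation "tot \<equiv> total_space E"

lemma base_atlas: "smooth_atlas M"
  and base_hausdorff: "Hausdorff_space (manifold_topology M)"
  and total_atlas: "smooth_atlas tot"
  and smooth_projection: "smooth_map tot M (projection E)"
  using vector_bundle by (simp_all add: vector_bundle_def smooth_manifold_def)

sublocale base: hausdorff_atlas M
  by unfold_locales (rule base_atlas, rule base_hausdorff)

lemma fibre_vector_space:
  "x \<in> points M \<Longrightarrow> real_vector_space_on (fibre E x) (vadd E) (vscale E) (vzero E x)"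
  using vector_bundle by (simp add: vector_bundle_def)

lemma vzero_in [simp]: "x \<in> points M \<Longrightarrow> vzero E x \<in> fibre E x"
  and vadd_in [simp]: "x \<in> points M \<Longrightarrow> u \<in> fibre E x \<Longrightarrow> v \<in> fibre E x \<Longrightarrow> vadd E u v \<in> fibre E x"
  and vscale_in [simp]: "x \<in> points M \<Longrightarrow> u \<in> fibre E x \<Longrightarrow> vscale E c u \<in> fibre E x"
  using fibre_vector_space[of x] unfolding real_vector_space_on_def by simp_all

lemma fibreD: "e \<in> fibre E x \<Longrightarrow> e \<in> points tot" "e \<in> fibre E x \<Longrightarrow> projection E e = x"
  unfolding fibre_def by simp_all

lemma fibreI: "e \<in> points tot \<Longrightarrow> e \<in> fibre E (projection E e)"
  unfolding fibre_def by simp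

text \<open>For fixed w this is the local section with constant components w; basis vectors w give
  the local frame on which \<open>dual_components\<close> evaluates a covector.\<close>

definition frame :: "('e \<Rightarrow> 'f) \<Rightarrow> 'a \<Rightarrow> 'f \<Rightarrow> 'e"
  where "frame \<Psi> x w = the_inv_into (fibre E x) \<Psi> w"

context
  fixes V \<Psi> assumes triv: "local_trivialization E V \<Psi>"
begin

section \<open>Local trivializations and local frames\<close>

lemma triv_open: "open_in_atlas M V"
  using triv openin_manifold_topology[OF base_atlas] unfolding local_trivialization_def by blast

lemma triv_subset: "V \<subseteq> points M"
  by (rule open_in_atlasD(2)[OF triv_open])

lemma triv_diffeo:
  "diffeomorphism (restrict_atlas tot (projection E -` V)) (prod_atlas (restrict_atlas M V) vector_space_atlas)
    (\<lambda>e. (projection E e, \<Psi> e))"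
  using triv unfolding local_trivialization_def by blast

lemma triv_bij: "bij_betw (\<lambda>e. (projection E e, \<Psi> e)) (points tot \<inter> projection E -` V) (V \<times> UNIV)"
proof -
  have *: "points (restrict_atlas tot (projection E -` V)) = points tot \<inter> projection E -` V"
    "points (prod_atlas (restrict_atlas M V) (vector_space_atlas :: ('f, 'f) atlas)) = V \<times> UNIV"
    using triv_subset by (auto simp: points_restrict_atlas points_prod_atlas points_vector_space_atlas)
  show ?thesis using conjunct1[OF triv_diffeo[unfolded diffeomorphism_def]] unfolding * .
qed

lemma triv_add: "x \<in> V \<Longrightarrow> u \<in> fibre E x \<Longrightarrow> v \<in> fibre E x \<Longrightarrow> \<Psi> (vadd E u v) = \<Psi> u + \<Psi> v"
  and triv_scale: "x \<in> V \<Longrightarrow> u \<in> fibre E x \<Longrightarrow> \<Psi> (vscale E c u) = c *\<^sub>R \<Psi> u"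
  using triv unfolding local_trivialization_def by blast+

lemma triv_fibre_bij: "x \<in> V \<Longrightarrow> bij_betw \<Psi> (fibre E x) UNIV"
proof -
  assume x: "x \<in> V"
  let ?f = "\<lambda>e. (projection E e, \<Psi> e)"
  have inj: "inj_on ?f (points tot \<inter> projection E -` V)" and
    im: "?f ` (points tot \<inter> projection E -` V) = V \<times> UNIV"
    using triv_bij unfolding bij_betw_def by blast+
  have "inj_on \<Psi> (fibre E x)"
  proof (rule inj_onI)
    fix u v assume uv: "u \<in> fibre E x" "v \<in> fibre E x" "\<Psi> u = \<Psi> v"
    show "u = v" by (rule inj_onD[OF inj]) (use uv x in \<open>auto simp: fibre_def\<close>)
  qed
  moreover have "w \<in> \<Psi> ` fibre E x" for w
  proof -
    have "(x, w) \<in> ?f ` (points tot \<inter> projection E -` V)" using im x by simp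
    then show ?thesis by (auto simp: fibre_def)
  qed
  ultimately show ?thesis unfolding bij_betw_def by blast
qed

lemma frame_in: "x \<in> V \<Longrightarrow> frame \<Psi> x w \<in> fibre E x"
  and triv_frame: "x \<in> V \<Longrightarrow> \<Psi> (frame \<Psi> x w) = w"
  and frame_triv: "x \<in> V \<Longrightarrow> e \<in> fibre E x \<Longrightarrow> frame \<Psi> x (\<Psi> e) = e"
proof -
  assume x: "x \<in> V"
  note b = triv_fibre_bij[OF x]
  have inj: "inj_on \<Psi> (fibre E x)" and w: "w \<in> \<Psi> ` fibre E x"
    using b unfolding bij_betw_def by auto
  show "frame \<Psi> x w \<in> fibre E x" unfolding frame_def by (rule the_inv_into_into[OF inj w subset_refl])
  show "\<Psi> (frame \<Psi> x w) = w" unfolding frame_def by (rule f_the_inv_into_f[OF inj w])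
  show "frame \<Psi> x (\<Psi> e) = e" if "e \<in> fibre E x" unfolding frame_def by (rule the_inv_into_f_f[OF inj that])
qed

lemma triv_zero: "x \<in> V \<Longrightarrow> \<Psi> (vzero E x) = 0"
proof -
  assume x: "x \<in> V"
  then have xM: "x \<in> points M" using triv_subset by blast
  have "vadd E (vzero E x) (vzero E x) = vzero E x"
    using fibre_vector_space[OF xM] unfolding real_vector_space_on_def by blast
  then have "\<Psi> (vzero E x) = \<Psi> (vzero E x) + \<Psi> (vzero E x)"
    using triv_add[OF x vzero_in[OF xM] vzero_in[OF xM]] by simp
  then show ?thesis by simp
qed

lemma triv_inj: "x \<in> V \<Longrightarrow> u \<in> fibre E x \<Longrightarrow> v \<in> fibre E x \<Longrightarrow> \<Psi> u = \<Psi> v \<Longrightarrow> u = v"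
  using frame_triv by metis

lemma triv_smooth:
  "open_in_atlas tot (points tot \<inter> projection E -` V)" "smooth_in tot (points tot \<inter> projection E -` V) \<Psi>"
proof -
  note pb = smooth_map_pullback(1)[OF total_atlas base_atlas smooth_projection]
  show "open_in_atlas tot (points tot \<inter> projection E -` V)" by (rule pb[OF triv_open])
  show "smooth_in tot (points tot \<inter> projection E -` V) \<Psi>"
  proof (rule smooth_in_local)
    fix e assume e: "e \<in> points tot \<inter> projection E -` V"
    then obtain W \<kappa> where c: "(W, \<kappa>) \<in> tot" "e \<in> W" by (auto simp: points_def)
    have "projection E e \<in> points M" using e triv_subset by blast
    then obtain U \<phi> where d: "(U, \<phi>) \<in> M" "projection E e \<in> U" by (rule pointsE)
    let ?f = "\<lambda>e. (projection E e, \<Psi> e)"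
    let ?S = "W \<inter> projection E -` (U \<inter> V)"
    have WT: "W \<subseteq> points tot" by (rule chart_subset_points[OF c(1)])
    have "open_in_atlas tot (W \<inter> (points tot \<inter> projection E -` (U \<inter> V)))"
      by (intro open_in_atlas_Int[OF total_atlas] open_in_atlas_chart[OF total_atlas c(1)] pb
          open_in_atlas_Int[OF base_atlas] open_in_atlas_chart[OF base_atlas d(1)] triv_open)
    moreover have "W \<inter> (points tot \<inter> projection E -` (U \<inter> V)) = ?S" using WT by blast
    ultimately have So: "open_in_atlas tot ?S" by simp
    have oS: "open (\<kappa> ` ?S)" using open_in_atlasD(1)[OF So c(1)] by (simp add: Int_absorb1 Int_assoc[symmetric])
    have ch: "(W \<inter> projection E -` V, \<kappa>) \<in> restrict_atlas tot (projection E -` V)"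
      "((U \<inter> V) \<times> UNIV, map_prod \<phi> id) \<in> prod_atlas (restrict_atlas M V) vector_space_atlas"
      by (rule restrict_atlasI[OF c(1)], rule prod_atlasI[OF restrict_atlasI[OF d(1)] vector_space_atlasI])
    have seteq: "W \<inter> projection E -` V \<inter> ?f -` ((U \<inter> V) \<times> UNIV) = ?S" by auto
    have "smooth_on (\<kappa> ` ?S) (\<lambda>y. map_prod \<phi> id (?f (the_inv_into (W \<inter> projection E -` V) \<kappa> y)))"
      using smooth_mapD(2)[OF conjunct1[OF conjunct2[OF triv_diffeo[unfolded diffeomorphism_def]]] ch] unfolding seteq .
    then have "smooth_on (\<kappa> ` ?S) (\<lambda>y. snd (map_prod \<phi> id (?f (the_inv_into (W \<inter> projection E -` V) \<kappa> y))))"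
      by (rule smooth_on_bounded_linear[OF oS bounded_linear_snd])
    then have "smooth_on (\<kappa> ` ?S) (\<lambda>y. \<Psi> (the_inv_into W \<kappa> y))"
    proof (rule smooth_on_cong_imp[OF oS])
      fix y assume "y \<in> \<kappa> ` ?S"
      then obtain z where z: "z \<in> ?S" "y = \<kappa> z" by blast
      have i: "inj_on \<kappa> W" by (rule smooth_atlasD(1)[OF total_atlas c(1)])
      \<comment> \<open>The diffeomorphism is stated for restricted charts, whose inverses are taken
        on smaller domains; on these domains they agree with the inverses of the original
        charts.\<close>
      have "the_inv_into (W \<inter> projection E -` V) \<kappa> (\<kappa> z) = z"
        by (rule the_inv_into_f_f) (use i z inj_on_subset[OF i] in auto)
      moreover have "the_inv_into W \<kappa> (\<kappa> z) = z" by (rule the_inv_into_f_f) (use i z in auto)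
      ultimately show "snd (map_prod \<phi> id (?f (the_inv_into (W \<inter> projection E -` V) \<kappa> y))) = \<Psi> (the_inv_into W \<kappa> y)"
        using z by simp
    qed
    then have "smooth_in tot ?S \<Psi>"
      by (intro smooth_in_chartI[OF total_atlas c(1) _ So]) auto
    then show "\<exists>T. open_in_atlas tot T \<and> e \<in> T \<and> smooth_in tot T \<Psi>" using So e c d by blast
  qed
qed

text \<open>Passes from smooth components to smoothness in the charts of the total space, by
  composing with the inverse of the trivialization.\<close>

lemma section_chart_smooth:
  assumes N: "open_in_atlas M N" "N \<subseteq> V" and s: "\<And>z. z \<in> N \<Longrightarrow> s z \<in> fibre E z"
    and sm: "smooth_in M N (\<lambda>z. \<Psi> (s z))" and x: "x \<in> N" and c: "(W, \<kappa>) \<in> tot" "s x \<in> W"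
  shows "\<exists>T. open_in_atlas M T \<and> x \<in> T \<and> T \<subseteq> s -` W \<and> smooth_in M T (\<lambda>x. \<kappa> (s x))"
proof -
  let ?f = "\<lambda>e. (projection E e, \<Psi> e)"
  let ?G = "the_inv_into (points (restrict_atlas tot (projection E -` V))) ?f"
  have "x \<in> points M" using x open_in_atlasD(2)[OF N(1)] by blast
  then obtain U \<phi> where d: "(U, \<phi>) \<in> M" "x \<in> U" by (rule pointsE)
  have ch: "(W \<inter> projection E -` V, \<kappa>) \<in> restrict_atlas tot (projection E -` V)"
    "((U \<inter> V) \<times> UNIV, map_prod \<phi> id) \<in> prod_atlas (restrict_atlas M V) vector_space_atlas"
    by (rule restrict_atlasI[OF c(1)], rule prod_atlasI[OF restrict_atlasI[OF d(1)] vector_space_atlasI])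
  \<comment> \<open>Q is the open set of coordinates of those points that the inverse trivialization
    sends into W, and k is the inverse trivialization read in coordinates there.\<close>
  define Q where "Q = map_prod \<phi> id ` (((U \<inter> V) \<times> UNIV) \<inter> ?G -` (W \<inter> projection E -` V))"
  define k where "k y = \<kappa> (?G (the_inv_into ((U \<inter> V) \<times> UNIV) (map_prod \<phi> id) y))" for y
  have "smooth_map (prod_atlas (restrict_atlas M V) vector_space_atlas) (restrict_atlas tot (projection E -` V)) ?G"
    using triv_diffeo unfolding diffeomorphism_def by blast
  then have Q: "open Q" "smooth_on Q k"
    unfolding Q_def k_def by (rule smooth_mapD[OF _ ch(2,1)])+
  have G: "?G (z, \<Psi> (s z)) = s z" if z: "z \<in> N" for z
  proof -
    have "?G (?f (s z)) = s z"
      by (rule the_inv_into_f_f)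
        (use triv_bij fibreD[OF s[OF z]] z N(2) in \<open>auto simp: bij_betw_def points_restrict_atlas\<close>)
    then show ?thesis using fibreD[OF s[OF z]] by simp
  qed
  have inj: "inj_on \<phi> U" by (rule smooth_atlasD(1)[OF base_atlas d(1)])
  have injp: "inj_on (map_prod \<phi> id) ((U \<inter> V) \<times> (UNIV :: 'f set))"
    using inj by (auto simp: inj_on_def)
  define h where "h z = (\<phi> z, \<Psi> (s z))" for z
  have o: "open_in_atlas M (N \<inter> U)" by (rule open_in_atlas_Int[OF base_atlas N(1) open_in_atlas_chart[OF base_atlas d(1)]])
  have h: "smooth_in M (N \<inter> U) h"
    unfolding h_def
    by (rule smooth_in_Pair[OF o smooth_in_subset[OF smooth_in_chart[OF base_atlas d(1)]] smooth_in_subset[OF sm]]) auto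
  define T where "T = N \<inter> U \<inter> h -` Q"
  have oT: "open_in_atlas M T"
    unfolding T_def by (rule open_in_atlas_smooth_preimage[OF base_atlas o h Q(1)])
  have kh: "s z \<in> W \<and> \<kappa> (s z) = k (h z)" if z: "z \<in> T" for z
  proof -
    have zz: "z \<in> N" "z \<in> U" "z \<in> V" "h z \<in> Q" using z N(2) by (auto simp: T_def)
    have "\<exists>a\<in>((U \<inter> V) \<times> UNIV) \<inter> ?G -` (W \<inter> projection E -` V). h z = map_prod \<phi> id a"
      using zz(4) unfolding Q_def image_iff .
    then obtain a where a: "a \<in> ((U \<inter> V) \<times> UNIV) \<inter> ?G -` (W \<inter> projection E -` V)" "h z = map_prod \<phi> id a"
      by (rule bexE)
    have a1: "fst a \<in> U" "?G a \<in> W" using a(1) by (simp_all add: mem_Times_iff)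
    have a2: "\<phi> (fst a) = \<phi> z" "snd a = \<Psi> (s z)" using a(2) by (cases a; simp add: h_def)+
    have "fst a = z" by (rule inj_onD[OF inj a2(1) a1(1) zz(2)])
    then have "a = (z, \<Psi> (s z))" using a2(2) by (simp add: prod_eq_iff)
    then have "s z \<in> W" using a1(2) by (simp only: G[OF zz(1)])
    moreover have "the_inv_into ((U \<inter> V) \<times> UNIV) (map_prod \<phi> id) (map_prod \<phi> id (z, \<Psi> (s z))) = (z, \<Psi> (s z))"
      by (rule the_inv_into_f_f[OF injp]) (use zz in auto)
    then have "\<kappa> (s z) = k (h z)" using G[OF zz(1)] by (simp add: k_def h_def)
    ultimately show ?thesis by blast
  qed
  have "x \<in> T"
  proof -
    have "projection E (s x) = x" by (rule fibreD(2)[OF s[OF x]])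
    then have "(x, \<Psi> (s x)) \<in> ((U \<inter> V) \<times> UNIV) \<inter> ?G -` (W \<inter> projection E -` V)"
      using G[OF x] x N(2) d(2) c(2) by auto
    then have "map_prod \<phi> id (x, \<Psi> (s x)) \<in> Q" unfolding Q_def by (rule imageI)
    then show ?thesis using x d(2) by (simp add: T_def h_def)
  qed
  moreover have "smooth_in M T (\<lambda>z. \<kappa> (s z))"
  proof (rule smooth_in_cong[OF base_atlas oT])
    show "smooth_in M T (\<lambda>z. k (h z))"
      by (rule smooth_in_compose[OF base_atlas oT smooth_in_subset[OF h] _ Q(2)]) (auto simp: T_def)
  qed (simp add: kh)
  ultimately show ?thesis using oT kh by (intro exI[of _ T] conjI) auto
qed

end

lemma trivE:
  assumes "x \<in> points M" obtains V \<Psi> where "local_trivialization E V \<Psi>" "x \<in> V"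
  using conjunct2[OF conjunct2[OF conjunct2[OF conjunct2[OF vector_bundle[unfolded vector_bundle_def]]]]] assms
  by metis

text \<open>Read off in a trivialization, where these are laws of the vector space
  \<open>'f\<close>, rather than derived from the axioms of
  \<open>real_vector_space_on\<close>.\<close>

lemma fibre_unit_laws:
  assumes x: "x \<in> points M" and u: "u \<in> fibre E x" shows "vadd E u (vzero E x) = u" "vscale E 0 u = vzero E x" "vscale E 1 u = u"
proof -
  obtain V \<Psi> where t: "local_trivialization E V \<Psi>" "x \<in> V" using x by (rule trivE)
  show "vadd E u (vzero E x) = u" "vscale E 0 u = vzero E x" "vscale E 1 u = u"
    by (rule triv_inj[OF t]; simp add: x u triv_add[OF t] triv_zero[OF t] triv_scale[OF t])+
qed

lemma section_in_fibre: "s \<in> sections E \<Longrightarrow> x \<in> points M \<Longrightarrow> s x \<in> fibre E x"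
  unfolding sections_def fibre_def using smooth_map_points by auto

lemma section_smooth:
  assumes t: "local_trivialization E V \<Psi>" and s: "s \<in> sections E"
  shows "smooth_in M V (\<lambda>x. \<Psi> (s x))"
proof -
  have "smooth_map M tot s" using s unfolding sections_def by blast
  then have "smooth_in M (points M \<inter> s -` (points tot \<inter> projection E -` V)) (\<lambda>x. \<Psi> (s x))"
    by (rule smooth_map_pullback(2)[OF base_atlas total_atlas _ triv_smooth[OF t]])
  then show ?thesis
    by (rule smooth_in_subset)
      (use triv_subset[OF t] fibreD[OF section_in_fibre[OF s]] in auto)
qed

text \<open>The trivialization may change from point to point, and only an open part N of its domain
  is inspected. Both freedoms serve sections that are extended by zero.\<close>

lemma sectionsI:
  assumes ext: "s \<in> extensional (points M)" and fib: "\<And>x. x \<in> points M \<Longrightarrow> s x \<in> fibre E x"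
    and loc: "\<And>x. x \<in> points M \<Longrightarrow> \<exists>V \<Psi> N. local_trivialization E V \<Psi> \<and> open_in_atlas M N \<and> x \<in> N \<and> N \<subseteq> V \<and>
      smooth_in M N (\<lambda>x. \<Psi> (s x))"
  shows "s \<in> sections E"
proof -
  have "smooth_map M tot s"
  proof (rule smooth_mapI[OF base_atlas])
    show "s x \<in> points tot" if "x \<in> points M" for x using fibreD(1)[OF fib[OF that]] .
    fix x W \<kappa> assume x: "x \<in> points M" and c: "(W, \<kappa>) \<in> tot" "s x \<in> W"
    obtain V \<Psi> N where l: "local_trivialization E V \<Psi>" "open_in_atlas M N" "x \<in> N" "N \<subseteq> V"
      "smooth_in M N (\<lambda>x. \<Psi> (s x))" using loc[OF x] by blast
    show "\<exists>T. open_in_atlas M T \<and> x \<in> T \<and> T \<subseteq> s -` W \<and> smooth_in M T (\<lambda>x. \<kappa> (s x))"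
      by (rule section_chart_smooth[OF l(1,2,4) fib l(5,3) c]) (use open_in_atlasD(2)[OF l(2)] in blast)
  qed
  then show ?thesis unfolding sections_def using ext fibreD(2)[OF fib] by blast
qed

lemma sections_eqI:
  assumes "s \<in> sections E" "t \<in> sections E" "\<And>x. x \<in> points M \<Longrightarrow> s x = t x"
  shows "s = t"
  by (rule extensionalityI[of _ "points M"]) (use assms in \<open>simp_all add: sections_def\<close>)

lemma sec_apply [simp]:
  "x \<in> points M \<Longrightarrow> sec_add E s t x = vadd E (s x) (t x)"
  "x \<in> points M \<Longrightarrow> sec_scale E c s x = vscale E c (s x)"
  "x \<in> points M \<Longrightarrow> sec_zero E x = vzero E x"
  "x \<in> points M \<Longrightarrow> sec_mult E f s x = vscale E (f x) (s x)"
  by (simp_all add: sec_add_def sec_scale_def sec_zero_def sec_mult_def)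

section \<open>The module of sections\<close>

lemma sec_add_in: assumes "s \<in> sections E" "t \<in> sections E" shows "sec_add E s t \<in> sections E"
proof (rule sectionsI)
  fix x assume x: "x \<in> points M"
  show "sec_add E s t x \<in> fibre E x" using x section_in_fibre assms by simp
  obtain V \<Psi> where tr: "local_trivialization E V \<Psi>" "x \<in> V" using x by (rule trivE)
  have "smooth_in M V (\<lambda>x. \<Psi> (sec_add E s t x))"
    by (rule smooth_in_cong[OF base_atlas triv_open[OF tr(1)] smooth_in_add[OF triv_open[OF tr(1)]
            section_smooth[OF tr(1) assms(1)] section_smooth[OF tr(1) assms(2)]]])
      (use triv_subset[OF tr(1)] section_in_fibre assms in \<open>auto simp: triv_add[OF tr(1)]\<close>)
  then show "\<exists>V \<Psi> N. local_trivialization E V \<Psi> \<and> open_in_atlas M N \<and> x \<in> N \<and> N \<subseteq> V \<and>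
      smooth_in M N (\<lambda>x. \<Psi> (sec_add E s t x))" using tr triv_open[OF tr(1)] by blast
qed (simp add: sec_add_def)

lemma sec_mult_in: assumes f: "f \<in> smooth_functions M" and s: "s \<in> sections E" shows "sec_mult E f s \<in> sections E"
proof (rule sectionsI)
  fix x assume x: "x \<in> points M"
  show "sec_mult E f s x \<in> fibre E x" using x section_in_fibre s by simp
  obtain V \<Psi> where tr: "local_trivialization E V \<Psi>" "x \<in> V" using x by (rule trivE)
  have "smooth_in M V (\<lambda>x. \<Psi> (sec_mult E f s x))"
    by (rule smooth_in_cong[OF base_atlas triv_open[OF tr(1)] smooth_in_scaleR[OF triv_open[OF tr(1)]
            smooth_functionsD(2)[OF base_atlas f triv_subset[OF tr(1)]] section_smooth[OF tr(1) s]]])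
      (use triv_subset[OF tr(1)] section_in_fibre s in \<open>auto simp: triv_scale[OF tr(1)]\<close>)
  then show "\<exists>V \<Psi> N. local_trivialization E V \<Psi> \<and> open_in_atlas M N \<and> x \<in> N \<and> N \<subseteq> V \<and>
      smooth_in M N (\<lambda>x. \<Psi> (sec_mult E f s x))" using tr triv_open[OF tr(1)] by blast
qed (simp add: sec_mult_def)

lemma sec_scale_eq_mult: "sec_scale E c s = sec_mult E (\<lambda>x\<in>points M. c) s"
  by (simp add: sec_scale_def sec_mult_def restrict_def fun_eq_iff)

lemma sec_scale_in: "s \<in> sections E \<Longrightarrow> sec_scale E c s \<in> sections E"
  unfolding sec_scale_eq_mult by (intro sec_mult_in base.smooth_fun_const)

definition local_section :: "'a set \<Rightarrow> ('e \<Rightarrow> 'f) \<Rightarrow> ('a \<Rightarrow> 'f) \<Rightarrow> 'a \<Rightarrow> 'e"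
  where "local_section V \<Psi> u = (\<lambda>x\<in>points M. if x \<in> V then frame \<Psi> x (u x) else vzero E x)"

text \<open>Vanishing near each point off V, and not merely at it, makes the extension by the zero
  section smooth.\<close>

definition supported_in :: "'a set \<Rightarrow> ('a \<Rightarrow> 'f) \<Rightarrow> bool"
  where "supported_in V u \<longleftrightarrow> smooth_in M (points M) u \<and>
    (\<forall>x\<in>points M - V. \<exists>T. open_in_atlas M T \<and> x \<in> T \<and> (\<forall>z\<in>T. u z = 0))"

lemma supported_in_cutoff:
  assumes \<beta>: "cutoff M W N \<beta>" and "W \<subseteq> V" and u: "smooth_in M W u"
  shows "supported_in V (\<lambda>x. if x \<in> W then \<beta> x *\<^sub>R u x else 0)"
  unfolding supported_in_def
proof (intro conjI ballI)
  show "smooth_in M (points M) (\<lambda>x. if x \<in> W then \<beta> x *\<^sub>R u x else 0)"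
    by (rule smooth_in_cutoff[OF base_atlas \<beta> u])
  fix x assume "x \<in> points M - V"
  then obtain T where "open_in_atlas M T" "x \<in> T" "\<forall>z\<in>T. \<beta> z = 0"
    using cutoffD(6)[OF \<beta>, of x] assms(2) by blast
  then show "\<exists>T. open_in_atlas M T \<and> x \<in> T \<and> (\<forall>z\<in>T. (if z \<in> W then \<beta> z *\<^sub>R u z else 0) = 0)" by auto
qed

lemma local_section_apply: "local_trivialization E V \<Psi> \<Longrightarrow> x \<in> V \<Longrightarrow> local_section V \<Psi> u x = frame \<Psi> x (u x)"
  using triv_subset by (auto simp: local_section_def)

lemma local_section_in:
  assumes t: "local_trivialization E V \<Psi>" and u: "supported_in V u"
  shows "local_section V \<Psi> u \<in> sections E"
proof (rule sectionsI)
  fix x assume x: "x \<in> points M"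
  show "local_section V \<Psi> u x \<in> fibre E x" using x frame_in[OF t] by (simp add: local_section_def)
  show "\<exists>V' \<Psi>' N. local_trivialization E V' \<Psi>' \<and> open_in_atlas M N \<and> x \<in> N \<and> N \<subseteq> V' \<and>
      smooth_in M N (\<lambda>x. \<Psi>' (local_section V \<Psi> u x))"
  proof (cases "x \<in> V")
    case True
    have "smooth_in M V (\<lambda>x. \<Psi> (local_section V \<Psi> u x))"
      by (rule smooth_in_cong[OF base_atlas triv_open[OF t] smooth_in_subset[OF _ triv_subset[OF t]]])
        (use u in \<open>auto simp: supported_in_def local_section_apply[OF t] triv_frame[OF t]\<close>)
    then show ?thesis using True t triv_open[OF t] by blast
  next
    case False
    then obtain T where T: "open_in_atlas M T" "x \<in> T" "\<And>z. z \<in> T \<Longrightarrow> u z = 0"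
      using u x unfolding supported_in_def by blast
    obtain V' \<Psi>' where t': "local_trivialization E V' \<Psi>'" "x \<in> V'" using x by (rule trivE)
    have o: "open_in_atlas M (T \<inter> V')" by (rule open_in_atlas_Int[OF base_atlas T(1) triv_open[OF t'(1)]])
    have z: "local_section V \<Psi> u z = vzero E z" if "z \<in> T" "z \<in> points M" for z
      using that T(3) frame_triv[OF t _ vzero_in] triv_zero[OF t] by (auto simp: local_section_def)
    have "smooth_in M (T \<inter> V') (\<lambda>x. \<Psi>' (local_section V \<Psi> u x))"
      by (rule smooth_in_cong[OF base_atlas o smooth_in_const[of _ _ 0]])
        (use z triv_zero[OF t'(1)] triv_subset[OF t'(1)] in auto)
    then show ?thesis using t' o T(2) by blast
  qed
qed (simp add: local_section_def)

text \<open>One neighbourhood N and one cutoff function serve all vectors w. The set W may be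
  smaller than V, so that it also fits into a chart domain of the base.\<close>

lemma local_section_frame_exists:
  assumes t: "local_trivialization E V \<Psi>" and W: "open_in_atlas M W" "W \<subseteq> V" and x: "x \<in> W"
  shows "\<exists>N \<beta>. x \<in> N \<and> cutoff M W N \<beta> \<and>
    (\<forall>w. local_section V \<Psi> (\<lambda>x. if x \<in> W then \<beta> x *\<^sub>R w else 0) \<in> sections E) \<and>
    (\<forall>z\<in>N. \<forall>w. local_section V \<Psi> (\<lambda>x. if x \<in> W then \<beta> x *\<^sub>R w else 0) z = frame \<Psi> z w)"
proof -
  obtain N \<beta> where N: "x \<in> N" "cutoff M W N \<beta>"
    using cutoff_exists[OF base_atlas base_hausdorff W(1) x] by blast
  have "local_section V \<Psi> (\<lambda>x. if x \<in> W then \<beta> x *\<^sub>R w else 0) z = frame \<Psi> z w" if z: "z \<in> N" for z w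
  proof -
    have "z \<in> W" "z \<in> V" using z cutoffD(4)[OF N(2)] W(2) by blast+
    then show ?thesis using cutoffD(5)[OF N(2) z] by (simp add: local_section_apply[OF t])
  qed
  then show ?thesis
    using N local_section_in[OF t supported_in_cutoff[OF N(2) W(2) smooth_in_const]]
    by (intro exI[of _ N] exI[of _ \<beta>]) simp
qed

text \<open>Statements about single vectors of a fibre thereby become statements about
  sections.\<close>

lemma section_through:
  assumes e: "e \<in> fibre E x" and x: "x \<in> points M"
  shows "\<exists>s\<in>sections E. s x = e"
proof -
  obtain V \<Psi> where t: "local_trivialization E V \<Psi>" "x \<in> V" using x by (rule trivE)
  obtain N \<beta> where "x \<in> N" and s: "\<forall>w. local_section V \<Psi> (\<lambda>x. if x \<in> V then \<beta> x *\<^sub>R w else 0) \<in> sections E"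
    "\<forall>z\<in>N. \<forall>w. local_section V \<Psi> (\<lambda>x. if x \<in> V then \<beta> x *\<^sub>R w else 0) z = frame \<Psi> z w"
    using local_section_frame_exists[OF t(1) triv_open[OF t(1)] subset_refl t(2)] by blast
  then have "local_section V \<Psi> (\<lambda>x. if x \<in> V then \<beta> x *\<^sub>R \<Psi> e else 0) x = e"
    using frame_triv[OF t e] by simp
  then show ?thesis using s(1) by blast
qed

text \<open>These are the transition functions of the bundle. They are smooth because the second
  frame is locally the restriction of global sections, whose components in the first trivialization
  are smooth.\<close>

lemma frame_smooth:
  assumes t: "local_trivialization E V \<Psi>" and t': "local_trivialization E V' \<Psi>'"
  shows "smooth_in M (V \<inter> V') (\<lambda>x. \<Psi> (frame \<Psi>' x w))"
proof (rule smooth_in_local)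
  fix x assume x: "x \<in> V \<inter> V'"
  obtain N \<beta> where N: "x \<in> N" "cutoff M V' N \<beta>"
    and s: "local_section V' \<Psi>' (\<lambda>x. if x \<in> V' then \<beta> x *\<^sub>R w else 0) \<in> sections E"
    "\<And>z. z \<in> N \<Longrightarrow> local_section V' \<Psi>' (\<lambda>x. if x \<in> V' then \<beta> x *\<^sub>R w else 0) z = frame \<Psi>' z w"
    using local_section_frame_exists[OF t' triv_open[OF t'] subset_refl, of x] x by blast
  have o: "open_in_atlas M (V \<inter> N)" by (rule open_in_atlas_Int[OF base_atlas triv_open[OF t] cutoffD(3)[OF N(2)]])
  have "smooth_in M (V \<inter> N) (\<lambda>x. \<Psi> (frame \<Psi>' x w))"
    by (rule smooth_in_cong[OF base_atlas o smooth_in_subset[OF section_smooth[OF t s(1)]]]) (use s(2) in auto)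
  then show "\<exists>T. open_in_atlas M T \<and> x \<in> T \<and> smooth_in M T (\<lambda>x. \<Psi> (frame \<Psi>' x w))" using o x N(1) by blast
qed

text \<open>The square of the cutoff function appears because both the coefficients of \<open>X\<close> and the frame
  have to be cut off to become global objects.\<close>

lemma frame_expansion:
  assumes t: "local_trivialization E V \<Psi>" and \<beta>: "cutoff M V N \<beta>" and X: "X \<in> sections E"
    and T: "\<And>X Y. X \<in> sections E \<Longrightarrow> Y \<in> sections E \<Longrightarrow> (T (sec_add E X Y) :: real) = T X + T Y"
  shows "T (sec_mult E \<beta> (sec_mult E \<beta> X)) = (\<Sum>b\<in>Basis. T (sec_mult E
    (\<lambda>x\<in>points M. if x \<in> V then \<beta> x *\<^sub>R (\<Psi> (X x) \<bullet> b) else 0)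
    (local_section V \<Psi> (\<lambda>x. if x \<in> V then \<beta> x *\<^sub>R b else 0))))"
proof -
  define c where "c b = (\<lambda>x\<in>points M. if x \<in> V then \<beta> x *\<^sub>R (\<Psi> (X x) \<bullet> b) else 0)" for b
  define e where "e b = local_section V \<Psi> (\<lambda>x. if x \<in> V then \<beta> x *\<^sub>R b else 0)" for b
  \<comment> \<open>The partial sums of the expansion are realised as sections, so that additivity
    of T on two sections is all the induction asks for. T may be a differential operator: the
    multipliers are not pulled out of it.\<close>
  define u where "u B = (\<lambda>x. if x \<in> V then \<beta> x *\<^sub>R (\<Sum>b\<in>B. (\<Psi> (X x) \<bullet> b) *\<^sub>R \<beta> x *\<^sub>R b) else 0)" for B
  note o = triv_open[OF t] and sub = triv_subset[OF t]
  note \<beta>s = smooth_functionsD(2)[OF base_atlas cutoffD(1)[OF \<beta>] sub]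
  have c: "c b \<in> smooth_functions M" for b
    unfolding c_def by (rule base.cutoff_function[OF \<beta>])
      (rule smooth_in_inner[OF o section_smooth[OF t X] smooth_in_const])
  have e: "e b \<in> sections E" for b
    unfolding e_def by (rule local_section_in[OF t supported_in_cutoff[OF \<beta> subset_refl smooth_in_const]])
  have ls: "local_section V \<Psi> (u B) \<in> sections E" for B
    unfolding u_def
    by (rule local_section_in[OF t supported_in_cutoff[OF \<beta> subset_refl]])
      (intro smooth_in_sum smooth_in_scaleR smooth_in_inner o section_smooth[OF t X] smooth_in_const \<beta>s)
  have V: "\<Psi> (local_section V \<Psi> (u B) x) = u B x" "\<Psi> (e b x) = \<beta> x *\<^sub>R b" if "x \<in> V" for B b x
    using that by (simp_all add: e_def local_section_apply[OF t] triv_frame[OF t])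
  have nV: "local_section V \<Psi> (u B) x = vzero E x" "c b x = 0" if "x \<notin> V" "x \<in> points M" for B b x
    using that by (simp_all add: local_section_def c_def)
  have ind: "T (local_section V \<Psi> (u B)) = (\<Sum>b\<in>B. T (sec_mult E (c b) (e b)))" if "finite B" for B
    using that
  proof induction
    case empty
    let ?z = "local_section V \<Psi> (u {})"
    \<comment> \<open>The zero section is its own double, so additivity alone forces T to vanish on
      it.\<close>
    have "sec_add E ?z ?z = ?z"
    proof (rule sections_eqI[OF sec_add_in[OF ls ls] ls])
      fix x assume x: "x \<in> points M"
      have "?z x = vzero E x"
        using x frame_triv[OF t _ vzero_in[OF x]] triv_zero[OF t] by (simp add: local_section_def u_def)
      then show "sec_add E ?z ?z x = ?z x" using x fibre_unit_laws(1)[OF x vzero_in[OF x]] by simp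
    qed
    then have "T ?z = T ?z + T ?z" using T[OF ls[of "{}"] ls[of "{}"]] by simp
    then show ?case by simp
  next
    case (insert b B)
    have "local_section V \<Psi> (u (insert b B)) = sec_add E (sec_mult E (c b) (e b)) (local_section V \<Psi> (u B))"
    proof (rule sections_eqI[OF ls sec_add_in[OF sec_mult_in[OF c e] ls]])
      fix x assume x: "x \<in> points M"
      note f = section_in_fibre[OF e x] section_in_fibre[OF ls x]
      show "local_section V \<Psi> (u (insert b B)) x = sec_add E (sec_mult E (c b) (e b)) (local_section V \<Psi> (u B)) x"
      proof (cases "x \<in> V")
        case True
        have cb: "c b x = \<beta> x * (\<Psi> (X x) \<bullet> b)" using x True by (simp add: c_def)
        show ?thesis
          by (rule triv_inj[OF t True f(2)])
            (simp_all add: x f V[OF True] triv_add[OF t True] triv_scale[OF t True] cb,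
              simp add: u_def True insert.hyps scaleR_add_right)
      next
        case False
        then show ?thesis
          using x nV[OF False x] fibre_unit_laws[OF x] f by simp
      qed
    qed
    then show ?case using T[OF sec_mult_in[OF c e] ls] insert by simp
  qed
  have "local_section V \<Psi> (u Basis) = sec_mult E \<beta> (sec_mult E \<beta> X)"
  proof (rule sections_eqI[OF ls])
    show "sec_mult E \<beta> (sec_mult E \<beta> X) \<in> sections E" by (intro sec_mult_in cutoffD(1)[OF \<beta>] X)
    fix x assume x: "x \<in> points M"
    note f = section_in_fibre[OF X x]
    show "local_section V \<Psi> (u Basis) x = sec_mult E \<beta> (sec_mult E \<beta> X) x"
    proof (cases "x \<in> V")
      case True
      have "u Basis x = \<beta> x *\<^sub>R \<beta> x *\<^sub>R (\<Sum>b\<in>Basis. (\<Psi> (X x) \<bullet> b) *\<^sub>R b)"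
        using True by (simp add: u_def scaleR_sum_right mult_ac)
      then have "u Basis x = \<beta> x *\<^sub>R \<beta> x *\<^sub>R \<Psi> (X x)" by (simp only: euclidean_representation)
      then show ?thesis
        by (intro triv_inj[OF t True section_in_fibre[OF ls x]])
          (simp_all add: x f V[OF True] triv_scale[OF t True])
    next
      case False
      have "\<beta> x = 0" using cutoffD(6)[OF \<beta> x False] by blast
      then show ?thesis using x nV[OF False x] fibre_unit_laws(2)[OF x] f by simp
    qed
  qed
  then show ?thesis using ind[OF finite_Basis] unfolding c_def e_def by simp
qed

end

section \<open>The dual bundle as a manifold\<close>

lemma smooth_on_fst_compose:
  fixes g :: "'m::finite_dim_inner \<Rightarrow> 'b::real_normed_vector"
  assumes "open S" "smooth_on S g"
  shows "smooth_on (S \<times> (UNIV :: 'n::real_normed_vector set)) (\<lambda>p. g (fst p))"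
  by (rule smooth_on_compose[OF open_Times[OF assms(1) open_UNIV] _ smooth_on_linear[OF open_Times[OF assms(1) open_UNIV] bounded_linear_fst] assms(2)])
    auto

context smooth_bundle
begin

abbreviation "dual \<equiv> dual_atlas E"

lemma dual_bundle_simps [simp]:
  "total_space (dual_bundle E) = dual" "projection (dual_bundle E) = fst"
  by (simp_all add: dual_bundle_def)

section \<open>Covectors in a local trivialization\<close>

lemma dual_spaceD:
  assumes "\<xi> \<in> dual_space E x"
  shows "\<xi> \<in> extensional (fibre E x)"
    "u \<in> fibre E x \<Longrightarrow> v \<in> fibre E x \<Longrightarrow> \<xi> (vadd E u v) = \<xi> u + \<xi> v"
    "u \<in> fibre E x \<Longrightarrow> \<xi> (vscale E c u) = c * \<xi> u"
  using assms by (simp_all add: dual_space_def)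

lemma dual_spaceI:
  assumes "\<xi> \<in> extensional (fibre E x)"
    and "\<And>u v. u \<in> fibre E x \<Longrightarrow> v \<in> fibre E x \<Longrightarrow> \<xi> (vadd E u v) = \<xi> u + \<xi> v"
    and "\<And>c u. u \<in> fibre E x \<Longrightarrow> \<xi> (vscale E c u) = c * \<xi> u"
  shows "\<xi> \<in> dual_space E x"
  using assms by (simp add: dual_space_def)

lemma dual_space_zero: "x \<in> points M \<Longrightarrow> \<xi> \<in> dual_space E x \<Longrightarrow> \<xi> (vzero E x) = 0"
  using dual_spaceD(3)[of \<xi> x "vzero E x" 0] fibre_unit_laws(2)[of x "vzero E x"] by simp

text \<open>Inverse to \<open>dual_components\<close>; the inner product of \<open>'f\<close>
  identifies the dual of the typical fibre with the fibre itself.\<close>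

definition coframe :: "('e \<Rightarrow> 'f) \<Rightarrow> 'a \<Rightarrow> 'f \<Rightarrow> 'e \<Rightarrow> real"
  where "coframe \<Psi> x \<eta> = (\<lambda>e\<in>fibre E x. \<Psi> e \<bullet> \<eta>)"

lemma coframe_apply [simp]: "e \<in> fibre E x \<Longrightarrow> coframe \<Psi> x \<eta> e = \<Psi> e \<bullet> \<eta>"
  by (simp add: coframe_def)

context
  fixes V \<Psi> assumes triv: "local_trivialization E V \<Psi>"
begin

text \<open>\<open>dual_components\<close> records the values of a covector on the frame only;
  linearity extends them to all of the fibre.\<close>

lemma dual_components_pairing:
  assumes x: "x \<in> V" and \<xi>: "\<xi> \<in> dual_space E x" and e: "e \<in> fibre E x"
  shows "\<xi> e = \<Psi> e \<bullet> dual_components E \<Psi> x \<xi>"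
proof -
  have xM: "x \<in> points M" using x triv_subset[OF triv] by blast
  define L where "L w = \<xi> (frame \<Psi> x w)" for w
  note fr = frame_in[OF triv x] triv_frame[OF triv x]
  have "linear L"
  proof (rule linearI)
    fix v w c
    have "frame \<Psi> x (v + w) = vadd E (frame \<Psi> x v) (frame \<Psi> x w)"
      by (rule triv_inj[OF triv x]) (simp_all add: fr xM triv_add[OF triv x])
    then show "L (v + w) = L v + L w" using dual_spaceD(2)[OF \<xi>] fr by (simp add: L_def)
    have "frame \<Psi> x (c *\<^sub>R w) = vscale E c (frame \<Psi> x w)"
      by (rule triv_inj[OF triv x]) (simp_all add: fr xM triv_scale[OF triv x])
    then show "L (c *\<^sub>R w) = c *\<^sub>R L w" using dual_spaceD(3)[OF \<xi>] fr by (simp add: L_def)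
  qed
  then have "L (\<Sum>b\<in>Basis. (\<Psi> e \<bullet> b) *\<^sub>R b) = (\<Sum>b\<in>Basis. (\<Psi> e \<bullet> b) * L b)"
    by (simp add: linear_sum linear_scale)
  then have "L (\<Psi> e) = (\<Sum>b\<in>Basis. (\<Psi> e \<bullet> b) * L b)" by (simp only: euclidean_representation)
  moreover have "L (\<Psi> e) = \<xi> e" using frame_triv[OF triv x e] by (simp add: L_def)
  moreover have "\<Psi> e \<bullet> dual_components E \<Psi> x \<xi> = (\<Sum>b\<in>Basis. (\<Psi> e \<bullet> b) * L b)"
    by (simp add: dual_components_def L_def frame_def inner_sum_right mult.commute)
  ultimately show ?thesis by simp
qed

lemma coframe_in: "x \<in> V \<Longrightarrow> coframe \<Psi> x \<eta> \<in> dual_space E x"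
  using triv_subset[OF triv]
  by (intro dual_spaceI) (auto simp: coframe_def triv_add[OF triv] triv_scale[OF triv] inner_add_left)

lemma dual_components_coframe:
  assumes x: "x \<in> V" shows "dual_components E \<Psi> x (coframe \<Psi> x \<eta>) = \<eta>"
proof -
  have "dual_components E \<Psi> x (coframe \<Psi> x \<eta>) = (\<Sum>b\<in>Basis. coframe \<Psi> x \<eta> (frame \<Psi> x b) *\<^sub>R b)"
    by (simp only: dual_components_def frame_def)
  also have "\<dots> = (\<Sum>b\<in>Basis. (\<eta> \<bullet> b) *\<^sub>R b)"
    by (rule sum.cong) (simp_all add: frame_in[OF triv x] triv_frame[OF triv x] inner_commute)
  finally show ?thesis by (simp only: euclidean_representation)
qed

lemma coframe_dual_components:
  assumes x: "x \<in> V" and \<xi>: "\<xi> \<in> dual_space E x" shows "coframe \<Psi> x (dual_components E \<Psi> x \<xi>) = \<xi>"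
  by (rule extensionalityI[of _ "fibre E x"])
    (simp_all add: dual_spaceD(1)[OF \<xi>] dual_components_pairing[OF x \<xi>], simp add: coframe_def)

end

definition dual_chart :: "('a \<Rightarrow> 'm) \<Rightarrow> ('e \<Rightarrow> 'f) \<Rightarrow> 'a \<times> ('e \<Rightarrow> real) \<Rightarrow> 'm \<times> 'f"
  where "dual_chart \<phi> \<Psi> = (\<lambda>(x, \<xi>). (\<phi> x, dual_components E \<Psi> x \<xi>))"

lemma dual_chart_apply [simp]: "dual_chart \<phi> \<Psi> (x, \<xi>) = (\<phi> x, dual_components E \<Psi> x \<xi>)"
  by (simp add: dual_chart_def)

section \<open>Charts of the dual bundle\<close>

lemma dual_atlasE:
  assumes "(W, \<kappa>) \<in> dual"
  obtains U \<phi> V \<Psi> where "(U, \<phi>) \<in> M" "local_trivialization E V \<Psi>" "W = (SIGMA x:U \<inter> V. dual_space E x)"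
    "\<kappa> = dual_chart \<phi> \<Psi>"
proof -
  have "\<exists>U \<phi> V \<Psi>. (W, \<kappa>) = (SIGMA x:U \<inter> V. dual_space E x, \<lambda>(x, \<xi>). (\<phi> x, dual_components E \<Psi> x \<xi>)) \<and>
      (U, \<phi>) \<in> M \<and> local_trivialization E V \<Psi>"
    using assms unfolding dual_atlas_def by (rule CollectD)
  then obtain U \<phi> V \<Psi> where
    e: "(W, \<kappa>) = (SIGMA x:U \<inter> V. dual_space E x, \<lambda>(x, \<xi>). (\<phi> x, dual_components E \<Psi> x \<xi>))"
    and c: "(U, \<phi>) \<in> M" "local_trivialization E V \<Psi>" by (elim exE conjE)
  show ?thesis by (rule that[OF c]) (use e in \<open>simp_all add: dual_chart_def\<close>)
qed

lemma dual_atlasI: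
  assumes "(U, \<phi>) \<in> M" "local_trivialization E V \<Psi>"
  shows "(SIGMA x:U \<inter> V. dual_space E x, dual_chart \<phi> \<Psi>) \<in> dual"
  unfolding dual_atlas_def dual_chart_def
  by (rule CollectI, rule exI[of _ U], rule exI[of _ \<phi>], rule exI[of _ V], rule exI[of _ \<Psi>]) (simp add: assms)

lemma points_dual: "points dual = (SIGMA x:points M. dual_space E x)"
proof (rule set_eqI, rule iffI)
  fix p assume "p \<in> points dual"
  then obtain W \<kappa> where w: "(W, \<kappa>) \<in> dual" "p \<in> W" by (rule pointsE)
  then obtain U \<phi> V \<Psi> where "(U, \<phi>) \<in> M" "W = (SIGMA x:U \<inter> V. dual_space E x)" by (elim dual_atlasE)
  then show "p \<in> (SIGMA x:points M. dual_space E x)" using w(2) chart_subset_points[of U \<phi> M] by auto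
next
  fix p assume p: "p \<in> (SIGMA x:points M. dual_space E x)"
  then have "fst p \<in> points M" by auto
  then obtain U \<phi> where c: "(U, \<phi>) \<in> M" "fst p \<in> U" by (rule pointsE)
  obtain V \<Psi> where t: "local_trivialization E V \<Psi>" "fst p \<in> V" using \<open>fst p \<in> points M\<close> by (rule trivE)
  show "p \<in> points dual"
    using chart_subset_points[OF dual_atlasI[OF c(1) t(1)]] p c(2) t(2) by auto
qed

lemma points_dualI [intro]: "x \<in> points M \<Longrightarrow> \<xi> \<in> dual_space E x \<Longrightarrow> (x, \<xi>) \<in> points dual"
  by (simp add: points_dual)

context
  fixes U \<phi> V \<Psi> assumes chart: "(U, \<phi>) \<in> M" and triv: "local_trivialization E V \<Psi>"
begin

lemma dual_chart_inj: "inj_on (dual_chart \<phi> \<Psi>) (SIGMA x:U \<inter> V. dual_space E x)"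
proof (rule inj_onI)
  fix p q assume pq: "p \<in> (SIGMA x:U \<inter> V. dual_space E x)" "q \<in> (SIGMA x:U \<inter> V. dual_space E x)"
    and eq: "dual_chart \<phi> \<Psi> p = dual_chart \<phi> \<Psi> q"
  obtain x \<xi> y \<eta> where xy: "p = (x, \<xi>)" "q = (y, \<eta>)" by fastforce
  have m: "x \<in> U" "x \<in> V" "\<xi> \<in> dual_space E x" "y \<in> U" "\<eta> \<in> dual_space E y" using pq xy by auto
  have "x = y" by (rule inj_onD[OF smooth_atlasD(1)[OF base_atlas chart] _ m(1,4)]) (use eq xy in simp)
  moreover have "dual_components E \<Psi> x \<xi> = dual_components E \<Psi> y \<eta>" using eq xy by simp
  ultimately have "\<xi> = \<eta>"
    using coframe_dual_components[OF triv m(2,3)] coframe_dual_components[OF triv m(2), of \<eta>] m by simp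
  then show "p = q" using \<open>x = y\<close> xy by simp
qed

lemma dual_chart_image:
  assumes "S \<subseteq> U \<inter> V"
  shows "dual_chart \<phi> \<Psi> ` (SIGMA x:S. dual_space E x) = \<phi> ` S \<times> UNIV"
proof (rule set_eqI, rule iffI)
  fix z assume "z \<in> \<phi> ` S \<times> (UNIV :: 'f set)"
  then obtain x where x: "x \<in> S" "fst z = \<phi> x" by auto
  have "x \<in> V" using x assms by blast
  then have "dual_chart \<phi> \<Psi> (x, coframe \<Psi> x (snd z)) = z" "coframe \<Psi> x (snd z) \<in> dual_space E x"
    using x(2) by (simp_all add: dual_components_coframe[OF triv] coframe_in[OF triv] prod_eq_iff)
  then show "z \<in> dual_chart \<phi> \<Psi> ` (SIGMA x:S. dual_space E x)"
    using x(1) by (intro image_eqI[of _ _ "(x, coframe \<Psi> x (snd z))"]) auto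
qed auto

lemma dual_chart_inv:
  assumes "x \<in> U" "x \<in> V"
  shows "the_inv_into (SIGMA x:U \<inter> V. dual_space E x) (dual_chart \<phi> \<Psi>) (\<phi> x, \<eta>) = (x, coframe \<Psi> x \<eta>)"
proof -
  have "dual_chart \<phi> \<Psi> (x, coframe \<Psi> x \<eta>) = (\<phi> x, \<eta>)" by (simp add: dual_components_coframe[OF triv assms(2)])
  moreover have "(x, coframe \<Psi> x \<eta>) \<in> (SIGMA x:U \<inter> V. dual_space E x)"
    using assms coframe_in[OF triv] by simp
  ultimately show ?thesis using the_inv_into_f_f[OF dual_chart_inj, of "(x, coframe \<Psi> x \<eta>)"] by simp
qed

text \<open>Changes of dual charts and affine functions have a common shape: affine in the fibre
  coordinate with coefficients smooth on the base. This lemma serves both, whence the general target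
  space.\<close>

lemma dual_chart_smooth_affine:
  fixes G :: "'f \<Rightarrow> 'a \<Rightarrow> 'b::real_normed_vector"
  assumes S: "S \<subseteq> U \<inter> V" "open_in_atlas M S" and h: "smooth_in M S h" and G: "\<And>b. b \<in> Basis \<Longrightarrow> smooth_in M S (G b)"
    and F: "\<And>x \<eta>. x \<in> S \<Longrightarrow> F (x, coframe \<Psi> x \<eta>) = h x + (\<Sum>b\<in>Basis. (\<eta> \<bullet> b) *\<^sub>R G b x)"
  shows "smooth_on (\<phi> ` S \<times> UNIV)
    (\<lambda>z. F (the_inv_into (SIGMA x:U \<inter> V. dual_space E x) (dual_chart \<phi> \<Psi>) z))"
proof -
  have US: "U \<inter> S = S" using S(1) by blast
  have o: "open (\<phi> ` S)" using open_in_atlasD(1)[OF S(2) chart] US by simp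
  have o2: "open (\<phi> ` S \<times> (UNIV::'f set))" by (rule open_Times[OF o open_UNIV])
  note inv = the_inv_into_chart[OF base_atlas chart]
  have hs: "smooth_on (\<phi> ` S \<times> (UNIV::'f set)) (\<lambda>z. h (the_inv_into U \<phi> (fst z)))"
    by (rule smooth_on_fst_compose[OF o]) (use smooth_inD[OF h chart] US in simp)
  have Gs: "smooth_on (\<phi> ` S \<times> (UNIV::'f set)) (\<lambda>z. G b (the_inv_into U \<phi> (fst z)))" if "b \<in> Basis" for b
    by (rule smooth_on_fst_compose[OF o]) (use smooth_inD[OF G[OF that] chart] US in simp)
  have sn: "smooth_on (\<phi> ` S \<times> (UNIV::'f set)) snd" by (rule smooth_on_linear[OF o2 bounded_linear_snd])
  have "smooth_on (\<phi> ` S \<times> (UNIV::'f set)) (\<lambda>z. h (the_inv_into U \<phi> (fst z)) +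
      (\<Sum>b\<in>Basis. (snd z \<bullet> b) *\<^sub>R G b (the_inv_into U \<phi> (fst z))))"
    by (intro smooth_on_add smooth_on_sum smooth_on_scaleR smooth_on_inner smooth_on_const hs Gs sn o2)
  then show ?thesis
  proof (rule smooth_on_cong_imp[OF o2])
    fix z assume "z \<in> \<phi> ` S \<times> (UNIV::'f set)"
    then obtain x where x: "x \<in> S" "z = (\<phi> x, snd z)" by (auto simp: prod_eq_iff)
    have xUV: "x \<in> U" "x \<in> V" using x(1) S(1) by blast+
    have 1: "the_inv_into (SIGMA x:U \<inter> V. dual_space E x) (dual_chart \<phi> \<Psi>) z = (x, coframe \<Psi> x (snd z))"
      by (subst x(2)) (rule dual_chart_inv[OF xUV])
    have 2: "the_inv_into U \<phi> (fst z) = x" by (subst x(2)) (simp add: inv[OF xUV(1)])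
    show "h (the_inv_into U \<phi> (fst z)) + (\<Sum>b\<in>Basis. (snd z \<bullet> b) *\<^sub>R G b (the_inv_into U \<phi> (fst z))) =
        F (the_inv_into (SIGMA x:U \<inter> V. dual_space E x) (dual_chart \<phi> \<Psi>) z)"
      unfolding 1 2 F[OF x(1)] ..
  qed
qed

end

lemma dual_smooth_atlas: "smooth_atlas dual"
proof -
  have main: "inj_on \<kappa> W \<and> open (\<kappa> ` W) \<and> open (\<kappa> ` (W \<inter> W')) \<and>
      smooth_on (\<kappa> ` (W \<inter> W')) (\<lambda>z. \<kappa>' (the_inv_into W \<kappa> z))"
    if W: "(W, \<kappa>) \<in> dual" and W': "(W', \<kappa>') \<in> dual" for W \<kappa> W' \<kappa>'
  proof -
    obtain U \<phi> V \<Psi> where c: "(U, \<phi>) \<in> M" and t: "local_trivialization E V \<Psi>"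
      and w: "W = (SIGMA x:U \<inter> V. dual_space E x)" "\<kappa> = dual_chart \<phi> \<Psi>" using W by (rule dual_atlasE)
    obtain U' \<phi>' V' \<Psi>' where c': "(U', \<phi>') \<in> M" and t': "local_trivialization E V' \<Psi>'"
      and w': "W' = (SIGMA x:U' \<inter> V'. dual_space E x)" "\<kappa>' = dual_chart \<phi>' \<Psi>'" using W' by (rule dual_atlasE)
    let ?S = "(U \<inter> V) \<inter> (U' \<inter> V')"
    note ois = open_in_atlas_Int[OF base_atlas] open_in_atlas_chart[OF base_atlas] triv_open
    have oUV: "open_in_atlas M (U \<inter> V)" by (intro ois(1) ois(2)[OF c] triv_open[OF t])
    have oS: "open_in_atlas M ?S" by (intro ois(1) ois(2)[OF c] ois(2)[OF c'] triv_open[OF t] triv_open[OF t'])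
    have WW': "W \<inter> W' = (SIGMA x:?S. dual_space E x)" unfolding w w' by auto
    have im: "\<kappa> ` W = \<phi> ` (U \<inter> V) \<times> UNIV" "\<kappa> ` (W \<inter> W') = \<phi> ` ?S \<times> UNIV"
      unfolding WW' unfolding w by (rule dual_chart_image[OF c t], blast)+
    have o: "open (\<phi> ` (U \<inter> V))" "open (\<phi> ` ?S)"
      using open_in_atlasD(1)[OF oUV c] open_in_atlasD(1)[OF oS c] by (simp_all add: Int_assoc[symmetric])
    have fs: "smooth_in M ?S \<phi>'" by (rule smooth_in_subset[OF smooth_in_chart[OF base_atlas c']]) blast
    have fr: "smooth_in M ?S (\<lambda>x. \<Psi> (frame \<Psi>' x b))" for b
      by (rule smooth_in_subset[OF frame_smooth[OF t t']]) blast
    let ?G = "\<lambda>b x. (\<Sum>d\<in>Basis. (b \<bullet> \<Psi> (frame \<Psi>' x d)) *\<^sub>R d)"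
    have Gs: "smooth_in M ?S (?G b)" for b
      by (intro smooth_in_sum smooth_in_scaleR smooth_in_inner smooth_in_const fr oS)
    \<comment> \<open>The fibre part of a change of dual charts is the transpose of the transition
      from \<Psi>' to \<Psi>, and hence linear in \<eta> with smooth coefficients.\<close>
    have dc: "dual_components E \<Psi>' x (coframe \<Psi> x \<eta>) = (\<Sum>b\<in>Basis. (\<eta> \<bullet> b) *\<^sub>R ?G b x)" if x: "x \<in> ?S" for x \<eta>
    proof -
      have xV: "x \<in> V'" using x by blast
      have "dual_components E \<Psi>' x (coframe \<Psi> x \<eta>) = (\<Sum>d\<in>Basis. coframe \<Psi> x \<eta> (frame \<Psi>' x d) *\<^sub>R d)"
        by (simp only: dual_components_def frame_def)
      also have "\<dots> = (\<Sum>d\<in>Basis. (\<eta> \<bullet> \<Psi> (frame \<Psi>' x d)) *\<^sub>R d)"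
        by (rule sum.cong) (simp_all add: frame_in[OF t' xV] inner_commute)
      also have "\<dots> = (\<Sum>d\<in>Basis. (\<Sum>b\<in>Basis. (\<eta> \<bullet> b) * (b \<bullet> \<Psi> (frame \<Psi>' x d))) *\<^sub>R d)"
        by (rule sum.cong[OF refl]) (subst euclidean_inner, simp add: inner_commute)
      also have "\<dots> = (\<Sum>d\<in>Basis. \<Sum>b\<in>Basis. ((\<eta> \<bullet> b) * (b \<bullet> \<Psi> (frame \<Psi>' x d))) *\<^sub>R d)"
        by (simp only: scaleR_sum_left)
      also have "\<dots> = (\<Sum>b\<in>Basis. \<Sum>d\<in>Basis. ((\<eta> \<bullet> b) * (b \<bullet> \<Psi> (frame \<Psi>' x d))) *\<^sub>R d)"
        by (rule sum.swap)
      finally show ?thesis by (simp only: scaleR_sum_right scaleR_scaleR)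
    qed
    have "smooth_on (\<phi> ` ?S \<times> UNIV)
        (\<lambda>z. dual_chart \<phi>' \<Psi>' (the_inv_into (SIGMA x:U \<inter> V. dual_space E x) (dual_chart \<phi> \<Psi>) z))"
    proof (rule dual_chart_smooth_affine[OF c t _ oS, where h="\<lambda>x. (\<phi>' x, 0)" and G="\<lambda>b x. (0, ?G b x)"])
      show "smooth_in M ?S (\<lambda>x. (\<phi>' x, 0 :: 'f))" by (intro smooth_in_Pair oS fs smooth_in_const)
      show "smooth_in M ?S (\<lambda>x. (0 :: 'm, ?G b x))" for b by (intro smooth_in_Pair oS Gs smooth_in_const)
      fix x \<eta> assume x: "x \<in> ?S"
      have "(\<Sum>b\<in>Basis. (\<eta> \<bullet> b) *\<^sub>R (0 :: 'm, ?G b x)) = (0, \<Sum>b\<in>Basis. (\<eta> \<bullet> b) *\<^sub>R ?G b x)"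
        by (simp add: prod_eq_iff fst_sum snd_sum)
      then show "dual_chart \<phi>' \<Psi>' (x, coframe \<Psi> x \<eta>) = (\<phi>' x, 0) + (\<Sum>b\<in>Basis. (\<eta> \<bullet> b) *\<^sub>R (0 :: 'm, ?G b x))"
        using dc[OF x] by simp
    qed blast
    then show ?thesis
      unfolding im using o dual_chart_inj[OF c t] unfolding w w' by (auto intro: open_Times)
  qed
  show ?thesis
    unfolding smooth_atlas_def o_def
    by (intro conjI ballI; clarify) (use main in \<open>blast+\<close>)
qed

lemma dual_restriction_open:
  assumes "open_in_atlas M S" shows "open_in_atlas dual (SIGMA x:S. dual_space E x)"
proof -
  have "\<exists>T. open_in_atlas dual T \<and> p \<in> T \<and> T \<subseteq> (SIGMA x:S. dual_space E x)" if p: "p \<in> (SIGMA x:S. dual_space E x)" for p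
  proof -
    have "fst p \<in> points M" using p open_in_atlasD(2)[OF assms] by auto
    then obtain U \<phi> where c: "(U, \<phi>) \<in> M" "fst p \<in> U" by (rule pointsE)
    obtain V \<Psi> where t: "local_trivialization E V \<Psi>" "fst p \<in> V" using \<open>fst p \<in> points M\<close> by (rule trivE)
    note a = dual_atlasI[OF c(1) t(1)]
    have o: "open_in_atlas M (U \<inter> S)" by (rule open_in_atlas_Int[OF base_atlas open_in_atlas_chart[OF base_atlas c(1)] assms])
    have "smooth_in dual (SIGMA x:U \<inter> V. dual_space E x) (\<lambda>z. fst (dual_chart \<phi> \<Psi> z))"
      by (rule smooth_in_bounded_linear[OF open_in_atlas_chart[OF dual_smooth_atlas a] bounded_linear_fst smooth_in_chart[OF dual_smooth_atlas a]])
    then have "open_in_atlas dual ((SIGMA x:U \<inter> V. dual_space E x) \<inter> (\<lambda>z. fst (dual_chart \<phi> \<Psi> z)) -` (\<phi> ` (U \<inter> S)))"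
      by (rule open_in_atlas_smooth_preimage[OF dual_smooth_atlas open_in_atlas_chart[OF dual_smooth_atlas a] _ open_in_atlasD(1)[OF assms c(1)]])
    moreover have "(SIGMA x:U \<inter> V. dual_space E x) \<inter> (\<lambda>z. fst (dual_chart \<phi> \<Psi> z)) -` (\<phi> ` (U \<inter> S)) \<subseteq> (SIGMA x:S. dual_space E x)"
      using smooth_atlasD(1)[OF base_atlas c(1)] by (auto dest: inj_onD)
    moreover have "p \<in> (SIGMA x:U \<inter> V. dual_space E x) \<inter> (\<lambda>z. fst (dual_chart \<phi> \<Psi> z)) -` (\<phi> ` (U \<inter> S))"
      using p c t by (cases p) auto
    ultimately show ?thesis by blast
  qed
  then show ?thesis by (rule open_in_atlas_local[OF dual_smooth_atlas])
qed

text \<open>Points over different base points are separated by open sets of the base, and points of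
  the same fibre inside one chart. The Hausdorff property makes cutoff functions available on the
  dual bundle.\<close>

lemma dual_hausdorff: "Hausdorff_space (manifold_topology dual)"
proof -
  note op = openin_manifold_topology[OF dual_smooth_atlas]
  have top: "topspace (manifold_topology M) = points M" "topspace (manifold_topology dual) = points dual"
    using openin_manifold_topology[OF base_atlas] open_in_atlas_points[OF base_atlas]
      op open_in_atlas_points[OF dual_smooth_atlas] open_in_atlasD(2)
    by (metis openin_topspace openin_subset subset_antisym)+
  have "\<exists>S T. openin (manifold_topology dual) S \<and> openin (manifold_topology dual) T \<and> p \<in> S \<and> q \<in> T \<and> disjnt S T"
    if pq: "p \<in> points dual" "q \<in> points dual" "p \<noteq> q" for p q
  proof (cases "fst p = fst q")
    case False
    have "fst p \<in> points M" "fst q \<in> points M" using pq by (auto simp: points_dual)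
    then obtain S T where ST: "openin (manifold_topology M) S" "openin (manifold_topology M) T" "fst p \<in> S" "fst q \<in> T" "disjnt S T"
      using base_hausdorff False unfolding Hausdorff_space_def top by meson
    have "open_in_atlas dual (SIGMA x:S. dual_space E x)" "open_in_atlas dual (SIGMA x:T. dual_space E x)"
      using ST(1,2) openin_manifold_topology[OF base_atlas] by (auto intro: dual_restriction_open)
    moreover have "p \<in> (SIGMA x:S. dual_space E x)" "q \<in> (SIGMA x:T. dual_space E x)"
      using ST(3,4) pq by (auto simp: points_dual)
    moreover have "disjnt (SIGMA x:S. dual_space E x) (SIGMA x:T. dual_space E x)"
      using ST(5) by (auto simp: disjnt_def)
    ultimately show ?thesis unfolding op by blast
  next
    case True
    obtain x \<xi> \<eta> where x: "p = (x, \<xi>)" "q = (x, \<eta>)" using True by (cases p; cases q) auto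
    have m: "x \<in> points M" "\<xi> \<in> dual_space E x" "\<eta> \<in> dual_space E x" using pq x by (auto simp: points_dual)
    obtain U \<phi> where c: "(U, \<phi>) \<in> M" "x \<in> U" using m(1) by (rule pointsE)
    obtain V \<Psi> where t: "local_trivialization E V \<Psi>" "x \<in> V" using m(1) by (rule trivE)
    let ?W = "SIGMA x:U \<inter> V. dual_space E x"
    note a = dual_atlasI[OF c(1) t(1)]
    have sm: "smooth_in dual ?W (dual_chart \<phi> \<Psi>)" by (rule smooth_in_chart[OF dual_smooth_atlas a])
    have pqW: "p \<in> ?W" "q \<in> ?W" using x m c t by auto
    have "dual_chart \<phi> \<Psi> p \<noteq> dual_chart \<phi> \<Psi> q" using inj_onD[OF dual_chart_inj[OF c(1) t(1)] _ pqW] pq(3) by blast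
    then obtain S T where ST: "open S" "open T" "dual_chart \<phi> \<Psi> p \<in> S" "dual_chart \<phi> \<Psi> q \<in> T" "S \<inter> T = {}"
      using hausdorff by meson
    have "open_in_atlas dual (?W \<inter> dual_chart \<phi> \<Psi> -` S)" "open_in_atlas dual (?W \<inter> dual_chart \<phi> \<Psi> -` T)"
      using open_in_atlas_smooth_preimage[OF dual_smooth_atlas open_in_atlas_chart[OF dual_smooth_atlas a] sm] ST(1,2) by blast+
    moreover have "disjnt (?W \<inter> dual_chart \<phi> \<Psi> -` S) (?W \<inter> dual_chart \<phi> \<Psi> -` T)"
      using ST(5) by (auto simp: disjnt_def)
    ultimately show ?thesis unfolding op using pqW ST(3,4)
      by (intro exI[of _ "?W \<inter> dual_chart \<phi> \<Psi> -` S"] exI[of _ "?W \<inter> dual_chart \<phi> \<Psi> -` T"]) auto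
  qed
  then show ?thesis unfolding Hausdorff_space_def top by blast
qed

sublocale dual: hausdorff_atlas "dual_atlas E"
  by (rule hausdorff_atlas.intro[OF dual_smooth_atlas dual_hausdorff])

lemma dual_smooth_affine:
  fixes F :: "'a \<times> ('e \<Rightarrow> real) \<Rightarrow> real"
  assumes t: "local_trivialization E V \<Psi>" and S: "S \<subseteq> V" "open_in_atlas M S"
    and h: "smooth_in M S h" and G: "smooth_in M S G"
    and F: "\<And>x \<xi>. x \<in> S \<Longrightarrow> \<xi> \<in> dual_space E x \<Longrightarrow> F (x, \<xi>) = h x + G x \<bullet> dual_components E \<Psi> x \<xi>"
  shows "smooth_in dual (SIGMA x:S. dual_space E x) F"
proof (rule smooth_in_local)
  fix p assume p: "p \<in> (SIGMA x:S. dual_space E x)"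
  have "fst p \<in> points M" using p open_in_atlasD(2)[OF S(2)] by auto
  then obtain U \<phi> where c: "(U, \<phi>) \<in> M" "fst p \<in> U" by (rule pointsE)
  let ?T = "SIGMA x:U \<inter> S. dual_space E x"
  have o: "open_in_atlas M (U \<inter> S)" by (rule open_in_atlas_Int[OF base_atlas open_in_atlas_chart[OF base_atlas c(1)] S(2)])
  have sub: "U \<inter> S \<subseteq> U \<inter> V" using S(1) by blast
  have "smooth_on (\<phi> ` (U \<inter> S) \<times> UNIV)
      (\<lambda>z. F (the_inv_into (SIGMA x:U \<inter> V. dual_space E x) (dual_chart \<phi> \<Psi>) z))"
  proof (rule dual_chart_smooth_affine[OF c(1) t sub o, where h=h and G="\<lambda>b x. G x \<bullet> b"])
    show "smooth_in M (U \<inter> S) h" by (rule smooth_in_subset[OF h]) blast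
    show "smooth_in M (U \<inter> S) (\<lambda>x. G x \<bullet> b)" for b
      by (rule smooth_in_inner[OF o smooth_in_subset[OF G] smooth_in_const]) blast
    fix x \<eta> assume x: "x \<in> U \<inter> S"
    then have "x \<in> S" "x \<in> V" using S(1) by blast+
    then have "F (x, coframe \<Psi> x \<eta>) = h x + G x \<bullet> \<eta>"
      using F[OF _ coframe_in[OF t]] dual_components_coframe[OF t] by simp
    also have "G x \<bullet> \<eta> = (\<Sum>b\<in>Basis. (\<eta> \<bullet> b) *\<^sub>R (G x \<bullet> b))"
      by (subst euclidean_inner) (simp add: mult.commute)
    finally show "F (x, coframe \<Psi> x \<eta>) = h x + (\<Sum>b\<in>Basis. (\<eta> \<bullet> b) *\<^sub>R (G x \<bullet> b))" .
  qed
  then have "smooth_in dual ?T F"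
    by (intro smooth_in_chartI[OF dual_smooth_atlas dual_atlasI[OF c(1) t] _ dual_restriction_open[OF o]])
      (use sub dual_chart_image[OF c(1) t sub] in auto)
  then show "\<exists>T. open_in_atlas dual T \<and> p \<in> T \<and> smooth_in dual T F"
    using dual_restriction_open[OF o] p c(2) by auto
qed

end

section \<open>Basic, vertical and affine functions\<close>

context smooth_bundle
begin

definition basic_function :: "('a \<Rightarrow> real) \<Rightarrow> 'a \<times> ('e \<Rightarrow> real) \<Rightarrow> real"
  where "basic_function h = (\<lambda>p\<in>points dual. h (fst p))"

definition zero_covector :: "'a \<Rightarrow> 'e \<Rightarrow> real"
  where "zero_covector x = (\<lambda>e\<in>fibre E x. 0)"

lemma zero_covector_apply [simp]: "e \<in> fibre E x \<Longrightarrow> zero_covector x e = 0"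
  by (simp add: zero_covector_def)

lemma vertical_apply: "x \<in> points M \<Longrightarrow> \<xi> \<in> dual_space E x \<Longrightarrow> vertical_function E X (x, \<xi>) = \<xi> (X x)"
  using points_dualI[of x \<xi>] by (simp add: vertical_function_def)

lemma basic_apply: "x \<in> points M \<Longrightarrow> \<xi> \<in> dual_space E x \<Longrightarrow> basic_function h (x, \<xi>) = h x"
  using points_dualI[of x \<xi>] by (simp add: basic_function_def)

lemma dual_fun_apply:
  assumes "x \<in> points M" "\<xi> \<in> dual_space E x"
  shows "fun_add dual f g (x, \<xi>) = f (x, \<xi>) + g (x, \<xi>)" "fun_mult dual f g (x, \<xi>) = f (x, \<xi>) * g (x, \<xi>)"
    "fun_scale dual c f (x, \<xi>) = c * f (x, \<xi>)" "fun_zero dual (x, \<xi>) = 0"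
  using points_dualI[OF assms] by simp_all

lemma dual_eqI:
  assumes "f \<in> smooth_functions dual" "g \<in> smooth_functions dual"
    and "\<And>x \<xi>. x \<in> points M \<Longrightarrow> \<xi> \<in> dual_space E x \<Longrightarrow> f (x, \<xi>) = g (x, \<xi>)"
  shows "f = g"
proof (rule smooth_functions_eqI[OF assms(1,2)])
  fix p assume "p \<in> points dual"
  then show "f p = g p" using assms(3) by (cases p) (auto simp: points_dual)
qed

lemma zero_covector_in: "x \<in> points M \<Longrightarrow> zero_covector x \<in> dual_space E x"
  by (rule dual_spaceI) (simp_all add: zero_covector_def)

text \<open>Covers basic and vertical functions at once, as both are affine on fibres with smooth
  coefficients.\<close>

lemma dual_smooth_functionI:
  assumes ext: "F \<in> extensional (points dual)"
    and loc: "\<And>x V \<Psi>. x \<in> V \<Longrightarrow> local_trivialization E V \<Psi> \<Longrightarrow> \<exists>h G. smooth_in M V h \<and> smooth_in M V G \<and>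
      (\<forall>z\<in>V. \<forall>\<xi>\<in>dual_space E z. F (z, \<xi>) = h z + G z \<bullet> dual_components E \<Psi> z \<xi>)"
  shows "F \<in> smooth_functions dual"
proof -
  have "smooth_in dual (points dual) F"
  proof (rule smooth_in_local)
    fix p assume p: "p \<in> points dual"
    then have "fst p \<in> points M" by (auto simp: points_dual)
    then obtain V \<Psi> where t: "local_trivialization E V \<Psi>" "fst p \<in> V" by (rule trivE)
    obtain h G where hG: "smooth_in M V h" "smooth_in M V G"
      "\<forall>z\<in>V. \<forall>\<xi>\<in>dual_space E z. F (z, \<xi>) = h z + G z \<bullet> dual_components E \<Psi> z \<xi>"
      using loc[OF t(2,1)] by blast
    have "smooth_in dual (SIGMA x:V. dual_space E x) F"
      by (rule dual_smooth_affine[OF t(1) subset_refl triv_open[OF t(1)] hG(1,2)]) (use hG(3) in blast)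
    moreover have "p \<in> (SIGMA x:V. dual_space E x)" using p t(2) by (auto simp: points_dual)
    ultimately show "\<exists>T. open_in_atlas dual T \<and> p \<in> T \<and> smooth_in dual T F"
      using dual_restriction_open[OF triv_open[OF t(1)]] by blast
  qed
  then show ?thesis using smooth_functions_iff[OF dual_smooth_atlas] ext by blast
qed

lemma vertical_smooth: assumes X: "X \<in> sections E" shows "vertical_function E X \<in> smooth_functions dual"
proof (rule dual_smooth_functionI)
  show "vertical_function E X \<in> extensional (points dual)" by (simp add: vertical_function_def)
  fix x V \<Psi> assume t: "x \<in> V" "local_trivialization E V \<Psi>"
  have "vertical_function E X (z, \<xi>) = 0 + \<Psi> (X z) \<bullet> dual_components E \<Psi> z \<xi>"
    if z: "z \<in> V" "\<xi> \<in> dual_space E z" for z \<xi>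
  proof -
    have zM: "z \<in> points M" using z triv_subset[OF t(2)] by blast
    show ?thesis
      using dual_components_pairing[OF t(2) z section_in_fibre[OF X zM]] vertical_apply[OF zM z(2)] by simp
  qed
  then show "\<exists>h G. smooth_in M V h \<and> smooth_in M V G \<and>
      (\<forall>z\<in>V. \<forall>\<xi>\<in>dual_space E z. vertical_function E X (z, \<xi>) = h z + G z \<bullet> dual_components E \<Psi> z \<xi>)"
    by (intro exI[of _ "\<lambda>z. 0"] exI[of _ "\<lambda>z. \<Psi> (X z)"])
      (simp add: smooth_in_const section_smooth[OF t(2) X])
qed

lemma basic_smooth: assumes h: "h \<in> smooth_functions M" shows "basic_function h \<in> smooth_functions dual"
proof (rule dual_smooth_functionI)
  show "basic_function h \<in> extensional (points dual)" by (simp add: basic_function_def)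
  fix x V \<Psi> assume t: "x \<in> V" "local_trivialization E V \<Psi>"
  have "basic_function h (z, \<xi>) = h z + 0 \<bullet> dual_components E \<Psi> z \<xi>" if z: "z \<in> V" "\<xi> \<in> dual_space E z" for z \<xi>
    using basic_apply[OF _ z(2)] z triv_subset[OF t(2)] by auto
  then show "\<exists>h' G. smooth_in M V h' \<and> smooth_in M V G \<and>
      (\<forall>z\<in>V. \<forall>\<xi>\<in>dual_space E z. basic_function h (z, \<xi>) = h' z + G z \<bullet> dual_components E \<Psi> z \<xi>)"
    by (intro exI[of _ h] exI[of _ "\<lambda>z. 0"])
      (simp add: smooth_in_const smooth_functionsD(2)[OF base_atlas h triv_subset[OF t(2)]])
qed

lemmas dual_closed = dual.smooth_fun_add dual.smooth_fun_mult dual.smooth_fun_scale dual.smooth_fun_zero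

lemma vertical_eqs:
  assumes X: "X \<in> sections E"
  shows "Y \<in> sections E \<Longrightarrow> vertical_function E (sec_add E X Y) = fun_add dual (vertical_function E X) (vertical_function E Y)"
    "vertical_function E (sec_scale E c X) = fun_scale dual c (vertical_function E X)"
    "f \<in> smooth_functions M \<Longrightarrow> vertical_function E (sec_mult E f X) = fun_mult dual (basic_function f) (vertical_function E X)"
proof -
  show "vertical_function E (sec_add E X Y) = fun_add dual (vertical_function E X) (vertical_function E Y)"
    if Y: "Y \<in> sections E"
    by (rule dual_eqI[OF vertical_smooth[OF sec_add_in[OF X Y]] dual_closed(1)[OF vertical_smooth[OF X] vertical_smooth[OF Y]]])
      (simp add: vertical_apply dual_fun_apply dual_spaceD(2) section_in_fibre[OF X] section_in_fibre[OF Y])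
  show "vertical_function E (sec_scale E c X) = fun_scale dual c (vertical_function E X)"
    by (rule dual_eqI[OF vertical_smooth[OF sec_scale_in[OF X]] dual_closed(3)[OF vertical_smooth[OF X]]])
      (simp add: vertical_apply dual_fun_apply dual_spaceD(3) section_in_fibre[OF X])
  show "vertical_function E (sec_mult E f X) = fun_mult dual (basic_function f) (vertical_function E X)"
    if f: "f \<in> smooth_functions M"
    by (rule dual_eqI[OF vertical_smooth[OF sec_mult_in[OF f X]] dual_closed(2)[OF basic_smooth[OF f] vertical_smooth[OF X]]])
      (simp add: vertical_apply basic_apply dual_fun_apply dual_spaceD(3) section_in_fibre[OF X])
qed

lemma sec_zero_in: "sec_zero E \<in> sections E"
proof (rule sectionsI)
  fix x assume x: "x \<in> points M"
  show "sec_zero E x \<in> fibre E x" using x by simp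
  obtain V \<Psi> where t: "local_trivialization E V \<Psi>" "x \<in> V" using x by (rule trivE)
  have "smooth_in M V (\<lambda>x. \<Psi> (sec_zero E x))"
    by (rule smooth_in_cong[OF base_atlas triv_open[OF t(1)] smooth_in_const[of _ _ 0]])
      (use triv_subset[OF t(1)] triv_zero[OF t(1)] in auto)
  then show "\<exists>V \<Psi> N. local_trivialization E V \<Psi> \<and> open_in_atlas M N \<and> x \<in> N \<and> N \<subseteq> V \<and>
      smooth_in M N (\<lambda>x. \<Psi> (sec_zero E x))" using t triv_open[OF t(1)] by blast
qed (simp add: sec_zero_def)

lemma vertical_zero: "vertical_function E (sec_zero E) = fun_zero dual"
  by (rule dual_eqI[OF vertical_smooth[OF sec_zero_in] dual_closed(4)])
    (simp add: vertical_apply dual_fun_apply dual_space_zero)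

lemma basic_eqs:
  assumes f: "f \<in> smooth_functions M"
  shows "g \<in> smooth_functions M \<Longrightarrow> basic_function (fun_add M f g) = fun_add dual (basic_function f) (basic_function g)"
    "basic_function (fun_scale M c f) = fun_scale dual c (basic_function f)"
    "g \<in> smooth_functions M \<Longrightarrow> basic_function (fun_mult M f g) = fun_mult dual (basic_function f) (basic_function g)"
proof -
  show "basic_function (fun_add M f g) = fun_add dual (basic_function f) (basic_function g)" if g: "g \<in> smooth_functions M"
    by (rule dual_eqI[OF basic_smooth[OF base.smooth_fun_add[OF f g]] dual_closed(1)[OF basic_smooth[OF f] basic_smooth[OF g]]])
      (simp add: basic_apply dual_fun_apply)
  show "basic_function (fun_scale M c f) = fun_scale dual c (basic_function f)"
    by (rule dual_eqI[OF basic_smooth[OF base.smooth_fun_scale[OF f]] dual_closed(3)[OF basic_smooth[OF f]]])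
      (simp add: basic_apply dual_fun_apply)
  show "basic_function (fun_mult M f g) = fun_mult dual (basic_function f) (basic_function g)" if g: "g \<in> smooth_functions M"
    by (rule dual_eqI[OF basic_smooth[OF base.smooth_fun_mult[OF f g]] dual_closed(2)[OF basic_smooth[OF f] basic_smooth[OF g]]])
      (simp add: basic_apply dual_fun_apply)
qed

lemma fibre_eqI:
  assumes x: "x \<in> points M" and u: "u \<in> fibre E x" and v: "v \<in> fibre E x"
    and eq: "\<And>\<xi>. \<xi> \<in> dual_space E x \<Longrightarrow> \<xi> u = \<xi> v"
  shows "u = v"
proof -
  obtain V \<Psi> where t: "local_trivialization E V \<Psi>" "x \<in> V" using x by (rule trivE)
  have "\<Psi> u \<bullet> \<eta> = \<Psi> v \<bullet> \<eta>" for \<eta>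
    using eq[OF coframe_in[OF t, of \<eta>]] u v by simp
  then have "\<Psi> u = \<Psi> v" using vector_eq_rdot[of "\<Psi> u" "\<Psi> v"] by blast
  then show ?thesis by (rule triv_inj[OF t u v])
qed

lemma vertical_inj:
  assumes X: "X \<in> sections E" and Y: "Y \<in> sections E" and eq: "vertical_function E X = vertical_function E Y"
  shows "X = Y"
proof (rule sections_eqI[OF X Y])
  fix x assume x: "x \<in> points M"
  show "X x = Y x"
  proof (rule fibre_eqI[OF x section_in_fibre[OF X x] section_in_fibre[OF Y x]])
    show "\<xi> (X x) = \<xi> (Y x)" if "\<xi> \<in> dual_space E x" for \<xi>
      using vertical_apply[OF x that, of X] vertical_apply[OF x that, of Y] eq by simp
  qed
qed

text \<open>Testing on global sections is enough: near a point the local frame consists of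
  restrictions of such sections, and the values on the frame are the fibre coordinates.\<close>

lemma covector_section_smooth:
  assumes \<tau>: "\<And>x. x \<in> points M \<Longrightarrow> \<tau> x \<in> dual_space E x"
    and sm: "\<And>X. X \<in> sections E \<Longrightarrow> smooth_in M (points M) (\<lambda>x. \<tau> x (X x))"
  shows "smooth_map M dual (\<lambda>x. (x, \<tau> x))"
proof (rule smooth_mapI[OF base_atlas])
  show "(x, \<tau> x) \<in> points dual" if "x \<in> points M" for x using points_dualI[OF that \<tau>[OF that]] .
  fix x W \<kappa> assume x: "x \<in> points M" and c: "(W, \<kappa>) \<in> dual" "(x, \<tau> x) \<in> W"
  obtain U \<phi> V \<Psi> where u: "(U, \<phi>) \<in> M" and t: "local_trivialization E V \<Psi>"
    and w: "W = (SIGMA x:U \<inter> V. dual_space E x)" "\<kappa> = dual_chart \<phi> \<Psi>" using c(1) by (rule dual_atlasE)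
  have xUV: "x \<in> U" "x \<in> V" using c(2) w by auto
  obtain N \<beta> where N: "x \<in> N" "cutoff M V N \<beta>"
    and s: "\<forall>w. local_section V \<Psi> (\<lambda>x. if x \<in> V then \<beta> x *\<^sub>R w else 0) \<in> sections E"
    "\<forall>z\<in>N. \<forall>w. local_section V \<Psi> (\<lambda>x. if x \<in> V then \<beta> x *\<^sub>R w else 0) z = frame \<Psi> z w"
    using local_section_frame_exists[OF t triv_open[OF t] subset_refl xUV(2)] by blast
  let ?T = "U \<inter> N"
  have o: "open_in_atlas M ?T" by (rule open_in_atlas_Int[OF base_atlas open_in_atlas_chart[OF base_atlas u] cutoffD(3)[OF N(2)]])
  have fr: "smooth_in M ?T (\<lambda>x. \<tau> x (frame \<Psi> x b))" for b
    by (rule smooth_in_cong[OF base_atlas o smooth_in_subset[OF sm[OF s(1)[rule_format, of b]] open_in_atlasD(2)[OF o]]])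
      (use s(2) in simp)
  have "smooth_in M ?T (\<lambda>x. (\<phi> x, \<Sum>b\<in>Basis. \<tau> x (frame \<Psi> x b) *\<^sub>R b))"
    by (intro smooth_in_Pair smooth_in_sum smooth_in_scaleR smooth_in_const fr o
        smooth_in_subset[OF smooth_in_chart[OF base_atlas u]]) blast
  moreover have "(\<lambda>x. \<kappa> (x, \<tau> x)) = (\<lambda>x. (\<phi> x, \<Sum>b\<in>Basis. \<tau> x (frame \<Psi> x b) *\<^sub>R b))"
    by (simp add: w dual_components_def frame_def)
  moreover have "?T \<subseteq> (\<lambda>x. (x, \<tau> x)) -` W"
    using cutoffD(4)[OF N(2)] \<tau> open_in_atlasD(2)[OF o] by (auto simp: w)
  ultimately show "\<exists>T. open_in_atlas M T \<and> x \<in> T \<and> T \<subseteq> (\<lambda>x. (x, \<tau> x)) -` W \<and> smooth_in M T (\<lambda>x. \<kappa> (x, \<tau> x))"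
    using o xUV(1) N(1) by (intro exI[of _ ?T]) simp
qed

lemma pullback_smooth:
  assumes \<tau>: "smooth_map M dual (\<lambda>x. (x, \<tau> x))" and F: "F \<in> smooth_functions dual"
  shows "(\<lambda>x\<in>points M. F (x, \<tau> x)) \<in> smooth_functions M"
proof -
  have "points M \<inter> (\<lambda>x. (x, \<tau> x)) -` points dual = points M" using smooth_map_points[OF \<tau>] by auto
  then show ?thesis
    using smooth_map_pullback(2)[OF base_atlas dual_smooth_atlas \<tau> open_in_atlas_points[OF dual_smooth_atlas]
      smooth_functionsD(2)[OF dual_smooth_atlas F subset_refl]]
    by (intro smooth_functions_restrictI[OF base_atlas]) simp
qed

text \<open>The push-forward of v under the covector field \<tau>. It provides tangent vectors that
  move the base point, complementing the fibre directions obtained from \<open>line\<close>.\<close>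

lemma pullback_tangent:
  assumes \<tau>: "smooth_map M dual (\<lambda>x. (x, \<tau> x))" and v: "v \<in> tangent_space M x" and x: "x \<in> points M"
  shows "(\<lambda>F\<in>smooth_functions dual. v (\<lambda>z\<in>points M. F (z, \<tau> z))) \<in> tangent_space dual (x, \<tau> x)"
proof -
  have pt: "(z, \<tau> z) \<in> points dual" if "z \<in> points M" for z by (rule smooth_map_points[OF \<tau> that])
  note p = pullback_smooth[OF \<tau>]
  have e: "(\<lambda>z\<in>points M. fun_add dual F G (z, \<tau> z)) = fun_add M (\<lambda>z\<in>points M. F (z, \<tau> z)) (\<lambda>z\<in>points M. G (z, \<tau> z))"
    "(\<lambda>z\<in>points M. fun_mult dual F G (z, \<tau> z)) = fun_mult M (\<lambda>z\<in>points M. F (z, \<tau> z)) (\<lambda>z\<in>points M. G (z, \<tau> z))"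
    "(\<lambda>z\<in>points M. fun_scale dual c F (z, \<tau> z)) = fun_scale M c (\<lambda>z\<in>points M. F (z, \<tau> z))" for F G c
    using pt by (simp_all add: fun_add_def fun_mult_def fun_scale_def restrict_def fun_eq_iff)
  show ?thesis
  proof (rule tangent_spaceI)
    fix F G c assume F: "F \<in> smooth_functions dual"
    show "(\<lambda>F\<in>smooth_functions dual. v (\<lambda>z\<in>points M. F (z, \<tau> z))) (fun_scale dual c F) =
        c * (\<lambda>F\<in>smooth_functions dual. v (\<lambda>z\<in>points M. F (z, \<tau> z))) F"
      using tangent_spaceD(2)[OF v p[OF F]] by (simp only: restrict_apply dual_closed F if_True e)
    assume G: "G \<in> smooth_functions dual"
    show "(\<lambda>F\<in>smooth_functions dual. v (\<lambda>z\<in>points M. F (z, \<tau> z))) (fun_add dual F G) =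
        (\<lambda>F\<in>smooth_functions dual. v (\<lambda>z\<in>points M. F (z, \<tau> z))) F +
        (\<lambda>F\<in>smooth_functions dual. v (\<lambda>z\<in>points M. F (z, \<tau> z))) G"
      using tangent_spaceD(1)[OF v p[OF F] p[OF G]] by (simp only: restrict_apply dual_closed F G if_True e)
    show "(\<lambda>F\<in>smooth_functions dual. v (\<lambda>z\<in>points M. F (z, \<tau> z))) (fun_mult dual F G) =
        (\<lambda>F\<in>smooth_functions dual. v (\<lambda>z\<in>points M. F (z, \<tau> z))) F * G (x, \<tau> x) +
        F (x, \<tau> x) * (\<lambda>F\<in>smooth_functions dual. v (\<lambda>z\<in>points M. F (z, \<tau> z))) G"
      using tangent_spaceD(3)[OF v p[OF F] p[OF G]] x by (simp only: restrict_apply dual_closed F G if_True e)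
  qed simp
qed

lemma zero_covector_smooth: "smooth_map M dual (\<lambda>x. (x, zero_covector x))"
proof (rule covector_section_smooth[OF zero_covector_in])
  show "smooth_in M (points M) (\<lambda>x. zero_covector x (X x))" if "X \<in> sections E" for X
    by (rule smooth_in_cong[OF base_atlas open_in_atlas_points[OF base_atlas] smooth_in_const[of _ _ 0]])
      (simp add: section_in_fibre[OF that])
qed

text \<open>The affine line through \<xi> in direction \<eta> inside one fibre. Its velocity at 0 is
  a tangent vector along the fibre; started at the zero covector, it is the ray through
  \<eta>.\<close>

definition line :: "'a \<Rightarrow> ('e \<Rightarrow> real) \<Rightarrow> ('e \<Rightarrow> real) \<Rightarrow> real \<Rightarrow> 'e \<Rightarrow> real"
  where "line x \<xi> \<eta> t = (\<lambda>e\<in>fibre E x. \<xi> e + t * \<eta> e)"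

lemma line_apply [simp]: "e \<in> fibre E x \<Longrightarrow> line x \<xi> \<eta> t e = \<xi> e + t * \<eta> e"
  by (simp add: line_def)

context
  fixes x \<xi> \<eta> assumes x: "x \<in> points M" and \<xi>: "\<xi> \<in> dual_space E x" and \<eta>: "\<eta> \<in> dual_space E x"
begin

lemma line_in: "line x \<xi> \<eta> t \<in> dual_space E x"
  by (rule dual_spaceI)
    (simp_all add: line_def x dual_spaceD(2,3)[OF \<xi>] dual_spaceD(2,3)[OF \<eta>] algebra_simps)

lemma line_0: "line x \<xi> \<eta> 0 = \<xi>"
  by (rule extensionalityI[of _ "fibre E x"]) (simp_all add: line_def dual_spaceD(1)[OF \<xi>])

lemma smooth_along_line:
  assumes F: "F \<in> smooth_functions dual"
  shows "smooth_on UNIV (\<lambda>t. F (x, line x \<xi> \<eta> t))"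
proof -
  obtain U \<phi> where c: "(U, \<phi>) \<in> M" "x \<in> U" using x by (rule pointsE)
  obtain V \<Psi> where t: "local_trivialization E V \<Psi>" "x \<in> V" using x by (rule trivE)
  let ?W = "SIGMA x:U \<inter> V. dual_space E x"
  note a = dual_atlasI[OF c(1) t(1)]
  have Fs: "smooth_on (dual_chart \<phi> \<Psi> ` ?W) (\<lambda>z. F (the_inv_into ?W (dual_chart \<phi> \<Psi>) z))"
    using smooth_inD[OF smooth_functionsD(2)[OF dual_smooth_atlas F chart_subset_points[OF a]] a] by simp
  \<comment> \<open>In a dual chart the line is straight and its base coordinate constant.\<close>
  let ?\<gamma> = "\<lambda>t. (\<phi> x, dual_components E \<Psi> x \<xi> + t *\<^sub>R dual_components E \<Psi> x \<eta>)"
  have dc: "dual_chart \<phi> \<Psi> (x, line x \<xi> \<eta> s) = ?\<gamma> s" for s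
    by (simp add: dual_components_def frame_in[OF t, unfolded frame_def] scaleR_add_left sum.distrib scaleR_sum_right)
  have mem: "(x, line x \<xi> \<eta> s) \<in> ?W" for s using c t line_in by simp
  have \<gamma>: "smooth_on UNIV ?\<gamma>"
    by (intro smooth_on_Pair smooth_on_add smooth_on_scaleR smooth_on_const smooth_on_id open_UNIV)
  have "?\<gamma> ` UNIV \<subseteq> dual_chart \<phi> \<Psi> ` ?W"
    unfolding dc[symmetric] using mem by blast
  then have "smooth_on UNIV (\<lambda>s. F (the_inv_into ?W (dual_chart \<phi> \<Psi>) (?\<gamma> s)))"
    by (rule smooth_on_compose[OF open_UNIV _ \<gamma> Fs])
  moreover have "the_inv_into ?W (dual_chart \<phi> \<Psi>) (?\<gamma> s) = (x, line x \<xi> \<eta> s)" for s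
    unfolding dc[symmetric] by (rule the_inv_into_chart[OF dual_smooth_atlas a mem])
  ultimately show ?thesis by simp
qed

lemma line_tangent:
  "(\<lambda>F\<in>smooth_functions dual. deriv (\<lambda>t. F (x, line x \<xi> \<eta> t)) 0) \<in> tangent_space dual (x, \<xi>)"
proof -
  have D: "((\<lambda>t. F (x, line x \<xi> \<eta> t)) has_real_derivative deriv (\<lambda>t. F (x, line x \<xi> \<eta> t)) 0) (at 0)"
    if "F \<in> smooth_functions dual" for F
  proof -
    have "(\<lambda>t. F (x, line x \<xi> \<eta> t)) differentiable (at 0)"
      using smooth_on_derivative[OF smooth_along_line[OF that], of 0] by (auto simp: differentiable_def)
    then show ?thesis using DERIV_deriv_iff_real_differentiable by blast
  qed
  note ap = dual_fun_apply[OF x line_in]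
  show ?thesis
  proof (rule tangent_spaceI)
    fix F G c assume F: "F \<in> smooth_functions dual"
    show "(\<lambda>F\<in>smooth_functions dual. deriv (\<lambda>t. F (x, line x \<xi> \<eta> t)) 0) (fun_scale dual c F) =
        c * (\<lambda>F\<in>smooth_functions dual. deriv (\<lambda>t. F (x, line x \<xi> \<eta> t)) 0) F"
      using DERIV_imp_deriv[OF DERIV_cmult[OF D[OF F], of c]] F by (simp add: ap dual_closed)
    assume G: "G \<in> smooth_functions dual"
    show "(\<lambda>F\<in>smooth_functions dual. deriv (\<lambda>t. F (x, line x \<xi> \<eta> t)) 0) (fun_add dual F G) =
        (\<lambda>F\<in>smooth_functions dual. deriv (\<lambda>t. F (x, line x \<xi> \<eta> t)) 0) F +
        (\<lambda>F\<in>smooth_functions dual. deriv (\<lambda>t. F (x, line x \<xi> \<eta> t)) 0) G"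
      using DERIV_imp_deriv[OF DERIV_add[OF D[OF F] D[OF G]]] F G by (simp add: ap dual_closed)
    show "(\<lambda>F\<in>smooth_functions dual. deriv (\<lambda>t. F (x, line x \<xi> \<eta> t)) 0) (fun_mult dual F G) =
        (\<lambda>F\<in>smooth_functions dual. deriv (\<lambda>t. F (x, line x \<xi> \<eta> t)) 0) F * G (x, \<xi>) +
        F (x, \<xi>) * (\<lambda>F\<in>smooth_functions dual. deriv (\<lambda>t. F (x, line x \<xi> \<eta> t)) 0) G"
      using DERIV_imp_deriv[OF DERIV_mult'[OF D[OF F] D[OF G]]] F G by (simp add: ap dual_closed line_0 algebra_simps)
  qed simp
qed

end

section \<open>Affine functions on the dual bundle\<close>

definition affine_function :: "('a \<Rightarrow> 'e) \<Rightarrow> ('a \<Rightarrow> real) \<Rightarrow> 'a \<times> ('e \<Rightarrow> real) \<Rightarrow> real"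
  where "affine_function X h = fun_add dual (vertical_function E X) (basic_function h)"

definition affine_functions :: "('a \<times> ('e \<Rightarrow> real) \<Rightarrow> real) set"
  where "affine_functions = {affine_function X h | X h. X \<in> sections E \<and> h \<in> smooth_functions M}"

lemma affine_apply:
  "x \<in> points M \<Longrightarrow> \<xi> \<in> dual_space E x \<Longrightarrow> affine_function X h (x, \<xi>) = \<xi> (X x) + h x"
  by (simp add: affine_function_def dual_fun_apply vertical_apply basic_apply)

lemma affine_smooth: "X \<in> sections E \<Longrightarrow> h \<in> smooth_functions M \<Longrightarrow> affine_function X h \<in> smooth_functions dual"
  unfolding affine_function_def by (intro dual_closed vertical_smooth basic_smooth)

lemma affine_functionsI: "X \<in> sections E \<Longrightarrow> h \<in> smooth_functions M \<Longrightarrow> affine_function X h \<in> affine_functions"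
  unfolding affine_functions_def by blast

lemma affine_functionsE:
  assumes "f \<in> affine_functions"
  obtains X h where "f = affine_function X h" "X \<in> sections E" "h \<in> smooth_functions M"
  using assms unfolding affine_functions_def by blast

text \<open>On the zero section only h survives; once the basic parts agree, covectors separate the
  sections.\<close>

lemma affine_inj:
  assumes X: "X \<in> sections E" "Y \<in> sections E" and h: "h \<in> smooth_functions M" "k \<in> smooth_functions M"
    and eq: "affine_function X h = affine_function Y k"
  shows "X = Y" "h = k"
proof -
  have e: "\<xi> (X x) + h x = \<xi> (Y x) + k x" if "x \<in> points M" "\<xi> \<in> dual_space E x" for x \<xi>
    using affine_apply[OF that, of X h] affine_apply[OF that, of Y k] eq by simp
  have hk: "h x = k x" if "x \<in> points M" for x
    using e[OF that zero_covector_in[OF that]] section_in_fibre[OF X(1) that] section_in_fibre[OF X(2) that] by simp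
  then show "h = k" by (rule smooth_functions_eqI[OF h])
  show "X = Y"
  proof (rule sections_eqI[OF X])
    fix x assume x: "x \<in> points M"
    show "X x = Y x"
      by (rule fibre_eqI[OF x section_in_fibre[OF X(1) x] section_in_fibre[OF X(2) x]])
        (use e[OF x] hk[OF x] in simp)
  qed
qed

lemma affine_eqs:
  assumes X: "X \<in> sections E" and h: "h \<in> smooth_functions M"
  shows "Y \<in> sections E \<Longrightarrow> k \<in> smooth_functions M \<Longrightarrow>
      fun_add dual (affine_function X h) (affine_function Y k) = affine_function (sec_add E X Y) (fun_add M h k)"
    "fun_scale dual c (affine_function X h) = affine_function (sec_scale E c X) (fun_scale M c h)"
    "vertical_function E X = affine_function X (fun_zero M)"
    "basic_function h = affine_function (sec_zero E) h"
    "fun_zero dual = affine_function (sec_zero E) (fun_zero M)"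
proof -
  show "fun_add dual (affine_function X h) (affine_function Y k) = affine_function (sec_add E X Y) (fun_add M h k)"
    if Y: "Y \<in> sections E" and k: "k \<in> smooth_functions M"
    by (rule dual_eqI[OF dual_closed(1)[OF affine_smooth[OF X h] affine_smooth[OF Y k]]
        affine_smooth[OF sec_add_in[OF X Y] base.smooth_fun_add[OF h k]]])
      (simp add: affine_apply dual_fun_apply dual_spaceD(2) section_in_fibre[OF X] section_in_fibre[OF Y])
  show "fun_scale dual c (affine_function X h) = affine_function (sec_scale E c X) (fun_scale M c h)"
    by (rule dual_eqI[OF dual_closed(3)[OF affine_smooth[OF X h]] affine_smooth[OF sec_scale_in[OF X] base.smooth_fun_scale[OF h]]])
      (simp add: affine_apply dual_fun_apply dual_spaceD(3) section_in_fibre[OF X] distrib_left)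
  show "vertical_function E X = affine_function X (fun_zero M)"
    by (rule dual_eqI[OF vertical_smooth[OF X] affine_smooth[OF X base.smooth_fun_zero]])
      (simp add: affine_apply vertical_apply)
  show "basic_function h = affine_function (sec_zero E) h"
    by (rule dual_eqI[OF basic_smooth[OF h] affine_smooth[OF sec_zero_in h]])
      (simp add: affine_apply basic_apply dual_space_zero)
  show "fun_zero dual = affine_function (sec_zero E) (fun_zero M)"
    by (rule dual_eqI[OF dual_closed(4) affine_smooth[OF sec_zero_in base.smooth_fun_zero]])
      (simp add: affine_apply dual_fun_apply dual_space_zero)
qed

text \<open>Base coordinates are basic functions and fibre coordinates are vertical ones, namely
  values on a frame. The cutoff is made on the base, so agreement with the chart holds on entire
  fibres over N.\<close>

lemma affine_coordinates:
  assumes p: "p \<in> points dual"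
  shows "\<exists>W \<kappa> S a. (W, \<kappa>) \<in> dual \<and> open_in_atlas dual S \<and> p \<in> S \<and> S \<subseteq> W \<and>
    (\<forall>b\<in>onb. a b \<in> affine_functions \<and> (\<forall>q\<in>S. a b q = \<kappa> q \<bullet> b))"
proof -
  have xM: "fst p \<in> points M" using p by (auto simp: points_dual)
  obtain U \<phi> where c: "(U, \<phi>) \<in> M" "fst p \<in> U" using xM by (rule pointsE)
  obtain V \<Psi> where t: "local_trivialization E V \<Psi>" "fst p \<in> V" using xM by (rule trivE)
  have o: "open_in_atlas M (U \<inter> V)"
    by (rule open_in_atlas_Int[OF base_atlas open_in_atlas_chart[OF base_atlas c(1)] triv_open[OF t(1)]])
  have sub: "U \<inter> V \<subseteq> V" and mem: "fst p \<in> U \<inter> V" using c t by auto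
  obtain N \<beta> where N: "fst p \<in> N" "cutoff M (U \<inter> V) N \<beta>"
    and s: "\<forall>w. local_section V \<Psi> (\<lambda>x. if x \<in> U \<inter> V then \<beta> x *\<^sub>R w else 0) \<in> sections E"
    "\<forall>z\<in>N. \<forall>w. local_section V \<Psi> (\<lambda>x. if x \<in> U \<inter> V then \<beta> x *\<^sub>R w else 0) z = frame \<Psi> z w"
    using local_section_frame_exists[OF t(1) o sub mem] by blast
  note N' = cutoffD[OF N(2)]
  define h where "h b = (\<lambda>x\<in>points M. if x \<in> U \<inter> V then \<beta> x *\<^sub>R (\<phi> x \<bullet> b) else 0)" for b
  have h: "h b \<in> smooth_functions M" for b
    unfolding h_def
    by (rule base.cutoff_function[OF N(2)], rule smooth_in_bounded_linear[OF o bounded_linear_inner_left],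
        rule smooth_in_subset[OF smooth_in_chart[OF base_atlas c(1)]]) blast
  \<comment> \<open>An element of the orthonormal basis of the product may have two nonzero
    components; a single affine function accounts for both.\<close>
  define a where "a b = affine_function (local_section V \<Psi> (\<lambda>x. if x \<in> U \<inter> V then \<beta> x *\<^sub>R snd b else 0)) (h (fst b))" for b
  have a: "a b \<in> affine_functions" for b
    unfolding a_def by (rule affine_functionsI) (use s(1) h in auto)
  have val: "a b q = dual_chart \<phi> \<Psi> q \<bullet> b" if q: "q \<in> (SIGMA x:N. dual_space E x)" for b q
  proof -
    obtain x \<xi> where x: "q = (x, \<xi>)" "x \<in> N" "\<xi> \<in> dual_space E x" using q by auto
    have xx: "x \<in> U" "x \<in> V" "x \<in> points M" using N'(4) x(2) triv_subset[OF t(1)] by blast+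
    have "a b q = \<xi> (frame \<Psi> x (snd b)) + \<phi> x \<bullet> fst b"
      using s(2) x(2) xx N'(5)[OF x(2)] by (simp add: a_def x(1) affine_apply[OF xx(3) x(3)] h_def)
    also have "\<xi> (frame \<Psi> x (snd b)) = snd b \<bullet> dual_components E \<Psi> x \<xi>"
      using dual_components_pairing[OF t(1) xx(2) x(3) frame_in[OF t(1) xx(2)]] triv_frame[OF t(1) xx(2)] by simp
    finally show ?thesis by (simp add: x(1) inner_prod_def inner_commute)
  qed
  have "p \<in> (SIGMA x:N. dual_space E x)" using p N(1) by (auto simp: points_dual)
  moreover have "(SIGMA x:N. dual_space E x) \<subseteq> (SIGMA x:U \<inter> V. dual_space E x)" using N'(4) by blast
  ultimately show ?thesis
    using dual_atlasI[OF c(1) t(1)] dual_restriction_open[OF N'(3)] a val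
    by (intro exI[of _ "SIGMA x:U \<inter> V. dual_space E x"] exI[of _ "dual_chart \<phi> \<Psi>"]
        exI[of _ "SIGMA x:N. dual_space E x"] exI[of _ a]) simp
qed

sublocale affine: coordinate_functions "dual_atlas E" affine_functions
proof unfold_locales
  note zero = base.smooth_fun_zero
  show "f \<in> smooth_functions dual" if "f \<in> affine_functions" for f
    using that by (rule affine_functionsE) (simp add: affine_smooth)
  show "fun_zero dual \<in> affine_functions"
    unfolding affine_eqs(5)[OF sec_zero_in zero] by (rule affine_functionsI[OF sec_zero_in zero])
  show "fun_add dual f g \<in> affine_functions" if f: "f \<in> affine_functions" and g: "g \<in> affine_functions" for f g
  proof -
    obtain X h where 1: "f = affine_function X h" "X \<in> sections E" "h \<in> smooth_functions M" using f by (rule affine_functionsE)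
    obtain Y k where 2: "g = affine_function Y k" "Y \<in> sections E" "k \<in> smooth_functions M" using g by (rule affine_functionsE)
    show ?thesis unfolding 1(1) 2(1) affine_eqs(1)[OF 1(2,3) 2(2,3)]
      by (intro affine_functionsI sec_add_in base.smooth_fun_add 1 2)
  qed
  show "fun_scale dual c f \<in> affine_functions" if f: "f \<in> affine_functions" for f c
  proof -
    obtain X h where 1: "f = affine_function X h" "X \<in> sections E" "h \<in> smooth_functions M" using f by (rule affine_functionsE)
    show ?thesis unfolding 1(1) affine_eqs(2)[OF 1(2,3)]
      by (intro affine_functionsI sec_scale_in base.smooth_fun_scale 1)
  qed
qed (rule affine_coordinates)

end

section \<open>The Poisson structure of a Lie algebroid\<close>

lemma tangent_atlasE:
  assumes "(W, \<kappa>) \<in> tangent_atlas A"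
  obtains U \<phi> where "(U, \<phi>) \<in> A" "W = (SIGMA x:U. tangent_space A x)"
    "\<kappa> = (\<lambda>(x, v). (\<phi> x, tangent_components A (U, \<phi>) x v))"
proof -
  have "\<exists>U \<phi>. (W, \<kappa>) = (SIGMA x:U. tangent_space A x, \<lambda>(x, v). (\<phi> x, tangent_components A (U, \<phi>) x v)) \<and> (U, \<phi>) \<in> A"
    using assms unfolding tangent_atlas_def by (rule CollectD)
  then obtain U \<phi> where e: "(W, \<kappa>) = (SIGMA x:U. tangent_space A x, \<lambda>(x, v). (\<phi> x, tangent_components A (U, \<phi>) x v))"
    and c: "(U, \<phi>) \<in> A" by (elim exE conjE)
  show ?thesis by (rule that[OF c]) (use e in simp_all)
qed

lemma points_tangent_atlasD:
  assumes "p \<in> points (tangent_atlas A)"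
  shows "fst p \<in> points A" "snd p \<in> tangent_space A (fst p)"
proof -
  obtain W \<kappa> where w: "(W, \<kappa>) \<in> tangent_atlas A" "p \<in> W" using assms by (rule pointsE)
  obtain U \<phi> where c: "(U, \<phi>) \<in> A" and e: "W = (SIGMA x:U. tangent_space A x)"
    using w(1) by (rule tangent_atlasE)
  have "p \<in> (SIGMA x:U. tangent_space A x)" using e w(2) by simp
  then show "fst p \<in> points A" "snd p \<in> tangent_space A (fst p)" using chart_subset_points[OF c] by auto
qed

lemma tangent_atlasI:
  "(U, \<phi>) \<in> A \<Longrightarrow> (SIGMA x:U. tangent_space A x, \<lambda>(x, v). (\<phi> x, tangent_components A (U, \<phi>) x v)) \<in> tangent_atlas A"
  unfolding tangent_atlas_def by (rule CollectI, rule exI[of _ U], rule exI[of _ \<phi>]) simp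

context smooth_bundle
begin

definition anchored_derivative :: "('e \<Rightarrow> 'a \<times> (('a \<Rightarrow> real) \<Rightarrow> real)) \<Rightarrow> ('a \<Rightarrow> 'e) \<Rightarrow> ('a \<Rightarrow> real) \<Rightarrow> 'a \<Rightarrow> real"
  where "anchored_derivative \<rho> X f = lie_derivative M (\<rho> \<circ> X) f"

lemma anchored_derivative_apply: "x \<in> points M \<Longrightarrow> anchored_derivative \<rho> X f x = snd (\<rho> (X x)) f"
  by (simp add: anchored_derivative_def lie_derivative_def)

lemma sections_pairing_eqI:
  assumes "X \<in> sections E" "Y \<in> sections E"
    and "\<And>x \<xi>. x \<in> points M \<Longrightarrow> \<xi> \<in> dual_space E x \<Longrightarrow> \<xi> (X x) = \<xi> (Y x)"
  shows "X = Y"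
  by (rule sections_eqI[OF assms(1,2)], rule fibre_eqI)
    (use assms section_in_fibre in auto)

text \<open>This fails in rank 0.\<close>

lemma nonvanishing_pairing:
  assumes x: "x \<in> points M"
  shows "\<exists>Z\<in>sections E. \<exists>\<xi>\<in>dual_space E x. \<xi> (Z x) = 1"
proof -
  obtain V \<Psi> where t: "local_trivialization E V \<Psi>" "x \<in> V" using x by (rule trivE)
  obtain b :: 'f where b: "b \<in> Basis" using nonempty_Basis by blast
  obtain Z where Z: "Z \<in> sections E" "Z x = frame \<Psi> x b" using section_through[OF frame_in[OF t] x] by blast
  have "coframe \<Psi> x b (Z x) = 1"
    using Z(2) frame_in[OF t] triv_frame[OF t] b by simp
  then show ?thesis using Z(1) coframe_in[OF t] by blast
qed

context
  fixes br \<rho> assumes algebroid: "lie_algebroid E br \<rho>"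
begin

private abbreviation "D \<equiv> anchored_derivative \<rho>"

lemma lie_bracket: "lie_bracket_on (sections E) (sec_add E) (sec_scale E) (sec_zero E) br"
  and anchor_extensional: "\<rho> \<in> extensional (points tot)"
  and anchor_map: "vector_bundle_map E (tangent_bundle M) \<rho>"
  and leibniz: "X \<in> sections E \<Longrightarrow> Y \<in> sections E \<Longrightarrow> f \<in> smooth_functions M \<Longrightarrow>
    br X (sec_mult E f Y) = sec_add E (sec_mult E f (br X Y)) (sec_mult E (D X f) Y)"
  using algebroid by (simp_all add: lie_algebroid_def anchored_derivative_def)

lemma bracket_in: "X \<in> sections E \<Longrightarrow> Y \<in> sections E \<Longrightarrow> br X Y \<in> sections E"
  by (rule PiE_mem[OF PiE_mem[OF conjunct1[OF lie_bracket[unfolded lie_bracket_on_def]]]])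

lemma bracket_eqs:
  assumes X: "X \<in> sections E" and Y: "Y \<in> sections E"
  shows "Z \<in> sections E \<Longrightarrow> br (sec_add E X Y) Z = sec_add E (br X Z) (br Y Z)"
    "Z \<in> sections E \<Longrightarrow> br Z (sec_add E X Y) = sec_add E (br Z X) (br Z Y)"
    "br (sec_scale E c X) Y = sec_scale E c (br X Y)" "br Y (sec_scale E c X) = sec_scale E c (br Y X)"
    "br X X = sec_zero E"
    "Z \<in> sections E \<Longrightarrow> sec_add E (sec_add E (br X (br Y Z)) (br Y (br Z X))) (br Z (br X Y)) = sec_zero E"
  using lie_bracket X Y unfolding lie_bracket_on_def by blast+

lemma anchor_tangent:
  assumes x: "x \<in> points M" and u: "u \<in> fibre E x"
  shows "fst (\<rho> u) = x" "snd (\<rho> u) \<in> tangent_space M x"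
proof -
  have "smooth_map tot (tangent_atlas M) \<rho>" "projection (tangent_bundle M) (\<rho> u) = projection E u"
    using anchor_map fibreD(1)[OF u] by (simp_all add: vector_bundle_map_def tangent_bundle_def)
  then have 1: "\<rho> u \<in> points (tangent_atlas M)" and 2: "fst (\<rho> u) = x"
    using smooth_map_points[OF _ fibreD(1)[OF u]] fibreD(2)[OF u] by (simp_all add: tangent_bundle_def)
  show "fst (\<rho> u) = x" by (rule 2)
  show "snd (\<rho> u) \<in> tangent_space M x" using points_tangent_atlasD(2)[OF 1] 2 by simp
qed

lemma anchor_linear:
  assumes x: "x \<in> points M" and u: "u \<in> fibre E x" and f: "f \<in> smooth_functions M"
  shows "v \<in> fibre E x \<Longrightarrow> snd (\<rho> (vadd E u v)) f = snd (\<rho> u) f + snd (\<rho> v) f"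
    "snd (\<rho> (vscale E c u)) f = c * snd (\<rho> u) f"
proof -
  have "\<rho> (vscale E c u) = vscale (tangent_bundle M) c (\<rho> u)"
    using anchor_map x u unfolding vector_bundle_map_def by blast
  then show "snd (\<rho> (vscale E c u)) f = c * snd (\<rho> u) f"
    using f by (cases "\<rho> u") (simp add: tangent_bundle_def)
  show "snd (\<rho> (vadd E u v)) f = snd (\<rho> u) f + snd (\<rho> v) f" if v: "v \<in> fibre E x"
  proof -
    have "\<rho> (vadd E u v) = vadd (tangent_bundle M) (\<rho> u) (\<rho> v)"
      using anchor_map x u v unfolding vector_bundle_map_def by blast
    then show ?thesis using f by (cases "\<rho> u"; cases "\<rho> v") (simp add: tangent_bundle_def)
  qed
qed

text \<open>A chart of the tangent bundle turns the anchored section into a smooth field of tangent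
  components, along which f is differentiated in coordinates.\<close>

lemma anchored_derivative_smooth:
  assumes X: "X \<in> sections E" and f: "f \<in> smooth_functions M"
  shows "D X f \<in> smooth_functions M"
proof -
  have "smooth_map tot (tangent_atlas M) \<rho>"
    using anchor_map by (simp add: vector_bundle_map_def tangent_bundle_def)
  moreover have "smooth_map M tot X" using X by (simp add: sections_def)
  ultimately have sm: "smooth_map M (tangent_atlas M) (\<lambda>x. \<rho> (X x))"
    using smooth_map_compose[OF base_atlas total_atlas] by blast
  have "smooth_in M (points M) (D X f)"
  proof (rule smooth_in_local)
    fix x assume "x \<in> points M"
    then obtain U \<phi> where c: "(U, \<phi>) \<in> M" "x \<in> U" by (rule pointsE)
    let ?W = "SIGMA x:U. tangent_space M x"
    let ?k = "\<lambda>(x, v). (\<phi> x, tangent_components M (U, \<phi>) x v)"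
    have UM: "U \<subseteq> points M" by (rule chart_subset_points[OF c(1)])
    note o = open_in_atlas_chart[OF base_atlas c(1)]
    have mem: "\<rho> (X z) = (z, snd (\<rho> (X z)))" "snd (\<rho> (X z)) \<in> tangent_space M z" if "z \<in> U" for z
    proof -
      have zM: "z \<in> points M" using that UM by blast
      show "\<rho> (X z) = (z, snd (\<rho> (X z)))" "snd (\<rho> (X z)) \<in> tangent_space M z"
        using anchor_tangent[OF zM section_in_fibre[OF X zM]] by (simp_all add: prod_eq_iff)
    qed
    have "smooth_in M (points M \<inter> (\<lambda>x. \<rho> (X x)) -` ?W) (\<lambda>x. ?k (\<rho> (X x)))"
      by (rule smooth_map_chart(2)[OF base_atlas sm tangent_atlasI[OF c(1)]])
    moreover have "U \<subseteq> points M \<inter> (\<lambda>x. \<rho> (X x)) -` ?W"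
    proof
      fix z assume z: "z \<in> U"
      have "\<rho> (X z) \<in> ?W" by (subst mem(1)[OF z]) (use z mem(2)[OF z] in simp)
      then show "z \<in> points M \<inter> (\<lambda>x. \<rho> (X x)) -` ?W" using z UM by blast
    qed
    ultimately have "smooth_in M U (\<lambda>x. ?k (\<rho> (X x)))" by (rule smooth_in_subset)
    then have "smooth_in M U (\<lambda>x. snd (?k (\<rho> (X x))))"
      by (rule smooth_in_bounded_linear[OF o bounded_linear_snd])
    then have "smooth_in M U (\<lambda>z. frechet_derivative (f \<circ> the_inv_into U \<phi>) (at (\<phi> z)) (snd (?k (\<rho> (X z)))))"
      by (rule base.smooth_in_directional_derivative[OF c(1) o subset_refl _ f])
    then have "smooth_in M U (D X f)"
    proof (rule smooth_in_cong[OF base_atlas o])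
      fix z assume z: "z \<in> U"
      have "snd (?k (\<rho> (X z))) = tangent_components M (U, \<phi>) z (snd (\<rho> (X z)))"
        by (subst mem(1)[OF z]) simp
      then show "frechet_derivative (f \<circ> the_inv_into U \<phi>) (at (\<phi> z)) (snd (?k (\<rho> (X z)))) = D X f z"
        using base.tangent_components_apply[OF c(1) z mem(2)[OF z] f] anchored_derivative_apply z UM by auto
    qed
    then show "\<exists>T. open_in_atlas M T \<and> x \<in> T \<and> smooth_in M T (D X f)" using o c(2) by blast
  qed
  then show ?thesis
    using smooth_functions_iff[OF base_atlas] by (simp add: anchored_derivative_def lie_derivative_def)
qed

lemma anchored_derivative_eqs:
  assumes x: "x \<in> points M" and X: "X \<in> sections E" and f: "f \<in> smooth_functions M"
  shows "Y \<in> sections E \<Longrightarrow> D (sec_add E X Y) f x = D X f x + D Y f x" "D (sec_scale E c X) f x = c * D X f x"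
    "g \<in> smooth_functions M \<Longrightarrow> D X (fun_add M f g) x = D X f x + D X g x" "D X (fun_scale M c f) x = c * D X f x"
    "D X (fun_zero M) x = 0"
proof -
  note F = section_in_fibre[OF _ x] and a = anchored_derivative_apply[OF x]
  have v: "snd (\<rho> (X x)) \<in> tangent_space M x" by (rule anchor_tangent(2)[OF x F[OF X]])
  show "Y \<in> sections E \<Longrightarrow> D (sec_add E X Y) f x = D X f x + D Y f x"
    using anchor_linear(1)[OF x F[OF X] f] F x by (simp add: a)
  show "D (sec_scale E c X) f x = c * D X f x" using anchor_linear(2)[OF x F[OF X] f] x by (simp add: a)
  show "g \<in> smooth_functions M \<Longrightarrow> D X (fun_add M f g) x = D X f x + D X g x"
    using tangent_spaceD(1)[OF v f] by (simp add: a)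
  show "D X (fun_scale M c f) x = c * D X f x" using tangent_spaceD(2)[OF v f] by (simp add: a)
  show "D X (fun_zero M) x = 0" using tangent_const[OF base_atlas v x, of 0] by (simp add: a fun_zero_def)
qed

declare sec_apply [simp del]

section \<open>Algebroid identities paired with a covector\<close>

context
  fixes x \<xi> assumes x: "x \<in> points M" and \<xi>: "\<xi> \<in> dual_space E x"
begin

text \<open>Pairing with a fixed covector turns identities in a fibre into identities of real
  numbers. As simplification rules these must see the section operations unevaluated, which is why
  \<open>sec_apply\<close> has just left the simpset.\<close>

lemma pairing_eqs:
  assumes "X \<in> sections E"
  shows "Y \<in> sections E \<Longrightarrow> \<xi> (sec_add E X Y x) = \<xi> (X x) + \<xi> (Y x)" "\<xi> (sec_scale E c X x) = c * \<xi> (X x)"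
    "\<xi> (sec_mult E f X x) = f x * \<xi> (X x)" "\<xi> (sec_zero E x) = 0"
  using x dual_spaceD(2,3)[OF \<xi>] section_in_fibre[OF assms x] section_in_fibre[OF _ x] dual_space_zero[OF x \<xi>]
  by (simp_all add: sec_apply)

lemma pairing_bracket_antisym:
  assumes X: "X \<in> sections E" and Y: "Y \<in> sections E"
  shows "\<xi> (br Y X x) = - \<xi> (br X Y x)"
proof -
  note XY = sec_add_in[OF X Y]
  have "\<xi> (br (sec_add E X Y) (sec_add E X Y) x) = 0" using bracket_eqs(5)[OF XY XY] pairing_eqs(4)[OF X] by simp
  moreover have "br (sec_add E X Y) (sec_add E X Y) =
      sec_add E (sec_add E (br X X) (br X Y)) (sec_add E (br Y X) (br Y Y))"
    by (simp only: bracket_eqs(1)[OF X Y XY] bracket_eqs(2)[OF X Y X] bracket_eqs(2)[OF X Y Y])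
  moreover have "\<xi> (br X X x) = 0" "\<xi> (br Y Y x) = 0"
    using bracket_eqs(5)[OF X X] bracket_eqs(5)[OF Y Y] pairing_eqs(4)[OF X] by simp_all
  ultimately show ?thesis by (simp add: pairing_eqs(1) bracket_in X Y sec_add_in)
qed

lemma pairing_leibniz:
  assumes X: "X \<in> sections E" and Y: "Y \<in> sections E" and f: "f \<in> smooth_functions M"
  shows "\<xi> (br X (sec_mult E f Y) x) = f x * \<xi> (br X Y x) + D X f x * \<xi> (Y x)"
  unfolding leibniz[OF X Y f]
  by (simp add: pairing_eqs(1,3) sec_mult_in bracket_in X Y f anchored_derivative_smooth)

lemma pairing_jacobi:
  assumes X: "X \<in> sections E" and Y: "Y \<in> sections E" and Z: "Z \<in> sections E"
  shows "\<xi> (br X (br Y Z) x) + \<xi> (br Y (br Z X) x) + \<xi> (br Z (br X Y) x) = 0"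
proof -
  have "\<xi> (sec_add E (sec_add E (br X (br Y Z)) (br Y (br Z X))) (br Z (br X Y)) x) = 0"
    unfolding bracket_eqs(6)[OF X Y Z] by (rule pairing_eqs(4)[OF X])
  then show ?thesis by (simp add: pairing_eqs(1) bracket_in X Y Z sec_add_in)
qed

end

lemma bracket_antisym:
  assumes X: "X \<in> sections E" and Y: "Y \<in> sections E"
  shows "br Y X = sec_scale E (-1) (br X Y)"
  by (rule sections_pairing_eqI[OF bracket_in[OF Y X] sec_scale_in[OF bracket_in[OF X Y]]])
    (simp add: pairing_bracket_antisym[OF _ _ X Y] pairing_eqs(2)[OF _ _ bracket_in[OF X Y]])

text \<open>Expand the Jacobi identity for X, Y and fZ by the Leibniz rule and remove f times the
  Jacobi identity for X, Y and Z. The mixed terms cancel, and the asserted difference remains as a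
  factor of Z. Positive rank permits a choice of Z and \<xi> with \<xi> (Z x) = 1.\<close>

lemma anchor_bracket:
  assumes x: "x \<in> points M" and X: "X \<in> sections E" and Y: "Y \<in> sections E" and f: "f \<in> smooth_functions M"
  shows "D (br X Y) f x = D X (D Y f) x - D Y (D X f) x"
proof -
  obtain Z \<xi> where Z: "Z \<in> sections E" and \<xi>: "\<xi> \<in> dual_space E x" and Z1: "\<xi> (Z x) = 1"
    using nonvanishing_pairing[OF x] by blast
  note p = pairing_eqs[OF x \<xi>] pairing_leibniz[OF x \<xi>] and anti = pairing_bracket_antisym[OF x \<xi>]
  note cl = bracket_in sec_mult_in sec_add_in anchored_derivative_smooth X Y Z f
  \<comment> \<open>Two applications of the Leibniz rule. The two mixed terms are together symmetric
    in A and B, so they drop out of the commutator.\<close>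
  have second: "\<xi> (br A (br B (sec_mult E f Z)) x) =
      f x * \<xi> (br A (br B Z) x) + D A f x * \<xi> (br B Z x) + D B f x * \<xi> (br A Z x) + D A (D B f) x"
    if A: "A \<in> sections E" and B: "B \<in> sections E" for A B
  proof -
    have "br A (br B (sec_mult E f Z)) = sec_add E (br A (sec_mult E f (br B Z))) (br A (sec_mult E (D B f) Z))"
      unfolding leibniz[OF B Z f] by (rule bracket_eqs(2)) (intro cl A B)+
    then show ?thesis by (simp add: p cl A B Z1)
  qed
  have "\<xi> (br X (br Y (sec_mult E f Z)) x) + \<xi> (br Y (br (sec_mult E f Z) X) x) + \<xi> (br (sec_mult E f Z) (br X Y) x) = 0"
    by (rule pairing_jacobi[OF x \<xi>]) (intro cl)+
  moreover have "\<xi> (br Y (br (sec_mult E f Z) X) x) = - \<xi> (br Y (br X (sec_mult E f Z)) x)"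
  proof -
    have "br (sec_mult E f Z) X = sec_scale E (-1) (br X (sec_mult E f Z))"
      by (rule bracket_antisym[OF X sec_mult_in[OF f Z]])
    then show ?thesis
      using bracket_eqs(4)[OF bracket_in[OF X sec_mult_in[OF f Z]] Y, of "-1"]
        p(2)[OF bracket_in[OF Y bracket_in[OF X sec_mult_in[OF f Z]]], of "-1"] by simp
  qed
  moreover have "\<xi> (br (sec_mult E f Z) (br X Y) x) = - (f x * \<xi> (br (br X Y) Z x) + D (br X Y) f x)"
    using anti[OF bracket_in[OF X Y] sec_mult_in[OF f Z]] p(5)[OF bracket_in[OF X Y] Z f] Z1 by simp
  moreover have "\<xi> (br X (br Y Z) x) - \<xi> (br Y (br X Z) x) - \<xi> (br (br X Y) Z x) = 0"
  proof -
    have "br Z X = sec_scale E (-1) (br X Z)" by (rule bracket_antisym[OF X Z])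
    then have "\<xi> (br Y (br Z X) x) = - \<xi> (br Y (br X Z) x)"
      using bracket_eqs(4)[OF bracket_in[OF X Z] Y, of "-1"] p(2)[OF bracket_in[OF Y bracket_in[OF X Z]], of "-1"] by simp
    then show ?thesis using pairing_jacobi[OF x \<xi> X Y Z] anti[OF bracket_in[OF X Y] Z] by simp
  qed
  \<comment> \<open>This multiple of the Jacobi identity for X, Y and Z is to be subtracted from the
    one for X, Y and fZ.\<close>
  then have "f x * \<xi> (br X (br Y Z) x) - f x * \<xi> (br Y (br X Z) x) - f x * \<xi> (br (br X Y) Z x) = 0"
    by (metis mult_zero_right right_diff_distrib)
  ultimately show ?thesis using second[OF X Y] second[OF Y X] by (simp add: distrib_left)
qed

text \<open>The hypothesis forces \<open>X\<close> to vanish at \<open>x\<close>, and, with \<open>\<tau>\<close> a covector field through \<open>\<xi>\<close> that is constant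
  in a local frame, it says that \<open>\<langle>\<tau>, X\<rangle> + h\<close> has zero differential at \<open>x\<close>.\<close>

lemma bracket_first_order:
  assumes x: "x \<in> points M" and \<xi>: "\<xi> \<in> dual_space E x"
    and X: "X \<in> sections E" and h: "h \<in> smooth_functions M" and Y: "Y \<in> sections E" and k: "k \<in> smooth_functions M"
    and zero: "\<And>v. v \<in> tangent_space dual (x, \<xi>) \<Longrightarrow> v (affine_function X h) = 0"
  shows "\<xi> (br X Y x) + D X k x - D Y h x = 0"
proof -
  note a = affine_smooth[OF X h]
  have Xx: "X x = vzero E x"
  proof (rule fibre_eqI[OF x section_in_fibre[OF X x] vzero_in[OF x]])
    fix \<eta> assume \<eta>: "\<eta> \<in> dual_space E x"
    \<comment> \<open>Directions along the fibre detect the value of X at x.\<close>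
    have "deriv (\<lambda>t. affine_function X h (x, line x \<xi> \<eta> t)) 0 = 0"
      using zero[OF line_tangent[OF x \<xi> \<eta>]] a by simp
    moreover have "(\<lambda>t. affine_function X h (x, line x \<xi> \<eta> t)) = (\<lambda>t. \<xi> (X x) + t * \<eta> (X x) + h x)"
      by (simp add: affine_apply[OF x line_in[OF x \<xi> \<eta>]] section_in_fibre[OF X x])
    moreover have "deriv (\<lambda>t. \<xi> (X x) + t * \<eta> (X x) + h x) 0 = \<eta> (X x)"
      by (rule DERIV_imp_deriv) (auto intro!: derivative_eq_intros)
    ultimately show "\<eta> (X x) = \<eta> (vzero E x)" using dual_space_zero[OF x \<eta>] by simp
  qed
  then have \<xi>X: "\<xi> (X x) = 0" using dual_space_zero[OF x \<xi>] by simp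
  have DX: "D X k x = 0"
    using anchor_linear(2)[OF x vzero_in[OF x] k, of 0] fibre_unit_laws(2)[OF x vzero_in[OF x]] Xx
    by (simp add: anchored_derivative_apply[OF x])
  obtain V \<Psi> where t: "local_trivialization E V \<Psi>" "x \<in> V" using x by (rule trivE)
  note o = triv_open[OF t(1)]
  obtain N \<beta> where N: "x \<in> N" "cutoff M V N \<beta>"
    using cutoff_exists[OF base_atlas base_hausdorff o t(2)] by blast
  note \<beta> = cutoffD(1)[OF N(2)]
  have \<beta>x: "\<beta> x = 1" using cutoffD(5)[OF N(2,1)] .
  define \<eta> where "\<eta> = dual_components E \<Psi> x \<xi>"
  define \<tau> where "\<tau> z = (\<lambda>e\<in>fibre E z. if z \<in> V then \<beta> z *\<^sub>R (\<Psi> e \<bullet> \<eta>) else 0)" for z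
  have \<tau>in: "\<tau> z \<in> dual_space E z" if "z \<in> points M" for z
    by (rule dual_spaceI)
      (use that in \<open>simp_all add: \<tau>_def triv_add[OF t(1)] triv_scale[OF t(1)] inner_add_left algebra_simps\<close>)
  have \<tau>s: "smooth_in M (points M) (\<lambda>z. \<tau> z (Z z))" if Z: "Z \<in> sections E" for Z
    by (rule smooth_in_cong[OF base_atlas open_in_atlas_points[OF base_atlas]
          smooth_in_cutoff[OF base_atlas N(2) smooth_in_inner[OF o section_smooth[OF t(1) Z] smooth_in_const[of _ _ \<eta>]]]])
      (simp add: \<tau>_def section_in_fibre[OF Z])
  have \<tau>x: "\<tau> x = \<xi>"
    by (rule extensionalityI[of _ "fibre E x"])
      (simp_all add: \<tau>_def t(2) \<beta>x dual_spaceD(1)[OF \<xi>] dual_components_pairing[OF t \<xi>] \<eta>_def)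
  note \<tau>m = covector_section_smooth[OF \<tau>in \<tau>s]
  define v where "v = snd (\<rho> (Y x))"
  have v: "v \<in> tangent_space M x" unfolding v_def by (rule anchor_tangent(2)[OF x section_in_fibre[OF Y x]])
  have Dv: "D Y f x = v f" for f by (simp add: anchored_derivative_apply[OF x] v_def)
  define q where "q = (\<lambda>z\<in>points M. \<tau> z (X z))"
  have q: "q \<in> smooth_functions M" unfolding q_def by (rule smooth_functions_restrictI[OF base_atlas \<tau>s[OF X]])
  have "v (\<lambda>z\<in>points M. affine_function X h (z, \<tau> z)) = 0"
    using zero[OF pullback_tangent[OF \<tau>m v x, unfolded \<tau>x]] a by simp
  moreover have "(\<lambda>z\<in>points M. affine_function X h (z, \<tau> z)) = fun_add M q h"
    by (simp add: fun_add_def q_def affine_apply \<tau>in restrict_def fun_eq_iff)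
  ultimately have vq: "v q + v h = 0" using tangent_spaceD(1)[OF v q h] by simp
  define c where "c b = (\<lambda>x\<in>points M. if x \<in> V then \<beta> x *\<^sub>R (\<Psi> (X x) \<bullet> b) else 0)" for b
  define e where "e b = local_section V \<Psi> (\<lambda>x. if x \<in> V then \<beta> x *\<^sub>R b else 0)" for b
  have c: "c b \<in> smooth_functions M" for b
    unfolding c_def by (rule base.cutoff_function[OF N(2)])
      (rule smooth_in_inner[OF o section_smooth[OF t(1) X] smooth_in_const])
  have e: "e b \<in> sections E" for b
    unfolding e_def by (rule local_section_in[OF t(1) supported_in_cutoff[OF N(2) subset_refl smooth_in_const]])
  have cx: "c b x = 0" for b using x t(2) Xx triv_zero[OF t] by (simp add: c_def)
  have ex: "\<xi> (e b x) = b \<bullet> \<eta>" for b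
    unfolding \<eta>_def
    using dual_components_pairing[OF t \<xi> frame_in[OF t]] triv_frame[OF t] t(2)
    by (simp add: e_def local_section_apply[OF t(1,2)] \<beta>x)
  let ?T = "\<lambda>Z. \<xi> (br Y Z x)"
  have "?T (sec_mult E \<beta> (sec_mult E \<beta> X)) = (\<Sum>b\<in>Basis. ?T (sec_mult E (c b) (e b)))"
    unfolding c_def e_def
    by (rule frame_expansion[OF t(1) N(2) X])
      (simp add: bracket_eqs(2)[OF _ _ Y] pairing_eqs(1)[OF x \<xi>] bracket_in Y)
  \<comment> \<open>The terms in which \<beta> is differentiated carry the factor \<xi> (X x) = 0,
    and \<beta> x = 1 in the remaining one.\<close>
  moreover have "?T (sec_mult E \<beta> (sec_mult E \<beta> X)) = ?T X"
    by (simp add: pairing_leibniz[OF x \<xi>] pairing_eqs(3)[OF x \<xi>] sec_mult_in \<beta> X Y \<beta>x \<xi>X)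
  \<comment> \<open>As \<open>c b\<close> vanishes at x, only the derivative term of the Leibniz
    rule is left; the unknown bracket of Y with the frame disappears.\<close>
  moreover have "?T (sec_mult E (c b) (e b)) = v (c b) * (b \<bullet> \<eta>)" for b
    by (simp add: pairing_leibniz[OF x \<xi> Y e c] cx ex Dv)
  moreover have "v q = (\<Sum>b\<in>Basis. v (c b) * (b \<bullet> \<eta>))"
  proof -
    have "q = (\<lambda>z\<in>points M. \<Sum>b\<in>Basis. fun_scale M (b \<bullet> \<eta>) (c b) z)"
    proof (rule smooth_functions_eqI[OF q base.smooth_fun_sum[OF base.smooth_fun_scale[OF c]]])
      fix z assume z: "z \<in> points M"
      show "q z = (\<lambda>z\<in>points M. \<Sum>b\<in>Basis. fun_scale M (b \<bullet> \<eta>) (c b) z) z"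
      proof (cases "z \<in> V")
        case True
        have "\<Psi> (X z) \<bullet> \<eta> = (\<Sum>b\<in>Basis. (b \<bullet> \<eta>) * (\<Psi> (X z) \<bullet> b))"
          by (subst euclidean_inner) (simp add: inner_commute mult.commute)
        then show ?thesis using z True by (simp add: q_def \<tau>_def section_in_fibre[OF X] c_def sum_distrib_left mult_ac)
      qed (simp add: z q_def \<tau>_def section_in_fibre[OF X] c_def)
    qed
    then have "v q = (\<Sum>b\<in>Basis. v (fun_scale M (b \<bullet> \<eta>) (c b)))"
      using tangent_sum[OF base_atlas v x finite_Basis, of "\<lambda>b. fun_scale M (b \<bullet> \<eta>) (c b)"] base.smooth_fun_scale[OF c] by simp
    then show ?thesis using tangent_spaceD(2)[OF v c] by (simp add: mult.commute)
  qed
  ultimately have "\<xi> (br Y X x) = v q" by simp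
  \<comment> \<open>Directions along \<tau> gave v q + v h = 0, so \<xi> (br X Y x) = - v q = v h,
    which is the derivative of h along Y.\<close>
  then show ?thesis using pairing_bracket_antisym[OF x \<xi> Y X] vq DX Dv by simp
qed

section \<open>The Lie bracket on affine functions\<close>

definition affine_parts :: "('a \<times> ('e \<Rightarrow> real) \<Rightarrow> real) \<Rightarrow> ('a \<Rightarrow> 'e) \<times> ('a \<Rightarrow> real)"
  where "affine_parts f = (SOME p. fst p \<in> sections E \<and> snd p \<in> smooth_functions M \<and> f = affine_function (fst p) (snd p))"

lemma affine_parts_affine:
  assumes X: "X \<in> sections E" and h: "h \<in> smooth_functions M"
  shows "affine_parts (affine_function X h) = (X, h)"
proof -
  let ?Q = "\<lambda>p. fst p \<in> sections E \<and> snd p \<in> smooth_functions M \<and> affine_function X h = affine_function (fst p) (snd p)"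
  have "?Q (affine_parts (affine_function X h))"
    unfolding affine_parts_def by (rule someI[of ?Q "(X, h)"]) (simp add: X h)
  then have s: "fst (affine_parts (affine_function X h)) \<in> sections E"
    "snd (affine_parts (affine_function X h)) \<in> smooth_functions M"
    and eq: "affine_function X h = affine_function (fst (affine_parts (affine_function X h))) (snd (affine_parts (affine_function X h)))"
    by blast+
  show ?thesis using affine_inj[OF X s(1) h s(2) eq] by (simp add: prod_eq_iff)
qed

definition affine_bracket where
  "affine_bracket = (\<lambda>f\<in>affine_functions. \<lambda>g\<in>affine_functions.
    affine_function (br (fst (affine_parts f)) (fst (affine_parts g)))
      (fun_add M (D (fst (affine_parts f)) (snd (affine_parts g)))
        (fun_scale M (-1) (D (fst (affine_parts g)) (snd (affine_parts f))))))"

lemma affine_bracket_eq: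
  assumes "X \<in> sections E" "h \<in> smooth_functions M" "Y \<in> sections E" "k \<in> smooth_functions M"
  shows "affine_bracket (affine_function X h) (affine_function Y k) =
    affine_function (br X Y) (fun_add M (D X k) (fun_scale M (-1) (D Y h)))"
  using assms by (simp add: affine_bracket_def affine_parts_affine affine_functionsI)

lemma affine_bracket_closed:
  assumes "X \<in> sections E" "h \<in> smooth_functions M" "Y \<in> sections E" "k \<in> smooth_functions M"
  shows "br X Y \<in> sections E" "fun_add M (D X k) (fun_scale M (-1) (D Y h)) \<in> smooth_functions M"
  using assms by (simp_all add: bracket_in anchored_derivative_smooth base.smooth_fun_add base.smooth_fun_scale)

lemma affine_bracket_apply:
  assumes "X \<in> sections E" "h \<in> smooth_functions M" "Y \<in> sections E" "k \<in> smooth_functions M"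
    "x \<in> points M" "\<xi> \<in> dual_space E x"
  shows "affine_bracket (affine_function X h) (affine_function Y k) (x, \<xi>) = \<xi> (br X Y x) + D X k x - D Y h x"
  unfolding affine_bracket_eq[OF assms(1-4)] affine_apply[OF assms(5,6)] using assms(5) by simp

lemma affine_bracket_in:
  assumes "f \<in> affine_functions" "g \<in> affine_functions"
  shows "affine_bracket f g \<in> affine_functions"
proof -
  obtain X h where 1: "f = affine_function X h" "X \<in> sections E" "h \<in> smooth_functions M" using assms(1) by (rule affine_functionsE)
  obtain Y k where 2: "g = affine_function Y k" "Y \<in> sections E" "k \<in> smooth_functions M" using assms(2) by (rule affine_functionsE)
  show ?thesis unfolding 1(1) 2(1) affine_bracket_eq[OF 1(2,3) 2(2,3)]
    by (rule affine_functionsI[OF affine_bracket_closed[OF 1(2,3) 2(2,3)]])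
qed

text \<open>Linearity on the right is deduced from linearity on the left by antisymmetry. In the
  Jacobi identity the section parts are handled by the Jacobi identity of the algebroid and the
  basic parts by \<open>anchor_bracket\<close>.\<close>

lemma affine_bracket_lie:
  "lie_bracket_on affine_functions (fun_add dual) (fun_scale dual) (fun_zero dual) affine_bracket"
proof -
  let ?B = affine_bracket
  note C = affine.C_smooth affine.C_add affine.C_scale affine.C_zero affine_bracket_in
  have ext: "?B \<in> affine_functions \<rightarrow>\<^sub>E affine_functions \<rightarrow>\<^sub>E affine_functions"
  proof (rule PiE_I)
    fix f assume f: "f \<in> affine_functions"
    show "?B f \<in> affine_functions \<rightarrow>\<^sub>E affine_functions"
      by (rule PiE_I) (use f affine_bracket_in in \<open>simp_all add: affine_bracket_def\<close>)
  qed (simp add: affine_bracket_def)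
  note cl = sec_add_in sec_scale_in bracket_in base.smooth_fun_add base.smooth_fun_scale anchored_derivative_smooth
  have anti: "?B g f = fun_scale dual (-1) (?B f g)" if f: "f \<in> affine_functions" and g: "g \<in> affine_functions" for f g
  proof -
    obtain X h where 1: "f = affine_function X h" "X \<in> sections E" "h \<in> smooth_functions M" using f by (rule affine_functionsE)
    obtain Y k where 2: "g = affine_function Y k" "Y \<in> sections E" "k \<in> smooth_functions M" using g by (rule affine_functionsE)
    show ?thesis
    proof (rule dual_eqI)
      show "?B g f \<in> smooth_functions dual" by (intro C f g)
      show "fun_scale dual (-1) (?B f g) \<in> smooth_functions dual" by (rule C(1), intro C f g)
      fix x \<xi> assume x: "x \<in> points M" "\<xi> \<in> dual_space E x"
      show "?B g f (x, \<xi>) = fun_scale dual (-1) (?B f g) (x, \<xi>)"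
        unfolding 1(1) 2(1)
        by (simp add: dual_fun_apply[OF x] affine_bracket_apply[OF 1(2,3) 2(2,3) x]
            affine_bracket_apply[OF 2(2,3) 1(2,3) x] pairing_bracket_antisym[OF x 1(2) 2(2)])
    qed
  qed
  have left: "?B (fun_add dual f g) p = fun_add dual (?B f p) (?B g p)" "?B (fun_scale dual c f) p = fun_scale dual c (?B f p)"
    if f: "f \<in> affine_functions" and g: "g \<in> affine_functions" and p: "p \<in> affine_functions" for f g p c
  proof -
    obtain X h where 1: "f = affine_function X h" "X \<in> sections E" "h \<in> smooth_functions M" using f by (rule affine_functionsE)
    obtain Y k where 2: "g = affine_function Y k" "Y \<in> sections E" "k \<in> smooth_functions M" using g by (rule affine_functionsE)
    obtain Z l where 3: "p = affine_function Z l" "Z \<in> sections E" "l \<in> smooth_functions M" using p by (rule affine_functionsE)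
    show "?B (fun_add dual f g) p = fun_add dual (?B f p) (?B g p)"
    proof (rule dual_eqI)
      show "?B (fun_add dual f g) p \<in> smooth_functions dual" by (rule C(1), intro C f g p)
      show "fun_add dual (?B f p) (?B g p) \<in> smooth_functions dual" by (rule C(1), intro C f g p)
      fix x \<xi> assume x: "x \<in> points M" "\<xi> \<in> dual_space E x"
      show "?B (fun_add dual f g) p (x, \<xi>) = fun_add dual (?B f p) (?B g p) (x, \<xi>)"
        unfolding 1(1) 2(1) 3(1) affine_eqs(1)[OF 1(2,3) 2(2,3)] dual_fun_apply[OF x]
          affine_bracket_apply[OF 1(2,3) 3(2,3) x] affine_bracket_apply[OF 2(2,3) 3(2,3) x]
          affine_bracket_apply[OF sec_add_in[OF 1(2) 2(2)] base.smooth_fun_add[OF 1(3) 2(3)] 3(2,3) x]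
          bracket_eqs(1)[OF 1(2) 2(2) 3(2)] pairing_eqs(1)[OF x bracket_in[OF 1(2) 3(2)] bracket_in[OF 2(2) 3(2)]]
          anchored_derivative_eqs(1)[OF x(1) 1(2) 3(3) 2(2)] anchored_derivative_eqs(3)[OF x(1) 3(2) 1(3) 2(3)]
        by simp
    qed
    show "?B (fun_scale dual c f) p = fun_scale dual c (?B f p)"
    proof (rule dual_eqI)
      show "?B (fun_scale dual c f) p \<in> smooth_functions dual" by (rule C(1), intro C f p)
      show "fun_scale dual c (?B f p) \<in> smooth_functions dual" by (rule C(1), intro C f p)
      fix x \<xi> assume x: "x \<in> points M" "\<xi> \<in> dual_space E x"
      show "?B (fun_scale dual c f) p (x, \<xi>) = fun_scale dual c (?B f p) (x, \<xi>)"
        unfolding 1(1) 3(1) affine_eqs(2)[OF 1(2,3)] dual_fun_apply[OF x] affine_bracket_apply[OF 1(2,3) 3(2,3) x]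
          affine_bracket_apply[OF sec_scale_in[OF 1(2)] base.smooth_fun_scale[OF 1(3)] 3(2,3) x]
          bracket_eqs(3)[OF 1(2) 3(2)] pairing_eqs(2)[OF x bracket_in[OF 1(2) 3(2)]]
          anchored_derivative_eqs(2)[OF x(1) 1(2) 3(3)] anchored_derivative_eqs(4)[OF x(1) 3(2) 1(3)]
        by (simp add: algebra_simps)
    qed
  qed
  have right: "?B p (fun_add dual f g) = fun_add dual (?B p f) (?B p g)" "?B p (fun_scale dual c f) = fun_scale dual c (?B p f)"
    if f: "f \<in> affine_functions" and g: "g \<in> affine_functions" and p: "p \<in> affine_functions" for f g p c
  proof -
    have "?B p (fun_add dual f g) = fun_scale dual (-1) (fun_add dual (?B f p) (?B g p))"
      using anti[OF affine.C_add[OF f g] p] left(1)[OF f g p] by simp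
    then show "?B p (fun_add dual f g) = fun_add dual (?B p f) (?B p g)"
      by (simp add: anti[OF f p] anti[OF g p] fun_add_def fun_scale_def fun_eq_iff restrict_def)
    have "?B p (fun_scale dual c f) = fun_scale dual (-1) (fun_scale dual c (?B f p))"
      using anti[OF affine.C_scale[OF f] p] left(2)[OF f f p] by simp
    then show "?B p (fun_scale dual c f) = fun_scale dual c (?B p f)"
      by (simp add: anti[OF f p] fun_scale_def fun_eq_iff restrict_def)
  qed
  have self: "?B f f = fun_zero dual" if f: "f \<in> affine_functions" for f
  proof (rule dual_eqI)
    show "?B f f \<in> smooth_functions dual" "fun_zero dual \<in> smooth_functions dual" by (rule C(1), intro C f)+
    fix x \<xi> assume x: "x \<in> points M" "\<xi> \<in> dual_space E x"
    have "?B f f (x, \<xi>) = fun_scale dual (-1) (?B f f) (x, \<xi>)" using anti[OF f f] by simp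
    then show "?B f f (x, \<xi>) = fun_zero dual (x, \<xi>)" by (simp add: dual_fun_apply[OF x])
  qed
  have jacobi: "fun_add dual (fun_add dual (?B f (?B g p)) (?B g (?B p f))) (?B p (?B f g)) = fun_zero dual"
    if f: "f \<in> affine_functions" and g: "g \<in> affine_functions" and p: "p \<in> affine_functions" for f g p
  proof -
    obtain X h where 1: "f = affine_function X h" "X \<in> sections E" "h \<in> smooth_functions M" using f by (rule affine_functionsE)
    obtain Y k where 2: "g = affine_function Y k" "Y \<in> sections E" "k \<in> smooth_functions M" using g by (rule affine_functionsE)
    obtain Z l where 3: "p = affine_function Z l" "Z \<in> sections E" "l \<in> smooth_functions M" using p by (rule affine_functionsE)
    \<comment> \<open>\<open>anchor_bracket\<close> writes the derivative along br Y Z as a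
      commutator. In the cyclic sum each second-order term then occurs twice with opposite
      signs.\<close>
    have nested: "?B (affine_function X h) (?B (affine_function Y k) (affine_function Z l)) (x, \<xi>) =
        \<xi> (br X (br Y Z) x) + D X (D Y l) x - D X (D Z k) x - (D Y (D Z h) x - D Z (D Y h) x)"
      if X: "X \<in> sections E" "h \<in> smooth_functions M" and Y: "Y \<in> sections E" "k \<in> smooth_functions M"
        and Z: "Z \<in> sections E" "l \<in> smooth_functions M" and x: "x \<in> points M" "\<xi> \<in> dual_space E x" for X h Y k Z l x \<xi>
      unfolding affine_bracket_eq[OF Y Z] affine_bracket_apply[OF X affine_bracket_closed[OF Y Z] x]
        anchored_derivative_eqs(3)[OF x(1) X(1) anchored_derivative_smooth[OF Y(1) Z(2)] base.smooth_fun_scale[OF anchored_derivative_smooth[OF Z(1) Y(2)]]]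
        anchored_derivative_eqs(4)[OF x(1) X(1) anchored_derivative_smooth[OF Z(1) Y(2)]]
        anchor_bracket[OF x(1) Y(1) Z(1) X(2)]
      by simp
    show ?thesis
    proof (rule dual_eqI)
      show "fun_add dual (fun_add dual (?B f (?B g p)) (?B g (?B p f))) (?B p (?B f g)) \<in> smooth_functions dual"
        by (rule C(1), intro C f g p)
      show "fun_zero dual \<in> smooth_functions dual" by (rule C(1), rule C)
      fix x \<xi> assume x: "x \<in> points M" "\<xi> \<in> dual_space E x"
      show "fun_add dual (fun_add dual (?B f (?B g p)) (?B g (?B p f))) (?B p (?B f g)) (x, \<xi>) = fun_zero dual (x, \<xi>)"
        unfolding dual_fun_apply[OF x] unfolding 1(1) 2(1) 3(1)
          nested[OF 1(2,3) 2(2,3) 3(2,3) x] nested[OF 2(2,3) 3(2,3) 1(2,3) x] nested[OF 3(2,3) 1(2,3) 2(2,3) x]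
        using pairing_jacobi[OF x 1(2) 2(2) 3(2)] by simp
    qed
  qed
  show ?thesis
    unfolding lie_bracket_on_def by (intro conjI ballI allI ext left(1) left(2) right(1) right(2) self jacobi)
qed

interpretation extension: poisson_extension "dual_atlas E" affine_functions affine_bracket
proof (unfold_locales, rule affine_bracket_lie)
  fix p f g assume p: "p \<in> points dual" and f: "f \<in> affine_functions" and g: "g \<in> affine_functions"
    and z: "\<And>v. v \<in> tangent_space dual p \<Longrightarrow> v f = 0"
  obtain x \<xi> where x: "p = (x, \<xi>)" "x \<in> points M" "\<xi> \<in> dual_space E x" using p by (auto simp: points_dual)
  obtain X h where 1: "f = affine_function X h" "X \<in> sections E" "h \<in> smooth_functions M" using f by (rule affine_functionsE)
  obtain Y k where 2: "g = affine_function Y k" "Y \<in> sections E" "k \<in> smooth_functions M" using g by (rule affine_functionsE)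
  show "affine_bracket f g p = 0"
    unfolding 1(1) 2(1) x(1) affine_bracket_apply[OF 1(2,3) 2(2,3) x(2,3)]
    by (rule bracket_first_order[OF x(2,3) 1(2,3) 2(2,3)]) (use z[unfolded x(1) 1(1)] in blast)
qed

text \<open>The values on all affine functions, anchor terms included, are part of the statement:
  they determine P, and with zero basic parts they give homogeneity.\<close>

theorem poisson_structure_of_lie_algebroid:
  "\<exists>P. poisson_structure dual P \<and> (\<forall>X\<in>sections E. \<forall>Y\<in>sections E. \<forall>h\<in>smooth_functions M. \<forall>k\<in>smooth_functions M.
    P (affine_function X h) (affine_function Y k) =
      affine_function (br X Y) (fun_add M (D X k) (fun_scale M (-1) (D Y h))))"
  using extension.poisson_structure_extended_bracket
  by (intro exI[of _ extension.extended_bracket])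
    (simp add: extension.extended_bracket_extends affine_functionsI affine_bracket_eq)

end

end

section \<open>The Lie algebroid of a homogeneous Poisson structure\<close>

context smooth_bundle
begin

lemma nonzero_covector:
  assumes x: "x \<in> points M" and \<xi>: "\<xi> \<in> dual_space E x" and nz: "\<xi> \<noteq> zero_covector x"
  shows "\<exists>Y\<in>sections E. \<xi> (Y x) \<noteq> 0"
proof (rule ccontr)
  assume *: "\<not> (\<exists>Y\<in>sections E. \<xi> (Y x) \<noteq> 0)"
  have "\<xi> = zero_covector x"
  proof (rule extensionalityI[of _ "fibre E x"])
    fix e assume e: "e \<in> fibre E x"
    then obtain Y where "Y \<in> sections E" "Y x = e" using section_through[OF e x] by blast
    then show "\<xi> e = zero_covector x e" using * e by auto
  qed (simp_all add: dual_spaceD(1)[OF \<xi>] zero_covector_def)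
  then show False using nz by simp
qed

text \<open>At the zero covector all vertical functions vanish, so dividing by one of them is
  impossible there; the value is recovered by continuity.\<close>

lemma limit_along_ray:
  assumes x: "x \<in> points M" and \<xi>: "\<xi> \<in> dual_space E x" and F: "F \<in> smooth_functions dual"
    and c: "\<And>t. t \<noteq> 0 \<Longrightarrow> F (x, line x (zero_covector x) \<xi> t) = c"
  shows "F (x, zero_covector x) = c"
proof -
  let ?g = "\<lambda>t. F (x, line x (zero_covector x) \<xi> t)"
  note z = zero_covector_in[OF x]
  have "continuous_on UNIV ?g"
    by (rule smooth_on_continuous[OF smooth_along_line[OF x z \<xi> F]])
  then have "(?g \<longlongrightarrow> ?g 0) (at 0)"
    by (simp add: continuous_on_eq_continuous_at isCont_def)
  moreover have "(?g \<longlongrightarrow> c) (at 0)"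
    by (rule tendsto_eventually) (simp add: eventually_at_filter c)
  ultimately have "?g 0 = c" using tendsto_unique[of "at (0::real)"] by (metis trivial_limit_at)
  then show ?thesis by (simp add: line_0[OF x z \<xi>])
qed

context
  fixes Q assumes homogeneous: "Q \<in> homogeneous_poisson_structures E"
begin

private abbreviation "\<Phi> \<equiv> vertical_function E"
private abbreviation "pull \<equiv> basic_function"

lemma poisson: "poisson_structure dual Q"
  and bracket_vertical: "X \<in> sections E \<Longrightarrow> Y \<in> sections E \<Longrightarrow> \<exists>Z\<in>sections E. Q (\<Phi> X) (\<Phi> Y) = \<Phi> Z"
proof -
  show "poisson_structure dual Q"
    using homogeneous by (simp add: homogeneous_poisson_structures_def)
  assume XY: "X \<in> sections E" "Y \<in> sections E"
  have "vertical E (\<Phi> X)" "vertical E (\<Phi> Y)" using XY unfolding vertical_def by blast+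
  then have "vertical E (Q (\<Phi> X) (\<Phi> Y))"
    using homogeneous by (simp add: homogeneous_poisson_structures_def)
  then show "\<exists>Z\<in>sections E. Q (\<Phi> X) (\<Phi> Y) = \<Phi> Z" unfolding vertical_def by blast
qed

lemma Q_biderivation: "biderivation dual Q"
  using poisson poisson_structure_iff[OF dual_smooth_atlas] by blast

private lemmas Q = biderivationD[OF Q_biderivation]
private lemmas Q_eqs = biderivation_eqs[OF dual_smooth_atlas Q_biderivation]
private lemmas Q_left = biderivation_left[OF dual_smooth_atlas Q_biderivation]

definition section_bracket :: "('a \<Rightarrow> 'e) \<Rightarrow> ('a \<Rightarrow> 'e) \<Rightarrow> 'a \<Rightarrow> 'e"
  where "section_bracket = (\<lambda>X\<in>sections E. \<lambda>Y\<in>sections E. SOME Z. Z \<in> sections E \<and> Q (\<Phi> X) (\<Phi> Y) = \<Phi> Z)"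

lemma section_bracket:
  assumes X: "X \<in> sections E" and Y: "Y \<in> sections E"
  shows "section_bracket X Y \<in> sections E" "\<Phi> (section_bracket X Y) = Q (\<Phi> X) (\<Phi> Y)"
proof -
  have "\<exists>Z. Z \<in> sections E \<and> Q (\<Phi> X) (\<Phi> Y) = \<Phi> Z" using bracket_vertical[OF X Y] by blast
  note s = someI_ex[OF this]
  have e: "section_bracket X Y = (SOME Z. Z \<in> sections E \<and> Q (\<Phi> X) (\<Phi> Y) = \<Phi> Z)"
    using X Y by (simp add: section_bracket_def)
  show "section_bracket X Y \<in> sections E" unfolding e by (rule conjunct1[OF s])
  show "\<Phi> (section_bracket X Y) = Q (\<Phi> X) (\<Phi> Y)" unfolding e by (rule conjunct2[OF s, symmetric])
qed

text \<open>The zero section picks a point of each fibre smoothly, so smoothness of the result is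
  that of a pullback.\<close>

definition base_derivative :: "('a \<Rightarrow> 'e) \<Rightarrow> ('a \<Rightarrow> real) \<Rightarrow> 'a \<Rightarrow> real"
  where "base_derivative X f = (\<lambda>x\<in>points M. Q (\<Phi> X) (pull f) (x, zero_covector x))"

lemma base_derivative_smooth:
  "X \<in> sections E \<Longrightarrow> f \<in> smooth_functions M \<Longrightarrow> base_derivative X f \<in> smooth_functions M"
  unfolding base_derivative_def
  by (rule pullback_smooth[OF zero_covector_smooth Q(1)[OF vertical_smooth basic_smooth]])

text \<open>The product of \<open>Q (\<Phi> X) (pull f)\<close> with every vertical function is vertical, hence linear on
  fibres; so \<open>Q (\<Phi> X) (pull f)\<close> is constant along every ray, and by continuity on every fibre.\<close>

lemma bracket_vertical_basic:
  assumes X: "X \<in> sections E" and f: "f \<in> smooth_functions M"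
  shows "Q (\<Phi> X) (pull f) = pull (base_derivative X f)"
proof (rule dual_eqI)
  note s = vertical_smooth[OF X] basic_smooth[OF f]
  let ?G = "Q (\<Phi> X) (pull f)"
  show G: "?G \<in> smooth_functions dual" by (rule Q(1)[OF s])
  show "pull (base_derivative X f) \<in> smooth_functions dual"
    by (rule basic_smooth[OF base_derivative_smooth[OF X f]])
  fix x \<xi> assume x: "x \<in> points M" and \<xi>: "\<xi> \<in> dual_space E x"
  have "?G (x, zero_covector x) = ?G (x, \<xi>)"
  proof (cases "\<xi> = zero_covector x")
    case False
    obtain Y where Y: "Y \<in> sections E" "\<xi> (Y x) \<noteq> 0" using nonzero_covector[OF x \<xi> False] by blast
    note v = vertical_smooth[OF Y(1)] and fY = sec_mult_in[OF f Y(1)]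
    have val: "?G (x, \<eta>) * \<eta> (Y x) = \<eta> (section_bracket X (sec_mult E f Y) x) - f x * \<eta> (section_bracket X Y x)"
      if \<eta>: "\<eta> \<in> dual_space E x" for \<eta>
    proof -
      have "Q (\<Phi> X) (\<Phi> (sec_mult E f Y)) (x, \<eta>) = ?G (x, \<eta>) * \<Phi> Y (x, \<eta>) + pull f (x, \<eta>) * Q (\<Phi> X) (\<Phi> Y) (x, \<eta>)"
        unfolding vertical_eqs(3)[OF Y(1) f] by (rule Q(5)[OF s points_dualI[OF x \<eta>] v])
      then show ?thesis
        unfolding section_bracket(2)[OF X fY, symmetric] section_bracket(2)[OF X Y(1), symmetric]
          vertical_apply[OF x \<eta>] basic_apply[OF x \<eta>] by simp
    qed
    show ?thesis
    proof (rule limit_along_ray[OF x \<xi> G])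
      fix t :: real assume t: "t \<noteq> 0"
      let ?\<eta> = "line x (zero_covector x) \<xi> t"
      have \<eta>: "?\<eta> \<in> dual_space E x" by (rule line_in[OF x zero_covector_in[OF x] \<xi>])
      have l: "?\<eta> (Z x) = t * \<xi> (Z x)" if "Z \<in> sections E" for Z
        using section_in_fibre[OF that x] by simp
      have "?G (x, ?\<eta>) * (t * \<xi> (Y x)) = t * (?G (x, \<xi>) * \<xi> (Y x))"
        using val[OF \<eta>] unfolding val[OF \<xi>] l[OF Y(1)] l[OF section_bracket(1)[OF X fY]]
          l[OF section_bracket(1)[OF X Y(1)]] by (simp add: algebra_simps)
      then show "?G (x, ?\<eta>) = ?G (x, \<xi>)" using t Y(2) by simp
    qed
  qed simp
  then show "?G (x, \<xi>) = pull (base_derivative X f) (x, \<xi>)"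
    using x by (simp add: basic_apply[OF x \<xi>] base_derivative_def)
qed

lemma bracket_basic_vertical:
  assumes X: "X \<in> sections E" and f: "f \<in> smooth_functions M" and x: "x \<in> points M" "\<xi> \<in> dual_space E x"
  shows "Q (pull f) (\<Phi> X) (x, \<xi>) = - base_derivative X f x"
  using Q(2)[OF vertical_smooth[OF X] basic_smooth[OF f] points_dualI[OF x]] bracket_vertical_basic[OF X f]
  by (simp add: basic_apply[OF x])

text \<open>The product of {f, g} with a vertical function is a combination of brackets of f with
  vertical functions, hence constant on fibres by \<open>bracket_vertical_basic\<close>. It can
  therefore be evaluated at the zero covector, where the vertical factor vanishes. So {f, g} is zero
  wherever some vertical function is nonzero, that is, off the zero section.\<close>

lemma bracket_basic_basic:
  assumes f: "f \<in> smooth_functions M" and g: "g \<in> smooth_functions M"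
  shows "Q (pull f) (pull g) = fun_zero dual"
proof (rule dual_eqI)
  note s = basic_smooth[OF f] basic_smooth[OF g]
  let ?H = "Q (pull f) (pull g)"
  show H: "?H \<in> smooth_functions dual" by (rule Q(1)[OF s])
  show "fun_zero dual \<in> smooth_functions dual" by (rule dual_closed)
  have nz: "?H (x, \<xi>) = 0" if x: "x \<in> points M" and \<xi>: "\<xi> \<in> dual_space E x" and \<xi>0: "\<xi> \<noteq> zero_covector x" for x \<xi>
  proof -
    obtain Y where Y: "Y \<in> sections E" "\<xi> (Y x) \<noteq> 0" using nonzero_covector[OF x \<xi> \<xi>0] by blast
    have val: "?H (x, \<eta>) * \<eta> (Y x) = - base_derivative (sec_mult E g Y) f x + g x * base_derivative Y f x"
      if \<eta>: "\<eta> \<in> dual_space E x" for \<eta>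
    proof -
      have "Q (pull f) (\<Phi> (sec_mult E g Y)) (x, \<eta>) = ?H (x, \<eta>) * \<Phi> Y (x, \<eta>) + pull g (x, \<eta>) * Q (pull f) (\<Phi> Y) (x, \<eta>)"
        unfolding vertical_eqs(3)[OF Y(1) g] by (rule Q(5)[OF s points_dualI[OF x \<eta>] vertical_smooth[OF Y(1)]])
      then show ?thesis
        unfolding bracket_basic_vertical[OF sec_mult_in[OF g Y(1)] f x \<eta>] bracket_basic_vertical[OF Y(1) f x \<eta>]
          vertical_apply[OF x \<eta>] basic_apply[OF x \<eta>] by simp
    qed
    have "?H (x, \<xi>) * \<xi> (Y x) = 0"
      using val[OF zero_covector_in[OF x]] section_in_fibre[OF Y(1) x] unfolding val[OF \<xi>] by simp
    then show ?thesis using Y(2) by simp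
  qed
  fix x \<xi> assume x: "x \<in> points M" and \<xi>: "\<xi> \<in> dual_space E x"
  show "?H (x, \<xi>) = fun_zero dual (x, \<xi>)"
  proof (cases "\<xi> = zero_covector x")
    case True
    \<comment> \<open>Positive rank provides a nonzero covector, and hence a ray of nonzero
      covectors ending at the zero covector.\<close>
    obtain Z \<eta> where Z: "Z \<in> sections E" and \<eta>: "\<eta> \<in> dual_space E x" "\<eta> (Z x) = 1"
      using nonvanishing_pairing[OF x] by blast
    have "?H (x, zero_covector x) = 0"
    proof (rule limit_along_ray[OF x \<eta>(1) H])
      fix t :: real assume t: "t \<noteq> 0"
      have "line x (zero_covector x) \<eta> t (Z x) \<noteq> zero_covector x (Z x)"
        using section_in_fibre[OF Z x] t \<eta>(2) by simp
      then have "line x (zero_covector x) \<eta> t \<noteq> zero_covector x" by metis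
      then show "?H (x, line x (zero_covector x) \<eta> t) = 0"
        by (rule nz[OF x line_in[OF x zero_covector_in[OF x] \<eta>(1)]])
    qed
    then show ?thesis using True by (simp add: dual_fun_apply[OF x zero_covector_in[OF x]])
  qed (simp add: nz[OF x \<xi>] dual_fun_apply[OF x \<xi>])
qed

text \<open>These make X act as a derivation that is linear over functions in X. For the latter, the
  Leibniz rule of Q leaves a bracket of two basic functions, which is zero.\<close>

lemma base_derivative_eqs:
  assumes X: "X \<in> sections E" and f: "f \<in> smooth_functions M" and x: "x \<in> points M"
  shows "Y \<in> sections E \<Longrightarrow> base_derivative (sec_add E X Y) f x = base_derivative X f x + base_derivative Y f x"
    "base_derivative (sec_scale E c X) f x = c * base_derivative X f x"
    "g \<in> smooth_functions M \<Longrightarrow> base_derivative (sec_mult E g X) f x = g x * base_derivative X f x"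
    "g \<in> smooth_functions M \<Longrightarrow> base_derivative X (fun_add M f g) x = base_derivative X f x + base_derivative X g x"
    "base_derivative X (fun_scale M c f) x = c * base_derivative X f x"
    "g \<in> smooth_functions M \<Longrightarrow>
      base_derivative X (fun_mult M f g) x = base_derivative X f x * g x + f x * base_derivative X g x"
proof -
  note z = zero_covector_in[OF x] and v = vertical_smooth[OF X] and b = basic_smooth[OF f]
  note ap = dual_fun_apply[OF x z] basic_apply[OF x z] and p = points_dualI[OF x z]
  have der: "base_derivative Y g x = Q (\<Phi> Y) (pull g) (x, zero_covector x)" for Y g
    using x by (simp add: base_derivative_def)
  show "base_derivative (sec_add E X Y) f x = base_derivative X f x + base_derivative Y f x" if Y: "Y \<in> sections E"
    unfolding der vertical_eqs(1)[OF X Y] Q_left(2)[OF b v vertical_smooth[OF Y]] ap ..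
  show "base_derivative (sec_scale E c X) f x = c * base_derivative X f x"
    unfolding der vertical_eqs(2)[OF X] Q_left(1)[OF b v] ap ..
  show "base_derivative (sec_mult E g X) f x = g x * base_derivative X f x" if g: "g \<in> smooth_functions M"
    unfolding der vertical_eqs(3)[OF X g] Q_left(3)[OF b basic_smooth[OF g] v] ap bracket_basic_basic[OF g f] by simp
  show "base_derivative X (fun_add M f g) x = base_derivative X f x + base_derivative X g x" if g: "g \<in> smooth_functions M"
    unfolding der basic_eqs(1)[OF f g] by (rule Q(4)[OF v b p basic_smooth[OF g]])
  show "base_derivative X (fun_scale M c f) x = c * base_derivative X f x"
    unfolding der basic_eqs(2)[OF f] by (rule Q(3)[OF v b p])
  show "base_derivative X (fun_mult M f g) x = base_derivative X f x * g x + f x * base_derivative X g x"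
    if g: "g \<in> smooth_functions M"
    unfolding der basic_eqs(3)[OF f g] Q(5)[OF v b p basic_smooth[OF g]] ap ..
qed

text \<open>The difference of X and Y vanishes at x. Up to cutoff factors it is a combination of
  frame sections whose coefficients vanish at x, and linearity over functions makes every term
  zero.\<close>

lemma base_derivative_tensorial:
  assumes X: "X \<in> sections E" and Y: "Y \<in> sections E" and f: "f \<in> smooth_functions M" and x: "x \<in> points M"
    and eq: "X x = Y x"
  shows "base_derivative X f x = base_derivative Y f x"
proof -
  obtain V \<Psi> where t: "local_trivialization E V \<Psi>" "x \<in> V" using x by (rule trivE)
  note o = triv_open[OF t(1)]
  obtain N \<beta> where N: "x \<in> N" "cutoff M V N \<beta>"
    using cutoff_exists[OF base_atlas base_hausdorff o t(2)] by blast
  note \<beta> = cutoffD(1)[OF N(2)]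
  have \<beta>x: "\<beta> x = 1" using cutoffD(5)[OF N(2,1)] .
  define Z where "Z = sec_add E X (sec_scale E (-1) Y)"
  have Z: "Z \<in> sections E" unfolding Z_def by (intro sec_add_in sec_scale_in X Y)
  have "\<Psi> (Z x) = 0"
    using x section_in_fibre[OF Y x] by (simp add: Z_def sec_apply triv_add[OF t] triv_scale[OF t] eq)
  then have c0: "(\<lambda>x\<in>points M. if x \<in> V then \<beta> x *\<^sub>R (\<Psi> (Z x) \<bullet> b) else 0) x = 0" for b
    using x t by simp
  have c: "(\<lambda>x\<in>points M. if x \<in> V then \<beta> x *\<^sub>R (\<Psi> (Z x) \<bullet> b) else 0) \<in> smooth_functions M" for b
    by (rule base.cutoff_function[OF N(2)]) (rule smooth_in_inner[OF o section_smooth[OF t(1) Z] smooth_in_const])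
  have e: "local_section V \<Psi> (\<lambda>x. if x \<in> V then \<beta> x *\<^sub>R b else 0) \<in> sections E" for b
    by (rule local_section_in[OF t(1) supported_in_cutoff[OF N(2) subset_refl smooth_in_const]])
  have "base_derivative (sec_mult E \<beta> (sec_mult E \<beta> Z)) f x = (\<Sum>b\<in>Basis. base_derivative (sec_mult E
      (\<lambda>x\<in>points M. if x \<in> V then \<beta> x *\<^sub>R (\<Psi> (Z x) \<bullet> b) else 0)
      (local_section V \<Psi> (\<lambda>x. if x \<in> V then \<beta> x *\<^sub>R b else 0))) f x)"
    by (rule frame_expansion[OF t(1) N(2) Z, where T="\<lambda>X. base_derivative X f x"])
      (rule base_derivative_eqs(1)[OF _ f x])
  also have "\<dots> = 0"
    by (rule sum.neutral) (simp only: base_derivative_eqs(3)[OF e f x c] c0, simp)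
  finally have "base_derivative Z f x = 0"
    unfolding base_derivative_eqs(3)[OF sec_mult_in[OF \<beta> Z] f x \<beta>] base_derivative_eqs(3)[OF Z f x \<beta>] \<beta>x by simp
  then show ?thesis
    unfolding Z_def base_derivative_eqs(1)[OF X f x sec_scale_in[OF Y]] base_derivative_eqs(2)[OF Y f x] by simp
qed

text \<open>The section through e is chosen arbitrarily; \<open>base_derivative_tensorial\<close>
  makes the result independent of the choice.\<close>

definition anchor :: "'e \<Rightarrow> 'a \<times> (('a \<Rightarrow> real) \<Rightarrow> real)"
  where "anchor = (\<lambda>e\<in>points tot. (projection E e, \<lambda>f\<in>smooth_functions M.
    base_derivative (SOME s. s \<in> sections E \<and> s (projection E e) = e) f (projection E e)))"

lemma anchor_section:
  assumes X: "X \<in> sections E" and x: "x \<in> points M"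
  shows "anchor (X x) = (x, \<lambda>f\<in>smooth_functions M. base_derivative X f x)"
proof -
  note Xx = section_in_fibre[OF X x]
  have pr: "projection E (X x) = x" by (rule fibreD(2)[OF Xx])
  define Y where "Y = (SOME s. s \<in> sections E \<and> s x = X x)"
  have Y: "Y \<in> sections E" "Y x = X x"
    using someI[of "\<lambda>s. s \<in> sections E \<and> s x = X x" X] X unfolding Y_def by simp_all
  have "anchor (X x) = (x, \<lambda>f\<in>smooth_functions M. base_derivative Y f x)"
    using fibreD(1)[OF Xx] by (simp add: anchor_def pr Y_def)
  moreover have "(\<lambda>f\<in>smooth_functions M. base_derivative Y f x) = (\<lambda>f\<in>smooth_functions M. base_derivative X f x)"
    by (rule restrict_ext) (rule base_derivative_tensorial[OF Y(1) X _ x Y(2)])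
  ultimately show ?thesis by simp
qed

lemma base_derivative_tangent:
  assumes X: "X \<in> sections E" and x: "x \<in> points M"
  shows "(\<lambda>f\<in>smooth_functions M. base_derivative X f x) \<in> tangent_space M x"
  by (rule tangent_spaceI)
    (simp_all add: base_derivative_eqs[OF X _ x] base.smooth_fun_add base.smooth_fun_mult base.smooth_fun_scale)

lemma anchor_derivative: "X \<in> sections E \<Longrightarrow> f \<in> smooth_functions M \<Longrightarrow> anchored_derivative anchor X f = base_derivative X f"
proof (rule extensionalityI[of _ "points M"])
  assume X: "X \<in> sections E" and f: "f \<in> smooth_functions M"
  show "anchored_derivative anchor X f x = base_derivative X f x" if "x \<in> points M" for x
    using f by (simp add: anchored_derivative_apply[OF that] anchor_section[OF X that])
qed (simp_all add: anchored_derivative_def lie_derivative_def base_derivative_def)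

text \<open>In coordinates the anchor is linear in the fibre component of e. Its matrix consists of
  the derivatives of coordinate functions along frame sections, smooth functions of the base point
  that are pulled back by the projection.\<close>

lemma anchor_smooth: "smooth_map tot (tangent_atlas M) anchor"
proof (rule smooth_mapI[OF total_atlas])
  have through: "\<exists>X\<in>sections E. X (projection E e) = e" and xM: "projection E e \<in> points M" if "e \<in> points tot" for e
  proof -
    show "projection E e \<in> points M" by (rule smooth_map_points[OF smooth_projection that])
    then show "\<exists>X\<in>sections E. X (projection E e) = e" by (rule section_through[OF fibreI[OF that]])
  qed
  have mem: "fst (anchor e) = projection E e" "snd (anchor e) \<in> tangent_space M (projection E e)" if e: "e \<in> points tot" for e
  proof -
    obtain X where X: "X \<in> sections E" "X (projection E e) = e" using through[OF e] by blast
    show "fst (anchor e) = projection E e" "snd (anchor e) \<in> tangent_space M (projection E e)"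
      using anchor_section[OF X(1) xM[OF e]] base_derivative_tangent[OF X(1) xM[OF e]] X(2) by simp_all
  qed
  show "anchor e \<in> points (tangent_atlas M)" if e: "e \<in> points tot" for e
  proof -
    obtain U \<phi> where c: "(U, \<phi>) \<in> M" "projection E e \<in> U" using xM[OF e] by (rule pointsE)
    have "anchor e \<in> (SIGMA x:U. tangent_space M x)" using mem[OF e] c(2) by (cases "anchor e") simp
    then show ?thesis by (rule subsetD[OF chart_subset_points[OF tangent_atlasI[OF c(1)]]])
  qed
  fix e0 W \<kappa> assume e0: "e0 \<in> points tot" and w: "(W, \<kappa>) \<in> tangent_atlas M" "anchor e0 \<in> W"
  obtain U \<phi> where c: "(U, \<phi>) \<in> M"
    and e: "W = (SIGMA x:U. tangent_space M x)" "\<kappa> = (\<lambda>(x, v). (\<phi> x, tangent_components M (U, \<phi>) x v))"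
    using w(1) by (rule tangent_atlasE)
  let ?x = "projection E e0"
  have xU: "?x \<in> U" using w(2) e(1) mem(1)[OF e0] by (cases "anchor e0") simp
  obtain V \<Psi> where t: "local_trivialization E V \<Psi>" "?x \<in> V" using xM[OF e0] by (rule trivE)
  obtain N a where N: "open_in_atlas M N" "?x \<in> N" "N \<subseteq> U"
    and a: "\<forall>b. a b \<in> smooth_functions M \<and> (\<forall>x\<in>N. a b x = \<phi> x \<bullet> b)"
    using base.coordinate_functions_exist[OF c xU] by blast
  obtain N' \<beta> where N': "?x \<in> N'" "cutoff M V N' \<beta>"
    and s: "\<forall>w. local_section V \<Psi> (\<lambda>x. if x \<in> V then \<beta> x *\<^sub>R w else 0) \<in> sections E"
    "\<forall>z\<in>N'. \<forall>w. local_section V \<Psi> (\<lambda>x. if x \<in> V then \<beta> x *\<^sub>R w else 0) z = frame \<Psi> z w"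
    using local_section_frame_exists[OF t(1) triv_open[OF t(1)] subset_refl t(2)] by blast
  note N'' = cutoffD(3,4)[OF N'(2)]
  define S where "S w = local_section V \<Psi> (\<lambda>x. if x \<in> V then \<beta> x *\<^sub>R w else 0)" for w
  have S: "S w \<in> sections E" "\<And>z. z \<in> N' \<Longrightarrow> S w z = frame \<Psi> z w" for w
    using s by (simp_all add: S_def)
  define T where "T = points tot \<inter> projection E -` (N \<inter> N')"
  have oNN: "open_in_atlas M (N \<inter> N')" by (rule open_in_atlas_Int[OF base_atlas N(1) N''(1)])
  have oT: "open_in_atlas tot T" unfolding T_def by (rule smooth_map_pullback(1)[OF total_atlas base_atlas smooth_projection oNN])
  have pb: "smooth_in tot T (\<lambda>e. g (projection E e))" if "smooth_in M (N \<inter> N') g" for g :: "'a \<Rightarrow> 'c::real_normed_vector"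
    unfolding T_def by (rule smooth_map_pullback(2)[OF total_atlas base_atlas smooth_projection oNN that])
  have \<Psi>s: "smooth_in tot T \<Psi>"
    by (rule smooth_in_subset[OF triv_smooth(2)[OF t(1)]]) (use N''(2) in \<open>auto simp: T_def\<close>)
  let ?k = "\<lambda>e. \<Sum>i\<in>onb. (\<Sum>b\<in>Basis. (\<Psi> e \<bullet> b) * base_derivative (S b) (a i) (projection E e)) *\<^sub>R i"
  have comp: "anchor e \<in> W \<and> \<kappa> (anchor e) = (\<phi> (projection E e), ?k e)" if eT: "e \<in> T" for e
  proof -
    let ?z = "projection E e"
    have z: "?z \<in> N" "?z \<in> N'" "?z \<in> V" "?z \<in> U" "e \<in> points tot" "?z \<in> points M"
      using eT N(3) N''(2) xM[of e] by (auto simp: T_def)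
    note ef = fibreI[OF z(5)]
    define L where "L i w = base_derivative (S w) (a i) ?z" for i w
    \<comment> \<open>The sections compared here are shown to agree only at the base point of e,
      which suffices by tensoriality.\<close>
    have "linear (L i)" for i
    proof (rule linearI)
      fix v w c
      have ai: "a i \<in> smooth_functions M" using a by simp
      have "S (v + w) ?z = sec_add E (S v) (S w) ?z"
        by (rule triv_inj[OF t(1) z(3)])
          (simp_all add: S z(2,6) sec_apply frame_in[OF t(1) z(3)] triv_frame[OF t(1) z(3)] triv_add[OF t(1) z(3)])
      then show "L i (v + w) = L i v + L i w"
        unfolding L_def using base_derivative_tensorial[OF S(1) sec_add_in[OF S(1) S(1)] ai z(6)]
          base_derivative_eqs(1)[OF S(1) ai z(6) S(1)] by simp
      have "S (c *\<^sub>R w) ?z = sec_scale E c (S w) ?z"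
        by (rule triv_inj[OF t(1) z(3)])
          (simp_all add: S z(2,6) sec_apply frame_in[OF t(1) z(3)] triv_frame[OF t(1) z(3)] triv_scale[OF t(1) z(3)])
      then show "L i (c *\<^sub>R w) = c *\<^sub>R L i w"
        unfolding L_def using base_derivative_tensorial[OF S(1) sec_scale_in[OF S(1)] ai z(6)]
          base_derivative_eqs(2)[OF S(1) ai z(6)] by simp
    qed
    then have "L i (\<Sum>b\<in>Basis. (\<Psi> e \<bullet> b) *\<^sub>R b) = (\<Sum>b\<in>Basis. (\<Psi> e \<bullet> b) * L i b)" for i
      by (simp add: linear_sum linear_scale)
    then have Li: "L i (\<Psi> e) = (\<Sum>b\<in>Basis. (\<Psi> e \<bullet> b) * L i b)" for i
      by (simp only: euclidean_representation)
    \<comment> \<open>The section with constant components \<Psi> e passes through e, so the anchor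
      at e can be computed from it.\<close>
    have Se: "S (\<Psi> e) ?z = e" using S(2)[OF z(2)] frame_triv[OF t(1) z(3) ef] by simp
    let ?v = "\<lambda>f\<in>smooth_functions M. base_derivative (S (\<Psi> e)) f ?z"
    have an: "anchor e = (?z, ?v)" using anchor_section[OF S(1) z(6), of "\<Psi> e"] Se by simp
    have v: "?v \<in> tangent_space M ?z" by (rule base_derivative_tangent[OF S(1) z(6)])
    have tc: "tangent_components M (U, \<phi>) ?z ?v \<bullet> i = (\<Sum>b\<in>Basis. (\<Psi> e \<bullet> b) * base_derivative (S b) (a i) ?z)" for i
    proof -
      have "tangent_components M (U, \<phi>) ?z ?v \<bullet> i = ?v (a i)"
        by (rule base.tangent_components_inner[OF c N(1) z(1,4) v]) (use a in auto)
      also have "\<dots> = L i (\<Psi> e)" using a by (simp add: L_def)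
      finally show ?thesis unfolding Li by (simp only: L_def)
    qed
    have "tangent_components M (U, \<phi>) ?z ?v = ?k e"
      by (subst onb_expansion) (simp only: tc)
    then show ?thesis using e an v z(4) by simp
  qed
  have "smooth_in M (N \<inter> N') \<phi>"
    by (rule smooth_in_subset[OF smooth_in_chart[OF base_atlas c]]) (use N(3) in blast)
  note \<phi>s = pb[OF this]
  have ds: "smooth_in tot T (\<lambda>e. base_derivative (S b) (a i) (projection E e))" for b i
    by (rule pb, rule smooth_functionsD(2)[OF base_atlas base_derivative_smooth[OF S(1)]])
      (use a open_in_atlasD(2)[OF oNN] in auto)
  have "smooth_in tot T (\<lambda>e. (\<phi> (projection E e), ?k e))"
    by (intro smooth_in_Pair smooth_in_sum smooth_in_scaleR smooth_in_mult smooth_in_inner smooth_in_const oT \<phi>s ds \<Psi>s)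
  then have "smooth_in tot T (\<lambda>e. \<kappa> (anchor e))"
    by (rule smooth_in_cong[OF total_atlas oT]) (simp add: comp)
  moreover have "T \<subseteq> anchor -` W" using comp by blast
  moreover have "e0 \<in> T" using e0 N(2) N'(1) by (simp add: T_def)
  ultimately show "\<exists>T. open_in_atlas tot T \<and> e0 \<in> T \<and> T \<subseteq> anchor -` W \<and> smooth_in tot T (\<lambda>e. \<kappa> (anchor e))"
    using oT by (intro exI[of _ T] conjI)
qed

lemma anchor_bundle_map: "vector_bundle_map E (tangent_bundle M) anchor"
proof -
  have "projection (tangent_bundle M) (anchor e) = projection E e" if "e \<in> points tot" for e
    using that by (simp add: anchor_def tangent_bundle_def)
  moreover have "anchor (vadd E u v) = vadd (tangent_bundle M) (anchor u) (anchor v)"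
    if x: "x \<in> points M" and u: "u \<in> fibre E x" and v: "v \<in> fibre E x" for x u v
  proof -
    obtain X where X: "X \<in> sections E" "X x = u" using section_through[OF u x] by blast
    obtain Y where Y: "Y \<in> sections E" "Y x = v" using section_through[OF v x] by blast
    have "sec_add E X Y x = vadd E u v" using x X Y by (simp add: sec_apply)
    then have "anchor (vadd E u v) = (x, \<lambda>f\<in>smooth_functions M. base_derivative (sec_add E X Y) f x)"
      using anchor_section[OF sec_add_in[OF X(1) Y(1)] x] by simp
    moreover have "(\<lambda>f\<in>smooth_functions M. base_derivative (sec_add E X Y) f x) =
        (\<lambda>f\<in>smooth_functions M. base_derivative X f x + base_derivative Y f x)"
      by (rule restrict_ext) (rule base_derivative_eqs(1)[OF X(1) _ x Y(1)])
    moreover have "vadd (tangent_bundle M) (anchor u) (anchor v) =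
        (x, \<lambda>f\<in>smooth_functions M. base_derivative X f x + base_derivative Y f x)"
      using anchor_section[OF X(1) x] anchor_section[OF Y(1) x] X(2) Y(2)
      by (simp add: tangent_bundle_def restrict_def fun_eq_iff)
    ultimately show ?thesis by simp
  qed
  moreover have "anchor (vscale E c u) = vscale (tangent_bundle M) c (anchor u)"
    if x: "x \<in> points M" and u: "u \<in> fibre E x" for x u c
  proof -
    obtain X where X: "X \<in> sections E" "X x = u" using section_through[OF u x] by blast
    have "sec_scale E c X x = vscale E c u" using x X by (simp add: sec_apply)
    then have "anchor (vscale E c u) = (x, \<lambda>f\<in>smooth_functions M. base_derivative (sec_scale E c X) f x)"
      using anchor_section[OF sec_scale_in[OF X(1), of c] x] by simp
    moreover have "(\<lambda>f\<in>smooth_functions M. base_derivative (sec_scale E c X) f x) =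
        (\<lambda>f\<in>smooth_functions M. c * base_derivative X f x)"
      by (rule restrict_ext) (rule base_derivative_eqs(2)[OF X(1) _ x])
    moreover have "vscale (tangent_bundle M) c (anchor u) = (x, \<lambda>f\<in>smooth_functions M. c * base_derivative X f x)"
      using anchor_section[OF X(1) x] X(2) by (simp add: tangent_bundle_def restrict_def fun_eq_iff)
    ultimately show ?thesis by simp
  qed
  ultimately show ?thesis
    unfolding vector_bundle_map_def using anchor_smooth by (simp add: tangent_bundle_def)
qed

text \<open>The passage from sections to vertical functions is linear, injective and turns this
  bracket into Q, so each law is inherited from Q.\<close>

lemma section_bracket_lie:
  "lie_bracket_on (sections E) (sec_add E) (sec_scale E) (sec_zero E) section_bracket"
proof -
  have ext: "section_bracket \<in> sections E \<rightarrow>\<^sub>E sections E \<rightarrow>\<^sub>E sections E"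
  proof (rule PiE_I)
    fix X assume X: "X \<in> sections E"
    show "section_bracket X \<in> sections E \<rightarrow>\<^sub>E sections E"
      by (rule PiE_I) (use X section_bracket(1) in \<open>simp_all add: section_bracket_def\<close>)
  qed (simp add: section_bracket_def)
  note lie = poisson[unfolded poisson_structure_def, THEN conjunct1, unfolded lie_bracket_on_def]
  note v = vertical_smooth and b = section_bracket and cl = sec_add_in sec_scale_in sec_zero_in section_bracket(1)
  have 1: "section_bracket (sec_add E X Y) Z = sec_add E (section_bracket X Z) (section_bracket Y Z)"
    "section_bracket Z (sec_add E X Y) = sec_add E (section_bracket Z X) (section_bracket Z Y)"
    if X: "X \<in> sections E" and Y: "Y \<in> sections E" and Z: "Z \<in> sections E" for X Y Z
  proof -
    show "section_bracket (sec_add E X Y) Z = sec_add E (section_bracket X Z) (section_bracket Y Z)"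
      by (rule vertical_inj, (intro cl X Y Z)+)
        (simp only: b(2)[OF sec_add_in[OF X Y] Z] vertical_eqs(1)[OF X Y] vertical_eqs(1)[OF b(1)[OF X Z] b(1)[OF Y Z]]
          b(2)[OF X Z] b(2)[OF Y Z] Q_left(2)[OF v[OF Z] v[OF X] v[OF Y]])
    show "section_bracket Z (sec_add E X Y) = sec_add E (section_bracket Z X) (section_bracket Z Y)"
      by (rule vertical_inj, (intro cl X Y Z)+)
        (simp only: b(2)[OF Z sec_add_in[OF X Y]] vertical_eqs(1)[OF X Y] vertical_eqs(1)[OF b(1)[OF Z X] b(1)[OF Z Y]]
          b(2)[OF Z X] b(2)[OF Z Y] Q_eqs(3)[OF v[OF Z] v[OF X] v[OF Y]])
  qed
  have 2: "section_bracket (sec_scale E c X) Y = sec_scale E c (section_bracket X Y)"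
    "section_bracket Y (sec_scale E c X) = sec_scale E c (section_bracket Y X)"
    if X: "X \<in> sections E" and Y: "Y \<in> sections E" for X Y c
  proof -
    show "section_bracket (sec_scale E c X) Y = sec_scale E c (section_bracket X Y)"
      by (rule vertical_inj, (intro cl X Y)+)
        (simp only: b(2)[OF sec_scale_in[OF X] Y] vertical_eqs(2)[OF X] vertical_eqs(2)[OF b(1)[OF X Y]]
          b(2)[OF X Y] Q_left(1)[OF v[OF Y] v[OF X]])
    show "section_bracket Y (sec_scale E c X) = sec_scale E c (section_bracket Y X)"
      by (rule vertical_inj, (intro cl X Y)+)
        (simp only: b(2)[OF Y sec_scale_in[OF X]] vertical_eqs(2)[OF X] vertical_eqs(2)[OF b(1)[OF Y X]]
          b(2)[OF Y X] Q_eqs(2)[OF v[OF Y] v[OF X]])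
  qed
  have 3: "section_bracket X X = sec_zero E" if X: "X \<in> sections E" for X
  proof (rule vertical_inj[OF b(1)[OF X X] sec_zero_in])
    show "\<Phi> (section_bracket X X) = \<Phi> (sec_zero E)"
      unfolding b(2)[OF X X] vertical_zero using lie v[OF X] by blast
  qed
  have 4: "sec_add E (sec_add E (section_bracket X (section_bracket Y Z)) (section_bracket Y (section_bracket Z X)))
      (section_bracket Z (section_bracket X Y)) = sec_zero E"
    if X: "X \<in> sections E" and Y: "Y \<in> sections E" and Z: "Z \<in> sections E" for X Y Z
  proof (rule vertical_inj)
    note i = b(1)[OF X b(1)[OF Y Z]] b(1)[OF Y b(1)[OF Z X]] b(1)[OF Z b(1)[OF X Y]]
    have "\<Phi> (sec_add E (sec_add E (section_bracket X (section_bracket Y Z)) (section_bracket Y (section_bracket Z X)))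
        (section_bracket Z (section_bracket X Y))) =
      fun_add dual (fun_add dual (Q (\<Phi> X) (Q (\<Phi> Y) (\<Phi> Z))) (Q (\<Phi> Y) (Q (\<Phi> Z) (\<Phi> X)))) (Q (\<Phi> Z) (Q (\<Phi> X) (\<Phi> Y)))"
      by (simp only: vertical_eqs(1)[OF sec_add_in[OF i(1,2)] i(3)] vertical_eqs(1)[OF i(1,2)]
          b(2)[OF X b(1)[OF Y Z]] b(2)[OF Y b(1)[OF Z X]] b(2)[OF Z b(1)[OF X Y]] b(2)[OF Y Z] b(2)[OF Z X] b(2)[OF X Y])
    also have "\<dots> = fun_zero dual" using lie v[OF X] v[OF Y] v[OF Z] by blast
    finally show "\<Phi> (sec_add E (sec_add E (section_bracket X (section_bracket Y Z)) (section_bracket Y (section_bracket Z X)))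
        (section_bracket Z (section_bracket X Y))) = \<Phi> (sec_zero E)" by (simp only: vertical_zero)
  qed (intro cl X Y Z)+
  show ?thesis
    unfolding lie_bracket_on_def by (intro conjI ballI allI ext 1 2 3 4)
qed

lemma section_bracket_leibniz:
  assumes X: "X \<in> sections E" and Y: "Y \<in> sections E" and f: "f \<in> smooth_functions M"
  shows "section_bracket X (sec_mult E f Y) =
    sec_add E (sec_mult E f (section_bracket X Y)) (sec_mult E (base_derivative X f) Y)"
proof -
  note b = section_bracket and d = base_derivative_smooth[OF X f] and v = vertical_smooth
  note s = b(1)[OF X sec_mult_in[OF f Y]] sec_mult_in[OF f b(1)[OF X Y]] sec_mult_in[OF d Y]
  show ?thesis
  proof (rule vertical_inj[OF s(1) sec_add_in[OF s(2,3)]], rule dual_eqI[OF v[OF s(1)] v[OF sec_add_in[OF s(2,3)]]])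
    fix x \<xi> assume x: "x \<in> points M" "\<xi> \<in> dual_space E x"
    show "\<Phi> (section_bracket X (sec_mult E f Y)) (x, \<xi>) =
      \<Phi> (sec_add E (sec_mult E f (section_bracket X Y)) (sec_mult E (base_derivative X f) Y)) (x, \<xi>)"
      unfolding b(2)[OF X sec_mult_in[OF f Y]] vertical_eqs(1)[OF s(2,3)] vertical_eqs(3)[OF Y f]
        vertical_eqs(3)[OF b(1)[OF X Y] f] vertical_eqs(3)[OF Y d] b(2)[OF X Y]
        Q(5)[OF v[OF X] basic_smooth[OF f] points_dualI[OF x] v[OF Y]] dual_fun_apply[OF x]
        bracket_vertical_basic[OF X f] by simp
  qed
qed

theorem lie_algebroid_of_homogeneous_poisson: "lie_algebroid E section_bracket anchor"
proof -
  have "anchor \<in> extensional (points tot)" by (simp add: anchor_def)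
  moreover have "lie_derivative M (anchor \<circ> X) f = base_derivative X f" if "X \<in> sections E" "f \<in> smooth_functions M" for X f
    using anchor_derivative[OF that] by (simp add: anchored_derivative_def)
  ultimately show ?thesis
    unfolding lie_algebroid_def
    using section_bracket_lie anchor_bundle_map section_bracket_leibniz by simp
qed

text \<open>Bilinearity gives four brackets, of which the basic one with basic vanishes. Every
  homogeneous Poisson structure thus has on affine functions the form that is prescribed by its own
  algebroid; surjectivity of the correspondence rests on this.\<close>

theorem bracket_affine:
  assumes X: "X \<in> sections E" and h: "h \<in> smooth_functions M" and Y: "Y \<in> sections E" and k: "k \<in> smooth_functions M"
  shows "Q (affine_function X h) (affine_function Y k) = affine_function (section_bracket X Y)
    (fun_add M (anchored_derivative anchor X k) (fun_scale M (-1) (anchored_derivative anchor Y h)))"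
proof (rule dual_eqI)
  note v = vertical_smooth and b = basic_smooth and d = base_derivative_smooth
  note a = affine_smooth[OF X h] affine_smooth[OF Y k]
  show "Q (affine_function X h) (affine_function Y k) \<in> smooth_functions dual" by (rule Q(1)[OF a])
  show "affine_function (section_bracket X Y)
    (fun_add M (anchored_derivative anchor X k) (fun_scale M (-1) (anchored_derivative anchor Y h))) \<in> smooth_functions dual"
    unfolding anchor_derivative[OF X k] anchor_derivative[OF Y h]
    by (intro affine_smooth section_bracket(1) base.smooth_fun_add base.smooth_fun_scale d X Y h k)
  fix x \<xi> assume x: "x \<in> points M" "\<xi> \<in> dual_space E x"
  have "Q (affine_function X h) (affine_function Y k) = fun_add dual
      (fun_add dual (Q (\<Phi> X) (\<Phi> Y)) (Q (\<Phi> X) (pull k))) (fun_add dual (Q (pull h) (\<Phi> Y)) (Q (pull h) (pull k)))"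
    unfolding affine_function_def[of X h] Q_left(2)[OF a(2) v[OF X] b[OF h]]
    unfolding affine_function_def Q_eqs(3)[OF v[OF X] v[OF Y] b[OF k]] Q_eqs(3)[OF b[OF h] v[OF Y] b[OF k]] ..
  then show "Q (affine_function X h) (affine_function Y k) (x, \<xi>) = affine_function (section_bracket X Y)
    (fun_add M (anchored_derivative anchor X k) (fun_scale M (-1) (anchored_derivative anchor Y h))) (x, \<xi>)"
    using x(1) by (simp add: dual_fun_apply[OF x] section_bracket(2)[OF X Y, symmetric] vertical_apply[OF x]
        bracket_vertical_basic[OF X k] basic_apply[OF x] bracket_basic_vertical[OF Y h x] bracket_basic_basic[OF h k]
        affine_apply[OF x] anchor_derivative[OF X k] anchor_derivative[OF Y h])
qed

end

section \<open>The one-to-one correspondence\<close>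

definition corresponding ::
    "(('a \<Rightarrow> 'e) \<Rightarrow> ('a \<Rightarrow> 'e) \<Rightarrow> 'a \<Rightarrow> 'e) \<Rightarrow> ('e \<Rightarrow> 'a \<times> (('a \<Rightarrow> real) \<Rightarrow> real)) \<Rightarrow>
     (('a \<times> ('e \<Rightarrow> real) \<Rightarrow> real) \<Rightarrow> ('a \<times> ('e \<Rightarrow> real) \<Rightarrow> real) \<Rightarrow> 'a \<times> ('e \<Rightarrow> real) \<Rightarrow> real) \<Rightarrow> bool"
  where "corresponding br \<rho> P \<longleftrightarrow> poisson_structure dual P \<and>
    (\<forall>X\<in>sections E. \<forall>Y\<in>sections E. \<forall>h\<in>smooth_functions M. \<forall>k\<in>smooth_functions M.
      P (affine_function X h) (affine_function Y k) = affine_function (br X Y)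
        (fun_add M (anchored_derivative \<rho> X k) (fun_scale M (-1) (anchored_derivative \<rho> Y h))))"

lemma correspondingD:
  assumes "corresponding br \<rho> P"
  shows "poisson_structure dual P"
    "X \<in> sections E \<Longrightarrow> Y \<in> sections E \<Longrightarrow> h \<in> smooth_functions M \<Longrightarrow> k \<in> smooth_functions M \<Longrightarrow>
      P (affine_function X h) (affine_function Y k) = affine_function (br X Y)
        (fun_add M (anchored_derivative \<rho> X k) (fun_scale M (-1) (anchored_derivative \<rho> Y h)))"
  using assms unfolding corresponding_def by blast+

text \<open>The relation fixes P on affine functions and not just on vertical ones; as these realise
  all differentials, nothing else of P is left free.\<close>

lemma corresponding_poisson_unique:
  assumes P: "corresponding br \<rho> P" and P': "corresponding br \<rho> P'"
  shows "P = P'"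
proof (rule affine.biderivation_eqI)
  show "biderivation dual P" "biderivation dual P'"
    using correspondingD(1)[OF P] correspondingD(1)[OF P'] poisson_structure_iff[OF dual_smooth_atlas] by blast+
  fix f g assume f: "f \<in> affine_functions" and g: "g \<in> affine_functions"
  obtain X h where 1: "f = affine_function X h" "X \<in> sections E" "h \<in> smooth_functions M" using f by (rule affine_functionsE)
  obtain Y k where 2: "g = affine_function Y k" "Y \<in> sections E" "k \<in> smooth_functions M" using g by (rule affine_functionsE)
  show "P f g = P' f g"
    unfolding 1(1) 2(1) correspondingD(2)[OF P 1(2) 2(2) 1(3) 2(3)] correspondingD(2)[OF P' 1(2) 2(2) 1(3) 2(3)] ..
qed

text \<open>Taking the first basic part to be zero removes one anchor term, so the bracket and the
  anchor can be read off separately from section part and basic part.\<close>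

lemma corresponding_zero_part:
  assumes la: "lie_algebroid E br \<rho>" and P: "corresponding br \<rho> P"
    and X: "X \<in> sections E" and Y: "Y \<in> sections E" and k: "k \<in> smooth_functions M"
  shows "P (vertical_function E X) (affine_function Y k) = affine_function (br X Y) (anchored_derivative \<rho> X k)"
proof -
  note d = anchored_derivative_smooth[OF la]
  have "fun_add M (anchored_derivative \<rho> X k) (fun_scale M (-1) (anchored_derivative \<rho> Y (fun_zero M))) = anchored_derivative \<rho> X k"
  proof (rule smooth_functions_eqI[OF base.smooth_fun_add[OF d[OF X k] base.smooth_fun_scale[OF d[OF Y base.smooth_fun_zero]]] d[OF X k]])
    fix x assume x: "x \<in> points M"
    show "fun_add M (anchored_derivative \<rho> X k) (fun_scale M (-1) (anchored_derivative \<rho> Y (fun_zero M))) x = anchored_derivative \<rho> X k x"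
      using x anchored_derivative_eqs(5)[OF la x Y base.smooth_fun_zero] by simp
  qed
  then show ?thesis
    using correspondingD(2)[OF P X Y base.smooth_fun_zero k] affine_eqs(3)[OF X base.smooth_fun_zero] by simp
qed

lemma corresponding_vertical:
  assumes la: "lie_algebroid E br \<rho>" and P: "corresponding br \<rho> P" and X: "X \<in> sections E" and Y: "Y \<in> sections E"
  shows "P (vertical_function E X) (vertical_function E Y) = vertical_function E (br X Y)"
proof -
  have b: "br X Y \<in> sections E" by (rule bracket_in[OF la X Y])
  have z: "anchored_derivative \<rho> X (fun_zero M) = fun_zero M"
    by (rule smooth_functions_eqI[OF anchored_derivative_smooth[OF la X base.smooth_fun_zero] base.smooth_fun_zero])
      (simp add: anchored_derivative_eqs(5)[OF la _ X base.smooth_fun_zero])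
  show ?thesis
    using corresponding_zero_part[OF la P X Y base.smooth_fun_zero]
    unfolding z affine_eqs(3)[OF Y base.smooth_fun_zero, symmetric] affine_eqs(3)[OF b base.smooth_fun_zero, symmetric] .
qed

lemma corresponding_homogeneous:
  assumes la: "lie_algebroid E br \<rho>" and P: "corresponding br \<rho> P"
  shows "P \<in> homogeneous_poisson_structures E"
proof -
  have "vertical E (P f g)" if f: "vertical E f" and g: "vertical E g" for f g
  proof -
    obtain X where X: "X \<in> sections E" "f = vertical_function E X" using f unfolding vertical_def by blast
    obtain Y where Y: "Y \<in> sections E" "g = vertical_function E Y" using g unfolding vertical_def by blast
    show ?thesis
      unfolding vertical_def X(2) Y(2) corresponding_vertical[OF la P X(1) Y(1)] using bracket_in[OF la X(1) Y(1)] by blast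
  qed
  then show ?thesis using correspondingD(1)[OF P] by (simp add: homogeneous_poisson_structures_def)
qed

text \<open>The two parts of an affine function are unique, so P yields the bracket and the
  derivatives along anchored sections. Evaluated on a section through a given vector, the latter
  yield the anchor itself.\<close>

lemma corresponding_algebroid_unique:
  assumes la: "lie_algebroid E br \<rho>" and la': "lie_algebroid E br' \<rho>'"
    and P: "corresponding br \<rho> P" and P': "corresponding br' \<rho>' P"
  shows "br = br'" "\<rho> = \<rho>'"
proof -
  have eq: "br X Y = br' X Y" "anchored_derivative \<rho> X k = anchored_derivative \<rho>' X k"
    if X: "X \<in> sections E" and Y: "Y \<in> sections E" and k: "k \<in> smooth_functions M" for X Y k
  proof -
    have "affine_function (br X Y) (anchored_derivative \<rho> X k) = affine_function (br' X Y) (anchored_derivative \<rho>' X k)"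
      using corresponding_zero_part[OF la P X Y k] corresponding_zero_part[OF la' P' X Y k] by simp
    then show "br X Y = br' X Y" "anchored_derivative \<rho> X k = anchored_derivative \<rho>' X k"
      using affine_inj[OF bracket_in[OF la X Y] bracket_in[OF la' X Y]
          anchored_derivative_smooth[OF la X k] anchored_derivative_smooth[OF la' X k]] by blast+
  qed
  have e: "br \<in> sections E \<rightarrow>\<^sub>E sections E \<rightarrow>\<^sub>E sections E" "br' \<in> sections E \<rightarrow>\<^sub>E sections E \<rightarrow>\<^sub>E sections E"
    using lie_bracket[OF la] lie_bracket[OF la'] by (simp_all add: lie_bracket_on_def)
  show "br = br'"
  proof (rule PiE_ext[OF e])
    fix X assume X: "X \<in> sections E"
    show "br X = br' X"
      by (rule PiE_ext[OF PiE_mem[OF e(1) X] PiE_mem[OF e(2) X]]) (rule eq(1)[OF X _ base.smooth_fun_zero])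
  qed
  show "\<rho> = \<rho>'"
  proof (rule extensionalityI[OF anchor_extensional[OF la] anchor_extensional[OF la']])
    fix e assume e: "e \<in> points tot"
    let ?x = "projection E e"
    have x: "?x \<in> points M" by (rule smooth_map_points[OF smooth_projection e])
    note ef = fibreI[OF e]
    obtain X where X: "X \<in> sections E" "X ?x = e" using section_through[OF ef x] by blast
    note t = anchor_tangent[OF la x ef] and t' = anchor_tangent[OF la' x ef]
    have "snd (\<rho> e) = snd (\<rho>' e)"
    proof (rule extensionalityI[of _ "smooth_functions M"])
      show "snd (\<rho> e) \<in> extensional (smooth_functions M)" "snd (\<rho>' e) \<in> extensional (smooth_functions M)"
        using t(2) t'(2) by (simp_all add: tangent_space_def)
      fix f assume f: "f \<in> smooth_functions M"
      have "anchored_derivative \<rho> X f ?x = anchored_derivative \<rho>' X f ?x" by (simp only: eq(2)[OF X(1) X(1) f])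
      then show "snd (\<rho> e) f = snd (\<rho>' e) f" by (simp add: anchored_derivative_apply[OF x] X(2))
    qed
    then show "\<rho> e = \<rho>' e" using t(1) t'(1) by (simp add: prod_eq_iff)
  qed
qed

text \<open>The map is obtained from \<open>corresponding\<close>, which relates each algebroid to
  exactly one Poisson structure. Injectivity is uniqueness of the algebroid, and surjectivity comes
  from the algebroid built out of a given P.\<close>

theorem lie_algebroid_poisson_correspondence:
  "\<exists>F. bij_betw F (lie_algebroid_structures E) (homogeneous_poisson_structures E) \<and>
    (\<forall>(br, \<rho>) \<in> lie_algebroid_structures E. \<forall>X\<in>sections E. \<forall>Y\<in>sections E.
       F (br, \<rho>) (vertical_function E X) (vertical_function E Y) = vertical_function E (br X Y))"
proof -
  define F where "F a = (THE P. corresponding (fst a) (snd a) P)" for a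
  have F: "corresponding br \<rho> (F (br, \<rho>))" if la: "lie_algebroid E br \<rho>" for br \<rho>
  proof -
    have "\<exists>!P. corresponding br \<rho> P"
    proof (rule ex_ex1I)
      show "\<exists>P. corresponding br \<rho> P"
        unfolding corresponding_def by (rule poisson_structure_of_lie_algebroid[OF la])
    qed (rule corresponding_poisson_unique)
    then show ?thesis unfolding F_def fst_conv snd_conv by (rule theI')
  qed
  have mem: "a \<in> lie_algebroid_structures E \<longleftrightarrow> lie_algebroid E (fst a) (snd a)" for a
    by (simp add: lie_algebroid_structures_def case_prod_unfold)
  have "bij_betw F (lie_algebroid_structures E) (homogeneous_poisson_structures E)"
  proof (rule bij_betw_imageI)
    show "inj_on F (lie_algebroid_structures E)"
    proof (rule inj_onI)
      fix a b assume "a \<in> lie_algebroid_structures E" "b \<in> lie_algebroid_structures E" and eq: "F a = F b"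
      then have la: "lie_algebroid E (fst a) (snd a)" "lie_algebroid E (fst b) (snd b)" by (simp_all add: mem)
      have "corresponding (fst b) (snd b) (F a)" using F[OF la(2)] eq by simp
      moreover have "corresponding (fst a) (snd a) (F a)" using F[OF la(1)] by simp
      ultimately show "a = b" using corresponding_algebroid_unique[OF la] by (simp add: prod_eq_iff)
    qed
    show "F ` lie_algebroid_structures E = homogeneous_poisson_structures E"
    proof (rule subset_antisym; rule subsetI)
      fix P assume "P \<in> F ` lie_algebroid_structures E"
      then obtain a where a: "lie_algebroid E (fst a) (snd a)" "P = F a" by (auto simp: mem)
      then show "P \<in> homogeneous_poisson_structures E"
        using corresponding_homogeneous[OF a(1) F[OF a(1)]] by simp
    next
      fix P assume P: "P \<in> homogeneous_poisson_structures E"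
      note la = lie_algebroid_of_homogeneous_poisson[OF P]
      have "corresponding (section_bracket P) (anchor P) P"
        unfolding corresponding_def using poisson[OF P] bracket_affine[OF P] by simp
      \<comment> \<open>Both P and the value of F correspond to the algebroid built from P, hence
        they coincide.\<close>
      then have "F (section_bracket P, anchor P) = P"
        by (rule corresponding_poisson_unique[OF F[OF la]])
      moreover have "(section_bracket P, anchor P) \<in> lie_algebroid_structures E" using la by (simp add: mem)
      ultimately show "P \<in> F ` lie_algebroid_structures E" by (metis image_eqI)
    qed
  qed
  moreover have "F (br, \<rho>) (vertical_function E X) (vertical_function E Y) = vertical_function E (br X Y)"
    if "(br, \<rho>) \<in> lie_algebroid_structures E" "X \<in> sections E" "Y \<in> sections E" for br \<rho> X Y
  proof -
    have la: "lie_algebroid E br \<rho>" using that(1) by (simp add: mem)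
    show ?thesis by (rule corresponding_vertical[OF la F[OF la] that(2,3)])
  qed
  ultimately show ?thesis by (intro exI[of _ F] conjI) auto
qed

end

theorem theorem6p3p5:
  fixes E :: "('a, 'm::finite_dim_inner, 'e, 'f::euclidean_space) vbundle"
  assumes "vector_bundle E"
  shows "\<exists>F. bij_betw F (lie_algebroid_structures E) (homogeneous_poisson_structures E) \<and>
    (\<forall>(br, \<rho>) \<in> lie_algebroid_structures E. \<forall>X\<in>sections E. \<forall>Y\<in>sections E.
       F (br, \<rho>) (vertical_function E X) (vertical_function E Y) = vertical_function E (br X Y))"
  by (rule smooth_bundle.lie_algebroid_poisson_correspondence[OF smooth_bundle.intro[OF assms]])

end
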